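(* Assume the model conditions (a), (b), (c), (d) stated in the context, and suppose that $\Theta_0$ contains a Euclidean ball $B(\theta_0,r)\subset\Theta^\circ$. Then there exist $a_0>0$, $\epsilon_0>0$ and $T_0<\infty$ such that, for every $0<a\le a_0$ and every $T\ge T_0$, $$\inf_{\tilde\theta_T}\sup_{\theta\in\Theta_0}\mathbb P_\theta\left(\|\tilde\theta_T-\theta\|_2\ge\frac{a}{\sqrt T}\right)\ge\epsilon_0 ,$$ where the infimum is over all estimators measurable with respect to $\sigma\{N|_{[-A,T]}\}$.
   Context: Setting. $D,p\ge 1$ are fixed integers and $A\in(0,\infty)$ is a fixed known memory length (none depends on $T$). $N=(N_1,\dots,N_D)$ is a simple $D$-variate point process on $\mathbb R$ (no multiple points, also not across components) with natural filtration $\mathcal F_t$. For a parameter $\theta$ put, for $i=1,\dots,D$, $$\lambda_i(t;\theta)=\phi_{\theta,i}\Big(\nu_{\theta,i}+\sum_{j=1}^D\int_{[t-A,t)}h_{\theta,ij}(t-s)\,dN_j(s)\Big),\qquad h_{\theta,ij}(u)=\tilde h_{\theta,ij}(u)\mathbf 1\{0\le u\le A\},$$ with baselines $\nu_{\theta,i}$, links $\phi_{\theta,i}$, and kernels of either sign; the argument of $\phi_{\theta,i}$ is the linear predictor. $\mathbb P_\theta$ (expectation $\mathbb E_\theta$) is the law of the stationary process whose $\mathcal F_t$-conditional intensity is $\lambda(\cdot;\theta)$. Model conditions. (a) $\Theta\subset\mathbb R^p$ is compact, $\Theta_0$ is a compact subset of the interior $\Theta^\circ$, and $\Theta$ is contained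 in a compact convex set $K_\Theta$ lying in the interior of the natural parameter domain. Let $\mathcal X_i(K_\Theta)$ be the set of linear-predictor values attainable with $\theta\in K_\Theta$. The maps $\theta\mapsto\nu_{\theta,i}$ and $(\theta,x)\mapsto\phi_{\theta,i}(x)$ are $C^3$ on neighborhoods of $K_\Theta$ and $K_\Theta\times\mathcal X_i(K_\Theta)$. Uniformly in $i$ on this set, $\phi_{\theta,i}$ is bounded away from zero (positive), $\partial_x\phi_{\theta,i}$ is bounded, and all mixed $(\theta,x)$-derivatives of $\phi_{\theta,i}$ up to order three have at most polynomial growth in $x$. Derivatives of $\nu_{\theta,i}$ up to order three are uniformly bounded on $K_\Theta$. Structural-zero coordinates have been removed from $\theta$. (b) Each $\tilde h_{\theta,ij}$ and its parameter derivatives up to order three are uniformly bounded and continuous on $[0,A]\times K_\Theta$, with second derivatives uniformly Lipschitz in $\theta$. (c) With $L_{\theta,i}$ a Lipschitz constant of $\phi_{\theta,i}$ and $G^{\mathrm{abs}}(\theta)_{ij}=L_{\theta,i}\int_0^A|h_{\theta,ij}(u)|\,du$, there is $\varepsilon>0$ with $\sup_{\theta\in\Theta}\rho\{G^{\mathrm{abs}}(\theta)\}\le 1-\varepsilon$ ($\rho$ = spectral radius). (d) For all $\theta,\theta'\in\Theta$, if $\lambda_i(t;\theta)=\lambda_i(t;\theta')$ for every $i$ and Lebesgue-a.e. $t$, $\mathbb P_\theta$-a.s., then $\theta=\theta'$; and the per-time Fisher information $I(\theta)=\mathbb E_\theta\big[\sum_{i=1}^D\lambda_i(0;\theta)^{-1}\nabla_\theta\lambda_i(0;\theta)\nabla_\theta\lambda_i(0;\theta)^\top\big]$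 is well defined and uniformly nonsingular on $\Theta_0$. *)

theory Defs
  imports "HOL-Probability.Probability"
begin

section \<open>Simple multivariate point processes on the line\<close>

text \<open>
  A point configuration assigns to each component \<open>i\<close> the set \<open>\<omega> i\<close> of its event times. As no point
  is multiple, the counting measure \<open>N\<^sub>i\<close> is recovered by \<open>N\<^sub>i(B) = card (\<omega> i \<inter> B)\<close>.
\<close>

type_synonym 'd config = "'d \<Rightarrow> real set"

definition configs :: "'d config set" where
  "configs = {\<omega>. (\<forall>i a b. finite (\<omega> i \<inter> {a..b})) \<and> (\<forall>i j. i \<noteq> j \<longrightarrow> \<omega> i \<inter> \<omega> j = {})}"

definition config_algebra :: "'d config measure" where
  "config_algebra = sigma configs
     {{\<omega> \<in> configs. card (\<omega> i \<inter> B) = n} | i B n. B \<in> sets borel \<and> bounded B}"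

definition restrict_config :: "real set \<Rightarrow> 'd config \<Rightarrow> 'd config" where
  "restrict_config S \<omega> = (\<lambda>i. \<omega> i \<inter> S)"

definition shift_config :: "real \<Rightarrow> 'd config \<Rightarrow> 'd config" where
  "shift_config s \<omega> = (\<lambda>i. (\<lambda>x. x + s) ` \<omega> i)"

text \<open>The \<open>\<sigma>\<close>-algebra \<open>\<sigma>{N|\<^sub>S}\<close>; the natural filtration is \<open>F\<^sub>t = observed {..t}\<close>.\<close>

definition observed :: "real set \<Rightarrow> 'd config measure" where
  "observed S = vimage_algebra configs (restrict_config S) config_algebra"

section \<open>Nonlinear Hawkes processes with bounded memory\<close>

text \<open>
  Throughout, \<open>\<nu> \<theta> i\<close> is the baseline, \<open>\<phi> \<theta> i\<close> the link and \<open>h \<theta> i j\<close> the untruncated kernel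
  (written with a tilde on paper).
\<close>

definition kernel ::
  "real \<Rightarrow> (real^'p \<Rightarrow> 'd \<Rightarrow> 'd \<Rightarrow> real \<Rightarrow> real) \<Rightarrow> real^'p \<Rightarrow> 'd \<Rightarrow> 'd \<Rightarrow> real \<Rightarrow> real" where
  "kernel A h \<theta> i j u = (if 0 \<le> u \<and> u \<le> A then h \<theta> i j u else 0)"

definition linear_predictor ::
  "real \<Rightarrow> (real^'p \<Rightarrow> 'd \<Rightarrow> real) \<Rightarrow> (real^'p \<Rightarrow> 'd \<Rightarrow> 'd \<Rightarrow> real \<Rightarrow> real) \<Rightarrow>
    real^'p \<Rightarrow> 'd::finite \<Rightarrow> 'd config \<Rightarrow> real \<Rightarrow> real" where
  "linear_predictor A \<nu> h \<theta> i \<omega> t =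
     \<nu> \<theta> i + (\<Sum>j\<in>UNIV. \<Sum>s\<in>\<omega> j \<inter> {t - A..<t}. kernel A h \<theta> i j (t - s))"

definition intensity ::
  "real \<Rightarrow> (real^'p \<Rightarrow> 'd \<Rightarrow> real) \<Rightarrow> (real^'p \<Rightarrow> 'd \<Rightarrow> real \<Rightarrow> real) \<Rightarrow>
    (real^'p \<Rightarrow> 'd \<Rightarrow> 'd \<Rightarrow> real \<Rightarrow> real) \<Rightarrow>
    real^'p \<Rightarrow> 'd::finite \<Rightarrow> 'd config \<Rightarrow> real \<Rightarrow> real" where
  "intensity A \<nu> \<phi> h \<theta> i \<omega> t = \<phi> \<theta> i (linear_predictor A \<nu> h \<theta> i \<omega> t)"

definition attainable_predictors ::
  "real \<Rightarrow> (real^'p \<Rightarrow> 'd \<Rightarrow> real) \<Rightarrow> (real^'p \<Rightarrow> 'd \<Rightarrow> 'd \<Rightarrow> real \<Rightarrow> real) \<Rightarrow>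
    (real^'p) set \<Rightarrow> 'd::finite \<Rightarrow> real set" where
  "attainable_predictors A \<nu> h K i =
     {linear_predictor A \<nu> h \<theta> i \<omega> t | \<theta> \<omega> t. \<theta> \<in> K \<and> \<omega> \<in> configs}"

text \<open>
  \<open>lam\<close> is a conditional intensity under \<open>M\<close> with respect to the natural filtration:
  \<open>E[N\<^sub>i(s,t] | F\<^sub>s] = E[\<integral>\<^sub>s\<^sup>t lam\<^sub>i(u) du | F\<^sub>s]\<close> almost surely, for all \<open>s < t\<close>.
\<close>

definition has_conditional_intensity ::
  "'d config measure \<Rightarrow> ('d \<Rightarrow> 'd config \<Rightarrow> real \<Rightarrow> real) \<Rightarrow> bool" where
  "has_conditional_intensity M lam \<longleftrightarrow>
     (\<forall>i s t. s < t \<longrightarrow>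
       (AE \<omega> in M.
          nn_cond_exp M (observed {..s}) (\<lambda>\<omega>. of_nat (card (\<omega> i \<inter> {s<..t}))) \<omega> =
          nn_cond_exp M (observed {..s}) (\<lambda>\<omega>. \<integral>\<^sup>+u\<in>{s<..t}. ennreal (lam i \<omega> u) \<partial>lborel) \<omega>))"

text \<open>
  The moment condition selects \<^emph>\<open>the\<close> stationary process: uniqueness of the stationary law
  with a given Lipschitz intensity is a statement about laws of finite mean intensity
  (Bremaud and Massoulie).
\<close>

definition stationary_hawkes_law ::
  "real \<Rightarrow> (real^'p \<Rightarrow> 'd \<Rightarrow> real) \<Rightarrow> (real^'p \<Rightarrow> 'd \<Rightarrow> real \<Rightarrow> real) \<Rightarrow>
    (real^'p \<Rightarrow> 'd \<Rightarrow> 'd \<Rightarrow> real \<Rightarrow> real) \<Rightarrow>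
    real^'p \<Rightarrow> 'd::finite config measure \<Rightarrow> bool" where
  "stationary_hawkes_law A \<nu> \<phi> h \<theta> M \<longleftrightarrow>
     prob_space M \<and> space M = configs \<and> sets M = sets config_algebra \<and>
     (\<forall>s. distr M config_algebra (shift_config s) = M) \<and>
     (\<forall>i. (\<integral>\<^sup>+\<omega>. of_nat (card (\<omega> i \<inter> {0<..1})) \<partial>M) < \<infinity>) \<and>
     has_conditional_intensity M (intensity A \<nu> \<phi> h \<theta>)"

section \<open>Iterated partial derivatives\<close>

primrec partials :: "'a::euclidean_space list \<Rightarrow> ('a \<Rightarrow> real) \<Rightarrow> 'a \<Rightarrow> real" where
  "partials [] f = f"
| "partials (b # bs) f = (\<lambda>x. frechet_derivative (partials bs f) (at x) b)"

definition multi_indices :: "nat \<Rightarrow> 'a::euclidean_space list set" where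
  "multi_indices n = {bs. set bs \<subseteq> Basis \<and> length bs = n}"

definition times_differentiable_on ::
  "nat \<Rightarrow> 'a::euclidean_space set \<Rightarrow> ('a \<Rightarrow> real) \<Rightarrow> bool" where
  "times_differentiable_on k U f \<longleftrightarrow>
     (\<forall>n<k. \<forall>bs\<in>multi_indices n. \<forall>x\<in>U. partials bs f differentiable (at x))"

definition C_on :: "nat \<Rightarrow> 'a::euclidean_space set \<Rightarrow> ('a \<Rightarrow> real) \<Rightarrow> bool" where
  "C_on k U f \<longleftrightarrow>
     times_differentiable_on k U f \<and>
     (\<forall>n\<le>k. \<forall>bs\<in>multi_indices n. continuous_on U (partials bs f))"

section \<open>The model conditions\<close>

text \<open>
  \<open>Dom\<close> is the natural parameter domain; values of the parametrization outside \<open>Dom\<close> are irrelevant.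
  The coordinate condition at the end says that \<open>\<Theta>\<close> carries no structural-zero coordinate.
\<close>

definition condition_a ::
  "real \<Rightarrow> (real^'p) set \<Rightarrow> (real^'p) set \<Rightarrow> (real^'p) set \<Rightarrow> (real^'p) set \<Rightarrow>
    (real^'p \<Rightarrow> 'd \<Rightarrow> real) \<Rightarrow> (real^'p \<Rightarrow> 'd \<Rightarrow> real \<Rightarrow> real) \<Rightarrow>
    (real^'p \<Rightarrow> 'd::finite \<Rightarrow> 'd \<Rightarrow> real \<Rightarrow> real) \<Rightarrow> bool" where
  "condition_a A Dom K \<Theta> \<Theta>\<^sub>0 \<nu> \<phi> h \<longleftrightarrow>
     (let X = attainable_predictors A \<nu> h K; \<Phi> = (\<lambda>i (\<theta>, x). \<phi> \<theta> i x) in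
       compact \<Theta> \<and> compact \<Theta>\<^sub>0 \<and> \<Theta>\<^sub>0 \<subseteq> interior \<Theta> \<and>
       compact K \<and> convex K \<and> \<Theta> \<subseteq> K \<and> K \<subseteq> interior Dom \<and>
       (\<forall>i. \<exists>U. open U \<and> K \<subseteq> U \<and> U \<subseteq> Dom \<and> C_on 3 U (\<lambda>\<theta>. \<nu> \<theta> i)) \<and>
       (\<forall>i. \<exists>W. open W \<and> K \<times> X i \<subseteq> W \<and> W \<subseteq> Dom \<times> UNIV \<and> C_on 3 W (\<Phi> i)) \<and>
       (\<exists>c>0. \<forall>i. \<forall>\<theta>\<in>K. \<forall>x\<in>X i. c \<le> \<phi> \<theta> i x) \<and>
       (\<exists>C. \<forall>i. \<forall>\<theta>\<in>K. \<forall>x\<in>X i. \<bar>partials [(0, 1)] (\<Phi> i) (\<theta>, x)\<bar> \<le> C) \<and>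
       (\<exists>C m. \<forall>i. \<forall>n\<le>3. \<forall>bs\<in>multi_indices n. \<forall>\<theta>\<in>K. \<forall>x\<in>X i.
          \<bar>partials bs (\<Phi> i) (\<theta>, x)\<bar> \<le> C * (1 + \<bar>x\<bar>) ^ m) \<and>
       (\<exists>C. \<forall>i. \<forall>n\<le>3. \<forall>bs\<in>multi_indices n. \<forall>\<theta>\<in>K. \<bar>partials bs (\<lambda>\<theta>. \<nu> \<theta> i) \<theta>\<bar> \<le> C) \<and>
       (\<forall>k. \<exists>\<theta>\<in>\<Theta>. \<theta> $ k \<noteq> 0))"

definition condition_b ::
  "real \<Rightarrow> (real^'p) set \<Rightarrow> (real^'p) set \<Rightarrow>
    (real^'p \<Rightarrow> 'd::finite \<Rightarrow> 'd \<Rightarrow> real \<Rightarrow> real) \<Rightarrow> bool" where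
  "condition_b A Dom K h \<longleftrightarrow>
     (\<forall>i j. \<exists>U. open U \<and> K \<subseteq> U \<and> U \<subseteq> Dom \<and>
        (\<forall>u\<in>{0..A}. times_differentiable_on 3 U (\<lambda>\<theta>. h \<theta> i j u))) \<and>
     (\<exists>C. \<forall>i j. \<forall>n\<le>3. \<forall>bs\<in>multi_indices n. \<forall>u\<in>{0..A}. \<forall>\<theta>\<in>K.
        \<bar>partials bs (\<lambda>\<theta>. h \<theta> i j u) \<theta>\<bar> \<le> C) \<and>
     (\<forall>i j. \<forall>n\<le>3. \<forall>bs\<in>multi_indices n.
        continuous_on ({0..A} \<times> K) (\<lambda>(u, \<theta>). partials bs (\<lambda>\<theta>. h \<theta> i j u) \<theta>)) \<and>
     (\<exists>C. \<forall>i j. \<forall>bs\<in>multi_indices 2. \<forall>u\<in>{0..A}.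
        C-lipschitz_on K (partials bs (\<lambda>\<theta>. h \<theta> i j u)))"

definition spectral_radius :: "real^'n^'n \<Rightarrow> real" where
  "spectral_radius M =
     Max (cmod ` {z. \<exists>v::complex^'n. v \<noteq> 0 \<and> map_matrix complex_of_real M *v v = z *s v})"

definition G_abs ::
  "real \<Rightarrow> (real^'p \<Rightarrow> 'd \<Rightarrow> 'd \<Rightarrow> real \<Rightarrow> real) \<Rightarrow> (real^'p \<Rightarrow> 'd \<Rightarrow> real) \<Rightarrow>
    real^'p \<Rightarrow> real^'d::finite^'d" where
  "G_abs A h L \<theta> = (\<chi> i j. L \<theta> i * integral {0..A} (\<lambda>u. \<bar>kernel A h \<theta> i j u\<bar>))"

text \<open>
  Only values of \<open>\<phi> \<theta> i\<close> at attainable predictors enter the model, so that is where the Lipschitz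
  constant is required; a Lipschitz constant on all of \<open>\<real>\<close> is in particular one here.
\<close>

definition condition_c ::
  "real \<Rightarrow> (real^'p) set \<Rightarrow> (real^'p) set \<Rightarrow>
    (real^'p \<Rightarrow> 'd \<Rightarrow> real) \<Rightarrow> (real^'p \<Rightarrow> 'd \<Rightarrow> real \<Rightarrow> real) \<Rightarrow>
    (real^'p \<Rightarrow> 'd::finite \<Rightarrow> 'd \<Rightarrow> real \<Rightarrow> real) \<Rightarrow> (real^'p \<Rightarrow> 'd \<Rightarrow> real) \<Rightarrow> bool" where
  "condition_c A K \<Theta> \<nu> \<phi> h L \<longleftrightarrow>
     (\<forall>\<theta>\<in>\<Theta>. \<forall>i. (L \<theta> i)-lipschitz_on (attainable_predictors A \<nu> h K i) (\<phi> \<theta> i)) \<and>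
     (\<exists>\<epsilon>>0. \<forall>\<theta>\<in>\<Theta>. spectral_radius (G_abs A h L \<theta>) \<le> 1 - \<epsilon>)"

definition gradient :: "(real^'p \<Rightarrow> real) \<Rightarrow> real^'p \<Rightarrow> real^'p" where
  "gradient f \<theta> = (\<chi> k. frechet_derivative f (at \<theta>) (axis k 1))"

definition score_square ::
  "real \<Rightarrow> (real^'p \<Rightarrow> 'd \<Rightarrow> real) \<Rightarrow> (real^'p \<Rightarrow> 'd \<Rightarrow> real \<Rightarrow> real) \<Rightarrow>
    (real^'p \<Rightarrow> 'd::finite \<Rightarrow> 'd \<Rightarrow> real \<Rightarrow> real) \<Rightarrow> real^'p \<Rightarrow> 'd config \<Rightarrow> real^'p^'p" where
  "score_square A \<nu> \<phi> h \<theta> \<omega> =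
     (\<Sum>i\<in>UNIV. let g = gradient (\<lambda>\<theta>'. intensity A \<nu> \<phi> h \<theta>' i \<omega> 0) \<theta> in
        inverse (intensity A \<nu> \<phi> h \<theta> i \<omega> 0) *\<^sub>R (\<chi> k l. g $ k * g $ l))"

definition fisher_information ::
  "real \<Rightarrow> (real^'p \<Rightarrow> 'd \<Rightarrow> real) \<Rightarrow> (real^'p \<Rightarrow> 'd \<Rightarrow> real \<Rightarrow> real) \<Rightarrow>
    (real^'p \<Rightarrow> 'd::finite \<Rightarrow> 'd \<Rightarrow> real \<Rightarrow> real) \<Rightarrow> (real^'p \<Rightarrow> 'd config measure) \<Rightarrow>
    real^'p \<Rightarrow> real^'p^'p" where
  "fisher_information A \<nu> \<phi> h P \<theta> = (\<integral>\<omega>. score_square A \<nu> \<phi> h \<theta> \<omega> \<partial>P \<theta>)"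

text \<open>Uniform nonsingularity: the information matrices are invertible with uniformly bounded inverses.\<close>

definition condition_d ::
  "real \<Rightarrow> (real^'p) set \<Rightarrow> (real^'p) set \<Rightarrow>
    (real^'p \<Rightarrow> 'd \<Rightarrow> real) \<Rightarrow> (real^'p \<Rightarrow> 'd \<Rightarrow> real \<Rightarrow> real) \<Rightarrow>
    (real^'p \<Rightarrow> 'd::finite \<Rightarrow> 'd \<Rightarrow> real \<Rightarrow> real) \<Rightarrow> (real^'p \<Rightarrow> 'd config measure) \<Rightarrow> bool" where
  "condition_d A \<Theta> \<Theta>\<^sub>0 \<nu> \<phi> h P \<longleftrightarrow>
     (\<forall>\<theta>\<in>\<Theta>. \<forall>\<theta>'\<in>\<Theta>.
        (AE \<omega> in P \<theta>. \<forall>i. AE t in lborel.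
           intensity A \<nu> \<phi> h \<theta> i \<omega> t = intensity A \<nu> \<phi> h \<theta>' i \<omega> t) \<longrightarrow> \<theta> = \<theta>') \<and>
     (\<forall>\<theta>\<in>\<Theta>\<^sub>0. integrable (P \<theta>) (score_square A \<nu> \<phi> h \<theta>)) \<and>
     (\<exists>C. \<forall>\<theta>\<in>\<Theta>\<^sub>0. invertible (fisher_information A \<nu> \<phi> h P \<theta>) \<and>
        onorm ((*v) (matrix_inv (fisher_information A \<nu> \<phi> h P \<theta>))) \<le> C)"

definition estimators :: "real \<Rightarrow> real \<Rightarrow> ('d config \<Rightarrow> real^'p) set" where
  "estimators A T = observed {-A..T} \<rightarrow>\<^sub>M borel"

end

theory Submission
  imports Defs
begin

text \<open>
  The bound is a two-point argument of Le Cam type, arranged so that no estimate has to be uniform in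
  the parameter. Two stationary laws \<open>P \<theta>\<close> and \<open>P \<theta>'\<close> have no explicit likelihood ratio,
  because their initial conditions on \<open>[-A, 0]\<close> have no tractable density. On the event \<open>E\<close>
  that \<open>[-A, 0]\<close> contains no point, however, the initial condition is the same single configuration, and
  the likelihood ratio of the two processes on \<open>E\<close>, observed up to time \<open>T\<close>, is the quotient of the two
  probabilities of \<open>E\<close> times \<open>exp (\<ell>' - \<ell>)\<close> with the usual log-likelihoods
  \<open>\<ell> = \<Sum> ln \<lambda> - \<integral> \<Lambda>\<close> (theorem \<open>change_of_measure\<close>). It suffices to prove a lower bound with a
  small constant \<open>\<epsilon>\<^sub>0\<close>, so everything outside the event \<open>E\<close> of positive probability may be given up.

  The change of measure is derived from the definition of a conditional intensity alone. That definition
  gives the Campbell formula, which says that summing a left-continuous adapted process over the points has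
  the same mean as integrating it against the intensity. Applied to the product
  \<open>\<Prod> (\<gamma> / \<lambda>) exp (\<integral> (\<Lambda> - \<Gamma>))\<close> with a small deterministic rate \<open>\<gamma>\<close>, it shows that this exponential has
  constant mean on \<open>E\<close> (lemma \<open>integral_tilt\<close>). Letting \<open>\<gamma>\<close> vanish on a set \<open>B\<close> turns the identity into a
  formula for void probabilities under the weighted law, and this formula contains no trace of \<open>\<lambda>\<close>.
  Void probabilities determine the law of a simple point process, so the two laws, weighted in this way,
  agree up to the factor given by the probabilities of \<open>E\<close>.

  For the comparison of the two hypotheses one needs that \<open>\<ell>' - \<ell>\<close> is rarely very negative on \<open>E\<close>. The
  Campbell formula bounds the mean of a majorant of \<open>\<ell> - \<ell>'\<close> by the mean of
  \<open>\<integral> \<Sum> (\<lambda> - \<lambda>')\<^sup>2 / \<lambda>'\<close>. The intensities are bounded below and depend on the parameter in a Lipschitz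
  way, with a constant that is polynomial in the number of points in the last window, so by stationarity
  this is at most a constant times \<open>T |\<theta> - \<theta>'|\<^sup>2\<close> times a moment of \<open>N [-A, 0)\<close>, hence bounded for
  \<open>|\<theta> - \<theta>'|\<close> of order \<open>1 / sqrt T\<close> (lemma \<open>two_point_bound\<close>).

  Two facts about each single law remain: the probability of \<open>E\<close> is positive and all moments of
  \<open>N [-A, 0)\<close> are finite. The first one is again exponential tilting, now with \<open>\<gamma> = 0\<close>. The
  second one uses the subcriticality condition: it provides positive weights \<open>u\<close> with
  \<open>u = 1 + G\<^sup>T u\<close>, and a Lyapunov function built from them has strictly negative drift when many points
  are present (lemma \<open>moment_finite\<close>).

  Neither fact comes with uniform bounds in \<open>\<theta>\<close>. Uniformity is obtained for free from the Baire category
  theorem: the ball around \<open>\<theta>\<^sub>0\<close> is the countable union of the sets on which the probability of \<open>E\<close> is at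
  least \<open>1 / n\<close> and the moment at most \<open>n\<close>, so one of these sets is dense in a smaller ball. Density is
  enough to find, at every scale \<open>a / sqrt T\<close>, two parameters of this set at a distance comparable to that
  scale, and the two-point bound applies to them with constants depending on \<open>n\<close> only.
\<close>

section \<open>Measurability of point configurations\<close>

lemma config_finite:
  assumes "\<omega> \<in> configs" "bounded B" shows "finite (\<omega> i \<inter> B)"
proof -
  obtain a where "\<And>x. x \<in> B \<Longrightarrow> \<bar>x\<bar> \<le> a" using assms(2) unfolding bounded_real by blast
  then have "B \<subseteq> {-a..a}" by (auto simp: abs_le_iff) (metis minus_le_iff)
  moreover have "finite (\<omega> i \<inter> {-a..a})" using assms(1) by (auto simp: configs_def)
  ultimately show ?thesis by (meson finite_subset inf.mono order_refl)
qed

lemma config_algebra_generators: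
  "{{\<omega> \<in> configs. card (\<omega> i \<inter> B) = n} | i B n. B \<in> sets borel \<and> bounded B} \<subseteq> Pow configs"
  by auto

lemma space_config_algebra [simp]: "space config_algebra = configs"
  unfolding config_algebra_def by (rule space_measure_of[OF config_algebra_generators])

lemma measurable_card:
  assumes "B \<in> sets borel" "bounded B"
  shows "(\<lambda>\<omega>. card (\<omega> i \<inter> B)) \<in> config_algebra \<rightarrow>\<^sub>M count_space UNIV"
proof (subst measurable_count_space_eq_countable)
  show "countable (UNIV::nat set)" by simp
  have "{\<omega> \<in> configs. card (\<omega> i \<inter> B) = n} \<in> sets config_algebra" for n
    unfolding config_algebra_def sets_measure_of[OF config_algebra_generators]
    using assms by (intro sigma_sets.Basic) auto
  then show "(\<lambda>\<omega>. card (\<omega> i \<inter> B)) \<in> space config_algebra \<rightarrow> UNIV \<and>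
    (\<forall>a\<in>UNIV. (\<lambda>\<omega>. card (\<omega> i \<inter> B)) -` {a} \<inter> space config_algebra \<in> sets config_algebra)"
    by (simp add: vimage_def Collect_conj_eq[symmetric] Int_def conj_commute)
qed

lemma restrict_config_configs:
  assumes "\<omega> \<in> configs" shows "restrict_config S \<omega> \<in> configs"
proof -
  have "finite (\<omega> i \<inter> S \<inter> {a..b})" for i a b
    using assms by (metis (no_types, lifting) configs_def finite_Int inf_assoc inf_commute mem_Collect_eq)
  moreover have "(\<omega> i \<inter> S) \<inter> (\<omega> j \<inter> S) = {}" if "i \<noteq> j" for i j
    using assms that unfolding configs_def by blast
  ultimately show ?thesis by (auto simp: configs_def restrict_config_def)
qed

text \<open>
  The generators fix a single count, so measurability of all counts is enough.
\<close>

lemma measurable_config_algebraI: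
  assumes "f \<in> space M \<rightarrow> configs"
    and "\<And>i B. B \<in> sets borel \<Longrightarrow> bounded B \<Longrightarrow>
      (\<lambda>\<omega>. card (f \<omega> i \<inter> B)) \<in> M \<rightarrow>\<^sub>M count_space UNIV"
  shows "f \<in> M \<rightarrow>\<^sub>M config_algebra"
  unfolding config_algebra_def
proof (rule measurable_measure_of[OF config_algebra_generators assms(1)])
  fix y :: "'b config set" 
  assume "y \<in> {{\<omega> \<in> configs. card (\<omega> i \<inter> B) = n} | i B n. B \<in> sets borel \<and> bounded B}"
  then obtain i :: 'b and B n where y: "y = {\<omega> \<in> configs. card (\<omega> i \<inter> B) = n}" "B \<in> sets borel" "bounded B" by blast
  have "f -` y \<inter> space M = (\<lambda>\<omega>. card (f \<omega> i \<inter> B)) -` {n} \<inter> space M"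
    using assms(1) y(1) by (auto simp: Pi_iff)
  then show "f -` y \<inter> space M \<in> sets M"
    using measurable_sets[OF assms(2)[OF y(2,3)], of "{n}" i] by simp
qed

lemma measurable_restrict_config:
  assumes "S \<in> sets borel"
  shows "restrict_config S \<in> config_algebra \<rightarrow>\<^sub>M config_algebra"
proof (rule measurable_config_algebraI)
  fix i :: 'a and B :: "real set" assume "B \<in> sets borel" "bounded B"
  then have "S \<inter> B \<in> sets borel" "bounded (S \<inter> B)" using assms by (auto simp: bounded_Int)
  from measurable_card[OF this, of i]
  show "(\<lambda>\<omega>. card (restrict_config S \<omega> i \<inter> B)) \<in> config_algebra \<rightarrow>\<^sub>M count_space UNIV"
    by (simp add: restrict_config_def Int_assoc)
qed (auto intro: restrict_config_configs)

lemma space_observed [simp]: "space (observed S) = configs"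
  by (simp add: observed_def)

lemma restrict_config_observed:
  "restrict_config S \<in> observed S \<rightarrow>\<^sub>M config_algebra"
  unfolding observed_def
  by (rule measurable_vimage_algebra1) (auto intro: restrict_config_configs)

lemma observed_measurableI:
  assumes "S \<in> sets borel" "restrict_config S \<in> M \<rightarrow>\<^sub>M config_algebra" "space M = configs"
  shows "sets (observed S) \<subseteq> sets M"
proof
  fix X assume "X \<in> sets (observed S :: 'a config measure)"
  then obtain Y where "Y \<in> sets config_algebra" "X = restrict_config S -` Y \<inter> configs"
    unfolding observed_def by (subst (asm) sets_vimage_algebra2) (auto intro: restrict_config_configs)
  then show "X \<in> sets M" using measurable_sets[OF assms(2)] assms(3) by auto
qed

lemma sets_observed_subset:
  assumes "S \<in> sets borel"
  shows "sets (observed S) \<subseteq> sets config_algebra"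
  by (rule observed_measurableI[OF assms measurable_restrict_config[OF assms]]) simp

lemma sets_observed_mono:
  assumes "S \<in> sets borel" "S \<subseteq> S'"
  shows "sets (observed S) \<subseteq> sets (observed S')"
proof (rule observed_measurableI[OF assms(1)])
  have "restrict_config S = (\<lambda>\<omega>::'a config. restrict_config S (restrict_config S' \<omega>))"
    using assms(2) by (auto simp: restrict_config_def fun_eq_iff)
  then show "restrict_config S \<in> observed S' \<rightarrow>\<^sub>M (config_algebra :: 'a config measure)"
    using measurable_compose[OF restrict_config_observed measurable_restrict_config[OF assms(1)]]
    by metis
qed simp

lemma measurable_observed_mono:
  assumes "f \<in> observed S \<rightarrow>\<^sub>M N" "S \<in> sets borel" "S \<subseteq> S'"
  shows "f \<in> observed S' \<rightarrow>\<^sub>M N"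
  using measurable_mono[of N N "observed S" "observed S'"] assms sets_observed_mono by auto

lemma measurable_observed_config_algebra:
  assumes "f \<in> observed S \<rightarrow>\<^sub>M N" "S \<in> sets borel"
  shows "f \<in> config_algebra \<rightarrow>\<^sub>M N"
  using measurable_mono[of N N "observed S" "config_algebra"] assms sets_observed_subset by auto

lemma measurable_card_observed:
  assumes "B \<in> sets borel" "bounded B" "B \<subseteq> S"
  shows "(\<lambda>\<omega>. card (\<omega> i \<inter> B)) \<in> observed S \<rightarrow>\<^sub>M count_space UNIV"
proof -
  have "restrict_config S \<omega> i \<inter> B = \<omega> i \<inter> B" for \<omega> using assms(3) by (auto simp: restrict_config_def)
  then show ?thesis
    using measurable_compose[OF restrict_config_observed measurable_card[OF assms(1,2)], of S i] by simp
qed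

lemma measurable_real_card_observed:
  assumes "B \<in> sets borel" "bounded B" "B \<subseteq> S"
  shows "(\<lambda>\<omega>. real (card (\<omega> i \<inter> B))) \<in> borel_measurable (observed S)"
  by (rule measurable_compose[OF measurable_card_observed[OF assms]]) simp

section \<open>Left-continuous adapted processes\<close>

text \<open>
  The left end point of the cell containing \<open>u\<close> when \<open>(a, b]\<close> is cut into \<open>n\<close> half-open cells. It stays
  strictly below \<open>u\<close>, so evaluating an adapted process at \<open>grid_floor a b n u\<close> uses only the strict past of \<open>u\<close>,
  and left continuity recovers the value at \<open>u\<close> in the limit.
\<close>

definition grid_floor :: "real \<Rightarrow> real \<Rightarrow> nat \<Rightarrow> real \<Rightarrow> real" where
  "grid_floor a b n u = a + (b - a) * (of_int \<lceil>(u - a) * real n / (b - a)\<rceil> - 1) / real n"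

definition grid_cell :: "real \<Rightarrow> real \<Rightarrow> nat \<Rightarrow> nat \<Rightarrow> real set" where
  "grid_cell a b n k = {a + (b - a) * real k / real n <.. a + (b - a) * real (Suc k) / real n}"

lemma grid_floor_less:
  assumes "a < b" "n > 0" shows "grid_floor a b n u < u"
proof -
  have "of_int \<lceil>(u - a) * real n / (b - a)\<rceil> - 1 < (u - a) * real n / (b - a)" by linarith
  then have "(b - a) * (of_int \<lceil>(u - a) * real n / (b - a)\<rceil> - 1) / real n < (b - a) * ((u - a) * real n / (b - a)) / real n"
    using assms by (intro divide_strict_right_mono mult_strict_left_mono) auto
  also have "\<dots> = u - a" using assms by simp
  finally show ?thesis unfolding grid_floor_def by linarith
qed

lemma grid_floor_ge:
  assumes "a < b" "n > 0" shows "u - (b - a) / real n \<le> grid_floor a b n u"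
proof -
  have "(u - a) * real n / (b - a) - 1 \<le> of_int \<lceil>(u - a) * real n / (b - a)\<rceil> - 1" by linarith
  then have "(b - a) * ((u - a) * real n / (b - a) - 1) / real n \<le> (b - a) * (of_int \<lceil>(u - a) * real n / (b - a)\<rceil> - 1) / real n"
    using assms by (intro divide_right_mono mult_left_mono) auto
  also have "(b - a) * ((u - a) * real n / (b - a) - 1) / real n = u - a - (b - a) / real n"
    using assms by (simp add: field_simps)
  finally show ?thesis unfolding grid_floor_def by linarith
qed

lemma grid_floor_at_left:
  assumes "a < b" shows "filterlim (\<lambda>n. grid_floor a b n u) (at_left u) sequentially"
proof -
  have lt: "\<forall>\<^sub>F n in sequentially. grid_floor a b n u < u"
    using eventually_gt_at_top[of 0] by (rule eventually_mono) (rule grid_floor_less[OF assms])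
  have ge: "\<forall>\<^sub>F n in sequentially. u - (b - a) / real n \<le> grid_floor a b n u"
    using eventually_gt_at_top[of 0] by (rule eventually_mono) (rule grid_floor_ge[OF assms])
  have "(\<lambda>n. u - (b - a) / real n) \<longlonglongrightarrow> u - 0"
    by (intro tendsto_diff tendsto_const lim_const_over_n)
  then have lim: "(\<lambda>n. u - (b - a) / real n) \<longlonglongrightarrow> u" by simp
  have le: "\<forall>\<^sub>F n in sequentially. grid_floor a b n u \<le> u" using lt by (rule eventually_mono) simp
  have "(\<lambda>n. grid_floor a b n u) \<longlonglongrightarrow> u" by (rule tendsto_sandwich[OF ge le lim tendsto_const])
  moreover have "\<forall>\<^sub>F n in sequentially. grid_floor a b n u \<in> {..<u} \<and> grid_floor a b n u \<noteq> u"
    using lt by (rule eventually_mono) auto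
  ultimately show ?thesis by (simp add: filterlim_at)
qed

lemma grid_cell_iff:
  assumes "a < b" "n > 0"
  shows "u \<in> grid_cell a b n k \<longleftrightarrow> \<lceil>(u - a) * real n / (b - a)\<rceil> = int k + 1"
proof -
  have ab: "0 < b - a" and n: "0 < real n" using assms by auto
  have "a + (b - a) * x / real n < u \<longleftrightarrow> x < (u - a) * real n / (b - a)" for x
  proof -
    have "a + (b - a) * x / real n < u \<longleftrightarrow> (b - a) * x / real n < u - a" by linarith
    also have "\<dots> \<longleftrightarrow> (b - a) * x < (u - a) * real n" by (rule pos_divide_less_eq[OF n])
    also have "\<dots> \<longleftrightarrow> x < (u - a) * real n / (b - a)"
      by (simp only: pos_less_divide_eq[OF ab] mult.commute[of x])
    finally show ?thesis .
  qed
  then have "u \<in> grid_cell a b n k \<longleftrightarrow> real k < (u - a) * real n / (b - a) \<and> (u - a) * real n / (b - a) \<le> real k + 1"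
    by (simp add: grid_cell_def not_less[symmetric] add.commute)
  also have "\<dots> \<longleftrightarrow> \<lceil>(u - a) * real n / (b - a)\<rceil> = int k + 1"
    by (auto simp: ceiling_eq_iff)
  finally show ?thesis .
qed

lemma grid_floor_cell:
  assumes "a < b" "n > 0" "u \<in> grid_cell a b n k"
  shows "grid_floor a b n u = a + (b - a) * real k / real n"
  using assms(3) unfolding grid_cell_iff[OF assms(1,2)] by (simp add: grid_floor_def)

lemma grid_cells_partition:
  assumes "a < b" "n > 0"
  shows "{a<..b} = (\<Union>k<n. grid_cell a b n k)" "disjoint_family_on (grid_cell a b n) UNIV"
proof -
  show "disjoint_family_on (grid_cell a b n) UNIV"
    using assms by (auto simp: disjoint_family_on_def grid_cell_iff)
  have "u \<in> {a<..b} \<longleftrightarrow> (\<exists>k<n. u \<in> grid_cell a b n k)" for u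
  proof -
    let ?x = "(u - a) * real n / (b - a)"
    have "u \<in> {a<..b} \<longleftrightarrow> 0 < ?x \<and> ?x \<le> real n"
    proof -
      have "?x \<le> real n \<longleftrightarrow> (u - a) * real n \<le> (b - a) * real n"
        using assms by (simp only: pos_divide_le_eq mult.commute diff_gt_0_iff_gt)
      also have "\<dots> \<longleftrightarrow> u \<le> b" using assms by (simp add: mult_le_cancel_right)
      finally have "?x \<le> real n \<longleftrightarrow> u \<le> b" .
      moreover have "0 < ?x \<longleftrightarrow> a < u" using assms by (simp add: zero_less_divide_iff zero_less_mult_iff)
      ultimately show ?thesis by auto
    qed
    also have "\<dots> \<longleftrightarrow> 1 \<le> \<lceil>?x\<rceil> \<and> \<lceil>?x\<rceil> \<le> int n" by (simp only: ceiling_le_iff one_le_ceiling of_int_of_nat_eq)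
    also have "\<dots> \<longleftrightarrow> (\<exists>k<n. \<lceil>?x\<rceil> = int k + 1)"
    proof
      assume "1 \<le> \<lceil>?x\<rceil> \<and> \<lceil>?x\<rceil> \<le> int n" 
      then have "nat (\<lceil>?x\<rceil> - 1) < n \<and> \<lceil>?x\<rceil> = int (nat (\<lceil>?x\<rceil> - 1)) + 1" by linarith
      then show "\<exists>k<n. \<lceil>?x\<rceil> = int k + 1" by blast
    next
      assume "\<exists>k<n. \<lceil>?x\<rceil> = int k + 1"
      then show "1 \<le> \<lceil>?x\<rceil> \<and> \<lceil>?x\<rceil> \<le> int n" by force
    qed
    finally show ?thesis by (simp add: grid_cell_iff[OF assms])
  qed
  then show "{a<..b} = (\<Union>k<n. grid_cell a b n k)" by blast
qed

lemma grid_cell_subset: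
  assumes "a < b" "k < n" shows "grid_cell a b n k \<subseteq> {a<..b}"
  using grid_cells_partition(1)[of a b n] assms by fastforce

text \<open>Riemann sums.\<close>

text \<open>
  Sampling at the left end points of the cells turns a sum over points, whose number is random, into a
  sum over a fixed number of cells weighted by counts. This is how counts, the only quantities the
  \<open>\<sigma>\<close>-algebra speaks about, control sums over points.
\<close>

lemma sum_grid_floor:
  fixes G :: "real \<Rightarrow> real"
  assumes "a < b" "n > 0" "finite (S \<inter> {a<..b})"
  shows "(\<Sum>s\<in>S \<inter> {a<..b}. G (grid_floor a b n s)) =
    (\<Sum>k<n. G (a + (b - a) * real k / real n) * real (card (S \<inter> grid_cell a b n k)))"
proof -
  have fin: "finite (S \<inter> grid_cell a b n k)" if "k < n" for k
    by (rule finite_subset[OF _ assms(3)]) (use grid_cell_subset[OF assms(1) that] in auto)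
  have "S \<inter> {a<..b} = (\<Union>k\<in>{..<n}. S \<inter> grid_cell a b n k)"
    using grid_cells_partition(1)[OF assms(1,2)] by auto
  also have "(\<Sum>s\<in>\<dots>. G (grid_floor a b n s)) = (\<Sum>k<n. \<Sum>s\<in>S \<inter> grid_cell a b n k. G (grid_floor a b n s))"
    using grid_cells_partition(2)[OF assms(1,2)] fin
    by (intro sum.UNION_disjoint) (auto simp: disjoint_family_on_def)
  also have "\<dots> = (\<Sum>k<n. \<Sum>s\<in>S \<inter> grid_cell a b n k. G (a + (b - a) * real k / real n))"
    by (intro sum.cong refl) (metis IntE grid_floor_cell[OF assms(1,2)])
  finally show ?thesis by (simp add: mult.commute)
qed

lemma indicator_grid_floor:
  fixes G :: "real \<Rightarrow> real"
  assumes "a < b" "n > 0" 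
  shows "G (grid_floor a b n u) * indicator {a<..b} u =
    (\<Sum>k<n. G (a + (b - a) * real k / real n) * indicator (grid_cell a b n k) u)"
proof (cases "u \<in> {a<..b}")
  case True
  then obtain k where k: "k < n" "u \<in> grid_cell a b n k" using grid_cells_partition(1)[OF assms] by blast
  have "(\<Sum>j<n. G (a + (b - a) * real j / real n) * indicator (grid_cell a b n j) u) =
    (\<Sum>j\<in>{..<n}. if j = k then G (a + (b - a) * real k / real n) else 0)"
    using k grid_cells_partition(2)[OF assms] by (intro sum.cong) (auto simp: disjoint_family_on_def indicator_def)
  then show ?thesis using k True by (simp add: grid_floor_cell[OF assms k(2)])
next
  case False
  then have "u \<notin> grid_cell a b n k" if "k < n" for k using grid_cell_subset[OF assms(1) that] by blast
  then have "(\<Sum>k<n. G (a + (b - a) * real k / real n) * indicator (grid_cell a b n k) u) = 0"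
    by (intro sum.neutral) auto
  with False show ?thesis by simp
qed

lemma borel_measurable_eqI:
  assumes "g \<in> borel_measurable N" "\<And>x. x \<in> space N \<Longrightarrow> f x = g x"
  shows "f \<in> borel_measurable N"
  using assms measurable_cong[of N f g borel] by blast

lemma measurable_sum_points:
  fixes G :: "real \<Rightarrow> 'd config \<Rightarrow> real"
  assumes N: "space N = configs"
    and cnt: "\<And>B. B \<in> sets borel \<Longrightarrow> B \<subseteq> {a<..b} \<Longrightarrow> (\<lambda>\<omega>. real (card (\<omega> i \<inter> B))) \<in> borel_measurable N"
    and G: "\<And>s. a \<le> s \<Longrightarrow> s < b \<Longrightarrow> G s \<in> borel_measurable N"
    and left: "\<And>\<omega> s. \<omega> \<in> configs \<Longrightarrow> a < s \<Longrightarrow> s \<le> b \<Longrightarrow> ((\<lambda>u. G u \<omega>) \<longlongrightarrow> G s \<omega>) (at_left s)"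
  shows "(\<lambda>\<omega>. \<Sum>s\<in>\<omega> i \<inter> {a<..b}. G s \<omega>) \<in> borel_measurable N"
proof (cases "a < b")
  case True
  show ?thesis
  proof (rule borel_measurable_LIMSEQ_real)
    fix \<omega> assume "\<omega> \<in> space N"
    then have w: "\<omega> \<in> configs" using N by simp
    show "(\<lambda>n. \<Sum>s\<in>\<omega> i \<inter> {a<..b}. G (grid_floor a b (Suc n) s) \<omega>) \<longlonglongrightarrow> (\<Sum>s\<in>\<omega> i \<inter> {a<..b}. G s \<omega>)"
      by (intro tendsto_sum LIMSEQ_Suc filterlim_compose[OF left[OF w] grid_floor_at_left[OF True]]) auto
  next
    fix n
    have sub: "grid_cell a b (Suc n) k \<subseteq> {a<..b}" if "k < Suc n" for k using grid_cell_subset[OF True that] .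
    have pt: "a \<le> a + (b - a) * real k / real (Suc n)" "a + (b - a) * real k / real (Suc n) < b" if "k < Suc n" for k
    proof -
      have "(b - a) * real k < (b - a) * real (Suc n)" using True that by (intro mult_strict_left_mono) auto
      then have "(b - a) * real k / real (Suc n) < b - a" by (simp add: divide_less_eq)
      then show "a + (b - a) * real k / real (Suc n) < b" by simp
    qed (use True in auto)
    have eq: "(\<Sum>s\<in>\<omega> i \<inter> {a<..b}. G (grid_floor a b (Suc n) s) \<omega>) =
      (\<Sum>k<Suc n. G (a + (b - a) * real k / real (Suc n)) \<omega> * real (card (\<omega> i \<inter> grid_cell a b (Suc n) k)))"
      if "\<omega> \<in> space N" for \<omega>
      using that N True by (intro sum_grid_floor config_finite) auto
    have "(\<lambda>\<omega>. \<Sum>k<Suc n. G (a + (b - a) * real k / real (Suc n)) \<omega> * real (card (\<omega> i \<inter> grid_cell a b (Suc n) k)))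
      \<in> borel_measurable N"
      using pt sub by (intro borel_measurable_sum borel_measurable_times G cnt) (auto simp: grid_cell_def)
    then show "(\<lambda>\<omega>. \<Sum>s\<in>\<omega> i \<inter> {a<..b}. G (grid_floor a b (Suc n) s) \<omega>) \<in> borel_measurable N"
      by (rule borel_measurable_eqI) (rule eq)
  qed
qed simp

text \<open>
  The class of integrands for which everything below works. Adaptedness together with left continuity
  is a pathwise substitute for predictability; finitely many discontinuities on bounded intervals make
  the fundamental theorem of calculus applicable to path integrals. Left continuity is required at positive
  times only, so that anything known at time \<open>0\<close> may enter as a constant.
\<close>

definition regular_process :: "(real \<Rightarrow> 'd config \<Rightarrow> real) \<Rightarrow> bool" where
  "regular_process H \<longleftrightarrow>
     (\<forall>t\<ge>0. H t \<in> borel_measurable (observed {..t})) \<and>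
     (\<forall>\<omega>\<in>configs. \<forall>t>0. ((\<lambda>s. H s \<omega>) \<longlongrightarrow> H t \<omega>) (at_left t)) \<and>
     (\<forall>\<omega>\<in>configs. \<forall>T. finite {t\<in>{0<..<T}. \<not> isCont (\<lambda>s. H s \<omega>) t})"

lemma
  assumes "regular_process H"
  shows regular_measurable: "t \<ge> 0 \<Longrightarrow> H t \<in> borel_measurable (observed {..t})"
    and regular_left: "\<omega> \<in> configs \<Longrightarrow> t > 0 \<Longrightarrow> ((\<lambda>s. H s \<omega>) \<longlongrightarrow> H t \<omega>) (at_left t)"
    and regular_finite: "\<omega> \<in> configs \<Longrightarrow> finite {t\<in>{0<..<T}. \<not> isCont (\<lambda>s. H s \<omega>) t}"
  using assms unfolding regular_process_def by simp_all

lemma regular_const: "regular_process (\<lambda>t \<omega>. c)"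
  by (simp add: regular_process_def)

lemma regular_indicator:
  assumes "F \<in> sets (observed {..0})" shows "regular_process (\<lambda>t \<omega>. indicator F \<omega>)"
proof -
  have "F \<in> sets (observed {..t})" if "0 \<le> t" for t :: real
    using assms sets_observed_mono[of "{..0}" "{..t}"] that by auto
  then show ?thesis by (simp add: regular_process_def)
qed

lemma regular_add:
  assumes H: "regular_process H" "regular_process H'"
  shows "regular_process (\<lambda>t \<omega>. H t \<omega> + H' t \<omega>)"
  unfolding regular_process_def
proof (intro conjI allI ballI impI)
  show "(\<lambda>\<omega>. H t \<omega> + H' t \<omega>) \<in> borel_measurable (observed {..t})" if "0 \<le> t" for t
    by (intro borel_measurable_add regular_measurable H that)
  show "((\<lambda>s. H s \<omega> + H' s \<omega>) \<longlongrightarrow> H t \<omega> + H' t \<omega>) (at_left t)" if "\<omega> \<in> configs" "0 < t" for \<omega> t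
    by (intro tendsto_add regular_left H that)
  show "finite {t \<in> {0<..<T}. \<not> isCont (\<lambda>s. H s \<omega> + H' s \<omega>) t}" if w: "\<omega> \<in> configs" for \<omega> T
  proof (rule finite_subset)
    show "{t \<in> {0<..<T}. \<not> isCont (\<lambda>s. H s \<omega> + H' s \<omega>) t} \<subseteq>
      {t \<in> {0<..<T}. \<not> isCont (\<lambda>s. H s \<omega>) t} \<union> {t \<in> {0<..<T}. \<not> isCont (\<lambda>s. H' s \<omega>) t}"
      by (auto intro: continuous_add)
    show "finite ({t \<in> {0<..<T}. \<not> isCont (\<lambda>s. H s \<omega>) t} \<union> {t \<in> {0<..<T}. \<not> isCont (\<lambda>s. H' s \<omega>) t})"
      using regular_finite[OF H(1) w] regular_finite[OF H(2) w] by (rule finite_UnI)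
  qed
qed

lemma regular_mult:
  assumes H: "regular_process H" "regular_process H'"
  shows "regular_process (\<lambda>t \<omega>. H t \<omega> * H' t \<omega>)"
  unfolding regular_process_def
proof (intro conjI allI ballI impI)
  show "(\<lambda>\<omega>. H t \<omega> * H' t \<omega>) \<in> borel_measurable (observed {..t})" if "0 \<le> t" for t
    by (intro borel_measurable_times regular_measurable H that)
  show "((\<lambda>s. H s \<omega> * H' s \<omega>) \<longlongrightarrow> H t \<omega> * H' t \<omega>) (at_left t)" if "\<omega> \<in> configs" "0 < t" for \<omega> t
    by (intro tendsto_mult regular_left H that)
  show "finite {t \<in> {0<..<T}. \<not> isCont (\<lambda>s. H s \<omega> * H' s \<omega>) t}" if w: "\<omega> \<in> configs" for \<omega> T
  proof (rule finite_subset)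
    show "{t \<in> {0<..<T}. \<not> isCont (\<lambda>s. H s \<omega> * H' s \<omega>) t} \<subseteq>
      {t \<in> {0<..<T}. \<not> isCont (\<lambda>s. H s \<omega>) t} \<union> {t \<in> {0<..<T}. \<not> isCont (\<lambda>s. H' s \<omega>) t}"
      by (auto intro: continuous_mult)
    show "finite ({t \<in> {0<..<T}. \<not> isCont (\<lambda>s. H s \<omega>) t} \<union> {t \<in> {0<..<T}. \<not> isCont (\<lambda>s. H' s \<omega>) t})"
      using regular_finite[OF H(1) w] regular_finite[OF H(2) w] by (rule finite_UnI)
  qed
qed

lemma regular_compose:
  assumes H: "regular_process H" and f: "f \<in> borel_measurable borel"
    and cont: "\<And>t \<omega>. 0 < t \<Longrightarrow> \<omega> \<in> configs \<Longrightarrow> isCont f (H t \<omega>)"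
  shows "regular_process (\<lambda>t \<omega>. f (H t \<omega>))"
  unfolding regular_process_def
proof (intro conjI allI ballI impI)
  show "(\<lambda>\<omega>. f (H t \<omega>)) \<in> borel_measurable (observed {..t})" if "0 \<le> t" for t
    by (rule measurable_compose[OF regular_measurable[OF H that] f])
  show "((\<lambda>s. f (H s \<omega>)) \<longlongrightarrow> f (H t \<omega>)) (at_left t)" if "\<omega> \<in> configs" "0 < t" for \<omega> t
    by (rule isCont_tendsto_compose[OF cont[OF that(2,1)] regular_left[OF H that]])
  show "finite {t \<in> {0<..<T}. \<not> isCont (\<lambda>s. f (H s \<omega>)) t}" if w: "\<omega> \<in> configs" for \<omega> T
  proof (rule finite_subset[OF _ regular_finite[OF H w]])
    have "isCont (\<lambda>s. f (H s \<omega>)) t" if "0 < t" "isCont (\<lambda>s. H s \<omega>) t" for t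
      by (rule isCont_o2[OF that(2) cont[OF that(1) w]])
    then show "{t \<in> {0<..<T}. \<not> isCont (\<lambda>s. f (H s \<omega>)) t} \<subseteq> {t \<in> {0<..<T}. \<not> isCont (\<lambda>s. H s \<omega>) t}"
      by auto
  qed
qed

lemma regular_cmult: "regular_process H \<Longrightarrow> regular_process (\<lambda>t \<omega>. c * H t \<omega>)"
  by (rule regular_mult[OF regular_const])

lemma regular_diff:
  assumes "regular_process H" "regular_process H'"
  shows "regular_process (\<lambda>t \<omega>. H t \<omega> - H' t \<omega>)"
  using regular_add[OF assms(1) regular_cmult[OF assms(2), of "-1"]] by simp

lemma regular_sum:
  assumes "finite I" "\<And>i. i \<in> I \<Longrightarrow> regular_process (H i)"
  shows "regular_process (\<lambda>t \<omega>. \<Sum>i\<in>I. H i t \<omega>)"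
  using assms by (induction I) (auto intro: regular_const regular_add)

lemma regular_prod:
  assumes "finite I" "\<And>i. i \<in> I \<Longrightarrow> regular_process (H i)"
  shows "regular_process (\<lambda>t \<omega>. \<Prod>i\<in>I. H i t \<omega>)"
  using assms by (induction I) (auto intro: regular_const regular_mult)

lemma regular_divide:
  assumes "regular_process H" "regular_process H'" "\<And>t \<omega>. 0 < t \<Longrightarrow> \<omega> \<in> configs \<Longrightarrow> H' t \<omega> \<noteq> 0"
  shows "regular_process (\<lambda>t \<omega>. H t \<omega> / H' t \<omega>)"
proof -
  have "regular_process (\<lambda>t \<omega>. inverse (H' t \<omega>))"
  proof (rule regular_compose[OF assms(2)])
    show "isCont inverse (H' t \<omega>)" if "0 < t" "\<omega> \<in> configs" for t \<omega>
      by (rule continuous_at_within_inverse[OF continuous_ident assms(3)[OF that]])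
  qed simp
  from regular_mult[OF assms(1) this] show ?thesis by (simp add: divide_inverse)
qed

section \<open>Shot noise\<close>

text \<open>
  Local finiteness leaves a gap around every time, which is why windows of points are locally constant on either side of it.
\<close>

lemma config_isolated:
  assumes "\<omega> \<in> configs"
  obtains e where "e > 0" "\<And>s. s \<in> \<omega> i \<Longrightarrow> s \<noteq> t \<Longrightarrow> e \<le> \<bar>s - t\<bar>"
proof -
  let ?S = "\<omega> i \<inter> {t - 1..t + 1} - {t}"
  have fin: "finite ?S" using assms by (auto simp: configs_def)
  define e where "e = Min (insert 1 ((\<lambda>s. \<bar>s - t\<bar>) ` ?S))"
  have "e > 0" unfolding e_def using fin by (subst Min_gr_iff) auto
  moreover have "e \<le> \<bar>s - t\<bar>" if "s \<in> \<omega> i" "s \<noteq> t" for s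
  proof (cases "s \<in> {t - 1..t + 1}")
    case True
    then show ?thesis unfolding e_def using that fin by (intro Min_le) auto
  next
    case False
    have "e \<le> 1" unfolding e_def using fin by (intro Min_le) auto
    with False show ?thesis by auto
  qed
  ultimately show ?thesis using that by blast
qed

lemma eventually_window_left:
  assumes "\<omega> \<in> configs"
  shows "\<forall>\<^sub>F u in at_left t. \<omega> i \<inter> {u - a..<u} = \<omega> i \<inter> {t - a..<t}"
proof -
  obtain e where e: "e > 0" "\<And>s. s \<in> \<omega> i \<Longrightarrow> s \<noteq> t \<Longrightarrow> e \<le> \<bar>s - t\<bar>" using config_isolated[OF assms] by metis
  obtain e' where e': "e' > 0" "\<And>s. s \<in> \<omega> i \<Longrightarrow> s \<noteq> t - a \<Longrightarrow> e' \<le> \<bar>s - (t - a)\<bar>"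
    using config_isolated[OF assms] by metis
  have "\<omega> i \<inter> {u - a..<u} = \<omega> i \<inter> {t - a..<t}" if "t - min e e' < u" "u < t" for u
  proof -
    have "s < u \<longleftrightarrow> s < t" "u - a \<le> s \<longleftrightarrow> t - a \<le> s" if "s \<in> \<omega> i" for s
    proof -
      have "s = t \<or> e \<le> \<bar>s - t\<bar>" "s = t - a \<or> e' \<le> \<bar>s - (t - a)\<bar>" using e(2) e'(2) that by blast+
      then show "s < u \<longleftrightarrow> s < t" "u - a \<le> s \<longleftrightarrow> t - a \<le> s" using \<open>t - min e e' < u\<close> \<open>u < t\<close> by arith+
    qed
    then show ?thesis by auto
  qed
  then show ?thesis unfolding eventually_at_left_field using e(1) e'(1)
    by (intro exI[of _ "t - min e e'"]) auto
qed

lemma eventually_window_right: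
  assumes "\<omega> \<in> configs"
  shows "\<forall>\<^sub>F u in at_right t. \<omega> i \<inter> {u - a..<u} = \<omega> i \<inter> {t - a<..t}"
proof -
  obtain e where e: "e > 0" "\<And>s. s \<in> \<omega> i \<Longrightarrow> s \<noteq> t \<Longrightarrow> e \<le> \<bar>s - t\<bar>" using config_isolated[OF assms] by metis
  obtain e' where e': "e' > 0" "\<And>s. s \<in> \<omega> i \<Longrightarrow> s \<noteq> t - a \<Longrightarrow> e' \<le> \<bar>s - (t - a)\<bar>"
    using config_isolated[OF assms] by metis
  have "\<omega> i \<inter> {u - a..<u} = \<omega> i \<inter> {t - a<..t}" if "u < t + min e e'" "t < u" for u
  proof -
    have "s < u \<longleftrightarrow> s \<le> t" "u - a \<le> s \<longleftrightarrow> t - a < s" if "s \<in> \<omega> i" for s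
    proof -
      have "s = t \<or> e \<le> \<bar>s - t\<bar>" "s = t - a \<or> e' \<le> \<bar>s - (t - a)\<bar>" using e(2) e'(2) that by blast+
      then show "s < u \<longleftrightarrow> s \<le> t" "u - a \<le> s \<longleftrightarrow> t - a < s" using \<open>u < t + min e e'\<close> \<open>t < u\<close> by arith+
    qed
    then show ?thesis by auto
  qed
  then show ?thesis unfolding eventually_at_right_field using e(1) e'(1)
    by (intro exI[of _ "t + min e e'"]) auto
qed

lemma eventually_past_left:
  assumes "\<omega> \<in> configs"
  shows "\<forall>\<^sub>F u in at_left t. \<omega> i \<inter> {0<..<u} = \<omega> i \<inter> {0<..<t}"
proof -
  obtain e where e: "e > 0" "\<And>s. s \<in> \<omega> i \<Longrightarrow> s \<noteq> t \<Longrightarrow> e \<le> \<bar>s - t\<bar>" using config_isolated[OF assms] by metis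
  have "\<omega> i \<inter> {0<..<u} = \<omega> i \<inter> {0<..<t}" if "t - e < u" "u < t" for u
    using e(2) that by fastforce
  then show ?thesis unfolding eventually_at_left_field using e(1) by (intro exI[of _ "t - e"]) auto
qed

lemma eventually_past_right:
  assumes "\<omega> \<in> configs"
  shows "\<forall>\<^sub>F u in at_right t. \<omega> i \<inter> {0<..<u} = \<omega> i \<inter> {0<..t}"
proof -
  obtain e where e: "e > 0" "\<And>s. s \<in> \<omega> i \<Longrightarrow> s \<noteq> t \<Longrightarrow> e \<le> \<bar>s - t\<bar>" using config_isolated[OF assms] by metis
  have "\<omega> i \<inter> {0<..<u} = \<omega> i \<inter> {0<..t}" if "u < t + e" "t < u" for u
    using e(2) that by fastforce
  then show ?thesis unfolding eventually_at_right_field using e(1) by (intro exI[of _ "t + e"]) auto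
qed

lemma eventually_past:
  assumes "\<omega> \<in> configs" "t \<notin> \<omega> i"
  shows "\<forall>\<^sub>F u in nhds t. \<omega> i \<inter> {0<..<u} = \<omega> i \<inter> {0<..<t}"
proof -
  have "\<omega> i \<inter> {0<..t} = \<omega> i \<inter> {0<..<t}" using assms(2) by (auto simp: less_le)
  then have "\<forall>\<^sub>F u in at t. \<omega> i \<inter> {0<..<u} = \<omega> i \<inter> {0<..<t}"
    using eventually_past_left[OF assms(1), of i t] eventually_past_right[OF assms(1), of i t]
    by (simp add: eventually_at_split)
  then show ?thesis by (simp add: eventually_nhds_conv_at)
qed

lemma eventually_window:
  assumes "\<omega> \<in> configs" "t \<notin> \<omega> i" "t - a \<notin> \<omega> i"
  shows "\<forall>\<^sub>F u in nhds t. \<omega> i \<inter> {u - a..<u} = \<omega> i \<inter> {t - a..<t}"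
proof -
  have "\<omega> i \<inter> {t - a<..t} = \<omega> i \<inter> {t - a..<t}" using assms(2,3) by (auto simp: less_eq_real_def less_imp_le)
  then have "\<forall>\<^sub>F u in at t. \<omega> i \<inter> {u - a..<u} = \<omega> i \<inter> {t - a..<t}"
    using eventually_window_left[OF assms(1), of i a t] eventually_window_right[OF assms(1), of i a t]
    by (simp add: eventually_at_split)
  then show ?thesis by (simp add: eventually_nhds_conv_at)
qed

definition shot_noise :: "(real \<Rightarrow> real) \<Rightarrow> real \<Rightarrow> 'd \<Rightarrow> real \<Rightarrow> 'd config \<Rightarrow> real" where
  "shot_noise f a i t \<omega> = (\<Sum>s\<in>\<omega> i \<inter> {t - a..<t}. f (t - s))"

text \<open>
  The right limit includes a point at \<open>t\<close> itself and drops one at \<open>t - a\<close>: the half-open window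
  \<open>[t - a, t)\<close> is replaced by \<open>(t - a, t]\<close>.
\<close>

lemma shot_noise_right:
  assumes "\<omega> \<in> configs" and f: "\<And>x. isCont f x"
  shows "((\<lambda>u. shot_noise f a i u \<omega>) \<longlongrightarrow> (\<Sum>s\<in>\<omega> i \<inter> {t - a<..t}. f (t - s))) (at_right t)"
proof -
  have "((\<lambda>u. \<Sum>s\<in>\<omega> i \<inter> {t - a<..t}. f (u - s)) \<longlongrightarrow> (\<Sum>s\<in>\<omega> i \<inter> {t - a<..t}. f (t - s))) (at_right t)"
    by (intro tendsto_sum isCont_tendsto_compose[OF f] tendsto_intros)
  then show ?thesis
    by (rule Lim_transform_eventually) 
      (use eventually_window_right[OF assms(1), of i a t] in eventually_elim, simp add: shot_noise_def)
qed

lemma shot_noise_left: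
  assumes "\<omega> \<in> configs" and f: "\<And>x. isCont f x"
  shows "((\<lambda>u. shot_noise f a i u \<omega>) \<longlongrightarrow> shot_noise f a i t \<omega>) (at_left t)"
proof -
  have "((\<lambda>u. \<Sum>s\<in>\<omega> i \<inter> {t - a..<t}. f (u - s)) \<longlongrightarrow> (\<Sum>s\<in>\<omega> i \<inter> {t - a..<t}. f (t - s))) (at_left t)"
    by (intro tendsto_sum isCont_tendsto_compose[OF f] tendsto_intros)
  then show ?thesis unfolding shot_noise_def[of f a i t]
    by (rule Lim_transform_eventually) 
      (use eventually_window_left[OF assms(1), of i a t] in eventually_elim, simp add: shot_noise_def)
qed

lemma shot_noise_isCont:
  assumes "\<omega> \<in> configs" "t \<notin> \<omega> i" "t - a \<notin> \<omega> i" and f: "\<And>x. isCont f x"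
  shows "isCont (\<lambda>u. shot_noise f a i u \<omega>) t"
proof -
  have "isCont (\<lambda>u. \<Sum>s\<in>\<omega> i \<inter> {t - a..<t}. f (u - s)) t"
    by (intro continuous_sum isCont_o2[OF _ f] continuous_intros)
  moreover have "\<forall>\<^sub>F u in nhds t. shot_noise f a i u \<omega> = (\<Sum>s\<in>\<omega> i \<inter> {t - a..<t}. f (u - s))"
    using eventually_window[OF assms(1-3)] by eventually_elim (simp add: shot_noise_def)
  ultimately show ?thesis by (subst isCont_cong)
qed

lemma shot_noise_deriv:
  assumes "\<omega> \<in> configs" "t \<notin> \<omega> i" "t - a \<notin> \<omega> i"
    and f: "\<And>s. s \<in> \<omega> i \<Longrightarrow> t - a < s \<Longrightarrow> s < t \<Longrightarrow> (f has_real_derivative f' (t - s)) (at (t - s))"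
  shows "((\<lambda>u. shot_noise f a i u \<omega>) has_real_derivative shot_noise f' a i t \<omega>) (at t)"
proof -
  have "((\<lambda>u. \<Sum>s\<in>\<omega> i \<inter> {t - a..<t}. f (u - s)) has_real_derivative (\<Sum>s\<in>\<omega> i \<inter> {t - a..<t}. f' (t - s))) (at t)"
  proof (rule DERIV_sum)
    fix s assume s: "s \<in> \<omega> i \<inter> {t - a..<t}"
    then have "s \<noteq> t - a" using assms(3) by auto
    with s have "(f has_real_derivative f' (t - s)) (at (t - s))" by (intro f) auto
    moreover have "((\<lambda>u. u - s) has_real_derivative 1) (at t)" by (auto intro!: derivative_eq_intros)
    ultimately show "((\<lambda>u. f (u - s)) has_real_derivative f' (t - s)) (at t)"
      using DERIV_chain2[of f "f' (t - s)" "\<lambda>u. u - s" t 1 UNIV] by simp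
  qed
  moreover have "\<forall>\<^sub>F u in nhds t. shot_noise f a i u \<omega> = (\<Sum>s\<in>\<omega> i \<inter> {t - a..<t}. f (u - s))"
    using eventually_window[OF assms(1-3)] by eventually_elim (simp add: shot_noise_def)
  ultimately show ?thesis unfolding shot_noise_def[of f' a i t] by (subst DERIV_cong_ev[OF refl _ refl])
qed

lemma finite_shifted_points:
  assumes "\<omega> \<in> configs" shows "finite {t\<in>{0<..<T}. t \<in> \<omega> i \<or> t - a \<in> \<omega> i}"
proof -
  have "{t\<in>{0<..<T}. t \<in> \<omega> i \<or> t - a \<in> \<omega> i} \<subseteq> (\<omega> i \<inter> {0<..<T}) \<union> (\<lambda>s. s + a) ` (\<omega> i \<inter> {-a<..<T - a})"
    by (auto intro!: image_eqI)
  then show ?thesis by (rule finite_subset) (auto intro!: config_finite[OF assms])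
qed

lemma regular_shot_noise:
  assumes f: "\<And>x. isCont f x" and "a > 0"
  shows "regular_process (shot_noise f a i)"
  unfolding regular_process_def
proof (intro conjI allI ballI impI)
  show "((\<lambda>s. shot_noise f a i s \<omega>) \<longlongrightarrow> shot_noise f a i t \<omega>) (at_left t)" if "\<omega> \<in> configs" "0 < t" for \<omega> t
    by (rule shot_noise_left[OF that(1) f])
  show "finite {t \<in> {0<..<T}. \<not> isCont (\<lambda>s. shot_noise f a i s \<omega>) t}" if "\<omega> \<in> configs" for \<omega> T
    by (rule finite_subset[OF _ finite_shifted_points[OF that, of T i a]])
      (use shot_noise_isCont[OF that _ _ f] in blast)
  fix t :: real assume "0 \<le> t"
  let ?S = "\<lambda>\<omega>. (\<Sum>s\<in>\<omega> i \<inter> {t - a<..t}. f (t - s))"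
  have 1: "?S \<in> borel_measurable (observed {..t})"
  proof (rule measurable_sum_points)
    show "(\<lambda>\<omega>. real (card (\<omega> i \<inter> B))) \<in> borel_measurable (observed {..t})"
      if "B \<in> sets borel" "B \<subseteq> {t - a<..t}" for B
      using that by (intro measurable_real_card_observed bounded_subset[of "{t - a<..t}" B]) auto
    show "((\<lambda>u. f (t - u)) \<longlongrightarrow> f (t - s)) (at_left s)" for s
      by (intro isCont_tendsto_compose[OF f] tendsto_intros)
  qed auto
  have 2: "(\<lambda>\<omega>. real (card (\<omega> i \<inter> {x}))) \<in> borel_measurable (observed {..t})" if "x \<le> t" for x
    by (rule measurable_real_card_observed) (use that in auto)
  have eq: "shot_noise f a i t \<omega> = ?S \<omega> + f a * real (card (\<omega> i \<inter> {t - a})) - f 0 * real (card (\<omega> i \<inter> {t}))"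
    if "\<omega> \<in> configs" for \<omega>
  proof -
    have fin: "finite (\<omega> i \<inter> B)" if "bounded B" for B by (rule config_finite[OF \<open>\<omega> \<in> configs\<close> that])
    have "shot_noise f a i t \<omega> + (\<Sum>s\<in>\<omega> i \<inter> {t}. f (t - s)) = (\<Sum>s\<in>\<omega> i \<inter> {t - a..<t} \<union> \<omega> i \<inter> {t}. f (t - s))"
      unfolding shot_noise_def by (intro sum.union_disjoint[symmetric] fin) auto
    also have "\<omega> i \<inter> {t - a..<t} \<union> \<omega> i \<inter> {t} = \<omega> i \<inter> {t - a<..t} \<union> \<omega> i \<inter> {t - a}"
      using \<open>a > 0\<close> by auto
    also have "(\<Sum>s\<in>\<dots>. f (t - s)) = ?S \<omega> + (\<Sum>s\<in>\<omega> i \<inter> {t - a}. f (t - s))"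
      by (intro sum.union_disjoint fin) auto
    finally show ?thesis by (cases "t \<in> \<omega> i"; cases "t - a \<in> \<omega> i") auto
  qed
  have "(\<lambda>\<omega>. ?S \<omega> + f a * real (card (\<omega> i \<inter> {t - a})) - f 0 * real (card (\<omega> i \<inter> {t}))) \<in> borel_measurable (observed {..t})"
    using 1 2[of t] 2[of "t - a"] \<open>a > 0\<close> by simp
  then show "shot_noise f a i t \<in> borel_measurable (observed {..t})"
    by (rule borel_measurable_eqI) (simp add: eq)
qed

lemma regular_point_sum:
  assumes G: "regular_process G"
  shows "regular_process (\<lambda>t \<omega>. \<Sum>s\<in>\<omega> i \<inter> {0<..<t}. G s \<omega>)"
  unfolding regular_process_def
proof (intro conjI allI ballI impI)
  show "((\<lambda>s. \<Sum>s\<in>\<omega> i \<inter> {0<..<s}. G s \<omega>) \<longlongrightarrow> (\<Sum>s\<in>\<omega> i \<inter> {0<..<t}. G s \<omega>)) (at_left t)" if "\<omega> \<in> configs" for \<omega> t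
    by (rule tendsto_eventually) (use eventually_past_left[OF that, of i t] in eventually_elim, simp)
  show "finite {t \<in> {0<..<T}. \<not> isCont (\<lambda>s. \<Sum>s\<in>\<omega> i \<inter> {0<..<s}. G s \<omega>) t}" if "\<omega> \<in> configs" for \<omega> T
  proof (rule finite_subset[OF _ finite_shifted_points[OF that, of T i 0]])
    have "isCont (\<lambda>s. \<Sum>s\<in>\<omega> i \<inter> {0<..<s}. G s \<omega>) t" if "t \<notin> \<omega> i" for t
    proof -
      have "\<forall>\<^sub>F u in nhds t. (\<Sum>s\<in>\<omega> i \<inter> {0<..<u}. G s \<omega>) = (\<Sum>s\<in>\<omega> i \<inter> {0<..<t}. G s \<omega>)"
        using eventually_past[OF \<open>\<omega> \<in> configs\<close> that] by eventually_elim simp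
      then show ?thesis by (subst isCont_cong) auto
    qed
    then show "{t \<in> {0<..<T}. \<not> isCont (\<lambda>s. \<Sum>s\<in>\<omega> i \<inter> {0<..<s}. G s \<omega>) t} \<subseteq> {t \<in> {0<..<T}. t \<in> \<omega> i \<or> t - 0 \<in> \<omega> i}"
      by auto
  qed
  fix t :: real assume t: "0 \<le> t"
  let ?S = "\<lambda>\<omega>. (\<Sum>s\<in>\<omega> i \<inter> {0<..t}. G s \<omega>)"
  have 1: "?S \<in> borel_measurable (observed {..t})"
  proof (rule measurable_sum_points)
    show "(\<lambda>\<omega>. real (card (\<omega> i \<inter> B))) \<in> borel_measurable (observed {..t})"
      if "B \<in> sets borel" "B \<subseteq> {0<..t}" for B
      using that by (intro measurable_real_card_observed bounded_subset[of "{0<..t}" B]) auto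
    show "((\<lambda>u. G u \<omega>) \<longlongrightarrow> G s \<omega>) (at_left s)" if "\<omega> \<in> configs" "0 < s" for s \<omega>
      by (rule regular_left[OF G that])
    show "G s \<in> borel_measurable (observed {..t})" if "0 \<le> s" "s < t" for s
      by (rule measurable_observed_mono[OF regular_measurable[OF G that(1)]]) (use that in auto)
  qed auto
  have 2: "(\<lambda>\<omega>. real (card (\<omega> i \<inter> {t}))) \<in> borel_measurable (observed {..t})"
    by (rule measurable_real_card_observed) auto
  have eq: "(\<Sum>s\<in>\<omega> i \<inter> {0<..<t}. G s \<omega>) = ?S \<omega> - (if t = 0 then 0 else G t \<omega> * real (card (\<omega> i \<inter> {t})))"
    if "\<omega> \<in> configs" for \<omega>
  proof (cases "t = 0")
    case False
    with t have "0 < t" by simp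
    have fin: "finite (\<omega> i \<inter> B)" if "bounded B" for B by (rule config_finite[OF \<open>\<omega> \<in> configs\<close> that])
    have "(\<Sum>s\<in>\<omega> i \<inter> {0<..<t}. G s \<omega>) + (\<Sum>s\<in>\<omega> i \<inter> {t}. G s \<omega>) = (\<Sum>s\<in>\<omega> i \<inter> {0<..<t} \<union> \<omega> i \<inter> {t}. G s \<omega>)"
      by (intro sum.union_disjoint[symmetric] fin) auto
    also have "\<omega> i \<inter> {0<..<t} \<union> \<omega> i \<inter> {t} = \<omega> i \<inter> {0<..t}"
      using \<open>t > 0\<close> by auto
    finally show ?thesis using False by (cases "t \<in> \<omega> i") auto
  qed simp
  have "(\<lambda>\<omega>. ?S \<omega> - (if t = 0 then 0 else G t \<omega> * real (card (\<omega> i \<inter> {t})))) \<in> borel_measurable (observed {..t})"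
    using 1 2 regular_measurable[OF G t] by (cases "t = 0") auto
  then show "(\<lambda>\<omega>. \<Sum>s\<in>\<omega> i \<inter> {0<..<t}. G s \<omega>) \<in> borel_measurable (observed {..t})"
    by (rule borel_measurable_eqI) (simp add: eq)
qed

text \<open>
  Adding \<open>1 / n\<close> to the factors makes the logarithm available, so that measurability of the product follows
  from that of sums; the product itself is recovered in the limit.
\<close>

lemma regular_point_prod:
  assumes G: "regular_process G" and pos: "\<And>t \<omega>. 0 < t \<Longrightarrow> \<omega> \<in> configs \<Longrightarrow> 0 \<le> G t \<omega>"
  shows "regular_process (\<lambda>t \<omega>. \<Prod>s\<in>\<omega> i \<inter> {0<..<t}. G s \<omega>)"
  unfolding regular_process_def
proof (intro conjI allI ballI impI)
  show "((\<lambda>s. \<Prod>s\<in>\<omega> i \<inter> {0<..<s}. G s \<omega>) \<longlongrightarrow> (\<Prod>s\<in>\<omega> i \<inter> {0<..<t}. G s \<omega>)) (at_left t)" if "\<omega> \<in> configs" for \<omega> t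
    by (rule tendsto_eventually) (use eventually_past_left[OF that, of i t] in eventually_elim, simp)
  show "finite {t \<in> {0<..<T}. \<not> isCont (\<lambda>s. \<Prod>s\<in>\<omega> i \<inter> {0<..<s}. G s \<omega>) t}" if "\<omega> \<in> configs" for \<omega> T
  proof (rule finite_subset[OF _ finite_shifted_points[OF that, of T i 0]])
    have "isCont (\<lambda>s. \<Prod>s\<in>\<omega> i \<inter> {0<..<s}. G s \<omega>) t" if "t \<notin> \<omega> i" for t
    proof -
      have "\<forall>\<^sub>F u in nhds t. (\<Prod>s\<in>\<omega> i \<inter> {0<..<u}. G s \<omega>) = (\<Prod>s\<in>\<omega> i \<inter> {0<..<t}. G s \<omega>)"
        using eventually_past[OF \<open>\<omega> \<in> configs\<close> that] by eventually_elim simp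
      then show ?thesis by (subst isCont_cong) auto
    qed
    then show "{t \<in> {0<..<T}. \<not> isCont (\<lambda>s. \<Prod>s\<in>\<omega> i \<inter> {0<..<s}. G s \<omega>) t} \<subseteq> {t \<in> {0<..<T}. t \<in> \<omega> i \<or> t - 0 \<in> \<omega> i}"
      by auto
  qed
  fix t :: real assume t: "0 \<le> t"
  show "(\<lambda>\<omega>. \<Prod>s\<in>\<omega> i \<inter> {0<..<t}. G s \<omega>) \<in> borel_measurable (observed {..t})"
  proof (rule borel_measurable_LIMSEQ_real)
    fix n :: nat
    have e: "1 / real (Suc n) > 0" by simp
    have "regular_process (\<lambda>t \<omega>. ln (G t \<omega> + 1 / real (Suc n)))"
    proof (rule regular_compose[where f=ln])
      show "isCont ln (G t \<omega> + 1 / real (Suc n))" if "0 < t" "\<omega> \<in> configs" for t \<omega>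
        using pos[OF that] e by (intro isCont_ln_pos add_nonneg_pos)
    qed (auto intro: regular_add G regular_const)
    from regular_measurable[OF regular_point_sum[OF this] t]
    show "(\<lambda>\<omega>. exp (\<Sum>s\<in>\<omega> i \<inter> {0<..<t}. ln (G s \<omega> + 1 / real (Suc n)))) \<in> borel_measurable (observed {..t})"
      by simp
  next
    fix \<omega> :: "'a config" assume "\<omega> \<in> space (observed {..t})"
    then have w: "\<omega> \<in> configs" by simp
    have fin: "finite (\<omega> i \<inter> {0<..<t})" by (rule config_finite[OF w]) auto
    have "exp (\<Sum>s\<in>\<omega> i \<inter> {0<..<t}. ln (G s \<omega> + 1 / real (Suc n))) = (\<Prod>s\<in>\<omega> i \<inter> {0<..<t}. G s \<omega> + 1 / real (Suc n))" for n
      unfolding exp_sum[OF fin] using pos[OF _ w] by (intro prod.cong refl exp_ln add_nonneg_pos) auto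
    moreover have "(\<lambda>n. \<Prod>s\<in>\<omega> i \<inter> {0<..<t}. G s \<omega> + 1 / real (Suc n)) \<longlonglongrightarrow> (\<Prod>s\<in>\<omega> i \<inter> {0<..<t}. G s \<omega> + 0)"
      by (intro tendsto_prod tendsto_intros LIMSEQ_Suc[OF lim_const_over_n])
    ultimately show "(\<lambda>n. exp (\<Sum>s\<in>\<omega> i \<inter> {0<..<t}. ln (G s \<omega> + 1 / real (Suc n)))) \<longlonglongrightarrow> (\<Prod>s\<in>\<omega> i \<inter> {0<..<t}. G s \<omega>)"
      by simp
  qed
qed

section \<open>Integrals along paths\<close>

lemma regular_measurable_config:
  assumes "regular_process H" "0 \<le> t" shows "H t \<in> borel_measurable config_algebra"
  by (rule measurable_observed_config_algebra[OF regular_measurable[OF assms]]) simp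

lemma regular_joint_measurable:
  assumes H: "regular_process H" and T: "0 < T"
  shows "(\<lambda>(\<omega>, u). H u \<omega> * indicator {0<..T} u) \<in> borel_measurable (observed {..T} \<Otimes>\<^sub>M borel)"
proof (rule borel_measurable_LIMSEQ_real)
  fix n
  have H': "H (0 + (T - 0) * real k / real (Suc n)) \<in> borel_measurable (observed {..T})" if "k < Suc n" for k
  proof -
    have "T * real k \<le> T * real (Suc n)" using that T by (intro mult_left_mono) auto
    then have "T * real k / real (Suc n) \<le> T" by (simp add: divide_le_eq)
    then show ?thesis using T
      by (intro measurable_observed_mono[OF regular_measurable[OF H]]) auto
  qed
  have "(\<lambda>x. \<Sum>k<Suc n. H (0 + (T - 0) * real k / real (Suc n)) (fst x) * indicator (grid_cell 0 T (Suc n) k) (snd x))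
    \<in> borel_measurable (observed {..T} \<Otimes>\<^sub>M borel)"
    by (intro borel_measurable_sum borel_measurable_times measurable_compose[OF measurable_fst H']
        borel_measurable_indicator' measurable_snd)
      (auto simp: grid_cell_def)
  then show "(\<lambda>x. H (grid_floor 0 T (Suc n) (snd x)) (fst x) * indicator {0<..T} (snd x)) \<in> borel_measurable (observed {..T} \<Otimes>\<^sub>M borel)"
    by (rule borel_measurable_eqI) (rule indicator_grid_floor[OF T], simp)
next
  fix x :: "'a config \<times> real" assume "x \<in> space (observed {..T} \<Otimes>\<^sub>M borel)"
  then have w: "fst x \<in> configs" by (auto simp: space_pair_measure)
  show "(\<lambda>n. H (grid_floor 0 T (Suc n) (snd x)) (fst x) * indicator {0<..T} (snd x)) \<longlonglongrightarrow>
    (case x of (\<omega>, u) \<Rightarrow> H u \<omega> * indicator {0<..T} u)"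
  proof (cases "snd x \<in> {0<..T}")
    case True
    then have "(\<lambda>n. H (grid_floor 0 T (Suc n) (snd x)) (fst x)) \<longlonglongrightarrow> H (snd x) (fst x)"
      by (intro LIMSEQ_Suc filterlim_compose[OF regular_left[OF H w] grid_floor_at_left[OF T]]) auto
    with True show ?thesis by (simp add: case_prod_beta)
  qed (simp add: case_prod_beta)
qed

definition locally_bounded :: "(real \<Rightarrow> 'd config \<Rightarrow> real) \<Rightarrow> bool" where
  "locally_bounded H \<longleftrightarrow> (\<forall>\<omega>\<in>configs. \<forall>T. \<exists>K. \<forall>t\<in>{0..T}. \<bar>H t \<omega>\<bar> \<le> K)"

lemma
  assumes H: "regular_process H" "locally_bounded H" and w: "\<omega> \<in> configs"
  shows regular_set_integrable: "set_integrable lborel {0<..T} (\<lambda>u. H u \<omega>)"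
    and regular_integrable_on: "(\<lambda>u. H u \<omega>) integrable_on {0..T}"
    and regular_integral_eq: "integral {0..T} (\<lambda>u. H u \<omega>) = (LINT u|lborel. H u \<omega> * indicator {0<..T} u)"
proof -
  have *: "set_integrable lborel {0<..T} (\<lambda>u. H u \<omega>)" if "0 < T"
  proof -
    obtain K where K: "\<And>t. t \<in> {0..T} \<Longrightarrow> \<bar>H t \<omega>\<bar> \<le> K" using H(2) w unfolding locally_bounded_def by meson
    have "(\<lambda>u. H u \<omega> * indicator {0<..T} u) \<in> borel_measurable borel"
      using measurable_compose[OF measurable_Pair1'[of \<omega> "observed {..T}" borel] regular_joint_measurable[OF H(1) that]] w by simp
    then have meas: "(\<lambda>u. indicator {0<..T} u *\<^sub>R H u \<omega>) \<in> borel_measurable lborel"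
      by (simp add: mult.commute)
    have "integrable lborel (\<lambda>u. K * indicator {0<..T} u :: real)"
      using that by (intro integrable_mult_right integrable_real_indicator) auto
    then show ?thesis unfolding set_integrable_def
    proof (rule Bochner_Integration.integrable_bound[OF _ meas])
      show "AE u in lborel. norm (indicator {0<..T} u *\<^sub>R H u \<omega>) \<le> norm (K * indicator {0<..T} u)"
      proof (rule AE_I2)
        show "norm (indicator {0<..T} u *\<^sub>R H u \<omega>) \<le> norm (K * indicator {0<..T} u)" for u
          using K[of u] by (cases "u \<in> {0<..T}") auto
      qed
    qed
  qed
  show 1: "set_integrable lborel {0<..T} (\<lambda>u. H u \<omega>)"
  proof (cases "0 < T")
    case False
    then show ?thesis by (simp add: set_integrable_def)
  qed (rule *)
  have eq: "((\<lambda>u. H u \<omega>) has_integral I) {0..T} \<longleftrightarrow> ((\<lambda>u. H u \<omega>) has_integral I) {0<..T}" for I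
  proof (rule has_integral_spike_set_eq)
    show "negligible {x \<in> {0..T} - {0<..T}. H x \<omega> \<noteq> 0}" by (rule negligible_subset[of "{0}"]) auto
    show "negligible {x \<in> {0<..T} - {0..T}. H x \<omega> \<noteq> 0}" by (rule negligible_subset[of "{}"]) auto
  qed
  have "((\<lambda>u. H u \<omega>) has_integral (LINT u:{0<..T}|lborel. H u \<omega>)) {0<..T}"
    using set_borel_integral_eq_integral[OF 1] by (simp add: has_integral_integrable_integral)
  then have "((\<lambda>u. H u \<omega>) has_integral (LINT u:{0<..T}|lborel. H u \<omega>)) {0..T}" by (simp add: eq)
  then show "(\<lambda>u. H u \<omega>) integrable_on {0..T}"
    "integral {0..T} (\<lambda>u. H u \<omega>) = (LINT u|lborel. H u \<omega> * indicator {0<..T} u)"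
    by (auto simp: set_lebesgue_integral_def mult.commute intro: integral_unique)
qed

lemma regular_integral_deriv:
  assumes H: "regular_process H" "locally_bounded H" and w: "\<omega> \<in> configs"
    and "0 < t" "isCont (\<lambda>u. H u \<omega>) t"
  shows "((\<lambda>t. integral {0..t} (\<lambda>u. H u \<omega>)) has_real_derivative H t \<omega>) (at t)"
proof -
  have "((\<lambda>t. integral {0..t} (\<lambda>u. H u \<omega>)) has_vector_derivative H t \<omega>) (at t within {0..t+1} - {})"
    by (rule integral_has_vector_derivative_continuous_at)
      (use assms(4,5) regular_integrable_on[OF H w] in \<open>auto intro!: continuous_at_imp_continuous_at_within\<close>)
  moreover have "at t within {0..t+1} - {} = at t" using \<open>0 < t\<close> by (intro at_within_interior) (auto simp: interior_atLeastAtMost_real)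
  ultimately show ?thesis by (simp add: has_real_derivative_iff_has_vector_derivative)
qed

lemma regular_integral_isCont:
  assumes H: "regular_process H" "locally_bounded H" and w: "\<omega> \<in> configs" and "0 < t"
  shows "isCont (\<lambda>t. integral {0..t} (\<lambda>u. H u \<omega>)) t"
proof -
  have "continuous_on {0..t+1} (\<lambda>t. integral {0..t} (\<lambda>u. H u \<omega>))"
    by (rule indefinite_integral_continuous_1[OF regular_integrable_on[OF H w]])
  moreover have "t \<in> interior {0..t+1}" using \<open>0 < t\<close> by (simp add: interior_atLeastAtMost_real)
  ultimately show ?thesis by (rule continuous_on_interior)
qed

lemma regular_integral:
  assumes H: "regular_process H" "locally_bounded H"
  shows "regular_process (\<lambda>t \<omega>. integral {0..t} (\<lambda>u. H u \<omega>))"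
  unfolding regular_process_def
proof (intro conjI allI ballI impI)
  show "((\<lambda>t. integral {0..t} (\<lambda>u. H u \<omega>)) \<longlongrightarrow> integral {0..t} (\<lambda>u. H u \<omega>)) (at_left t)" if "\<omega> \<in> configs" "0 < t" for \<omega> t
    using regular_integral_isCont[OF H that] by (simp add: isCont_def filterlim_at_split)
  show "finite {t \<in> {0<..<T}. \<not> isCont (\<lambda>t. integral {0..t} (\<lambda>u. H u \<omega>)) t}" if "\<omega> \<in> configs" for \<omega> T
  proof -
    have "{t \<in> {0<..<T}. \<not> isCont (\<lambda>t. integral {0..t} (\<lambda>u. H u \<omega>)) t} = {}"
      using regular_integral_isCont[OF H that] by auto
    then show ?thesis by (simp only: finite.emptyI)
  qed
  fix t :: real assume "0 \<le> t"
  show "(\<lambda>\<omega>. integral {0..t} (\<lambda>u. H u \<omega>)) \<in> borel_measurable (observed {..t})"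
  proof (cases "t = 0")
    case False
    with \<open>0 \<le> t\<close> have t: "0 < t" by simp
    have "(\<lambda>(\<omega>, u). H u \<omega> * indicator {0<..t} u) \<in> borel_measurable (observed {..t} \<Otimes>\<^sub>M lborel)"
      using regular_joint_measurable[OF H(1) t] by (simp cong: measurable_cong_sets sets_pair_measure_cong)
    from lborel.borel_measurable_lebesgue_integral[OF this]
    have "(\<lambda>\<omega>. LINT u|lborel. H u \<omega> * indicator {0<..t} u) \<in> borel_measurable (observed {..t})" .
    then show ?thesis by (rule borel_measurable_eqI) (simp add: regular_integral_eq[OF H])
  qed simp
qed

text \<open>
  The fundamental theorem of calculus for a left-continuous path \<open>X\<close> with right limits \<open>Xp\<close>: the jumps at the
  points of \<open>S\<close> are accounted for explicitly, while \<open>D\<close> collects the times where the path is merely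
  not differentiable.
\<close>

lemma jump_ftc:
  fixes X Xp X' :: "real \<Rightarrow> real"
  assumes T: "0 < T" and S: "finite S" "S \<subseteq> {0<..T}" and D: "finite D"
    and left: "\<And>t. 0 < t \<Longrightarrow> t \<le> T \<Longrightarrow> (X \<longlongrightarrow> X t) (at_left t)"
    and right: "\<And>t. 0 \<le> t \<Longrightarrow> t < T \<Longrightarrow> (X \<longlongrightarrow> Xp t) (at_right t)"
    and nojump: "\<And>t. 0 \<le> t \<Longrightarrow> t \<le> T \<Longrightarrow> t \<notin> S \<Longrightarrow> Xp t = X t"
    and deriv: "\<And>t. 0 < t \<Longrightarrow> t < T \<Longrightarrow> t \<notin> D \<Longrightarrow> (X has_real_derivative X' t) (at t)"
  shows "(X' has_integral (Xp T - X 0 - (\<Sum>t\<in>S. Xp t - X t))) {0..T}"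
proof -
  define g where "g t = Xp t - X t" for t
  define Q where "Q t = (\<Sum>s\<in>S \<inter> {..<t}. g s)" for t
  define C where "C t = X t - Q t" for t
  have gap: "\<exists>e>0. \<forall>s\<in>S. s \<noteq> t \<longrightarrow> e \<le> \<bar>s - t\<bar>" for t
  proof -
    have "finite ((\<lambda>s. \<bar>s - t\<bar>) ` (S - {t}))" using S(1) by auto
    then show ?thesis
      by (intro exI[of _ "Min (insert 1 ((\<lambda>s. \<bar>s - t\<bar>) ` (S - {t})))"]) (auto simp: Min_gr_iff)
  qed
  have Ql: "\<forall>\<^sub>F u in at_left t. Q u = Q t" for t
  proof -
    obtain e where e: "e > 0" "\<And>s. s \<in> S \<Longrightarrow> s \<noteq> t \<Longrightarrow> e \<le> \<bar>s - t\<bar>" using gap[of t] by auto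
    have "S \<inter> {..<u} = S \<inter> {..<t}" if "t - e < u" "u < t" for u using e(2) that by fastforce
    then have "Q u = Q t" if "t - e < u" "u < t" for u using that by (simp add: Q_def)
    then show ?thesis unfolding eventually_at_left_field using e(1) by (intro exI[of _ "t - e"]) auto
  qed
  have Qr: "\<forall>\<^sub>F u in at_right t. Q u = Q t + (if t \<in> S then g t else 0)" for t
  proof -
    obtain e where e: "e > 0" "\<And>s. s \<in> S \<Longrightarrow> s \<noteq> t \<Longrightarrow> e \<le> \<bar>s - t\<bar>" using gap[of t] by auto
    have "S \<inter> {..<u} = (if t \<in> S then insert t (S \<inter> {..<t}) else S \<inter> {..<t})" if "u < t + e" "t < u" for u
    proof -
      have "s < u \<longleftrightarrow> s < t \<or> s = t" if "s \<in> S" for s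
        using e(2)[OF that] \<open>u < t + e\<close> \<open>t < u\<close> by (cases "s = t") auto
      then show ?thesis by auto
    qed
    then have "Q u = Q t + (if t \<in> S then g t else 0)" if "u < t + e" "t < u" for u using that S(1) by (simp add: Q_def)
    then show ?thesis unfolding eventually_at_right_field using e(1) by (intro exI[of _ "t + e"]) auto
  qed
  have Cl: "(C \<longlongrightarrow> C t) (at_left t)" if "0 < t" "t \<le> T" for t
    unfolding C_def by (intro tendsto_diff left that tendsto_eventually[OF Ql])
  have Cr: "(C \<longlongrightarrow> C t) (at_right t)" if "0 \<le> t" "t < T" for t
  proof -
    have "(C \<longlongrightarrow> Xp t - (Q t + (if t \<in> S then g t else 0))) (at_right t)"
      unfolding C_def by (intro tendsto_diff right that tendsto_eventually[OF Qr])
    also have "Xp t - (Q t + (if t \<in> S then g t else 0)) = C t"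
      using nojump[of t] that by (simp add: C_def g_def)
    finally show ?thesis .
  qed
  have "(X' has_integral (C T - C 0)) {0..T}"
  proof (rule fundamental_theorem_of_calculus_interior_strong)
    show "finite (D \<union> S)" using D S(1) by simp
    show "continuous_on {0..T} C"
      by (rule continuous_on_IccI) (use Cl Cr T in \<open>auto simp: filterlim_at_split\<close>)
    fix t assume t: "t \<in> {0<..<T} - (D \<union> S)"
    have "\<forall>\<^sub>F u in at t. Q u = Q t" using Ql[of t] Qr[of t] t by (simp add: eventually_at_split)
    then have "\<forall>\<^sub>F u in nhds t. C u = X u - Q t" by (auto simp: eventually_nhds_conv_at C_def elim: eventually_mono)
    moreover have "((\<lambda>u. X u - Q t) has_real_derivative X' t) (at t)"
      using deriv[of t] t by (auto intro!: derivative_eq_intros)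
    ultimately have "(C has_real_derivative X' t) (at t)" by (subst DERIV_cong_ev[OF refl _ refl])
    then show "(C has_vector_derivative X' t) (at t)" by (simp add: has_real_derivative_iff_has_vector_derivative)
  qed (use T in simp)
  also have "C T - C 0 = Xp T - X 0 - (\<Sum>t\<in>S. g t)"
  proof -
    have "Q 0 = 0" unfolding Q_def using S(2) by (intro sum.neutral) fastforce
    moreover have "(\<Sum>t\<in>S. g t) = Q T + (if T \<in> S then g T else 0)"
    proof -
      have "S - {T} = S \<inter> {..<T}" using S(2) by (auto simp: less_le)
      then show ?thesis using sum.remove[OF S(1), of T g] by (cases "T \<in> S") (auto simp: Q_def)
    qed
    ultimately show ?thesis using nojump[of T] T by (simp add: C_def g_def)
  qed
  finally show ?thesis by (simp add: g_def)
qed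

section \<open>The Campbell formula\<close>

lemma regular_joint_measurable_ennreal:
  assumes H: "regular_process H" and M: "sets M = sets config_algebra"
  shows "(\<lambda>(\<omega>, u). ennreal (H u \<omega>) * indicator {0<..T} u) \<in> borel_measurable (M \<Otimes>\<^sub>M lborel)"
proof (cases "0 < T")
  case True
  have "(\<lambda>x. (fst x, snd x)) \<in> M \<Otimes>\<^sub>M lborel \<rightarrow>\<^sub>M observed {..T} \<Otimes>\<^sub>M (borel :: real measure)"
  proof (rule measurable_Pair)
    have "(\<lambda>\<omega>. \<omega>) \<in> M \<rightarrow>\<^sub>M observed {..T}"
      using sets_observed_subset[of "{..T}"] M sets_eq_imp_space_eq[OF M] by (auto simp: measurable_def sets.sets_into_space)
    then show "fst \<in> M \<Otimes>\<^sub>M lborel \<rightarrow>\<^sub>M observed {..T}"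
      using measurable_compose[OF measurable_fst] by blast
    have "snd \<in> M \<Otimes>\<^sub>M lborel \<rightarrow>\<^sub>M (lborel :: real measure)" by (rule measurable_snd)
    then show "snd \<in> M \<Otimes>\<^sub>M lborel \<rightarrow>\<^sub>M (borel :: real measure)" by (simp only: measurable_cong_sets[OF refl sets_lborel])
  qed
  note measurable_compose[OF measurable_compose[OF this regular_joint_measurable[OF H True]] measurable_ennreal]
  then show ?thesis
    by (rule borel_measurable_eqI) (auto simp: case_prod_beta split: split_indicator)
qed simp

text \<open>
  The lower bound \<open>c\<close> on the intensity keeps likelihood ratios finite. The finite mean
  provides the dominating function for limits of sampled processes.
\<close>

locale counting_process =
  fixes M :: "'d::finite config measure" and lam :: "'d \<Rightarrow> 'd config \<Rightarrow> real \<Rightarrow> real" and c :: real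
  assumes prob_space_M: "prob_space M"
    and sets_M: "sets M = sets config_algebra"
    and cond_intensity: "has_conditional_intensity M lam"
    and finite_mean: "\<And>i T. (\<integral>\<^sup>+\<omega>. of_nat (card (\<omega> i \<inter> {0<..T})) \<partial>M) < \<infinity>"
    and regular_lam: "\<And>i. regular_process (\<lambda>t \<omega>. lam i \<omega> t)"
    and bounded_lam: "\<And>i. locally_bounded (\<lambda>t \<omega>. lam i \<omega> t)"
    and c_pos: "0 < c"
    and lam_ge: "\<And>i \<omega> t. \<omega> \<in> configs \<Longrightarrow> c \<le> lam i \<omega> t"
begin

sublocale prob_space M by (rule prob_space_M)

lemma space_M: "space M = configs"
  using sets_eq_imp_space_eq[OF sets_M] by simp

lemma lam_pos: "\<omega> \<in> configs \<Longrightarrow> 0 < lam i \<omega> t"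
  using lam_ge[of \<omega> i t] c_pos by simp

lemma measurable_M: "f \<in> borel_measurable config_algebra \<Longrightarrow> f \<in> borel_measurable M"
  by (simp only: measurable_cong_sets[OF sets_M refl])

lemma measurable_card_M:
  assumes "B \<in> sets borel" "bounded B"
  shows "(\<lambda>\<omega>. of_nat (card (\<omega> i \<inter> B)) :: ennreal) \<in> borel_measurable M"
proof -
  have "(\<lambda>\<omega>. card (\<omega> i \<inter> B)) \<in> M \<rightarrow>\<^sub>M count_space UNIV"
    using measurable_card[OF assms] by (simp only: measurable_cong_sets[OF sets_M refl])
  then show ?thesis by (rule measurable_compose) simp
qed

lemma sigma_finite_subalgebra_observed:
  assumes "S \<in> sets borel" shows "sigma_finite_subalgebra M (observed S)"
proof -
  have "finite_measure_subalgebra M (observed S)"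
    by unfold_locales (use assms sets_observed_subset sets_M space_M in \<open>auto simp: subalgebra_def\<close>)
  then show ?thesis by (rule finite_measure_subalgebra_is_sigma_finite)
qed

lemma integral_lam_measurable:
  "(\<lambda>\<omega>. \<integral>\<^sup>+u\<in>{s<..t}. ennreal (lam i \<omega> u) \<partial>lborel) \<in> borel_measurable M" if "0 \<le> s"
proof -
  have "(\<lambda>x. (case x of (\<omega>, u) \<Rightarrow> ennreal (lam i \<omega> u) * indicator {0<..t} u) * indicator {s<..t} (snd x)) \<in> borel_measurable (M \<Otimes>\<^sub>M lborel)"
    by (intro borel_measurable_times_ennreal regular_joint_measurable_ennreal[OF regular_lam sets_M]) measurable
  then have "(\<lambda>x. ennreal (lam i (fst x) (snd x)) * indicator {s<..t} (snd x)) \<in> borel_measurable (M \<Otimes>\<^sub>M lborel)"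
    by (rule borel_measurable_eqI) (use that in \<open>auto simp: indicator_def case_prod_beta\<close>)
  then have "(\<lambda>(\<omega>, u). ennreal (lam i \<omega> u) * indicator {s<..t} u) \<in> borel_measurable (M \<Otimes>\<^sub>M lborel)"
    by (simp add: case_prod_beta)
  from lborel.borel_measurable_nn_integral[OF this] show ?thesis by simp
qed

text \<open>
  The defining property of a conditional intensity, integrated against a weight known at time \<open>s\<close>.
\<close>

lemma campbell_interval:
  assumes s: "0 \<le> s" "s < t" and W: "W \<in> borel_measurable (observed {..s})"
  shows "(\<integral>\<^sup>+\<omega>. W \<omega> * of_nat (card (\<omega> i \<inter> {s<..t})) \<partial>M) =
    (\<integral>\<^sup>+\<omega>. W \<omega> * (\<integral>\<^sup>+u\<in>{s<..t}. ennreal (lam i \<omega> u) \<partial>lborel) \<partial>M)"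
proof -
  interpret S: sigma_finite_subalgebra M "observed {..s}" by (rule sigma_finite_subalgebra_observed) simp
  have N: "(\<lambda>\<omega>. of_nat (card (\<omega> i \<inter> {s<..t})) :: ennreal) \<in> borel_measurable M"
    by (rule measurable_card_M) simp_all
  have "(\<integral>\<^sup>+\<omega>. W \<omega> * of_nat (card (\<omega> i \<inter> {s<..t})) \<partial>M) =
    (\<integral>\<^sup>+\<omega>. W \<omega> * nn_cond_exp M (observed {..s}) (\<lambda>\<omega>. of_nat (card (\<omega> i \<inter> {s<..t}))) \<omega> \<partial>M)"
    by (rule S.nn_cond_exp_intg[OF W N, symmetric])
  also have "\<dots> = (\<integral>\<^sup>+\<omega>. W \<omega> * nn_cond_exp M (observed {..s}) (\<lambda>\<omega>. \<integral>\<^sup>+u\<in>{s<..t}. ennreal (lam i \<omega> u) \<partial>lborel) \<omega> \<partial>M)"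
  proof (rule nn_integral_cong_AE)
    have "AE \<omega> in M. nn_cond_exp M (observed {..s}) (\<lambda>\<omega>. of_nat (card (\<omega> i \<inter> {s<..t}))) \<omega> =
       nn_cond_exp M (observed {..s}) (\<lambda>\<omega>. \<integral>\<^sup>+u\<in>{s<..t}. ennreal (lam i \<omega> u) \<partial>lborel) \<omega>"
      using cond_intensity s(2) unfolding has_conditional_intensity_def by blast
    then show "AE \<omega> in M. W \<omega> * nn_cond_exp M (observed {..s}) (\<lambda>\<omega>. of_nat (card (\<omega> i \<inter> {s<..t}))) \<omega> =
       W \<omega> * nn_cond_exp M (observed {..s}) (\<lambda>\<omega>. \<integral>\<^sup>+u\<in>{s<..t}. ennreal (lam i \<omega> u) \<partial>lborel) \<omega>"
      by (rule eventually_mono) simp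
  qed
  also have "\<dots> = (\<integral>\<^sup>+\<omega>. W \<omega> * (\<integral>\<^sup>+u\<in>{s<..t}. ennreal (lam i \<omega> u) \<partial>lborel) \<partial>M)"
    by (rule S.nn_cond_exp_intg[OF W integral_lam_measurable[OF s(1)]])
  finally show ?thesis .
qed

text \<open>
  Sampled on a grid, the process is constant on each cell with a value known at the left end of the
  cell, so the previous lemma applies cell by cell; dominated convergence refines the grid.
\<close>

lemma campbell_bounded:
  assumes T: "0 < T" and H: "regular_process H"
    and bnd: "\<And>\<omega> u. \<omega> \<in> configs \<Longrightarrow> 0 \<le> u \<Longrightarrow> u \<le> T \<Longrightarrow> 0 \<le> H u \<omega> \<and> H u \<omega> \<le> K"
  shows "(\<integral>\<^sup>+\<omega>. (\<Sum>s\<in>\<omega> i \<inter> {0<..T}. ennreal (H s \<omega>)) \<partial>M) =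
    (\<integral>\<^sup>+\<omega>. \<integral>\<^sup>+u. ennreal (H u \<omega> * lam i \<omega> u) * indicator {0<..T} u \<partial>lborel \<partial>M)"
proof -
  define tk where "tk n k = 0 + (T - 0) * real k / real (Suc n)" for n k
  define g where "g n u = grid_floor 0 T (Suc n) u" for n u
  have tk: "0 \<le> tk n k" "tk n k < T" "tk n k < tk n (Suc k)" "tk n (Suc k) \<le> T" if "k < Suc n" for n k
  proof -
    have "T * real k < T * real (Suc n)" using that T by (intro mult_strict_left_mono) auto
    then show "tk n k < T" by (simp add: tk_def divide_less_eq)
    have "T * real (Suc k) \<le> T * real (Suc n)" using that T by (intro mult_left_mono) auto
    then show "tk n (Suc k) \<le> T" unfolding tk_def by (simp add: divide_le_eq)
    have "T * real k < T * real (Suc k)" using T by (intro mult_strict_left_mono) auto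
    then show "tk n k < tk n (Suc k)" unfolding tk_def by (simp add: divide_less_cancel)
    show "0 \<le> tk n k" using T by (simp add: tk_def)
  qed
  have cell: "grid_cell 0 T (Suc n) k = {tk n k<..tk n (Suc k)}" for n k by (simp add: grid_cell_def tk_def)
  have gtk: "\<exists>k<Suc n. g n u = tk n k" if "u \<in> {0<..T}" for n u
  proof -
    have "u \<in> (\<Union>k<Suc n. grid_cell 0 T (Suc n) k)"
      using that by (simp only: grid_cells_partition(1)[OF T zero_less_Suc, symmetric])
    then obtain k where "k < Suc n" "u \<in> grid_cell 0 T (Suc n) k" by (elim UN_E) simp
    then show ?thesis using grid_floor_cell[OF T, of "Suc n" u k] by (auto simp: g_def tk_def)
  qed
  have bg: "0 \<le> H (g n u) \<omega>" "H (g n u) \<omega> \<le> K" if w: "\<omega> \<in> configs" and u: "u \<in> {0<..T}" for n u \<omega>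
  proof -
    obtain k where k: "k < Suc n" "g n u = tk n k" using gtk[OF u] by blast
    show "0 \<le> H (g n u) \<omega>" "H (g n u) \<omega> \<le> K" using bnd[OF w tk(1)[OF k(1)]] tk(2)[OF k(1)] k(2) by auto
  qed
  have lim: "(\<lambda>n. H (g n u) \<omega>) \<longlonglongrightarrow> H u \<omega>" if "\<omega> \<in> configs" "u \<in> {0<..T}" for \<omega> u
    unfolding g_def using that
    by (intro LIMSEQ_Suc filterlim_compose[OF regular_left[OF H] grid_floor_at_left[OF T]]) auto
  have Hm: "(\<lambda>\<omega>. ennreal (H (tk n k) \<omega>)) \<in> borel_measurable (observed {..tk n k})" if "k < Suc n" for n k
    using regular_measurable[OF H tk(1)[OF that]] by simp
  have HmM: "(\<lambda>\<omega>. ennreal (H (tk n k) \<omega>)) \<in> borel_measurable M" if "k < Suc n" for n k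
    using measurable_M[OF regular_measurable_config[OF H tk(1)[OF that]]] by simp
  let ?A = "\<lambda>n \<omega>. \<Sum>s\<in>\<omega> i \<inter> {0<..T}. ennreal (H (g n s) \<omega>)"
  let ?B = "\<lambda>n \<omega> u. ennreal (H (g n u) \<omega> * lam i \<omega> u) * indicator {0<..T} u"
  let ?C = "\<lambda>\<omega> u. ennreal (H u \<omega> * lam i \<omega> u) * indicator {0<..T} u"
  have A_eq: "?A n \<omega> = (\<Sum>k<Suc n. ennreal (H (tk n k) \<omega>) * of_nat (card (\<omega> i \<inter> {tk n k<..tk n (Suc k)})))"
    if w: "\<omega> \<in> configs" for n \<omega>
  proof -
    have "?A n \<omega> = ennreal (\<Sum>s\<in>\<omega> i \<inter> {0<..T}. H (g n s) \<omega>)"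
      using bg[OF w] by (intro sum_ennreal) auto
    also have "(\<Sum>s\<in>\<omega> i \<inter> {0<..T}. H (g n s) \<omega>) =
      (\<Sum>k<Suc n. H (tk n k) \<omega> * real (card (\<omega> i \<inter> grid_cell 0 T (Suc n) k)))"
      unfolding g_def tk_def by (rule sum_grid_floor[OF T]) (auto intro: config_finite[OF w])
    also have "ennreal \<dots> = (\<Sum>k<Suc n. ennreal (H (tk n k) \<omega> * real (card (\<omega> i \<inter> grid_cell 0 T (Suc n) k))))"
      using bnd[OF w] tk by (intro sum_ennreal[symmetric] mult_nonneg_nonneg) (auto simp: less_imp_le)
    also have "\<dots> = (\<Sum>k<Suc n. ennreal (H (tk n k) \<omega>) * of_nat (card (\<omega> i \<inter> {tk n k<..tk n (Suc k)})))"
      using bnd[OF w] tk by (intro sum.cong refl) (simp add: cell ennreal_mult less_imp_le ennreal_of_nat_eq_real_of_nat)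
    finally show ?thesis .
  qed
  have B_eq: "?B n \<omega> u = (\<Sum>k<Suc n. ennreal (H (tk n k) \<omega>) * (ennreal (lam i \<omega> u) * indicator {tk n k<..tk n (Suc k)} u))"
    if w: "\<omega> \<in> configs" for n \<omega> u
  proof -
    have "?B n \<omega> u = ennreal (H (g n u) \<omega> * indicator {0<..T} u) * ennreal (lam i \<omega> u)"
      using bg[OF w] lam_pos[OF w, of i u] by (cases "u \<in> {0<..T}") (auto simp: ennreal_mult less_imp_le)
    also have "H (g n u) \<omega> * indicator {0<..T} u = (\<Sum>k<Suc n. H (tk n k) \<omega> * indicator (grid_cell 0 T (Suc n) k) u)"
      unfolding g_def tk_def by (rule indicator_grid_floor[OF T]) simp
    also have "ennreal \<dots> = (\<Sum>k<Suc n. ennreal (H (tk n k) \<omega> * indicator (grid_cell 0 T (Suc n) k) u))"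
      using bnd[OF w] tk by (intro sum_ennreal[symmetric] mult_nonneg_nonneg) (auto simp: less_imp_le)
    also have "\<dots> * ennreal (lam i \<omega> u) = (\<Sum>k<Suc n. ennreal (H (tk n k) \<omega>) * (ennreal (lam i \<omega> u) * indicator {tk n k<..tk n (Suc k)} u))"
      unfolding sum_distrib_right cell using bnd[OF w] tk 
      by (intro sum.cong refl) (auto simp: indicator_def)
    finally show ?thesis .
  qed
  have lamM: "(\<lambda>u. ennreal (lam i \<omega> u) * indicator {s<..t} u) \<in> borel_measurable lborel" 
    if "\<omega> \<in> configs" "0 \<le> s" for \<omega> s t
  proof -
    have "(\<lambda>u. (case (\<omega>, u) of (\<omega>, u) \<Rightarrow> ennreal (lam i \<omega> u) * indicator {0<..t} u) * indicator {s<..t} u) \<in> borel_measurable lborel"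
      using that(1) space_M by (intro borel_measurable_times_ennreal
        measurable_compose[OF measurable_Pair1' regular_joint_measurable_ennreal[OF regular_lam sets_M]]) auto
    then show ?thesis
      by (rule borel_measurable_eqI) (use that in \<open>auto simp: indicator_def\<close>)
  qed
  have eq_n: "(\<integral>\<^sup>+\<omega>. ?A n \<omega> \<partial>M) = (\<integral>\<^sup>+\<omega>. \<integral>\<^sup>+u. ?B n \<omega> u \<partial>lborel \<partial>M)" for n
  proof -
    have "(\<integral>\<^sup>+\<omega>. ?A n \<omega> \<partial>M) =
      (\<integral>\<^sup>+\<omega>. (\<Sum>k<Suc n. ennreal (H (tk n k) \<omega>) * of_nat (card (\<omega> i \<inter> {tk n k<..tk n (Suc k)}))) \<partial>M)"
      using A_eq by (intro nn_integral_cong) (simp add: space_M)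
    also have "\<dots> = (\<Sum>k<Suc n. \<integral>\<^sup>+\<omega>. ennreal (H (tk n k) \<omega>) * of_nat (card (\<omega> i \<inter> {tk n k<..tk n (Suc k)})) \<partial>M)"
      using HmM by (intro nn_integral_sum borel_measurable_times_ennreal measurable_card_M) auto
    also have "\<dots> = (\<Sum>k<Suc n. \<integral>\<^sup>+\<omega>. ennreal (H (tk n k) \<omega>) * (\<integral>\<^sup>+u\<in>{tk n k<..tk n (Suc k)}. ennreal (lam i \<omega> u) \<partial>lborel) \<partial>M)"
      using tk Hm by (intro sum.cong refl campbell_interval) auto
    also have "\<dots> = (\<integral>\<^sup>+\<omega>. (\<Sum>k<Suc n. ennreal (H (tk n k) \<omega>) * (\<integral>\<^sup>+u\<in>{tk n k<..tk n (Suc k)}. ennreal (lam i \<omega> u) \<partial>lborel)) \<partial>M)"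
      using HmM tk(1) by (intro nn_integral_sum[symmetric] borel_measurable_times_ennreal integral_lam_measurable) auto
    also have "\<dots> = (\<integral>\<^sup>+\<omega>. \<integral>\<^sup>+u. ?B n \<omega> u \<partial>lborel \<partial>M)"
    proof (intro nn_integral_cong)
      fix \<omega> assume "\<omega> \<in> space M"
      then have w: "\<omega> \<in> configs" by (simp add: space_M)
      have "(\<integral>\<^sup>+u. ?B n \<omega> u \<partial>lborel) =
        (\<integral>\<^sup>+u. (\<Sum>k<Suc n. ennreal (H (tk n k) \<omega>) * (ennreal (lam i \<omega> u) * indicator {tk n k<..tk n (Suc k)} u)) \<partial>lborel)"
        by (intro nn_integral_cong B_eq[OF w])
      also have "\<dots> = (\<Sum>k<Suc n. \<integral>\<^sup>+u. ennreal (H (tk n k) \<omega>) * (ennreal (lam i \<omega> u) * indicator {tk n k<..tk n (Suc k)} u) \<partial>lborel)"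
        using tk(1) by (intro nn_integral_sum borel_measurable_times_ennreal borel_measurable_const lamM w) auto
      also have "\<dots> = (\<Sum>k<Suc n. ennreal (H (tk n k) \<omega>) * (\<integral>\<^sup>+u\<in>{tk n k<..tk n (Suc k)}. ennreal (lam i \<omega> u) \<partial>lborel))"
        using tk(1) by (intro sum.cong refl nn_integral_cmult lamM w) auto
      finally show "(\<Sum>k<Suc n. ennreal (H (tk n k) \<omega>) * (\<integral>\<^sup>+u\<in>{tk n k<..tk n (Suc k)}. ennreal (lam i \<omega> u) \<partial>lborel)) = (\<integral>\<^sup>+u. ?B n \<omega> u \<partial>lborel)"
        by simp
    qed
    finally show ?thesis .
  qed
  have A_meas: "?A n \<in> borel_measurable M" for n
  proof (rule borel_measurable_eqI)
    show "(\<lambda>\<omega>. (\<Sum>k<Suc n. ennreal (H (tk n k) \<omega>) * of_nat (card (\<omega> i \<inter> {tk n k<..tk n (Suc k)})))) \<in> borel_measurable M"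
      using HmM by (intro borel_measurable_sum borel_measurable_times_ennreal measurable_card_M) auto
  qed (simp add: A_eq space_M)
  have A_lim: "(\<lambda>n. ?A n \<omega>) \<longlonglongrightarrow> (\<Sum>s\<in>\<omega> i \<inter> {0<..T}. ennreal (H s \<omega>))" if "\<omega> \<in> configs" for \<omega>
    using lim[OF that] by (intro tendsto_sum tendsto_ennrealI) auto
  have "(\<lambda>n. \<integral>\<^sup>+\<omega>. ?A n \<omega> \<partial>M) \<longlonglongrightarrow> (\<integral>\<^sup>+\<omega>. (\<Sum>s\<in>\<omega> i \<inter> {0<..T}. ennreal (H s \<omega>)) \<partial>M)"
  proof (rule nn_integral_dominated_convergence[where w = "\<lambda>\<omega>. ennreal K * of_nat (card (\<omega> i \<inter> {0<..T}))"])
    show "(\<lambda>\<omega>. \<Sum>s\<in>\<omega> i \<inter> {0<..T}. ennreal (H s \<omega>)) \<in> borel_measurable M"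
      by (rule borel_measurable_LIMSEQ_order[of _ ?A]) (use A_lim A_meas space_M in auto)
    show "(\<lambda>\<omega>. ennreal K * of_nat (card (\<omega> i \<inter> {0<..T}))) \<in> borel_measurable M"
      by (intro borel_measurable_times_ennreal measurable_card_M) auto
    show "(\<integral>\<^sup>+\<omega>. ennreal K * of_nat (card (\<omega> i \<inter> {0<..T})) \<partial>M) < \<infinity>"
      by (subst nn_integral_cmult) (use finite_mean[of i T] in \<open>auto intro!: measurable_card_M simp: ennreal_mult_less_top\<close>)
    show "AE \<omega> in M. ?A n \<omega> \<le> ennreal K * of_nat (card (\<omega> i \<inter> {0<..T}))" for n
    proof (rule AE_I2)
      fix \<omega> assume "\<omega> \<in> space M"
      then have w: "\<omega> \<in> configs" by (simp add: space_M)
      have "?A n \<omega> \<le> (\<Sum>s\<in>\<omega> i \<inter> {0<..T}. ennreal K)" using bg[OF w] by (intro sum_mono ennreal_leI) auto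
      then show "?A n \<omega> \<le> ennreal K * of_nat (card (\<omega> i \<inter> {0<..T}))" by (simp add: mult.commute)
    qed
    show "AE \<omega> in M. (\<lambda>n. ?A n \<omega>) \<longlonglongrightarrow> (\<Sum>s\<in>\<omega> i \<inter> {0<..T}. ennreal (H s \<omega>))"
      using A_lim by (intro AE_I2) (simp add: space_M)
  qed (rule A_meas)
  moreover have "(\<lambda>n. \<integral>\<^sup>+\<omega>. \<integral>\<^sup>+u. ?B n \<omega> u \<partial>lborel \<partial>M) \<longlonglongrightarrow> (\<integral>\<^sup>+\<omega>. \<integral>\<^sup>+u. ?C \<omega> u \<partial>lborel \<partial>M)"
  proof -
    have B_meas: "case_prod (?B n) \<in> borel_measurable (M \<Otimes>\<^sub>M lborel)" for n
    proof (rule borel_measurable_eqI)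
      have "(\<lambda>x. (case x of (\<omega>, u) \<Rightarrow> ennreal (lam i \<omega> u) * indicator {0<..T} u) * indicator {s<..t} (snd x)) \<in> borel_measurable (M \<Otimes>\<^sub>M lborel)" for s t
        by (intro borel_measurable_times_ennreal regular_joint_measurable_ennreal[OF regular_lam sets_M]) measurable
      then show "(\<lambda>x. \<Sum>k<Suc n. ennreal (H (tk n k) (fst x)) * ((case x of (\<omega>, u) \<Rightarrow> ennreal (lam i \<omega> u) * indicator {0<..T} u) * indicator {tk n k<..tk n (Suc k)} (snd x))) \<in> borel_measurable (M \<Otimes>\<^sub>M lborel)"
        using HmM by (intro borel_measurable_sum borel_measurable_times_ennreal[OF measurable_compose[OF measurable_fst HmM]]) auto
      fix x assume "x \<in> space (M \<Otimes>\<^sub>M (lborel :: real measure))"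
      then have w: "fst x \<in> configs" by (auto simp: space_pair_measure space_M)
      show "case_prod (?B n) x = (\<Sum>k<Suc n. ennreal (H (tk n k) (fst x)) * ((case x of (\<omega>, u) \<Rightarrow> ennreal (lam i \<omega> u) * indicator {0<..T} u) * indicator {tk n k<..tk n (Suc k)} (snd x)))"
        unfolding case_prod_beta B_eq[OF w]
      proof (rule sum.cong[OF refl])
        fix k assume "k \<in> {..<Suc n}"
        then have "0 \<le> tk n k" "tk n (Suc k) \<le> T" using tk by auto
        then show "ennreal (H (tk n k) (fst x)) * (ennreal (lam i (fst x) (snd x)) * indicator {tk n k<..tk n (Suc k)} (snd x)) =
          ennreal (H (tk n k) (fst x)) * (ennreal (lam i (fst x) (snd x)) * indicator {0<..T} (snd x) * indicator {tk n k<..tk n (Suc k)} (snd x))"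
          by (auto simp: indicator_def)
      qed
    qed
    have B0_meas: "case_prod ?C \<in> borel_measurable (M \<Otimes>\<^sub>M lborel)"
      using regular_joint_measurable_ennreal[OF regular_mult[OF H regular_lam] sets_M] .
    let ?w = "\<lambda>(\<omega>, u). ennreal K * (ennreal (lam i \<omega> u) * indicator {0<..T} u)"
    have w_meas: "?w \<in> borel_measurable (M \<Otimes>\<^sub>M lborel)"
      using borel_measurable_times_ennreal[OF borel_measurable_const regular_joint_measurable_ennreal[OF regular_lam sets_M, of i T], of "ennreal K"]
      by (simp add: case_prod_beta)
    have "integral\<^sup>N (M \<Otimes>\<^sub>M lborel) ?w = (\<integral>\<^sup>+\<omega>. \<integral>\<^sup>+u. ?w (\<omega>, u) \<partial>lborel \<partial>M)"
      by (rule lborel.nn_integral_fst[OF w_meas, symmetric])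
    also have "\<dots> = (\<integral>\<^sup>+\<omega>. ennreal K * (\<integral>\<^sup>+u\<in>{0<..T}. ennreal (lam i \<omega> u) \<partial>lborel) \<partial>M)"
      using lamM by (intro nn_integral_cong) (simp add: space_M nn_integral_cmult)
    also have "\<dots> = (\<integral>\<^sup>+\<omega>. ennreal K * of_nat (card (\<omega> i \<inter> {0<..T})) \<partial>M)"
      by (rule campbell_interval[symmetric]) (use T in auto)
    also have "\<dots> < \<infinity>"
      by (subst nn_integral_cmult) (use finite_mean[of i T] in \<open>auto intro!: measurable_card_M simp: ennreal_mult_less_top\<close>)
    finally have w_fin: "integral\<^sup>N (M \<Otimes>\<^sub>M lborel) ?w < \<infinity>" .
    have "(\<lambda>n. integral\<^sup>N (M \<Otimes>\<^sub>M lborel) (case_prod (?B n))) \<longlonglongrightarrow> integral\<^sup>N (M \<Otimes>\<^sub>M lborel) (case_prod ?C)"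
    proof (rule nn_integral_dominated_convergence[OF B_meas B0_meas w_meas _ w_fin])
      show "AE x in M \<Otimes>\<^sub>M lborel. case_prod (?B n) x \<le> ?w x" for n
      proof (rule AE_I2)
        fix x assume "x \<in> space (M \<Otimes>\<^sub>M (lborel :: real measure))"
        then have w: "fst x \<in> configs" by (auto simp: space_pair_measure space_M)
        show "case_prod (?B n) x \<le> ?w x"
          using bg[OF w, of "snd x" n] lam_pos[OF w, of i "snd x"]
          by (cases "snd x \<in> {0<..T}")
            (auto simp: case_prod_beta ennreal_mult[symmetric] intro!: ennreal_leI mult_right_mono)
      qed
      show "AE x in M \<Otimes>\<^sub>M lborel. (\<lambda>n. case_prod (?B n) x) \<longlonglongrightarrow> case_prod ?C x"
      proof (rule AE_I2)
        fix x assume "x \<in> space (M \<Otimes>\<^sub>M (lborel :: real measure))"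
        then have w: "fst x \<in> configs" by (auto simp: space_pair_measure space_M)
        show "(\<lambda>n. case_prod (?B n) x) \<longlonglongrightarrow> case_prod ?C x"
          using lim[OF w, of "snd x"]
          by (cases "snd x \<in> {0<..T}") (auto simp: case_prod_beta intro!: tendsto_ennrealI tendsto_mult)
      qed
    qed
    then show ?thesis
      using lborel.nn_integral_fst[OF B_meas] lborel.nn_integral_fst[OF B0_meas] by (simp only: case_prod_conv)
  qed
  ultimately show ?thesis unfolding eq_n by (rule LIMSEQ_unique)
qed

end

lemma locally_bounded_const: "locally_bounded (\<lambda>t \<omega>. c)"
  by (auto simp: locally_bounded_def)

lemma locally_boundedD:
  assumes "locally_bounded H" "\<omega> \<in> configs"
  obtains K where "0 \<le> K" "\<And>t. 0 \<le> t \<Longrightarrow> t \<le> T \<Longrightarrow> \<bar>H t \<omega>\<bar> \<le> K"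
proof -
  obtain K where "\<And>t. 0 \<le> t \<Longrightarrow> t \<le> T \<Longrightarrow> \<bar>H t \<omega>\<bar> \<le> K" using assms unfolding locally_bounded_def by (metis atLeastAtMost_iff)
  then show ?thesis using that[of "max 0 K"] by (metis max.cobounded1 max.coboundedI2)
qed

lemma locally_bounded_add:
  assumes "locally_bounded H" "locally_bounded H'"
  shows "locally_bounded (\<lambda>t \<omega>. H t \<omega> + H' t \<omega>)"
  unfolding locally_bounded_def
proof (intro ballI allI)
  fix \<omega> :: "'a config" and T assume w: "\<omega> \<in> configs"
  obtain K K' where K: "\<And>t. 0 \<le> t \<Longrightarrow> t \<le> T \<Longrightarrow> \<bar>H t \<omega>\<bar> \<le> K" "\<And>t. 0 \<le> t \<Longrightarrow> t \<le> T \<Longrightarrow> \<bar>H' t \<omega>\<bar> \<le> K'"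
    using locally_boundedD[OF assms(1) w] locally_boundedD[OF assms(2) w] by metis
  have "\<bar>H t \<omega> + H' t \<omega>\<bar> \<le> K + K'" if "t \<in> {0..T}" for t
    using K(1)[of t] K(2)[of t] that by auto
  then show "\<exists>K. \<forall>t\<in>{0..T}. \<bar>H t \<omega> + H' t \<omega>\<bar> \<le> K" by blast
qed

lemma locally_bounded_mult:
  assumes "locally_bounded H" "locally_bounded H'"
  shows "locally_bounded (\<lambda>t \<omega>. H t \<omega> * H' t \<omega>)"
  unfolding locally_bounded_def
proof (intro ballI allI)
  fix \<omega> :: "'a config" and T assume w: "\<omega> \<in> configs"
  obtain K where K: "0 \<le> K" "\<And>t. 0 \<le> t \<Longrightarrow> t \<le> T \<Longrightarrow> \<bar>H t \<omega>\<bar> \<le> K"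
    using locally_boundedD[OF assms(1) w] by metis
  obtain K' where K': "0 \<le> K'" "\<And>t. 0 \<le> t \<Longrightarrow> t \<le> T \<Longrightarrow> \<bar>H' t \<omega>\<bar> \<le> K'"
    using locally_boundedD[OF assms(2) w] by metis
  have "\<bar>H t \<omega> * H' t \<omega>\<bar> \<le> K * K'" if "t \<in> {0..T}" for t
    unfolding abs_mult using K K' that by (intro mult_mono) auto
  then show "\<exists>K. \<forall>t\<in>{0..T}. \<bar>H t \<omega> * H' t \<omega>\<bar> \<le> K" by blast
qed

lemma locally_bounded_diff:
  assumes "locally_bounded H" "locally_bounded H'"
  shows "locally_bounded (\<lambda>t \<omega>. H t \<omega> - H' t \<omega>)"
  using locally_bounded_add[OF assms(1) locally_bounded_mult[OF locally_bounded_const[of "-1"] assms(2)]] by simp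

lemma locally_bounded_sum:
  assumes "finite I" "\<And>i. i \<in> I \<Longrightarrow> locally_bounded (H i)"
  shows "locally_bounded (\<lambda>t \<omega>. \<Sum>i\<in>I. H i t \<omega>)"
  using assms by (induction I) (auto intro: locally_bounded_const locally_bounded_add)

lemma locally_bounded_le:
  assumes "locally_bounded H'" "\<And>t \<omega>. \<omega> \<in> configs \<Longrightarrow> 0 \<le> t \<Longrightarrow> \<bar>H t \<omega>\<bar> \<le> \<bar>H' t \<omega>\<bar>"
  shows "locally_bounded H"
  using assms unfolding locally_bounded_def by (meson atLeastAtMost_iff order_trans)

lemma measurable_point_sum:
  assumes H: "regular_process H"
  shows "(\<lambda>\<omega>. \<Sum>s\<in>\<omega> i \<inter> {0<..T}. H s \<omega>) \<in> borel_measurable config_algebra"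
proof (rule measurable_sum_points)
  show "(\<lambda>\<omega>. real (card (\<omega> i \<inter> B))) \<in> borel_measurable config_algebra"
    if "B \<in> sets borel" "B \<subseteq> {0<..T}" for B
    by (rule measurable_compose[OF measurable_card[OF that(1) bounded_subset[OF _ that(2)]]]) simp_all
  show "((\<lambda>u. H u \<omega>) \<longlongrightarrow> H s \<omega>) (at_left s)" if "\<omega> \<in> configs" "0 < s" for s \<omega>
    by (rule regular_left[OF H that])
  show "H s \<in> borel_measurable config_algebra" if "0 \<le> s" for s
    by (rule regular_measurable_config[OF H that])
qed simp

context counting_process
begin

text \<open>
  Truncation at level \<open>n\<close> and monotone convergence remove the bound on \<open>H\<close>.
\<close>

lemma campbell_nonneg:
  assumes T: "0 < T" and H: "regular_process H"
    and pos: "\<And>\<omega> u. \<omega> \<in> configs \<Longrightarrow> 0 \<le> u \<Longrightarrow> u \<le> T \<Longrightarrow> 0 \<le> H u \<omega>"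
  shows "(\<integral>\<^sup>+\<omega>. (\<Sum>s\<in>\<omega> i \<inter> {0<..T}. ennreal (H s \<omega>)) \<partial>M) =
    (\<integral>\<^sup>+\<omega>. \<integral>\<^sup>+u. ennreal (H u \<omega> * lam i \<omega> u) * indicator {0<..T} u \<partial>lborel \<partial>M)"
proof -
  let ?H = "\<lambda>n u \<omega>. min (real n) (H u \<omega>)"
  have reg: "regular_process (?H n)" for n
  proof (rule regular_compose[OF H, where f = "min (real n)"])
    show "isCont (min (real n)) x" for x by (rule continuous_min[OF continuous_const continuous_ident])
  qed simp
  let ?A = "\<lambda>n \<omega>. \<Sum>s\<in>\<omega> i \<inter> {0<..T}. ennreal (?H n s \<omega>)"
  let ?B = "\<lambda>n x. ennreal (?H n (snd x) (fst x) * lam i (fst x) (snd x)) * indicator {0<..T} (snd x)"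
  let ?C = "\<lambda>x. ennreal (H (snd x) (fst x) * lam i (fst x) (snd x)) * indicator {0<..T} (snd x)"
  have B_meas: "?B n \<in> borel_measurable (M \<Otimes>\<^sub>M lborel)" for n
    using regular_joint_measurable_ennreal[OF regular_mult[OF reg regular_lam] sets_M] by (simp add: case_prod_beta)
  have C_meas: "?C \<in> borel_measurable (M \<Otimes>\<^sub>M lborel)"
    using regular_joint_measurable_ennreal[OF regular_mult[OF H regular_lam] sets_M] by (simp add: case_prod_beta)
  have A_meas: "?A n \<in> borel_measurable M" for n
  proof (rule borel_measurable_eqI)
    show "(\<lambda>\<omega>. ennreal (\<Sum>s\<in>\<omega> i \<inter> {0<..T}. ?H n s \<omega>)) \<in> borel_measurable M"
      using measurable_M[OF measurable_point_sum[OF reg]] by simp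
    show "?A n \<omega> = ennreal (\<Sum>s\<in>\<omega> i \<inter> {0<..T}. ?H n s \<omega>)" if "\<omega> \<in> space M" for \<omega>
      using pos that by (intro sum_ennreal) (auto simp: space_M)
  qed
  have eq: "(\<integral>\<^sup>+\<omega>. ?A n \<omega> \<partial>M) = integral\<^sup>N (M \<Otimes>\<^sub>M lborel) (?B n)" for n
  proof -
    have "(\<integral>\<^sup>+\<omega>. ?A n \<omega> \<partial>M) = (\<integral>\<^sup>+\<omega>. \<integral>\<^sup>+u. ?B n (\<omega>, u) \<partial>lborel \<partial>M)"
      unfolding fst_conv snd_conv by (rule campbell_bounded[OF T reg, of _ "real n"]) (use pos in auto)
    also have "\<dots> = integral\<^sup>N (M \<Otimes>\<^sub>M lborel) (?B n)" by (rule lborel.nn_integral_fst[OF B_meas])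
    finally show ?thesis .
  qed
  have ev: "\<forall>\<^sub>F n in sequentially. min (real n) x = x" for x :: real
    using eventually_ge_at_top[of "nat \<lceil>x\<rceil>"] by eventually_elim linarith
  have "(\<integral>\<^sup>+\<omega>. (\<Sum>s\<in>\<omega> i \<inter> {0<..T}. ennreal (H s \<omega>)) \<partial>M) = (\<integral>\<^sup>+\<omega>. (SUP n. ?A n \<omega>) \<partial>M)"
  proof (rule nn_integral_cong)
    fix \<omega> assume "\<omega> \<in> space M"
    have "incseq (\<lambda>n. ?A n \<omega>)" by (auto simp: incseq_def intro!: sum_mono ennreal_leI min.mono)
    moreover have "(\<lambda>n. ?A n \<omega>) \<longlonglongrightarrow> (\<Sum>s\<in>\<omega> i \<inter> {0<..T}. ennreal (H s \<omega>))"
      by (intro tendsto_sum tendsto_ennrealI tendsto_eventually ev)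
    ultimately show "(\<Sum>s\<in>\<omega> i \<inter> {0<..T}. ennreal (H s \<omega>)) = (SUP n. ?A n \<omega>)"
      by (rule LIMSEQ_unique[OF _ LIMSEQ_SUP, rotated])
  qed
  also have "\<dots> = (SUP n. \<integral>\<^sup>+\<omega>. ?A n \<omega> \<partial>M)"
    by (rule nn_integral_monotone_convergence_SUP[OF _ A_meas])
      (auto simp: incseq_def le_fun_def intro!: sum_mono ennreal_leI min.mono)
  also have "\<dots> = (SUP n. integral\<^sup>N (M \<Otimes>\<^sub>M lborel) (?B n))" unfolding eq ..
  also have "\<dots> = (\<integral>\<^sup>+x. (SUP n. ?B n x) \<partial>(M \<Otimes>\<^sub>M lborel))"
  proof (rule nn_integral_monotone_convergence_SUP_AE[OF _ B_meas, symmetric])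
    fix n show "AE x in M \<Otimes>\<^sub>M lborel. ?B n x \<le> ?B (Suc n) x"
    proof (rule AE_I2)
      fix x assume "x \<in> space (M \<Otimes>\<^sub>M (lborel :: real measure))"
      then have "0 < lam i (fst x) (snd x)" by (intro lam_pos) (auto simp: space_pair_measure space_M)
      then show "?B n x \<le> ?B (Suc n) x" by (intro mult_right_mono ennreal_leI) auto
    qed
  qed
  also have "\<dots> = (\<integral>\<^sup>+x. ?C x \<partial>(M \<Otimes>\<^sub>M lborel))"
  proof (rule nn_integral_cong)
    fix x assume "x \<in> space (M \<Otimes>\<^sub>M (lborel :: real measure))"
    then have "0 < lam i (fst x) (snd x)" by (intro lam_pos) (auto simp: space_pair_measure space_M)
    then have "incseq (\<lambda>n. ?B n x)" unfolding incseq_def by (intro allI impI mult_right_mono ennreal_leI) auto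
    moreover have "(\<lambda>n. ?B n x) \<longlonglongrightarrow> ?C x"
      by (rule tendsto_eventually) (use ev[of "H (snd x) (fst x)"] in \<open>auto elim!: eventually_mono\<close>)
    ultimately show "(SUP n. ?B n x) = ?C x" by (rule LIMSEQ_unique[OF LIMSEQ_SUP])
  qed
  also have "\<dots> = (\<integral>\<^sup>+\<omega>. \<integral>\<^sup>+u. ?C (\<omega>, u) \<partial>lborel \<partial>M)" by (rule lborel.nn_integral_fst[OF C_meas, symmetric])
  finally show ?thesis by (simp only: fst_conv snd_conv)
qed

lemma nn_integral_time:
  assumes H: "regular_process H" "locally_bounded H" and w: "\<omega> \<in> configs"
    and pos: "\<And>u. 0 \<le> u \<Longrightarrow> 0 \<le> H u \<omega>"
  shows "(\<integral>\<^sup>+u. ennreal (H u \<omega>) * indicator {0<..T} u \<partial>lborel) = ennreal (integral {0..T} (\<lambda>u. H u \<omega>))"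
    and "0 \<le> integral {0..T} (\<lambda>u. H u \<omega>)"
proof -
  have int: "integrable lborel (\<lambda>u. H u \<omega> * indicator {0<..T} u)"
    using regular_set_integrable[OF H w] by (simp add: set_integrable_def mult.commute)
  have nn: "0 \<le> H u \<omega> * indicator {0<..T} u" for u using pos[of u] by (auto simp: indicator_def)
  have "(\<integral>\<^sup>+u. ennreal (H u \<omega>) * indicator {0<..T} u \<partial>lborel) = (\<integral>\<^sup>+u. ennreal (H u \<omega> * indicator {0<..T} u) \<partial>lborel)"
    by (intro nn_integral_cong) (simp split: split_indicator)
  also have "\<dots> = ennreal (LINT u|lborel. H u \<omega> * indicator {0<..T} u)"
    by (rule nn_integral_eq_integral[OF int]) (use nn in simp)
  finally show "(\<integral>\<^sup>+u. ennreal (H u \<omega>) * indicator {0<..T} u \<partial>lborel) = ennreal (integral {0..T} (\<lambda>u. H u \<omega>))"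
    by (simp only: regular_integral_eq[OF H w])
  show "0 \<le> integral {0..T} (\<lambda>u. H u \<omega>)"
    unfolding regular_integral_eq[OF H w] by (rule integral_nonneg_AE) (use nn in simp)
qed

lemma campbell_nonneg_real:
  assumes T: "0 < T" and H: "regular_process H" "locally_bounded H"
    and pos: "\<And>\<omega> u. \<omega> \<in> configs \<Longrightarrow> 0 \<le> u \<Longrightarrow> 0 \<le> H u \<omega>"
    and fin: "(\<integral>\<^sup>+\<omega>. \<integral>\<^sup>+u. ennreal (H u \<omega> * lam i \<omega> u) * indicator {0<..T} u \<partial>lborel \<partial>M) < \<infinity>"
  shows "integrable M (\<lambda>\<omega>. \<Sum>s\<in>\<omega> i \<inter> {0<..T}. H s \<omega>)" (is "integrable M ?A")
    and "integrable M (\<lambda>\<omega>. integral {0..T} (\<lambda>u. H u \<omega> * lam i \<omega> u))" (is "integrable M ?B")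
    and "(\<integral>\<omega>. (\<Sum>s\<in>\<omega> i \<inter> {0<..T}. H s \<omega>) \<partial>M) = (\<integral>\<omega>. integral {0..T} (\<lambda>u. H u \<omega> * lam i \<omega> u) \<partial>M)"
proof -
  have HL: "regular_process (\<lambda>u \<omega>. H u \<omega> * lam i \<omega> u)" "locally_bounded (\<lambda>u \<omega>. H u \<omega> * lam i \<omega> u)"
    by (intro regular_mult H regular_lam, intro locally_bounded_mult H bounded_lam)
  have HLpos: "0 \<le> H u \<omega> * lam i \<omega> u" if "\<omega> \<in> configs" "0 \<le> u" for \<omega> u
    using pos[OF that] lam_pos[OF that(1), of i u] by simp
  have A_meas: "?A \<in> borel_measurable M" by (rule measurable_M[OF measurable_point_sum[OF H(1)]])
  have B_meas: "?B \<in> borel_measurable M"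
    using measurable_M[OF regular_measurable_config[OF regular_integral[OF HL], of T]] T by simp
  have A_pos: "AE \<omega> in M. 0 \<le> ?A \<omega>" using pos by (intro AE_I2 sum_nonneg) (auto simp: space_M)
  have B_pos: "AE \<omega> in M. 0 \<le> ?B \<omega>" using nn_integral_time(2)[OF HL _ HLpos] by (intro AE_I2) (simp add: space_M)
  have "(\<integral>\<^sup>+\<omega>. ennreal (?B \<omega>) \<partial>M) = (\<integral>\<^sup>+\<omega>. \<integral>\<^sup>+u. ennreal (H u \<omega> * lam i \<omega> u) * indicator {0<..T} u \<partial>lborel \<partial>M)"
    by (intro nn_integral_cong nn_integral_time(1)[OF HL _ HLpos, symmetric]) (auto simp: space_M)
  moreover have "(\<integral>\<^sup>+\<omega>. ennreal (?A \<omega>) \<partial>M) = (\<integral>\<^sup>+\<omega>. (\<Sum>s\<in>\<omega> i \<inter> {0<..T}. ennreal (H s \<omega>)) \<partial>M)"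
    using pos by (intro nn_integral_cong sum_ennreal[symmetric]) (auto simp: space_M)
  ultimately have eq: "(\<integral>\<^sup>+\<omega>. ennreal (?A \<omega>) \<partial>M) = (\<integral>\<^sup>+\<omega>. ennreal (?B \<omega>) \<partial>M)" "(\<integral>\<^sup>+\<omega>. ennreal (?B \<omega>) \<partial>M) < \<infinity>"
    using campbell_nonneg[OF T H(1) pos] fin by auto
  show "integrable M ?A" by (rule integrableI_nonneg[OF A_meas A_pos]) (use eq in simp)
  show "integrable M ?B" by (rule integrableI_nonneg[OF B_meas B_pos]) (use eq in simp)
  show "(\<integral>\<omega>. ?A \<omega> \<partial>M) = (\<integral>\<omega>. ?B \<omega> \<partial>M)"
    unfolding integral_eq_nn_integral[OF A_meas A_pos] integral_eq_nn_integral[OF B_meas B_pos] eq(1) ..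
qed

text \<open>
  The form used later: absolute integrability against the intensity gives integrability of both sides, by
  splitting \<open>H\<close> into positive and negative part.
\<close>

lemma campbell:
  assumes T: "0 < T" and H: "regular_process H" "locally_bounded H"
    and fin: "(\<integral>\<^sup>+\<omega>. \<integral>\<^sup>+u. ennreal (\<bar>H u \<omega>\<bar> * lam i \<omega> u) * indicator {0<..T} u \<partial>lborel \<partial>M) < \<infinity>"
  shows "integrable M (\<lambda>\<omega>. \<Sum>s\<in>\<omega> i \<inter> {0<..T}. H s \<omega>)"
    and "integrable M (\<lambda>\<omega>. integral {0..T} (\<lambda>u. H u \<omega> * lam i \<omega> u))"
    and "(\<integral>\<omega>. (\<Sum>s\<in>\<omega> i \<inter> {0<..T}. H s \<omega>) \<partial>M) = (\<integral>\<omega>. integral {0..T} (\<lambda>u. H u \<omega> * lam i \<omega> u) \<partial>M)"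
proof -
  let ?P = "\<lambda>u \<omega>. max 0 (H u \<omega>)" and ?N = "\<lambda>u \<omega>. max 0 (- H u \<omega>)"
  have P: "regular_process ?P"
  proof (rule regular_compose[OF H(1), where f = "max 0"])
    show "isCont (max 0) x" for x :: real by (rule continuous_max[OF continuous_const continuous_ident])
  qed simp
  have N: "regular_process ?N"
  proof (rule regular_compose[OF H(1), where f = "\<lambda>x. max 0 (- x)"])
    show "isCont (\<lambda>x. max 0 (- x)) x" for x :: real by (intro continuous_intros)
  qed simp
  have lb: "locally_bounded ?P" "locally_bounded ?N" by (auto intro!: locally_bounded_le[OF H(2)])
  have finP: "(\<integral>\<^sup>+\<omega>. \<integral>\<^sup>+u. ennreal (?P u \<omega> * lam i \<omega> u) * indicator {0<..T} u \<partial>lborel \<partial>M) < \<infinity>"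
    using lam_pos by (intro le_less_trans[OF _ fin] nn_integral_mono mult_right_mono ennreal_leI)
      (auto simp: space_M intro!: mult_right_mono less_imp_le)
  have finN: "(\<integral>\<^sup>+\<omega>. \<integral>\<^sup>+u. ennreal (?N u \<omega> * lam i \<omega> u) * indicator {0<..T} u \<partial>lborel \<partial>M) < \<infinity>"
    using lam_pos by (intro le_less_trans[OF _ fin] nn_integral_mono mult_right_mono ennreal_leI)
      (auto simp: space_M intro!: mult_right_mono less_imp_le)
  note cP = campbell_nonneg_real[OF T P lb(1) _ finP] and cN = campbell_nonneg_real[OF T N lb(2) _ finN]
  have A: "(\<Sum>s\<in>\<omega> i \<inter> {0<..T}. H s \<omega>) = (\<Sum>s\<in>\<omega> i \<inter> {0<..T}. ?P s \<omega>) - (\<Sum>s\<in>\<omega> i \<inter> {0<..T}. ?N s \<omega>)" for \<omega>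
    unfolding sum_subtractf[symmetric] by (intro sum.cong refl) auto
  have B: "integral {0..T} (\<lambda>u. H u \<omega> * lam i \<omega> u) =
    integral {0..T} (\<lambda>u. ?P u \<omega> * lam i \<omega> u) - integral {0..T} (\<lambda>u. ?N u \<omega> * lam i \<omega> u)" if w: "\<omega> \<in> space M" for \<omega>
  proof -
    have w': "\<omega> \<in> configs" using w by (simp add: space_M)
    have "(\<lambda>u. ?P u \<omega> * lam i \<omega> u) integrable_on {0..T}"
      by (rule regular_integrable_on[OF regular_mult[OF P regular_lam] locally_bounded_mult[OF lb(1) bounded_lam] w'])
    moreover have "(\<lambda>u. ?N u \<omega> * lam i \<omega> u) integrable_on {0..T}"
      by (rule regular_integrable_on[OF regular_mult[OF N regular_lam] locally_bounded_mult[OF lb(2) bounded_lam] w'])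
    ultimately have "integral {0..T} (\<lambda>u. ?P u \<omega> * lam i \<omega> u - ?N u \<omega> * lam i \<omega> u) =
      integral {0..T} (\<lambda>u. ?P u \<omega> * lam i \<omega> u) - integral {0..T} (\<lambda>u. ?N u \<omega> * lam i \<omega> u)" by (rule integral_diff)
    moreover have "H u \<omega> * lam i \<omega> u = ?P u \<omega> * lam i \<omega> u - ?N u \<omega> * lam i \<omega> u" for u
      by (simp add: max_def)
    ultimately show ?thesis by presburger
  qed
  show "integrable M (\<lambda>\<omega>. \<Sum>s\<in>\<omega> i \<inter> {0<..T}. H s \<omega>)"
    unfolding A by (intro Bochner_Integration.integrable_diff cP(1) cN(1)) auto
  have "integrable M (\<lambda>\<omega>. integral {0..T} (\<lambda>u. ?P u \<omega> * lam i \<omega> u) - integral {0..T} (\<lambda>u. ?N u \<omega> * lam i \<omega> u))"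
    by (intro Bochner_Integration.integrable_diff cP(2) cN(2)) auto
  then show "integrable M (\<lambda>\<omega>. integral {0..T} (\<lambda>u. H u \<omega> * lam i \<omega> u))"
    by (rule iffD2[OF Bochner_Integration.integrable_cong[OF refl B], rotated]) 
  have "(\<integral>\<omega>. (\<Sum>s\<in>\<omega> i \<inter> {0<..T}. H s \<omega>) \<partial>M) =
    (\<integral>\<omega>. (\<Sum>s\<in>\<omega> i \<inter> {0<..T}. ?P s \<omega>) \<partial>M) - (\<integral>\<omega>. (\<Sum>s\<in>\<omega> i \<inter> {0<..T}. ?N s \<omega>) \<partial>M)"
    unfolding A by (intro Bochner_Integration.integral_diff cP(1) cN(1)) auto
  also have "\<dots> = (\<integral>\<omega>. integral {0..T} (\<lambda>u. ?P u \<omega> * lam i \<omega> u) \<partial>M) - (\<integral>\<omega>. integral {0..T} (\<lambda>u. ?N u \<omega> * lam i \<omega> u) \<partial>M)"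
    by (simp add: cP(3) cN(3))
  also have "\<dots> = (\<integral>\<omega>. integral {0..T} (\<lambda>u. ?P u \<omega> * lam i \<omega> u) - integral {0..T} (\<lambda>u. ?N u \<omega> * lam i \<omega> u) \<partial>M)"
    by (intro Bochner_Integration.integral_diff[symmetric] cP(2) cN(2)) auto
  also have "\<dots> = (\<integral>\<omega>. integral {0..T} (\<lambda>u. H u \<omega> * lam i \<omega> u) \<partial>M)"
    by (intro Bochner_Integration.integral_cong refl) (simp add: B)
  finally show "(\<integral>\<omega>. (\<Sum>s\<in>\<omega> i \<inter> {0<..T}. H s \<omega>) \<partial>M) = (\<integral>\<omega>. integral {0..T} (\<lambda>u. H u \<omega> * lam i \<omega> u) \<partial>M)" .
qed

lemma nn_integral_lam_finite:
  assumes "0 < T" "K < \<infinity>"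
  shows "(\<integral>\<^sup>+\<omega>. \<integral>\<^sup>+u. K * ennreal (lam i \<omega> u) * indicator {0<..T} u \<partial>lborel \<partial>M) < \<infinity>"
proof -
  have "(\<integral>\<^sup>+\<omega>. \<integral>\<^sup>+u. K * ennreal (lam i \<omega> u) * indicator {0<..T} u \<partial>lborel \<partial>M) =
    (\<integral>\<^sup>+\<omega>. K * (\<integral>\<^sup>+u\<in>{0<..T}. ennreal (lam i \<omega> u) \<partial>lborel) \<partial>M)"
  proof (rule nn_integral_cong)
    fix \<omega> assume "\<omega> \<in> space M"
    then have "(\<lambda>u. ennreal (lam i \<omega> u) * indicator {0<..T} u) \<in> borel_measurable lborel"
      using measurable_compose[OF measurable_Pair1' regular_joint_measurable_ennreal[OF regular_lam sets_M, of i T]] by simp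
    from nn_integral_cmult[OF this, of K]
    show "(\<integral>\<^sup>+u. K * ennreal (lam i \<omega> u) * indicator {0<..T} u \<partial>lborel) = K * (\<integral>\<^sup>+u\<in>{0<..T}. ennreal (lam i \<omega> u) \<partial>lborel)"
      by (simp add: mult.assoc)
  qed
  also have "\<dots> = (\<integral>\<^sup>+\<omega>. K * of_nat (card (\<omega> i \<inter> {0<..T})) \<partial>M)"
    by (rule campbell_interval[symmetric]) (use assms in auto)
  also have "\<dots> < \<infinity>"
    by (subst nn_integral_cmult) (use finite_mean[of i T] assms in \<open>auto intro!: measurable_card_M simp: ennreal_mult_less_top\<close>)
  finally show ?thesis .
qed

lemma campbell_bounded_real:
  assumes T: "0 < T" and H: "regular_process H" "locally_bounded H"
    and bnd: "\<And>\<omega> u. \<omega> \<in> configs \<Longrightarrow> 0 \<le> u \<Longrightarrow> u \<le> T \<Longrightarrow> \<bar>H u \<omega>\<bar> \<le> K"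
  shows "integrable M (\<lambda>\<omega>. \<Sum>s\<in>\<omega> i \<inter> {0<..T}. H s \<omega>)"
    and "integrable M (\<lambda>\<omega>. integral {0..T} (\<lambda>u. H u \<omega> * lam i \<omega> u))"
    and "(\<integral>\<omega>. (\<Sum>s\<in>\<omega> i \<inter> {0<..T}. H s \<omega>) \<partial>M) = (\<integral>\<omega>. integral {0..T} (\<lambda>u. H u \<omega> * lam i \<omega> u) \<partial>M)"
proof -
  have "(\<integral>\<^sup>+\<omega>. \<integral>\<^sup>+u. ennreal (\<bar>H u \<omega>\<bar> * lam i \<omega> u) * indicator {0<..T} u \<partial>lborel \<partial>M) \<le>
    (\<integral>\<^sup>+\<omega>. \<integral>\<^sup>+u. ennreal K * ennreal (lam i \<omega> u) * indicator {0<..T} u \<partial>lborel \<partial>M)"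
  proof (intro nn_integral_mono)
    fix \<omega> u assume "\<omega> \<in> space M"
    then have w: "\<omega> \<in> configs" by (simp add: space_M)
    show "ennreal (\<bar>H u \<omega>\<bar> * lam i \<omega> u) * indicator {0<..T} u \<le> ennreal K * ennreal (lam i \<omega> u) * indicator {0<..T} u"
      using bnd[OF w, of u] lam_pos[OF w, of i u]
      by (cases "u \<in> {0<..T}") (auto simp: ennreal_mult[symmetric] intro!: ennreal_leI mult_right_mono)
  qed
  also have "\<dots> < \<infinity>" by (rule nn_integral_lam_finite[OF T]) simp
  finally have fin: "(\<integral>\<^sup>+\<omega>. \<integral>\<^sup>+u. ennreal (\<bar>H u \<omega>\<bar> * lam i \<omega> u) * indicator {0<..T} u \<partial>lborel \<partial>M) < \<infinity>" .
  note campbell[OF T H fin]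
  then show "integrable M (\<lambda>\<omega>. \<Sum>s\<in>\<omega> i \<inter> {0<..T}. H s \<omega>)"
    and "integrable M (\<lambda>\<omega>. integral {0..T} (\<lambda>u. H u \<omega> * lam i \<omega> u))"
    and "(\<integral>\<omega>. (\<Sum>s\<in>\<omega> i \<inter> {0<..T}. H s \<omega>) \<partial>M) = (\<integral>\<omega>. integral {0..T} (\<lambda>u. H u \<omega> * lam i \<omega> u) \<partial>M)"
    by blast+
qed

end

section \<open>Exponential tilting\<close>

definition points :: "'d::finite config \<Rightarrow> real set \<Rightarrow> nat" where
  "points \<omega> S = (\<Sum>i\<in>UNIV. card (\<omega> i \<inter> S))"

lemma points_mono:
  assumes "\<omega> \<in> configs" "S \<subseteq> S'" "bounded S'" shows "points \<omega> S \<le> points \<omega> S'"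
  unfolding points_def using assms by (intro sum_mono card_mono config_finite) auto

lemma points_Un: "points \<omega> (S \<union> S') \<le> points \<omega> S + points \<omega> S'"
  unfolding points_def sum.distrib[symmetric] by (intro sum_mono) (metis Int_Un_distrib card_Un_le)

lemma points_eq_0_iff:
  assumes "\<omega> \<in> configs" "bounded S" shows "points \<omega> S = 0 \<longleftrightarrow> (\<forall>i. \<omega> i \<inter> S = {})"
  unfolding points_def using config_finite[OF assms] by (auto simp: sum_nonneg_eq_0_iff)

lemma measurable_points:
  assumes "S \<in> sets borel" "bounded S" "S \<subseteq> S'"
  shows "(\<lambda>\<omega>. real (points \<omega> S)) \<in> borel_measurable (observed S')"
  unfolding points_def of_nat_sum by (intro borel_measurable_sum measurable_real_card_observed assms)

lemma locally_bounded_point_prod: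
  assumes "locally_bounded G" "\<And>t \<omega>. \<omega> \<in> configs \<Longrightarrow> 0 \<le> G t \<omega>"
  shows "locally_bounded (\<lambda>t \<omega>. \<Prod>s\<in>\<omega> i \<inter> {0<..<t}. G s \<omega>)"
  unfolding locally_bounded_def
proof (intro ballI allI)
  fix \<omega> :: "'a config" and T assume w: "\<omega> \<in> configs"
  obtain K where K: "0 \<le> K" "\<And>t. 0 \<le> t \<Longrightarrow> t \<le> T \<Longrightarrow> \<bar>G t \<omega>\<bar> \<le> K" using locally_boundedD[OF assms(1) w] by metis
  have "\<bar>\<Prod>s\<in>\<omega> i \<inter> {0<..<t}. G s \<omega>\<bar> \<le> (K + 1) ^ card (\<omega> i \<inter> {0<..<T})" if t: "t \<in> {0..T}" for t
  proof -
    have "(\<Prod>s\<in>\<omega> i \<inter> {0<..<t}. G s \<omega>) \<le> (\<Prod>s\<in>\<omega> i \<inter> {0<..<t}. K + 1)"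
    proof (intro prod_mono conjI assms(2)[OF w])
      fix s assume "s \<in> \<omega> i \<inter> {0<..<t}"
      then show "G s \<omega> \<le> K + 1" using K(2)[of s] t by auto
    qed
    also have "\<dots> = (K + 1) ^ card (\<omega> i \<inter> {0<..<t})" by simp
    also have "\<dots> \<le> (K + 1) ^ card (\<omega> i \<inter> {0<..<T})"
      using K(1) t by (intro power_increasing card_mono config_finite[OF w]) auto
    finally show ?thesis using assms(2)[OF w] by (simp add: prod_nonneg)
  qed
  then show "\<exists>K. \<forall>t\<in>{0..T}. \<bar>\<Prod>s\<in>\<omega> i \<inter> {0<..<t}. G s \<omega>\<bar> \<le> K" by blast
qed

lemma locally_bounded_prod:
  assumes "finite I" "\<And>i. i \<in> I \<Longrightarrow> locally_bounded (H i)"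
  shows "locally_bounded (\<lambda>t \<omega>. \<Prod>i\<in>I. H i t \<omega>)"
  using assms by (induction I) (auto intro: locally_bounded_const locally_bounded_mult)

lemma locally_bounded_exp_integral:
  assumes H: "regular_process H" "locally_bounded H"
  shows "locally_bounded (\<lambda>t \<omega>. exp (integral {0..t} (\<lambda>u. H u \<omega>)))"
  unfolding locally_bounded_def
proof (intro ballI allI)
  fix \<omega> :: "'a config" and T :: real assume w: "\<omega> \<in> configs"
  obtain K where K: "0 \<le> K" "\<And>t. 0 \<le> t \<Longrightarrow> t \<le> T \<Longrightarrow> \<bar>H t \<omega>\<bar> \<le> K" using locally_boundedD[OF H(2) w] by metis
  have "integral {0..t} (\<lambda>u. H u \<omega>) \<le> K * T" if t: "t \<in> {0..T}" for t
  proof -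
    have "integral {0..t} (\<lambda>u. H u \<omega>) \<le> integral {0..t} (\<lambda>u. K)"
    proof (rule integral_le[OF regular_integrable_on[OF H w] integrable_const_ivl])
      show "H u \<omega> \<le> K" if "u \<in> {0..t}" for u using K(2)[of u] t that by auto
    qed
    also have "\<dots> = K * t" using t by simp
    also have "\<dots> \<le> K * T" using t K(1) by (intro mult_left_mono) auto
    finally show ?thesis .
  qed
  then show "\<exists>K. \<forall>t\<in>{0..T}. \<bar>exp (integral {0..t} (\<lambda>u. H u \<omega>))\<bar> \<le> K"
    by (intro exI[of _ "exp (K * T)"]) auto
qed

text \<open>
  Linear growth in the number of recent points keeps the integrated intensity comparable to the number of
  points, which is what makes exponential tilts bounded.
\<close>

locale hawkes_process = counting_process M lam c
  for M :: "'d::finite config measure" and lam :: "'d \<Rightarrow> 'd config \<Rightarrow> real \<Rightarrow> real" and c :: real +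
  fixes A b :: real
  assumes A_pos: "0 < A"
    and growth: "\<And>i \<omega> t. \<omega> \<in> configs \<Longrightarrow> lam i \<omega> t \<le> b * (1 + real (points \<omega> {t - A..<t}))"
begin

lemma b_pos: "0 < b"
proof -
  have "(\<lambda>i. {}) \<in> configs" by (auto simp: configs_def)
  from lam_ge[OF this, of undefined 0] growth[OF this, of undefined 0] c_pos show ?thesis
    by (simp add: points_def)
qed

text \<open>
  While the window still reaches into the past, the points of \<open>[-A, 0]\<close> enter; they are at most \<open>n\<close> in
  number, and all others lie in \<open>(0, t)\<close>.
\<close>

lemma total_rate_le:
  assumes w: "\<omega> \<in> configs" and n: "points \<omega> {-A..0} \<le> n" and u: "0 \<le> u" "u \<le> t"
  shows "(\<Sum>i\<in>UNIV. lam i \<omega> u) \<le> real CARD('d) * b * (1 + real n + real (points \<omega> {0<..<t}))"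
proof -
  have "points \<omega> {u - A..<u} \<le> points \<omega> ({-A..0} \<union> {0<..<t})"
    using u by (intro points_mono w) auto
  also have "\<dots> \<le> points \<omega> {-A..0} + points \<omega> {0<..<t}" by (rule points_Un)
  finally have "real (points \<omega> {u - A..<u}) \<le> real n + real (points \<omega> {0<..<t})" using n by linarith
  then have "lam i \<omega> u \<le> b * (1 + real n + real (points \<omega> {0<..<t}))" for i
    using growth[OF w, of i u] b_pos by (smt (verit) mult_left_mono)
  then have "(\<Sum>i\<in>UNIV. lam i \<omega> u) \<le> (\<Sum>i\<in>(UNIV::'d set). b * (1 + real n + real (points \<omega> {0<..<t})))"
    by (intro sum_mono)
  then show ?thesis by simp
qed

definition drift_of :: "('d \<Rightarrow> real \<Rightarrow> real) \<Rightarrow> real \<Rightarrow> 'd config \<Rightarrow> real" where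
  "drift_of \<gamma> u \<omega> = (\<Sum>i\<in>UNIV. lam i \<omega> u - \<gamma> i u)"

text \<open>
  The candidate density process of a Poisson process with the small rate \<open>\<gamma>\<close> with respect to the given
  one, started on the event \<open>F\<close>. The product over \<open>(0, t)\<close> is left-continuous, hence a legitimate integrand
  for the Campbell formula; the variant below includes a point at \<open>t\<close> and is its right limit.
\<close>

definition tilt_of :: "('d \<Rightarrow> real \<Rightarrow> real) \<Rightarrow> 'd config set \<Rightarrow> real \<Rightarrow> 'd config \<Rightarrow> real" where
  "tilt_of \<gamma> F t \<omega> = indicator F \<omega> *
    (\<Prod>i\<in>UNIV. \<Prod>s\<in>\<omega> i \<inter> {0<..<t}. \<gamma> i s / lam i \<omega> s) * exp (integral {0..t} (\<lambda>u. drift_of \<gamma> u \<omega>))"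

definition tilt_plus_of :: "('d \<Rightarrow> real \<Rightarrow> real) \<Rightarrow> 'd config set \<Rightarrow> real \<Rightarrow> 'd config \<Rightarrow> real" where
  "tilt_plus_of \<gamma> F t \<omega> = indicator F \<omega> *
    (\<Prod>i\<in>UNIV. \<Prod>s\<in>\<omega> i \<inter> {0<..t}. \<gamma> i s / lam i \<omega> s) * exp (integral {0..t} (\<lambda>u. drift_of \<gamma> u \<omega>))"

context
  fixes \<gamma> :: "'d \<Rightarrow> real \<Rightarrow> real" and \<delta> T :: real and F :: "'d config set" and n :: nat
  assumes T: "0 < T" and \<delta>: "0 < \<delta>" "\<delta> \<le> c * exp (- (real CARD('d) * b * T))"
    and \<gamma>: "\<And>i. regular_process (\<lambda>t \<omega>::'d config. \<gamma> i t)"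
    and \<gamma>_bounds: "\<And>i t. 0 \<le> \<gamma> i t \<and> \<gamma> i t \<le> \<delta>"
    and F: "F \<in> sets (observed {..0})" and n: "\<And>\<omega>. \<omega> \<in> F \<Longrightarrow> points \<omega> {-A..0} \<le> n"
begin

abbreviation "drift \<equiv> drift_of \<gamma>"
abbreviation "tilt \<equiv> tilt_of \<gamma> F"
abbreviation "tilt_plus \<equiv> tilt_plus_of \<gamma> F"
lemmas drift_def = drift_of_def and tilt_def = tilt_of_def and tilt_plus_def = tilt_plus_of_def

lemma locally_bounded_gamma: "locally_bounded (\<lambda>t \<omega>. \<gamma> i t)"
proof (rule locally_bounded_le[OF locally_bounded_const[of \<delta>]])
  show "\<bar>\<gamma> i t\<bar> \<le> \<bar>\<delta>\<bar>" for t using \<gamma>_bounds[of i t] by linarith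
qed

lemma regular_drift: "regular_process drift" and locally_bounded_drift: "locally_bounded drift"
proof -
  have "regular_process (\<lambda>u \<omega>. \<Sum>i\<in>UNIV. lam i \<omega> u - \<gamma> i u)"
    by (intro regular_sum regular_diff regular_lam \<gamma>) simp
  then show "regular_process drift" by (simp add: drift_def[abs_def])
  have "locally_bounded (\<lambda>u \<omega>. \<Sum>i\<in>UNIV. lam i \<omega> u - \<gamma> i u)"
    by (intro locally_bounded_sum locally_bounded_diff bounded_lam locally_bounded_gamma) simp
  then show "locally_bounded drift" by (simp add: drift_def[abs_def])
qed

lemma regular_tilt: "regular_process tilt"
proof -
  have ratio: "regular_process (\<lambda>t \<omega>. \<gamma> i t / lam i \<omega> t)" for i
    by (rule regular_divide[OF \<gamma> regular_lam]) (metis lam_pos less_irrefl)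
  have "regular_process (\<lambda>t \<omega>. \<Prod>s\<in>\<omega> i \<inter> {0<..<t}. \<gamma> i s / lam i \<omega> s)" for i
    by (rule regular_point_prod[OF ratio]) (metis \<gamma>_bounds divide_nonneg_pos lam_pos)
  moreover have "regular_process (\<lambda>t \<omega>. exp (integral {0..t} (\<lambda>u. drift u \<omega>)))"
    by (rule regular_compose[OF regular_integral[OF regular_drift locally_bounded_drift]]) auto
  ultimately have "regular_process (\<lambda>t \<omega>. indicator F \<omega> *
    (\<Prod>i\<in>UNIV. \<Prod>s\<in>\<omega> i \<inter> {0<..<t}. \<gamma> i s / lam i \<omega> s) * exp (integral {0..t} (\<lambda>u. drift u \<omega>)))"
    by (intro regular_mult regular_prod regular_indicator[OF F]) simp_all
  then show ?thesis by (simp add: tilt_def[abs_def])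
qed

lemma ratio_le: "\<omega> \<in> configs \<Longrightarrow> \<gamma> i s / lam i \<omega> s \<le> \<delta> / c"
  using \<gamma>_bounds[of i s] lam_ge[of \<omega> i s] c_pos by (intro frac_le) auto

lemma regular_jump: "regular_process (\<lambda>u \<omega>. tilt u \<omega> * (\<gamma> i u / lam i \<omega> u - 1))"
proof -
  have "regular_process (\<lambda>t \<omega>. \<gamma> i t / lam i \<omega> t)"
    by (rule regular_divide[OF \<gamma> regular_lam]) (metis lam_pos less_irrefl)
  then show ?thesis by (intro regular_mult regular_tilt regular_diff regular_const)
qed

lemma locally_bounded_jump: "locally_bounded (\<lambda>u \<omega>. tilt u \<omega> * (\<gamma> i u / lam i \<omega> u - 1))"
proof -
  have pos: "0 \<le> \<gamma> i t / lam i \<omega> t" if "\<omega> \<in> configs" for i t \<omega>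
    using \<gamma>_bounds lam_pos[OF that] by (metis divide_nonneg_pos)
  have ratio: "locally_bounded (\<lambda>t \<omega>. \<gamma> i t / lam i \<omega> t)" for i
  proof (rule locally_bounded_le[OF locally_bounded_const[of "\<delta> / c"]])
    show "\<bar>\<gamma> i t / lam i \<omega> t\<bar> \<le> \<bar>\<delta> / c\<bar>" if "\<omega> \<in> configs" for t \<omega>
      using pos[OF that, of i t] ratio_le[OF that, of i t] by linarith
  qed
  have F: "locally_bounded (\<lambda>t \<omega>. indicator F \<omega>)"
    by (rule locally_bounded_le[OF locally_bounded_const[of 1]]) (simp add: indicator_def)
  have "locally_bounded (\<lambda>t \<omega>. indicator F \<omega> *
    (\<Prod>i\<in>UNIV. \<Prod>s\<in>\<omega> i \<inter> {0<..<t}. \<gamma> i s / lam i \<omega> s) * exp (integral {0..t} (\<lambda>u. drift u \<omega>)))"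
    by (intro locally_bounded_mult F locally_bounded_prod locally_bounded_point_prod[OF ratio pos]
      locally_bounded_exp_integral regular_drift locally_bounded_drift) simp_all
  then have "locally_bounded tilt" by (simp add: tilt_def[abs_def])
  then show ?thesis by (intro locally_bounded_mult locally_bounded_diff ratio locally_bounded_const)
qed

text \<open>
  This is what the smallness of \<open>\<delta>\<close> is for. If \<open>N\<close> points lie in \<open>(0, t)\<close>, the exponential of the
  integrated intensity is at most \<open>exp (D b T (1 + n + N))\<close>, and each of the \<open>N\<close> factors \<open>\<gamma> / \<lambda>\<close> is at most
  \<open>\<delta> / c \<le> exp (- D b T)\<close>; the growth in \<open>N\<close> cancels. The tilt is therefore bounded, although the
  intensity is not.
\<close>

lemma tilt_bounds:
  assumes w: "\<omega> \<in> configs" and t: "0 \<le> t" "t \<le> T"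
  shows "0 \<le> tilt t \<omega>" "tilt t \<omega> \<le> exp ((real CARD('d) * b * T) * (1 + real n))"
proof -
  have rpos: "0 \<le> \<gamma> i s / lam i \<omega> s" for i s using \<gamma>_bounds lam_pos[OF w] by (metis divide_nonneg_pos)
  then show "0 \<le> tilt t \<omega>" unfolding tilt_def by (intro mult_nonneg_nonneg prod_nonneg) auto
  show "tilt t \<omega> \<le> exp ((real CARD('d) * b * T) * (1 + real n))"
  proof (cases "\<omega> \<in> F")
    case True
    let ?N = "points \<omega> {0<..<t}" and ?R = "real CARD('d) * b * (1 + real n + real (points \<omega> {0<..<t}))"
    have "(\<Prod>i\<in>UNIV. \<Prod>s\<in>\<omega> i \<inter> {0<..<t}. \<gamma> i s / lam i \<omega> s) \<le> (\<Prod>i\<in>(UNIV::'d set). \<Prod>s\<in>\<omega> i \<inter> {0<..<t}. \<delta> / c)"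
      using rpos ratio_le[OF w] by (intro prod_mono conjI prod_nonneg) auto
    also have "\<dots> = (\<delta> / c) ^ ?N" by (simp add: points_def power_sum)
    finally have 1: "(\<Prod>i\<in>UNIV. \<Prod>s\<in>\<omega> i \<inter> {0<..<t}. \<gamma> i s / lam i \<omega> s) \<le> (\<delta> / c) ^ ?N" .
    have "integral {0..t} (\<lambda>u. drift u \<omega>) \<le> integral {0..t} (\<lambda>u. ?R)"
    proof (rule integral_le)
      show "(\<lambda>u. drift u \<omega>) integrable_on {0..t}" by (rule regular_integrable_on[OF regular_drift locally_bounded_drift w])
      fix u assume u: "u \<in> {0..t}"
      have "drift u \<omega> \<le> (\<Sum>i\<in>UNIV. lam i \<omega> u)" unfolding drift_def using \<gamma>_bounds by (intro sum_mono) (simp add: less_imp_le)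
      also have "\<dots> \<le> ?R" using u by (intro total_rate_le[OF w n[OF True]]) auto
      finally show "drift u \<omega> \<le> ?R" .
    qed (rule integrable_const_ivl)
    also have "\<dots> = t * ?R" using t by simp
    also have "\<dots> \<le> T * ?R" using t b_pos by (intro mult_right_mono) auto
    also have "\<dots> = (real CARD('d) * b * T) * (1 + real n) + real ?N * (real CARD('d) * b * T)" by (simp add: algebra_simps)
    finally have "exp (integral {0..t} (\<lambda>u. drift u \<omega>)) \<le> exp ((real CARD('d) * b * T) * (1 + real n)) * exp ((real CARD('d) * b * T)) ^ ?N"
      by (simp add: exp_add[symmetric] exp_of_nat_mult[symmetric])
    then have "tilt t \<omega> \<le> (\<delta> / c) ^ ?N * (exp ((real CARD('d) * b * T) * (1 + real n)) * exp ((real CARD('d) * b * T)) ^ ?N)"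
      unfolding tilt_def using True 1 \<delta> c_pos by (auto intro!: mult_mono prod_nonneg rpos)
    also have "\<dots> = (\<delta> / c * exp ((real CARD('d) * b * T))) ^ ?N * exp ((real CARD('d) * b * T) * (1 + real n))"
      by (simp only: power_mult_distrib mult_ac)
    also have "\<dots> \<le> 1 * exp ((real CARD('d) * b * T) * (1 + real n))"
    proof (intro mult_right_mono power_le_one)
      show "\<delta> / c * exp ((real CARD('d) * b * T)) \<le> 1"
        using \<delta> c_pos by (simp add: field_simps exp_minus)
    qed (use \<delta> c_pos in auto)
    finally show ?thesis by simp
  qed (simp add: tilt_def)
qed

text \<open>
  The path is absolutely continuous between points, with logarithmic derivative \<open>\<Lambda> - \<Gamma>\<close>, and jumps by the
  factor \<open>\<gamma> / \<lambda>\<close> at a point. The result is a sum over points minus its compensator.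
\<close>

lemma tilt_decomposition:
  assumes w: "\<omega> \<in> configs"
  shows "tilt_plus T \<omega> = indicator F \<omega>
    + (\<Sum>i\<in>UNIV. \<Sum>s\<in>\<omega> i \<inter> {0<..T}. tilt s \<omega> * (\<gamma> i s / lam i \<omega> s - 1))
    - (\<Sum>i\<in>UNIV. integral {0..T} (\<lambda>u. (tilt u \<omega> * (\<gamma> i u / lam i \<omega> u - 1)) * lam i \<omega> u))"
proof -
  let ?S = "\<Union>i. \<omega> i \<inter> {0<..T}"
  let ?D = "(\<Union>i. \<omega> i \<inter> {0<..T}) \<union> {t\<in>{0<..<T}. \<not> isCont (\<lambda>u. drift u \<omega>) t}"
  let ?I = "\<lambda>t. exp (integral {0..t} (\<lambda>u. drift u \<omega>))"
  have fin: "finite (\<omega> i \<inter> {0<..T})" for i by (rule config_finite[OF w]) simp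
  have int_cont: "continuous_on {0..T+1} (\<lambda>t. integral {0..t} (\<lambda>u. drift u \<omega>))"
    by (rule indefinite_integral_continuous_1[OF regular_integrable_on[OF regular_drift locally_bounded_drift w]])
  have nojump: "tilt_plus t \<omega> = tilt t \<omega>" if "0 \<le> t" "t \<le> T" "t \<notin> ?S" for t
  proof -
    have "\<omega> i \<inter> {0<..t} = \<omega> i \<inter> {0<..<t}" for i using that by (auto simp: less_le)
    then show ?thesis by (simp add: tilt_def tilt_plus_def)
  qed
  have "((\<lambda>u. tilt u \<omega> * drift u \<omega>) has_integral (tilt_plus T \<omega> - tilt 0 \<omega> - (\<Sum>t\<in>?S. tilt_plus t \<omega> - tilt t \<omega>))) {0..T}"
  proof (rule jump_ftc[where X="\<lambda>t. tilt t \<omega>" and Xp="\<lambda>t. tilt_plus t \<omega>" and D="?D", OF T])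
    show S: "finite ?S" by (intro finite_UN_I fin finite)
    show "?S \<subseteq> {0<..T}" by auto
    show "finite ?D" by (rule finite_UnI[OF S regular_finite[OF regular_drift w]])
    show "((\<lambda>t. tilt t \<omega>) \<longlongrightarrow> tilt t \<omega>) (at_left t)" if "0 < t" for t
      by (rule regular_left[OF regular_tilt w that])
    show "((\<lambda>t. tilt t \<omega>) \<longlongrightarrow> tilt_plus t \<omega>) (at_right t)" if "0 \<le> t" "t < T" for t
    proof -
      have "continuous_on {t..T+1} (\<lambda>t. integral {0..t} (\<lambda>u. drift u \<omega>))"
        by (rule continuous_on_subset[OF int_cont]) (use that in auto)
      then have I: "((\<lambda>t. integral {0..t} (\<lambda>u. drift u \<omega>)) \<longlongrightarrow> integral {0..t} (\<lambda>u. drift u \<omega>)) (at_right t)"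
        by (rule continuous_on_Icc_at_rightD) (use that in simp)
      have "((\<lambda>u. \<Prod>s\<in>\<omega> i \<inter> {0<..<u}. \<gamma> i s / lam i \<omega> s) \<longlongrightarrow> (\<Prod>s\<in>\<omega> i \<inter> {0<..t}. \<gamma> i s / lam i \<omega> s)) (at_right t)" for i
        by (rule tendsto_eventually) (use eventually_past_right[OF w, of i t] in eventually_elim, simp)
      then show ?thesis unfolding tilt_def tilt_plus_def
        by (intro tendsto_mult tendsto_const tendsto_prod tendsto_exp I)
    qed
    show "((\<lambda>t. tilt t \<omega>) has_real_derivative tilt t \<omega> * drift t \<omega>) (at t)" if "0 < t" "t < T" "t \<notin> ?D" for t
    proof -
      have I: "((\<lambda>t. integral {0..t} (\<lambda>u. drift u \<omega>)) has_real_derivative drift t \<omega>) (at t)"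
        by (rule regular_integral_deriv[OF regular_drift locally_bounded_drift w]) (use that in auto)
      have "\<forall>\<^sub>F u in nhds t. \<forall>i. \<omega> i \<inter> {0<..<u} = \<omega> i \<inter> {0<..<t}"
        using that by (intro eventually_all_finite eventually_past[OF w]) auto
      then have "\<forall>\<^sub>F u in nhds t. tilt u \<omega> = indicator F \<omega> * (\<Prod>i\<in>UNIV. \<Prod>s\<in>\<omega> i \<inter> {0<..<t}. \<gamma> i s / lam i \<omega> s) * ?I u"
        by eventually_elim (simp add: tilt_def)
      moreover have "((\<lambda>u. indicator F \<omega> * (\<Prod>i\<in>UNIV. \<Prod>s\<in>\<omega> i \<inter> {0<..<t}. \<gamma> i s / lam i \<omega> s) * ?I u)
        has_real_derivative tilt t \<omega> * drift t \<omega>) (at t)"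
        unfolding tilt_def by (auto intro!: derivative_eq_intros I)
      ultimately show ?thesis by (subst DERIV_cong_ev[OF refl _ refl])
    qed
  qed (rule nojump)
  then have "integral {0..T} (\<lambda>u. tilt u \<omega> * drift u \<omega>) = tilt_plus T \<omega> - tilt 0 \<omega> - (\<Sum>t\<in>?S. tilt_plus t \<omega> - tilt t \<omega>)"
    by (rule integral_unique)
  moreover have "tilt 0 \<omega> = indicator F \<omega>" by (simp add: tilt_def)
  moreover have "(\<Sum>t\<in>?S. tilt_plus t \<omega> - tilt t \<omega>) = (\<Sum>i\<in>UNIV. \<Sum>s\<in>\<omega> i \<inter> {0<..T}. tilt s \<omega> * (\<gamma> i s / lam i \<omega> s - 1))"
  proof -
    have disj: "\<omega> i \<inter> \<omega> j = {}" if "i \<noteq> j" for i j using w that by (simp add: configs_def)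
    have "(\<Sum>t\<in>?S. tilt_plus t \<omega> - tilt t \<omega>) = (\<Sum>i\<in>UNIV. \<Sum>t\<in>\<omega> i \<inter> {0<..T}. tilt_plus t \<omega> - tilt t \<omega>)"
      using disj fin by (intro sum.UNION_disjoint) auto
    also have "\<dots> = (\<Sum>i\<in>UNIV. \<Sum>s\<in>\<omega> i \<inter> {0<..T}. tilt s \<omega> * (\<gamma> i s / lam i \<omega> s - 1))"
    proof (intro sum.cong refl)
      fix i s assume s: "s \<in> \<omega> i \<inter> {0<..T}"
      have fin': "finite (\<omega> j \<inter> {0<..<s})" for j by (rule config_finite[OF w]) simp
      have "\<omega> j \<inter> {0<..s} = (if j = i then insert s (\<omega> j \<inter> {0<..<s}) else \<omega> j \<inter> {0<..<s})" for j
        using s disj[of j i] by (auto simp: less_le)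
      then have "(\<Prod>r\<in>\<omega> j \<inter> {0<..s}. \<gamma> j r / lam j \<omega> r) =
        (if j = i then \<gamma> i s / lam i \<omega> s else 1) * (\<Prod>r\<in>\<omega> j \<inter> {0<..<s}. \<gamma> j r / lam j \<omega> r)" for j
        using fin' by (simp only: if_distrib) simp
      then have "(\<Prod>j\<in>UNIV. \<Prod>r\<in>\<omega> j \<inter> {0<..s}. \<gamma> j r / lam j \<omega> r) =
        \<gamma> i s / lam i \<omega> s * (\<Prod>j\<in>UNIV. \<Prod>r\<in>\<omega> j \<inter> {0<..<s}. \<gamma> j r / lam j \<omega> r)"
        by (simp add: prod.distrib prod.delta)
      then have "tilt_plus s \<omega> = \<gamma> i s / lam i \<omega> s * tilt s \<omega>" by (simp add: tilt_plus_def tilt_def)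
      then show "tilt_plus s \<omega> - tilt s \<omega> = tilt s \<omega> * (\<gamma> i s / lam i \<omega> s - 1)" by (simp add: algebra_simps)
    qed
    finally show ?thesis .
  qed
  moreover have "integral {0..T} (\<lambda>u. tilt u \<omega> * drift u \<omega>) =
    - (\<Sum>i\<in>UNIV. integral {0..T} (\<lambda>u. (tilt u \<omega> * (\<gamma> i u / lam i \<omega> u - 1)) * lam i \<omega> u))"
  proof -
    have eq: "(tilt u \<omega> * (\<gamma> i u / lam i \<omega> u - 1)) * lam i \<omega> u = tilt u \<omega> * (\<gamma> i u - lam i \<omega> u)" for i u
      using lam_pos[OF w, of i u] by (simp add: field_simps)
    have int: "(\<lambda>u. (tilt u \<omega> * (\<gamma> i u / lam i \<omega> u - 1)) * lam i \<omega> u) integrable_on {0..T}" for i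
      by (rule regular_integrable_on[OF regular_mult[OF regular_jump regular_lam] locally_bounded_mult[OF locally_bounded_jump bounded_lam] w])
    have "integral {0..T} (\<lambda>u. tilt u \<omega> * drift u \<omega>) =
      integral {0..T} (\<lambda>u. - (\<Sum>i\<in>UNIV. (tilt u \<omega> * (\<gamma> i u / lam i \<omega> u - 1)) * lam i \<omega> u))"
      by (simp only: eq drift_def) (simp add: sum_distrib_left right_diff_distrib sum_negf[symmetric])
    also have "\<dots> = - (\<Sum>i\<in>UNIV. integral {0..T} (\<lambda>u. (tilt u \<omega> * (\<gamma> i u / lam i \<omega> u - 1)) * lam i \<omega> u))"
      using int by (simp add: integral_sum)
    finally show ?thesis .
  qed
  ultimately show ?thesis by simp
qed

text \<open>
  By the Campbell formula, the sum over points and its compensator in the decomposition have equal means.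
\<close>

lemma integral_tilt:
  "integrable M (tilt_plus T)" "integral\<^sup>L M (tilt_plus T) = measure M F"
proof -
  let ?J = "\<lambda>i u \<omega>. tilt u \<omega> * (\<gamma> i u / lam i \<omega> u - 1)"
  define K where "K = exp ((real CARD('d) * b * T) * (1 + real n)) * (\<delta> / c + 1)"
  have bnd: "\<bar>?J i u \<omega>\<bar> \<le> K" if w: "\<omega> \<in> configs" and u: "0 \<le> u" "u \<le> T" for i u \<omega>
  proof -
    have "0 \<le> \<gamma> i u / lam i \<omega> u" using \<gamma>_bounds lam_pos[OF w] by (metis divide_nonneg_pos)
    then have "\<bar>\<gamma> i u / lam i \<omega> u - 1\<bar> \<le> \<delta> / c + 1" using ratio_le[OF w, of i u] by linarith
    then show ?thesis unfolding K_def abs_mult using tilt_bounds[OF w u] by (intro mult_mono) auto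
  qed
  note C = campbell_bounded_real[OF T regular_jump locally_bounded_jump bnd]
  have FM: "F \<in> sets M" using F sets_observed_subset[of "{..0}"] sets_M by auto
  let ?R = "\<lambda>\<omega>. indicator F \<omega> + (\<Sum>i\<in>UNIV. \<Sum>s\<in>\<omega> i \<inter> {0<..T}. ?J i s \<omega>)
    - (\<Sum>i\<in>UNIV. integral {0..T} (\<lambda>u. ?J i u \<omega> * lam i \<omega> u))"
  have eq: "tilt_plus T \<omega> = ?R \<omega>" if "\<omega> \<in> space M" for \<omega>
    by (rule tilt_decomposition) (use that space_M in simp)
  have intF: "integrable M (indicator F :: _ \<Rightarrow> real)" using FM by (simp add: emeasure_eq_measure)
  have int1: "integrable M (\<lambda>\<omega>. \<Sum>i\<in>UNIV. \<Sum>s\<in>\<omega> i \<inter> {0<..T}. ?J i s \<omega>)"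
    by (intro Bochner_Integration.integrable_sum C(1))
  have int2: "integrable M (\<lambda>\<omega>. \<Sum>i\<in>UNIV. integral {0..T} (\<lambda>u. ?J i u \<omega> * lam i \<omega> u))"
    by (intro Bochner_Integration.integrable_sum C(2))
  have "integrable M ?R" by (intro Bochner_Integration.integrable_diff Bochner_Integration.integrable_add intF int1 int2)
  then show "integrable M (tilt_plus T)"
    by (rule iffD2[OF Bochner_Integration.integrable_cong[OF refl eq], rotated])
  have "integral\<^sup>L M (tilt_plus T) = integral\<^sup>L M ?R"
    by (rule Bochner_Integration.integral_cong[OF refl eq])
  also have "\<dots> = integral\<^sup>L M (indicator F) + (\<integral>\<omega>. (\<Sum>i\<in>UNIV. \<Sum>s\<in>\<omega> i \<inter> {0<..T}. ?J i s \<omega>) \<partial>M)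
    - (\<integral>\<omega>. (\<Sum>i\<in>UNIV. integral {0..T} (\<lambda>u. ?J i u \<omega> * lam i \<omega> u)) \<partial>M)"
    using Bochner_Integration.integral_diff[OF Bochner_Integration.integrable_add[OF intF int1] int2]
      Bochner_Integration.integral_add[OF intF int1] by presburger
  also have "(\<integral>\<omega>. (\<Sum>i\<in>UNIV. \<Sum>s\<in>\<omega> i \<inter> {0<..T}. ?J i s \<omega>) \<partial>M) =
    (\<Sum>i\<in>UNIV. \<integral>\<omega>. (\<Sum>s\<in>\<omega> i \<inter> {0<..T}. ?J i s \<omega>) \<partial>M)"
    by (intro Bochner_Integration.integral_sum C(1))
  also have "\<dots> = (\<Sum>i\<in>UNIV. \<integral>\<omega>. integral {0..T} (\<lambda>u. ?J i u \<omega> * lam i \<omega> u) \<partial>M)"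
    by (intro sum.cong refl C(3))
  also have "\<dots> = (\<integral>\<omega>. (\<Sum>i\<in>UNIV. integral {0..T} (\<lambda>u. ?J i u \<omega> * lam i \<omega> u)) \<partial>M)"
    by (intro Bochner_Integration.integral_sum[symmetric] C(2))
  finally show "integral\<^sup>L M (tilt_plus T) = measure M F" using FM by simp
qed

end

end

section \<open>Void events determine the law\<close>

definition void_event :: "('d \<Rightarrow> real set) \<Rightarrow> 'd config set" where
  "void_event B = {\<omega> \<in> configs. \<forall>i. \<omega> i \<inter> B i = {}}"

definition interval_union :: "real set \<Rightarrow> bool" where
  "interval_union B \<longleftrightarrow> (\<exists>I. finite I \<and> B = (\<Union>(a, b)\<in>I. {a<..b}))"

text \<open>
  Finite unions of half-open intervals are closed under union, so the void events form a \<open>\<pi>\<close>-system, and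
  their indicators in time are left-continuous, as the tilting argument demands.
\<close>

definition void_events :: "'d config set set" where
  "void_events = {void_event B | B. \<forall>i. interval_union (B i)}"

lemma interval_union_Ioc: "interval_union {a<..b}"
  unfolding interval_union_def by (intro exI[of _ "{(a, b)}"]) simp

lemma interval_union_empty: "interval_union {}"
  unfolding interval_union_def by (intro exI[of _ "{}"]) simp

lemma interval_union_Un: "interval_union B \<Longrightarrow> interval_union B' \<Longrightarrow> interval_union (B \<union> B')"
  unfolding interval_union_def by (metis UN_Un finite_UnI)

lemma Int_stable_void_events: "Int_stable void_events"
proof (rule Int_stableI)
  fix a b :: "'d config set" assume "a \<in> void_events" "b \<in> void_events"
  then obtain B B' where *: "a = void_event B" "b = void_event B'" "\<And>i. interval_union (B i)" "\<And>i. interval_union (B' i)"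
    unfolding void_events_def by auto
  then have "a \<inter> b = void_event (\<lambda>i. B i \<union> B' i)" unfolding void_event_def by blast
  then show "a \<inter> b \<in> void_events" using *(3,4) unfolding void_events_def
    by (auto intro!: exI[of _ "\<lambda>i. B i \<union> B' i"] interval_union_Un)
qed

lemma void_events_Pow: "void_events \<subseteq> Pow configs"
  by (auto simp: void_events_def void_event_def)

lemma configs_void_event: "configs = void_event (\<lambda>i. {})"
  by (simp add: void_event_def)

lemma interval_union_borel: "interval_union B \<Longrightarrow> B \<in> sets borel \<and> bounded B"
  unfolding interval_union_def by auto

lemma void_event_measurable:
  assumes "\<And>i. B i \<in> sets borel" "\<And>i. bounded (B i)"
  shows "void_event (B :: 'd::finite \<Rightarrow> real set) \<in> sets config_algebra"
proof -
  have "void_event B = (\<Inter>i. (\<lambda>\<omega>. card (\<omega> i \<inter> B i)) -` {0} \<inter> space config_algebra)"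
  proof -
    have "card (\<omega> i \<inter> B i) = 0 \<longleftrightarrow> \<omega> i \<inter> B i = {}" if "\<omega> \<in> configs" for \<omega> i
      using config_finite[OF that assms(2)] by (simp add: card_eq_0_iff)
    then have "\<omega> \<in> void_event B \<longleftrightarrow> \<omega> \<in> (\<Inter>i. (\<lambda>\<omega>. card (\<omega> i \<inter> B i)) -` {0} \<inter> space config_algebra)" for \<omega>
      by (cases "\<omega> \<in> configs") (simp_all add: void_event_def)
    then show ?thesis by (rule set_eqI)
  qed
  also have "\<dots> \<in> sets config_algebra"
    by (intro sets.finite_INT measurable_sets[OF measurable_card[OF assms]]) auto
  finally show ?thesis .
qed

text \<open>
  For a fine grid every cell holds at most one point, so the number of occupied cells is the number of
  points. This is where simplicity of the process enters: an event time is recorded by its presence.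
\<close>

lemma card_as_limit:
  assumes "finite S" "S \<subseteq> {a<..b}" "a < b"
  shows "(\<lambda>n. \<Sum>k<Suc n. of_bool (S \<inter> grid_cell a b (Suc n) k \<noteq> {})) \<longlonglongrightarrow> real (card S)"
proof -
  define e where "e = Min (insert 1 ((\<lambda>(s, t). \<bar>s - t\<bar>) ` {(s, t). s \<in> S \<and> t \<in> S \<and> s \<noteq> t}))"
  have fin: "finite {(s, t). s \<in> S \<and> t \<in> S \<and> s \<noteq> t}"
    by (rule finite_subset[OF _ finite_cartesian_product[OF assms(1) assms(1)]]) auto
  have e: "e > 0" unfolding e_def using fin by (subst Min_gr_iff) auto
  have gap: "e \<le> \<bar>s - t\<bar>" if "s \<in> S" "t \<in> S" "s \<noteq> t" for s t
  proof -
    have "\<bar>s - t\<bar> \<in> (\<lambda>(s, t). \<bar>s - t\<bar>) ` {(s, t). s \<in> S \<and> t \<in> S \<and> s \<noteq> t}" using that by force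
    then show ?thesis unfolding e_def using fin by (intro Min_le) auto
  qed
  have "(\<lambda>n. (b - a) / real (Suc n)) \<longlonglongrightarrow> 0" by (rule LIMSEQ_Suc[OF lim_const_over_n])
  then have "\<forall>\<^sub>F n in sequentially. (b - a) / real (Suc n) < e" using e by (rule order_tendstoD)
  then have "\<forall>\<^sub>F n in sequentially. (\<Sum>k<Suc n. of_bool (S \<inter> grid_cell a b (Suc n) k \<noteq> {})) = real (card S)"
  proof (rule eventually_mono)
    fix n assume n: "(b - a) / real (Suc n) < e"
    have one: "of_bool (S \<inter> grid_cell a b (Suc n) k \<noteq> {}) = real (card (S \<inter> grid_cell a b (Suc n) k))" for k
    proof -
      have "s = t" if "s \<in> S \<inter> grid_cell a b (Suc n) k" "t \<in> S \<inter> grid_cell a b (Suc n) k" for s t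
      proof (rule ccontr)
        assume "s \<noteq> t"
        then have "e \<le> \<bar>s - t\<bar>" using gap that by blast
        moreover have "a + (b - a) * real (Suc k) / real (Suc n) = a + (b - a) * real k / real (Suc n) + (b - a) / real (Suc n)"
          unfolding of_nat_Suc[of k] distrib_left add_divide_distrib by (simp only: mult_1_right ac_simps)
        then have "\<bar>s - t\<bar> < (b - a) / real (Suc n)" using that unfolding grid_cell_def by auto
        ultimately show False using n by linarith
      qed
      then have "S \<inter> grid_cell a b (Suc n) k = {} \<or> (\<exists>s. S \<inter> grid_cell a b (Suc n) k = {s})" by blast
      then show ?thesis by auto
    qed
    have "S \<inter> {a<..b} = S" using assms(2) by blast
    then have "real (card S) = (\<Sum>s\<in>S \<inter> {a<..b}. 1)" by simp
    also have "\<dots> = (\<Sum>k<Suc n. 1 * real (card (S \<inter> grid_cell a b (Suc n) k)))"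
      by (rule sum_grid_floor[of a b "Suc n" S "\<lambda>_. 1", OF assms(3)]) (use assms(1) in auto)
    finally show "(\<Sum>k<Suc n. of_bool (S \<inter> grid_cell a b (Suc n) k \<noteq> {})) = real (card S)" by (simp add: one)
  qed
  then show ?thesis by (rule tendsto_eventually)
qed

lemma card_Ioc_measurable_void:
  "(\<lambda>\<omega>. real (card (\<omega> i \<inter> {a<..b}))) \<in> borel_measurable (sigma configs void_events)"
proof (cases "a < b")
  case True
  show ?thesis
  proof (rule borel_measurable_LIMSEQ_real)
    fix \<omega> assume "\<omega> \<in> space (sigma configs (void_events :: 'a config set set))"
    then have "\<omega> \<in> configs" by (simp add: space_measure_of[OF void_events_Pow])
    then show "(\<lambda>n. \<Sum>k<Suc n. of_bool ((\<omega> i \<inter> {a<..b}) \<inter> grid_cell a b (Suc n) k \<noteq> {})) \<longlonglongrightarrow> real (card (\<omega> i \<inter> {a<..b}))"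
      by (intro card_as_limit config_finite True) auto
  next
    fix n
    have "(\<lambda>\<omega>. of_bool ((\<omega> i \<inter> {a<..b}) \<inter> grid_cell a b (Suc n) k \<noteq> {}) :: real) \<in> borel_measurable (sigma configs void_events)"
      if "k < Suc n" for k
    proof -
      let ?C = "grid_cell a b (Suc n) k"
      have sub: "?C \<subseteq> {a<..b}" by (rule grid_cell_subset[OF True that])
      let ?V = "void_event (\<lambda>j. if j = i then ?C else {}) :: 'a config set"
      have "?V \<in> void_events" unfolding void_events_def
        by (auto intro!: exI[of _ "\<lambda>j. if j = i then ?C else {}"] interval_union_empty simp: grid_cell_def interval_union_Ioc)
      then have V: "?V \<in> sets (sigma configs void_events)"
        unfolding sets_measure_of[OF void_events_Pow] by (rule sigma_sets.Basic)
      show ?thesis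
      proof (rule borel_measurable_eqI)
        show "(\<lambda>\<omega>. 1 - indicator ?V \<omega> :: real) \<in> borel_measurable (sigma configs void_events)"
          using V by (intro borel_measurable_diff borel_measurable_const borel_measurable_indicator)
        fix \<omega> assume "\<omega> \<in> space (sigma configs (void_events :: 'a config set set))"
        then have "\<omega> \<in> configs" by (simp add: space_measure_of[OF void_events_Pow])
        moreover have "(\<omega> i \<inter> {a<..b}) \<inter> ?C = \<omega> i \<inter> ?C" using sub by blast
        ultimately show "of_bool ((\<omega> i \<inter> {a<..b}) \<inter> ?C \<noteq> {}) = (1 - indicator ?V \<omega> :: real)"
          by (auto simp: void_event_def indicator_def)
      qed
    qed
    then show "(\<lambda>\<omega>. \<Sum>k<Suc n. of_bool ((\<omega> i \<inter> {a<..b}) \<inter> grid_cell a b (Suc n) k \<noteq> {}) :: real) \<in> borel_measurable (sigma configs void_events)"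
      by (intro borel_measurable_sum) auto
  qed
qed simp

text \<open>
  Counts over intervals are limits of occupied-cell counts; the general Borel set is reached by
  a Dynkin-system argument.
\<close>

lemma card_measurable_void:
  assumes B: "B \<in> sets borel" "bounded B"
  shows "(\<lambda>\<omega>. real (card (\<omega> i \<inter> B))) \<in> borel_measurable (sigma configs void_events)"
proof -
  let ?N = "sigma configs (void_events :: 'a config set set)"
  have sp: "space ?N = configs" by (rule space_measure_of[OF void_events_Pow])
  obtain m where m: "\<And>x. x \<in> B \<Longrightarrow> \<bar>x\<bar> \<le> m" using B(2) unfolding bounded_real by blast
  define W where "W = {-m - 1<..m}"
  have BW: "B \<subseteq> W" using m unfolding W_def by (force simp: abs_le_iff)
  let ?f = "\<lambda>X \<omega>. \<Sum>s\<in>\<omega> i \<inter> W. indicator X s :: real"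
  have f_eq: "?f X \<omega> = real (card (\<omega> i \<inter> (X \<inter> W)))" if "\<omega> \<in> configs" for X \<omega>
  proof -
    have "finite (\<omega> i \<inter> W)" unfolding W_def by (rule config_finite[OF that]) simp
    then have "?f X \<omega> = real (card (\<omega> i \<inter> W \<inter> X))" by (simp add: sum.inter_restrict[symmetric] indicator_def)
    then show ?thesis by (simp add: ac_simps)
  qed
  have gen: "B \<in> sigma_sets UNIV (range (\<lambda>(a, b). {a<..b}))"
    using B(1) by (simp add: borel_sigma_sets_Ioc)
  have stable: "Int_stable (range (\<lambda>(a, b). {a<..b::real}))"
  proof (rule Int_stableI)
    fix X Y :: "real set" assume "X \<in> range (\<lambda>(a, b). {a<..b})" "Y \<in> range (\<lambda>(a, b). {a<..b})"
    then obtain a b a' b' where "X = {a<..b}" "Y = {a'<..b'}" by auto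
    then have "X \<inter> Y = (\<lambda>(a, b). {a<..b}) (max a a', min b b')" by auto
    then show "X \<inter> Y \<in> range (\<lambda>(a, b). {a<..b})" by (rule image_eqI) simp
  qed
  have "?f B \<in> borel_measurable ?N"
  proof (rule sigma_sets_induct_disjoint[OF stable _ gen, where P="\<lambda>X. ?f X \<in> borel_measurable ?N"])
    fix X :: "real set" assume "X \<in> range (\<lambda>(a, b). {a<..b})"
    then obtain a b where "X = {a<..b}" by auto
    then have "X \<inter> W = {max a (-m-1)<..min b m}" by (auto simp: W_def)
    then show "?f X \<in> borel_measurable ?N"
      by (intro borel_measurable_eqI[OF card_Ioc_measurable_void[of i "max a (-m-1)" "min b m"]]) (simp add: sp f_eq)
  next
    fix X :: "real set" assume "?f X \<in> borel_measurable ?N"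
    moreover have "(\<lambda>\<omega>. real (card (\<omega> i \<inter> W))) \<in> borel_measurable ?N" unfolding W_def by (rule card_Ioc_measurable_void)
    ultimately have "(\<lambda>\<omega>. real (card (\<omega> i \<inter> W)) - ?f X \<omega>) \<in> borel_measurable ?N" by simp
    then show "?f (UNIV - X) \<in> borel_measurable ?N"
    proof (rule borel_measurable_eqI)
      fix \<omega>
      have "real (card (\<omega> i \<inter> W)) - ?f X \<omega> = (\<Sum>s\<in>\<omega> i \<inter> W. 1 - indicator X s)" by (simp add: sum_subtractf)
      also have "\<dots> = ?f (UNIV - X) \<omega>" by (intro sum.cong refl) (auto simp: indicator_def)
      finally show "?f (UNIV - X) \<omega> = real (card (\<omega> i \<inter> W)) - ?f X \<omega>" by simp
    qed
  next
    fix X :: "nat \<Rightarrow> real set" assume X: "disjoint_family X" "\<And>k. ?f (X k) \<in> borel_measurable ?N"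
    show "?f (\<Union>k. X k) \<in> borel_measurable ?N"
    proof (rule borel_measurable_LIMSEQ_real)
      show "(\<lambda>\<omega>. \<Sum>k<n. ?f (X k) \<omega>) \<in> borel_measurable ?N" for n by (intro borel_measurable_sum X)
      fix \<omega>
      have "(\<lambda>n. \<Sum>s\<in>\<omega> i \<inter> W. \<Sum>k<n. indicator (X k) s) \<longlonglongrightarrow> ?f (\<Union>k. X k) \<omega>"
        using X(1) by (intro tendsto_sum indicator_sums[unfolded sums_def]) (auto simp: disjoint_family_on_def)
      then show "(\<lambda>n. \<Sum>k<n. ?f (X k) \<omega>) \<longlonglongrightarrow> ?f (\<Union>k. X k) \<omega>" by (subst sum.swap)
    qed
  qed auto
  then show ?thesis
  proof (rule borel_measurable_eqI)
    have "B \<inter> W = B" using BW by blast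
    then show "real (card (\<omega> i \<inter> B)) = ?f B \<omega>" if "\<omega> \<in> space ?N" for \<omega> using f_eq[of \<omega> B] that sp by simp
  qed
qed

lemma sets_config_algebra_void:
  "sets (config_algebra :: 'd::finite config measure) = sigma_sets configs void_events"
proof
  show "sigma_sets configs void_events \<subseteq> sets (config_algebra :: 'd config measure)"
  proof -
    have "(void_events :: 'd config set set) \<subseteq> sets config_algebra"
    proof
      fix X :: "'d config set" assume "X \<in> void_events"
      then obtain B where "X = void_event B" "\<And>i. interval_union (B i)" unfolding void_events_def by auto
      then show "X \<in> sets config_algebra" using interval_union_borel by (simp add: void_event_measurable)
    qed
    then show ?thesis using sets.sigma_sets_subset[of void_events config_algebra] by simp
  qed
  show "sets (config_algebra :: 'd config measure) \<subseteq> sigma_sets configs void_events"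
    unfolding config_algebra_def sets_measure_of[OF config_algebra_generators]
  proof (rule sigma_sets_mono, rule subsetI)
    fix y :: "'d config set"
    assume "y \<in> {{\<omega> \<in> configs. card (\<omega> i \<inter> B) = n} | i B n. B \<in> sets borel \<and> bounded B}"
    then obtain i :: 'd and B n where y: "y = {\<omega> \<in> configs. card (\<omega> i \<inter> B) = n}" "B \<in> sets borel" "bounded B" by blast
    have "(\<lambda>\<omega>. real (card (\<omega> i \<inter> B))) -` {real n} \<inter> space (sigma configs void_events) \<in> sets (sigma configs void_events)"
      by (rule measurable_sets[OF card_measurable_void[OF y(2,3)]]) simp
    moreover have "(\<lambda>\<omega>. real (card (\<omega> i \<inter> B))) -` {real n} \<inter> space (sigma configs void_events) = y"
      unfolding y(1) space_measure_of[OF void_events_Pow] by auto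
    ultimately show "y \<in> sigma_sets configs void_events" by (simp add: sets_measure_of[OF void_events_Pow])
  qed
qed

text \<open>
  The uniqueness theorem of Renyi: the void probabilities of finite unions of intervals determine the
  law of a simple point process.
\<close>

theorem void_probabilities_determine:
  fixes M N :: "'d::finite config measure"
  assumes M: "sets M = sets config_algebra" and N: "sets N = sets config_algebra"
    and eq: "\<And>B. (\<And>i. interval_union (B i)) \<Longrightarrow> emeasure M (void_event B) = emeasure N (void_event B)"
    and fin: "emeasure M configs < \<infinity>"
  shows "M = N"
proof (rule measure_eqI_generator_eq[OF Int_stable_void_events void_events_Pow])
  show "emeasure M X = emeasure N X" if "X \<in> void_events" for X
    using that eq unfolding void_events_def by blast
  show "sets M = sigma_sets configs void_events" "sets N = sigma_sets configs void_events"
    using M N sets_config_algebra_void by auto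
  show "range (\<lambda>_::nat. configs) \<subseteq> void_events"
    unfolding void_events_def using configs_void_event interval_union_empty by auto
  show "emeasure M configs \<noteq> \<infinity>" using fin by simp
qed simp

section \<open>Change of measure on a common past\<close>

lemma void_event_observed:
  assumes "\<And>i. B i \<in> sets borel" "\<And>i. bounded (B i)" "\<And>i. B i \<subseteq> S"
  shows "void_event (B :: 'd::finite \<Rightarrow> real set) \<in> sets (observed S)"
proof -
  have "card (\<omega> i \<inter> B i) = 0 \<longleftrightarrow> \<omega> i \<inter> B i = {}" if "\<omega> \<in> configs" for \<omega> i
    using config_finite[OF that assms(2)] by (simp add: card_eq_0_iff)
  then have "\<omega> \<in> void_event B \<longleftrightarrow> \<omega> \<in> (\<Inter>i. (\<lambda>\<omega>. card (\<omega> i \<inter> B i)) -` {0} \<inter> space (observed S))" for \<omega>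
    by (cases "\<omega> \<in> configs") (simp_all add: void_event_def)
  then have "void_event B = (\<Inter>i. (\<lambda>\<omega>. card (\<omega> i \<inter> B i)) -` {0} \<inter> space (observed S))" by (rule set_eqI)
  also have "\<dots> \<in> sets (observed S)"
    by (intro sets.finite_INT measurable_sets[OF measurable_card_observed[OF assms]]) auto
  finally show ?thesis .
qed

lemma regular_indicator_Ioc: "regular_process (\<lambda>t \<omega>. indicator {a<..b} t)"
  unfolding regular_process_def
proof (intro conjI allI ballI impI)
  show "((\<lambda>s. indicator {a<..b} s) \<longlongrightarrow> (indicator {a<..b} t :: real)) (at_left t)" for t
  proof (rule tendsto_eventually)
    show "\<forall>\<^sub>F u in at_left t. indicator {a<..b} u = (indicator {a<..b} t :: real)"
      unfolding eventually_at_left_field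
      by (intro exI[of _ "max (if a < t then a else t - 1) (if b < t then b else t - 1)"]) (auto simp: indicator_def)
  qed
  fix T
  show "finite {t \<in> {0<..<T}. \<not> isCont (\<lambda>s. indicator {a<..b} s :: real) t}"
  proof (rule finite_subset)
    show "{t \<in> {0<..<T}. \<not> isCont (\<lambda>s. indicator {a<..b} s :: real) t} \<subseteq> {a, b}"
    proof (rule subsetI, rule ccontr)
      fix t assume t: "t \<in> {t \<in> {0<..<T}. \<not> isCont (\<lambda>s. indicator {a<..b} s :: real) t}" "t \<notin> {a, b}"
      have "t \<notin> frontier {a<..b}" using t(2) by (cases "a < b") (auto simp: frontier_def)
      then have "isCont (indicator {a<..b} :: real \<Rightarrow> real) t" by (simp add: isCont_indicator)
      then show False using t(1) by simp
    qed
  qed simp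
qed auto

lemma interval_union_regular:
  assumes "interval_union B" shows "regular_process (\<lambda>t \<omega>. indicator B t)"
proof -
  obtain I where I: "finite I" "B = (\<Union>(a, b)\<in>I. {a<..b})" using assms unfolding interval_union_def by blast
  have "indicator B t = 1 - (\<Prod>p\<in>I. 1 - indicator {fst p<..snd p} t :: real)" for t
  proof (cases "t \<in> B")
    case True
    then obtain p where "p \<in> I" "t \<in> {fst p<..snd p}" unfolding I(2) by auto
    then have "(\<Prod>p\<in>I. 1 - indicator {fst p<..snd p} t :: real) = 0"
      by (intro prod_zero I(1) bexI[of _ p]) auto
    with True show ?thesis by simp
  next
    case False
    then have "(\<Prod>p\<in>I. 1 - indicator {fst p<..snd p} t :: real) = 1"
      unfolding I(2) by (intro prod.neutral) (auto simp: indicator_def)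
    with False show ?thesis by simp
  qed
  moreover have "regular_process (\<lambda>t \<omega>. 1 - (\<Prod>p\<in>I. 1 - indicator {fst p<..snd p} t :: real))"
    by (intro regular_diff regular_const regular_prod I(1) regular_indicator_Ioc)
  ultimately show ?thesis by simp
qed

definition log_likelihood :: "('d::finite \<Rightarrow> 'd config \<Rightarrow> real \<Rightarrow> real) \<Rightarrow> real \<Rightarrow> 'd config \<Rightarrow> real" where
  "log_likelihood lam T \<omega> = (\<Sum>i\<in>UNIV. \<Sum>s\<in>\<omega> i \<inter> {0<..T}. ln (lam i \<omega> s))
     - integral {0..T} (\<lambda>u. \<Sum>i\<in>UNIV. lam i \<omega> u)"

context counting_process
begin

lemma regular_total: "regular_process (\<lambda>u \<omega>. \<Sum>i\<in>UNIV. lam i \<omega> u)"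
  by (intro regular_sum regular_lam) simp

lemma locally_bounded_total: "locally_bounded (\<lambda>u \<omega>. \<Sum>i\<in>UNIV. lam i \<omega> u)"
  by (intro locally_bounded_sum bounded_lam) simp

lemma measurable_log_likelihood:
  assumes "0 \<le> T" shows "log_likelihood lam T \<in> borel_measurable config_algebra"
proof -
  have ln: "regular_process (\<lambda>t \<omega>. ln (lam i \<omega> t))" for i
    by (rule regular_compose[OF regular_lam]) (auto intro!: isCont_ln_pos lam_pos)
  show ?thesis unfolding log_likelihood_def
    by (intro borel_measurable_diff borel_measurable_sum measurable_point_sum[OF ln]
        regular_measurable_config[OF regular_integral[OF regular_total locally_bounded_total] assms])
qed

end

lemma measurable_points_config:
  assumes "S \<in> sets borel" "bounded S"
  shows "(\<lambda>\<omega>. real (points \<omega> S)) \<in> borel_measurable config_algebra"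
  by (rule measurable_observed_config_algebra[OF measurable_points[OF assms subset_refl] assms(1)])

context hawkes_process
begin

definition tilt_level where "tilt_level T = c * exp (- (real CARD('d) * b * T))"

lemma tilt_level_pos: "0 < tilt_level T"
  using c_pos by (simp add: tilt_level_def)

lemma void_event_past: "(void_event (\<lambda>_. {-A..0}) :: 'd config set) \<in> sets (observed {..0})"
  by (rule void_event_observed) auto

text \<open>
  With \<open>\<gamma> = 0\<close> the tilt vanishes unless \<open>(0, T]\<close> is empty, and on that event it is bounded. Its mean
  is the probability of the starting event \<open>F\<close>, here a bound on the number of past points, so the
  void event cannot be null.
\<close>

lemma prob_no_points_pos:
  assumes T: "0 < T" shows "0 < measure M (void_event (\<lambda>_. {0<..T}))"
proof -
  let ?V = "void_event (\<lambda>_. {0<..T}) :: 'd config set"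
  let ?F = "\<lambda>n::nat. {\<omega> \<in> space (observed {..0}). real (points \<omega> {-A..0}) \<le> real n} :: 'd config set"
  have Fobs: "?F n \<in> sets (observed {..0})" for n
    using measurable_points[of "{-A..0}" "{..0}"] by (intro borel_measurable_le) auto
  then have FM: "?F n \<in> sets M" for n using sets_observed_subset[of "{..0}"] sets_M by auto
  have VM: "?V \<in> sets M" unfolding sets_M by (rule void_event_measurable) auto
  obtain n where n: "measure M (?F n) > 0"
  proof (rule ccontr)
    assume "\<not> thesis"
    have "measure M (?F n) = 0" for n
    proof -
      have "\<not> 0 < measure M (?F n)" using that[of n] \<open>\<not> thesis\<close> by blast
      then show ?thesis using measure_nonneg[of M "?F n"] by linarith
    qed
    then have "emeasure M (?F n) = 0" for n by (simp add: emeasure_eq_measure)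
    then have "emeasure M (\<Union>n. ?F n) = 0" using FM by (intro emeasure_UN_eq_0) auto
    moreover have "(\<Union>n. ?F n) = space M" by (auto simp: space_M)
    ultimately show False using emeasure_space_1 by simp
  qed
  let ?K = "exp (T * (real CARD('d) * b * (1 + real n)))"
  have level: "tilt_level T \<le> c * exp (- (real CARD('d) * b * T))" by (simp add: tilt_level_def)
  have zero: "0 \<le> (0::real) \<and> 0 \<le> tilt_level T" using tilt_level_pos[of T] by simp
  have count: "points \<omega> {-A..0} \<le> n" if "\<omega> \<in> ?F n" for \<omega> using that by simp
  note tilt = integral_tilt[where \<gamma> = "\<lambda>i t. 0", OF T tilt_level_pos level regular_const zero Fobs[of n] count]
  have le: "tilt_plus_of (\<lambda>i t. 0) (?F n) T \<omega> \<le> ?K * indicator ?V \<omega>" if "\<omega> \<in> space M" for \<omega>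
  proof -
    have w: "\<omega> \<in> configs" using that by (simp add: space_M)
    show ?thesis
    proof (cases "\<omega> \<in> ?V")
      case False
      then obtain i s where s: "s \<in> \<omega> i \<inter> {0<..T}" using w unfolding void_event_def by blast
      have "(\<Prod>s\<in>\<omega> i \<inter> {0<..T}. 0 / lam i \<omega> s) = 0"
        using s by (intro prod_zero config_finite[OF w]) auto
      then have "(\<Prod>i\<in>UNIV. \<Prod>s\<in>\<omega> i \<inter> {0<..T}. 0 / lam i \<omega> s) = 0" by (intro prod_zero) auto
      then have "tilt_plus_of (\<lambda>i t. 0) (?F n) T \<omega> = 0"
        by (simp only: tilt_plus_of_def mult_zero_left mult_zero_right)
      then show ?thesis by simp
    next
      case True
      then have empty: "\<omega> i \<inter> {0<..T} = {}" for i by (auto simp: void_event_def)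
      show ?thesis
      proof (cases "\<omega> \<in> ?F n")
        case F: True
        have "points \<omega> {0<..<T} = 0" using empty by (subst points_eq_0_iff[OF w]) fastforce+
        then have "(\<Sum>i\<in>UNIV. lam i \<omega> u) \<le> real CARD('d) * b * (1 + real n)" if "u \<in> {0..T}" for u
          using total_rate_le[OF w, of n u T] F that by simp
        then have "integral {0..T} (\<lambda>u. \<Sum>i\<in>UNIV. lam i \<omega> u) \<le> integral {0..T} (\<lambda>u. real CARD('d) * b * (1 + real n))"
          by (intro integral_le regular_integrable_on[OF regular_total locally_bounded_total w] integrable_const_ivl)
        also have "\<dots> = T * (real CARD('d) * b * (1 + real n))" using T by simp
        finally show ?thesis using True F by (simp add: tilt_plus_of_def drift_of_def empty)
      qed (simp add: tilt_plus_of_def True)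
    qed
  qed
  have "measure M (?F n) = integral\<^sup>L M (tilt_plus_of (\<lambda>i t. 0) (?F n) T)" by (rule tilt(2)[symmetric])
  also have "\<dots> \<le> (\<integral>\<omega>. ?K * indicator ?V \<omega> \<partial>M)" using VM
    by (intro integral_mono tilt(1) le integrable_mult_right) (auto simp: emeasure_eq_measure)
  also have "\<dots> = ?K * measure M ?V" using VM by simp
  finally have "0 < ?K * measure M ?V" using n by (rule less_le_trans[rotated])
  then show ?thesis by (rule zero_less_mult_pos) simp
qed

text \<open>
  Taking \<open>\<gamma>\<close> equal to the constant \<open>tilt_level T\<close> off \<open>B\<close> and \<open>0\<close> on \<open>B\<close> makes the tilt the product of a
  weight independent of \<open>B\<close> and the indicator that \<open>B\<close> is void. The right-hand side depends on
  the intensity only through the probability of the empty past.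
\<close>

lemma weighted_void_probability:
  fixes B :: "'d \<Rightarrow> real set"
  assumes T: "0 < T" and B: "\<And>i. interval_union (B i)"
  defines "g \<equiv> (\<lambda>\<omega>. indicator (void_event (\<lambda>_. {-A..0})) \<omega> * indicator (void_event (\<lambda>i. {0<..T} \<inter> B i)) \<omega> *
    exp (ln (tilt_level T) * real (points \<omega> {0<..T}) - log_likelihood lam T \<omega>))"
  shows "integrable M g"
    and "integral\<^sup>L M g = measure M (void_event (\<lambda>_. {-A..0})) *
      exp (integral {0..T} (\<lambda>u. \<Sum>i\<in>UNIV. tilt_level T * (1 - indicator (B i) u)))"
proof -
  let ?E = "void_event (\<lambda>_. {-A..0}) :: 'd config set"
  let ?V = "void_event (\<lambda>i. {0<..T} \<inter> B i) :: 'd config set"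
  define \<delta> where "\<delta> = tilt_level T"
  define \<gamma> where "\<gamma> i t = \<delta> * (1 - indicator (B i) t)" for i t
  define \<kappa> where "\<kappa> = integral {0..T} (\<lambda>u. \<Sum>i\<in>UNIV. \<gamma> i u)"
  have \<delta>: "0 < \<delta>" using tilt_level_pos by (simp add: \<delta>_def)
  have \<gamma>: "regular_process (\<lambda>t \<omega>. \<gamma> i t)" for i
    unfolding \<gamma>_def by (intro regular_cmult regular_diff regular_const interval_union_regular B)
  have \<gamma>b: "0 \<le> \<gamma> i t \<and> \<gamma> i t \<le> \<delta>" for i t using \<delta> by (auto simp: \<gamma>_def indicator_def)
  have E0: "points \<omega> {-A..0} \<le> 0" if "\<omega> \<in> ?E" for \<omega>
    using that points_eq_0_iff[of \<omega> "{-A..0}"] by (simp add: void_event_def)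
  have "\<delta> \<le> c * exp (- (real CARD('d) * b * T))" by (simp add: \<delta>_def tilt_level_def)
  note tilt = integral_tilt[OF T \<delta> this \<gamma> \<gamma>b void_event_past E0]
  have g: "g \<omega> = tilt_plus_of \<gamma> ?E T \<omega> * exp \<kappa>" if "\<omega> \<in> space M" for \<omega>
  proof -
    have w: "\<omega> \<in> configs" using that by (simp add: space_M)
    have fin: "finite (\<omega> i \<inter> {0<..T})" for i by (rule config_finite[OF w]) simp
    have "integral {0..T} (\<lambda>u. drift_of \<gamma> u \<omega>) = integral {0..T} (\<lambda>u. \<Sum>i\<in>UNIV. lam i \<omega> u) - \<kappa>"
      unfolding drift_of_def sum_subtractf \<kappa>_def
    proof (rule integral_diff)
      show "(\<lambda>u. \<Sum>i\<in>UNIV. lam i \<omega> u) integrable_on {0..T}"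
        by (rule regular_integrable_on[OF regular_total locally_bounded_total w])
      have lb: "locally_bounded (\<lambda>t \<omega>. \<gamma> i t)" for i
        by (rule locally_bounded_le[OF locally_bounded_const[of \<delta>]]) (use \<gamma>b \<delta> in auto)
      show "(\<lambda>u. \<Sum>i\<in>UNIV. \<gamma> i u) integrable_on {0..T}"
        by (rule regular_integrable_on[OF regular_sum locally_bounded_sum w]) (simp_all add: \<gamma> lb)
    qed
    moreover have "(\<Prod>i\<in>UNIV. \<Prod>s\<in>\<omega> i \<inter> {0<..T}. \<gamma> i s / lam i \<omega> s) =
      indicator ?V \<omega> * exp (ln \<delta> * real (points \<omega> {0<..T}) - (\<Sum>i\<in>UNIV. \<Sum>s\<in>\<omega> i \<inter> {0<..T}. ln (lam i \<omega> s)))"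
    proof (cases "\<omega> \<in> ?V")
      case True
      then have "\<gamma> i s / lam i \<omega> s = exp (ln \<delta> - ln (lam i \<omega> s))" if "s \<in> \<omega> i \<inter> {0<..T}" for i s
      proof -
        have "s \<notin> B i" using True that unfolding void_event_def by blast
        then show ?thesis using \<delta> lam_pos[OF w, of i s] by (simp add: \<gamma>_def exp_diff)
      qed
      then have "(\<Prod>i\<in>UNIV. \<Prod>s\<in>\<omega> i \<inter> {0<..T}. \<gamma> i s / lam i \<omega> s) =
        (\<Prod>i\<in>UNIV. \<Prod>s\<in>\<omega> i \<inter> {0<..T}. exp (ln \<delta> - ln (lam i \<omega> s)))" by (intro prod.cong refl) auto
      also have "\<dots> = exp (\<Sum>i\<in>UNIV. \<Sum>s\<in>\<omega> i \<inter> {0<..T}. ln \<delta> - ln (lam i \<omega> s))"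
        by (simp add: exp_sum fin)
      also have "(\<Sum>i\<in>UNIV. \<Sum>s\<in>\<omega> i \<inter> {0<..T}. ln \<delta> - ln (lam i \<omega> s)) =
        ln \<delta> * real (points \<omega> {0<..T}) - (\<Sum>i\<in>UNIV. \<Sum>s\<in>\<omega> i \<inter> {0<..T}. ln (lam i \<omega> s))"
        by (simp add: sum_subtractf points_def sum_distrib_left mult.commute)
      finally show ?thesis using True by simp
    next
      case False
      then obtain i s where s: "s \<in> \<omega> i \<inter> {0<..T}" "s \<in> B i" using w unfolding void_event_def by blast
      then have "(\<Prod>s\<in>\<omega> i \<inter> {0<..T}. \<gamma> i s / lam i \<omega> s) = 0"
        by (intro prod_zero fin bexI[of _ s]) (auto simp: \<gamma>_def)
      then have "(\<Prod>i\<in>UNIV. \<Prod>s\<in>\<omega> i \<inter> {0<..T}. \<gamma> i s / lam i \<omega> s) = 0" by (intro prod_zero) auto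
      with False show ?thesis by simp
    qed
    ultimately show ?thesis
      by (simp add: g_def tilt_plus_of_def log_likelihood_def \<delta>_def[symmetric] exp_diff exp_add)
  qed
  have "integrable M (\<lambda>\<omega>. tilt_plus_of \<gamma> ?E T \<omega> * exp \<kappa>)" by (intro integrable_mult_left tilt(1))
  then show "integrable M g" by (rule iffD2[OF Bochner_Integration.integrable_cong[OF refl g], rotated])
  have "integral\<^sup>L M g = (\<integral>\<omega>. tilt_plus_of \<gamma> ?E T \<omega> * exp \<kappa> \<partial>M)"
    by (rule Bochner_Integration.integral_cong[OF refl g])
  also have "\<dots> = measure M ?E * exp \<kappa>" by (simp add: tilt(2))
  finally show "integral\<^sup>L M g = measure M ?E * exp (integral {0..T} (\<lambda>u. \<Sum>i\<in>UNIV. tilt_level T * (1 - indicator (B i) u)))"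
    by (simp add: \<kappa>_def \<gamma>_def \<delta>_def)
qed

end

context hawkes_process
begin

definition path_weight :: "real \<Rightarrow> 'd config \<Rightarrow> real" where
  "path_weight T \<omega> = exp (ln (tilt_level T) * real (points \<omega> {0<..T}) - log_likelihood lam T \<omega>)"

text \<open>
  On the empty past this density turns the process on \<open>(0, T]\<close> into a Poisson process of rate
  \<open>tilt_level T\<close>, up to a constant factor. Restriction to \<open>(0, T]\<close> discards what the void
  probabilities do not control.
\<close>

definition weighted_law :: "real \<Rightarrow> 'd config measure" where
  "weighted_law T = distr (density M (\<lambda>\<omega>. ennreal (indicator (void_event (\<lambda>_. {-A..0})) \<omega> * path_weight T \<omega>)))
     config_algebra (restrict_config {0<..T})"

lemma measurable_path_weight: "0 \<le> T \<Longrightarrow> path_weight T \<in> borel_measurable config_algebra"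
  unfolding path_weight_def[abs_def]
  by (intro measurable_compose[OF _ borel_measurable_exp] borel_measurable_diff borel_measurable_times
      borel_measurable_const measurable_log_likelihood measurable_points_config) auto

lemma void_event_past_M: "void_event (\<lambda>_. {-A..0}) \<in> sets M"
  unfolding sets_M by (rule void_event_measurable) auto

lemma nn_integral_weighted_law:
  assumes T: "0 < T" and f: "f \<in> borel_measurable config_algebra"
  shows "(\<integral>\<^sup>+\<omega>. f \<omega> \<partial>weighted_law T) =
    (\<integral>\<^sup>+\<omega>. ennreal (indicator (void_event (\<lambda>_. {-A..0})) \<omega> * path_weight T \<omega>) * f (restrict_config {0<..T} \<omega>) \<partial>M)"
proof -
  let ?w = "\<lambda>\<omega>. ennreal (indicator (void_event (\<lambda>_. {-A..0})) \<omega> * path_weight T \<omega>)"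
  have r: "restrict_config {0<..T} \<in> M \<rightarrow>\<^sub>M config_algebra"
    unfolding measurable_cong_sets[OF sets_M refl] by (rule measurable_restrict_config) simp
  have w: "?w \<in> borel_measurable M"
    using measurable_M[OF measurable_path_weight[OF less_imp_le[OF T]]] void_event_past_M by simp
  have "(\<integral>\<^sup>+\<omega>. f \<omega> \<partial>weighted_law T) = (\<integral>\<^sup>+\<omega>. f (restrict_config {0<..T} \<omega>) \<partial>density M ?w)"
    unfolding weighted_law_def by (rule nn_integral_distr) (use r f in simp_all)
  also have "\<dots> = (\<integral>\<^sup>+\<omega>. ?w \<omega> * f (restrict_config {0<..T} \<omega>) \<partial>M)"
    by (rule nn_integral_density[OF w measurable_compose[OF r f]])
  finally show ?thesis .
qed

lemma emeasure_weighted_law_void: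
  fixes B :: "'d \<Rightarrow> real set"
  assumes T: "0 < T" and B: "\<And>i. interval_union (B i)"
  shows "emeasure (weighted_law T) (void_event B) = ennreal (measure M (void_event (\<lambda>_. {-A..0})) *
      exp (integral {0..T} (\<lambda>u. \<Sum>i\<in>UNIV. tilt_level T * (1 - indicator (B i) u))))"
proof -
  let ?g = "\<lambda>\<omega>. indicator (void_event (\<lambda>_. {-A..0})) \<omega> * indicator (void_event (\<lambda>i. {0<..T} \<inter> B i)) \<omega> *
    exp (ln (tilt_level T) * real (points \<omega> {0<..T}) - log_likelihood lam T \<omega>)"
  have V: "void_event B \<in> sets config_algebra"
    using interval_union_borel[OF B] by (intro void_event_measurable) auto
  have "emeasure (weighted_law T) (void_event B) = (\<integral>\<^sup>+\<omega>. indicator (void_event B) \<omega> \<partial>weighted_law T)"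
    by (rule nn_integral_indicator[symmetric]) (use V in \<open>simp add: weighted_law_def\<close>)
  also have "\<dots> = (\<integral>\<^sup>+\<omega>. ennreal (indicator (void_event (\<lambda>_. {-A..0})) \<omega> * path_weight T \<omega>) *
      indicator (void_event B) (restrict_config {0<..T} \<omega>) \<partial>M)"
    by (rule nn_integral_weighted_law[OF T]) (use V in simp)
  also have "\<dots> = (\<integral>\<^sup>+\<omega>. ennreal (?g \<omega>) \<partial>M)"
  proof (rule nn_integral_cong)
    fix \<omega> assume "\<omega> \<in> space M"
    then have w: "\<omega> \<in> configs" by (simp add: space_M)
    have "restrict_config {0<..T} \<omega> \<in> void_event B \<longleftrightarrow> \<omega> \<in> void_event (\<lambda>i. {0<..T} \<inter> B i)"
      using w restrict_config_configs[OF w] by (simp add: void_event_def restrict_config_def Int_assoc)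
    then show "ennreal (indicator (void_event (\<lambda>_. {-A..0})) \<omega> * path_weight T \<omega>) *
      indicator (void_event B) (restrict_config {0<..T} \<omega>) = ennreal (?g \<omega>)"
      by (simp add: path_weight_def split: split_indicator)
  qed
  also have "\<dots> = ennreal (integral\<^sup>L M ?g)"
    by (rule nn_integral_eq_integral[OF weighted_void_probability(1)[OF T B]]) simp
  finally show ?thesis by (simp only: weighted_void_probability(2)[OF T B])
qed

end

text \<open>
  Both weighted laws have the void probabilities of the same Poisson process up to constants, so they are
  proportional. Undoing the weight of \<open>M'\<close> is possible because \<open>lam'\<close> looks back at most \<open>A\<close>: on
  \<open>E\<close> its likelihood is a function of the configuration on \<open>(0, T]\<close>. The factors
  \<open>measure M' E\<close> and \<open>measure M E\<close> are the normalising constants of the two conditional laws.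
\<close>

theorem change_of_measure:
  fixes M M' :: "'d::finite config measure"
  assumes H: "hawkes_process M lam c A b" and H': "hawkes_process M' lam' c A b"
    and local: "\<And>i \<omega> \<omega>' t. \<omega> \<in> configs \<Longrightarrow> \<omega>' \<in> configs \<Longrightarrow>
      (\<And>j. \<omega> j \<inter> {t - A..<t} = \<omega>' j \<inter> {t - A..<t}) \<Longrightarrow> lam' i \<omega> t = lam' i \<omega>' t"
    and T: "0 < T" and X: "X \<in> sets (observed {-A..T})"
  defines "E \<equiv> void_event (\<lambda>_. {-A..0})"
  shows "ennreal (measure M' E) *
      (\<integral>\<^sup>+\<omega>. indicator (X \<inter> E) \<omega> * ennreal (exp (log_likelihood lam' T \<omega> - log_likelihood lam T \<omega>)) \<partial>M) =
    ennreal (measure M E) * emeasure M' (X \<inter> E)"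
proof -
  interpret P: hawkes_process M lam c A b by (rule H)
  interpret Q: hawkes_process M' lam' c A b by (rule H')
  let ?r = "restrict_config {0<..T} :: 'd config \<Rightarrow> 'd config"
  have sets_P: "sets (P.weighted_law T) = sets config_algebra" and sets_Q: "sets (Q.weighted_law T) = sets config_algebra"
    by (simp_all add: P.weighted_law_def Q.weighted_law_def)
  have swap: "ennreal x * ennreal (y * z) = ennreal y * ennreal (x * z)" if "0 \<le> x" "0 \<le> y" "0 \<le> z" for x y z
    using that by (simp add: ennreal_mult[symmetric] mult.left_commute)
  have laws: "density (P.weighted_law T) (\<lambda>_. ennreal (measure M' E)) = density (Q.weighted_law T) (\<lambda>_. ennreal (measure M E))"
  proof (rule void_probabilities_determine)
    have em: "emeasure (density (P.weighted_law T) (\<lambda>_. ennreal (measure M' E))) (void_event B) =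
        ennreal (measure M' E) * emeasure (P.weighted_law T) (void_event B)"
      "emeasure (density (Q.weighted_law T) (\<lambda>_. ennreal (measure M E))) (void_event B) =
        ennreal (measure M E) * emeasure (Q.weighted_law T) (void_event B)"
      if "\<And>i. interval_union (B i)" for B :: "'d \<Rightarrow> real set"
    proof -
      have V: "void_event B \<in> sets config_algebra"
        using interval_union_borel[OF that] by (intro void_event_measurable) auto
      show "emeasure (density (P.weighted_law T) (\<lambda>_. ennreal (measure M' E))) (void_event B) =
        ennreal (measure M' E) * emeasure (P.weighted_law T) (void_event B)"
        by (rule emeasure_density_const) (use V sets_P in simp)
      show "emeasure (density (Q.weighted_law T) (\<lambda>_. ennreal (measure M E))) (void_event B) =
        ennreal (measure M E) * emeasure (Q.weighted_law T) (void_event B)"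
        by (rule emeasure_density_const) (use V sets_Q in simp)
    qed
    show "emeasure (density (P.weighted_law T) (\<lambda>_. ennreal (measure M' E))) (void_event B) =
      emeasure (density (Q.weighted_law T) (\<lambda>_. ennreal (measure M E))) (void_event B)"
      if B: "\<And>i. interval_union (B i)" for B :: "'d \<Rightarrow> real set"
    proof -
      define z where "z = exp (integral {0..T} (\<lambda>u. \<Sum>i\<in>UNIV. P.tilt_level T * (1 - indicator (B i) u)))"
      have z: "0 \<le> z" by (simp add: z_def)
      have 1: "emeasure (P.weighted_law T) (void_event B) = ennreal (measure M E * z)"
        unfolding E_def z_def by (rule P.emeasure_weighted_law_void[OF T B])
      have 2: "emeasure (Q.weighted_law T) (void_event B) = ennreal (measure M' E * z)"
        unfolding E_def z_def by (rule Q.emeasure_weighted_law_void[OF T B])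
      have "emeasure (density (P.weighted_law T) (\<lambda>_. ennreal (measure M' E))) (void_event B) =
        ennreal (measure M' E) * emeasure (P.weighted_law T) (void_event B)" by (rule em(1)) (rule B)
      also have "\<dots> = ennreal (measure M E) * emeasure (Q.weighted_law T) (void_event B)"
        unfolding 1 2 by (rule swap) (rule measure_nonneg measure_nonneg z)+
      also have "\<dots> = emeasure (density (Q.weighted_law T) (\<lambda>_. ennreal (measure M E))) (void_event B)"
        by (rule em(2)[symmetric]) (rule B)
      finally show ?thesis .
    qed
    have "emeasure (density (P.weighted_law T) (\<lambda>_. ennreal (measure M' E))) (void_event (\<lambda>_. {})) =
      ennreal (measure M' E) * emeasure (P.weighted_law T) (void_event (\<lambda>_. {}))"
      by (rule em(1)) (rule interval_union_empty)
    also have "\<dots> < \<infinity>"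
      by (subst P.emeasure_weighted_law_void[OF T interval_union_empty]) (simp add: ennreal_mult_less_top)
    finally have "emeasure (density (P.weighted_law T) (\<lambda>_. ennreal (measure M' E))) (void_event (\<lambda>_. {})) < \<infinity>" .
    then show "emeasure (density (P.weighted_law T) (\<lambda>_. ennreal (measure M' E))) configs < \<infinity>"
      by (simp add: configs_void_event[symmetric])
  qed (simp_all add: sets_P sets_Q)
  \<comment> \<open>The events observed on [-A, T] are pulled back from the restriction to this window, and on the void event E that restriction is the one to (0, T].\<close>
  obtain Y where Y: "Y \<in> sets config_algebra" "X = restrict_config {-A..T} -` Y \<inter> configs"
    using X unfolding observed_def by (subst (asm) sets_vimage_algebra2) (auto intro: restrict_config_configs)
  define f where "f \<omega> = indicator Y \<omega> * ennreal (inverse (Q.path_weight T \<omega>))" for \<omega>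
  have f: "f \<in> borel_measurable config_algebra"
    unfolding f_def using Y(1) Q.measurable_path_weight[of T] T
    by (intro borel_measurable_times_ennreal borel_measurable_indicator
        measurable_compose[OF _ measurable_ennreal] borel_measurable_inverse) auto
  have pw_pos: "0 < Q.path_weight T \<omega>" for \<omega> by (simp add: Q.path_weight_def)
  have fr: "f (?r \<omega>) = indicator X \<omega> * ennreal (inverse (Q.path_weight T \<omega>))" if "\<omega> \<in> E" for \<omega>
  proof -
    have w: "\<omega> \<in> configs" and empty: "\<And>i. \<omega> i \<inter> {-A..0} = {}" using that by (auto simp: E_def void_event_def)
    have rc: "?r \<omega> \<in> configs" by (rule restrict_config_configs[OF w])
    have "\<omega> i \<inter> {-A..T} = \<omega> i \<inter> {0<..T}" for i
    proof -
      have "{-A..T} = {-A..0} \<union> {0<..T}" using T P.A_pos by auto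
      then show ?thesis using empty[of i] by (simp add: Int_Un_distrib)
    qed
    then have "restrict_config {-A..T} \<omega> = ?r \<omega>" by (simp add: restrict_config_def)
    then have "?r \<omega> \<in> Y \<longleftrightarrow> \<omega> \<in> X" using w by (simp add: Y(2))
    moreover have lam: "lam' i (?r \<omega>) u = lam' i \<omega> u" if u: "u \<in> {0..T}" for i u
    proof (rule local[OF rc w])
      fix j
      have "{u - A..<u} \<subseteq> {-A..0} \<union> {0<..T}" using u by auto
      then show "?r \<omega> j \<inter> {u - A..<u} = \<omega> j \<inter> {u - A..<u}"
        using empty[of j] by (auto simp: restrict_config_def)
    qed
    have "log_likelihood lam' T (?r \<omega>) = log_likelihood lam' T \<omega>"
    proof -
      have "?r \<omega> i \<inter> {0<..T} = \<omega> i \<inter> {0<..T}" for i by (auto simp: restrict_config_def)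
      moreover have "(\<Sum>s\<in>\<omega> i \<inter> {0<..T}. ln (lam' i (?r \<omega>) s)) = (\<Sum>s\<in>\<omega> i \<inter> {0<..T}. ln (lam' i \<omega> s))" for i
        by (intro sum.cong refl arg_cong[where f = ln] lam) auto
      moreover have "integral {0..T} (\<lambda>u. \<Sum>i\<in>UNIV. lam' i (?r \<omega>) u) = integral {0..T} (\<lambda>u. \<Sum>i\<in>UNIV. lam' i \<omega> u)"
        by (intro Henstock_Kurzweil_Integration.integral_cong sum.cong refl lam)
      ultimately show ?thesis by (simp add: log_likelihood_def)
    qed
    moreover have "points (?r \<omega>) {0<..T} = points \<omega> {0<..T}"
      by (simp add: points_def restrict_config_def Int_assoc)
    ultimately show ?thesis by (simp add: f_def Q.path_weight_def split: split_indicator)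
  qed
  have E_M: "E \<in> sets M" "E \<in> sets M'" unfolding E_def using P.void_event_past_M Q.void_event_past_M by auto
  have X_M: "X \<in> sets M" "X \<in> sets M'" using X sets_observed_subset[of "{-A..T}"] P.sets_M Q.sets_M by auto
  have "ennreal (measure M' E) * (\<integral>\<^sup>+\<omega>. f \<omega> \<partial>P.weighted_law T) =
    (\<integral>\<^sup>+\<omega>. f \<omega> \<partial>density (P.weighted_law T) (\<lambda>_. ennreal (measure M' E)))"
    using f by (simp add: nn_integral_density nn_integral_cmult measurable_cong_sets[OF sets_P refl])
  also have "\<dots> = (\<integral>\<^sup>+\<omega>. f \<omega> \<partial>density (Q.weighted_law T) (\<lambda>_. ennreal (measure M E)))" by (simp only: laws)
  also have "\<dots> = ennreal (measure M E) * (\<integral>\<^sup>+\<omega>. f \<omega> \<partial>Q.weighted_law T)"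
    using f by (simp add: nn_integral_density nn_integral_cmult measurable_cong_sets[OF sets_Q refl])
  also have "(\<integral>\<^sup>+\<omega>. f \<omega> \<partial>Q.weighted_law T) = (\<integral>\<^sup>+\<omega>. indicator (X \<inter> E) \<omega> \<partial>M')"
    unfolding Q.nn_integral_weighted_law[OF T f] E_def[symmetric]
  proof (rule nn_integral_cong)
    fix \<omega>
    show "ennreal (indicator E \<omega> * Q.path_weight T \<omega>) * f (?r \<omega>) = indicator (X \<inter> E) \<omega>"
      using fr[of \<omega>] pw_pos[of \<omega>] by (auto simp: indicator_def ennreal_mult[symmetric])
  qed
  also have "\<dots> = emeasure M' (X \<inter> E)" using E_M X_M by simp
  also have "(\<integral>\<^sup>+\<omega>. f \<omega> \<partial>P.weighted_law T) =
    (\<integral>\<^sup>+\<omega>. indicator (X \<inter> E) \<omega> * ennreal (exp (log_likelihood lam' T \<omega> - log_likelihood lam T \<omega>)) \<partial>M)"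
    unfolding P.nn_integral_weighted_law[OF T f] E_def[symmetric]
  proof (rule nn_integral_cong)
    fix \<omega>
    have "P.path_weight T \<omega> * inverse (Q.path_weight T \<omega>) = exp (log_likelihood lam' T \<omega> - log_likelihood lam T \<omega>)"
      by (simp add: P.path_weight_def Q.path_weight_def exp_diff field_simps)
    moreover have "0 < P.path_weight T \<omega>" by (simp add: P.path_weight_def)
    ultimately show "ennreal (indicator E \<omega> * P.path_weight T \<omega>) * f (?r \<omega>) =
      indicator (X \<inter> E) \<omega> * ennreal (exp (log_likelihood lam' T \<omega> - log_likelihood lam T \<omega>))"
      using fr[of \<omega>] pw_pos[of \<omega>] by (auto simp: indicator_def ennreal_mult[symmetric])
  qed
  finally show ?thesis .
qed

section \<open>Stationarity\<close>

lemma regular_cong: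
  assumes "regular_process H" "\<And>t \<omega>. \<omega> \<in> configs \<Longrightarrow> H' t \<omega> = H t \<omega>"
  shows "regular_process H'"
  unfolding regular_process_def
proof (intro conjI allI ballI impI)
  show "H' t \<in> borel_measurable (observed {..t})" if "0 \<le> t" for t
    by (rule borel_measurable_eqI[OF regular_measurable[OF assms(1) that]]) (simp add: assms(2))
  show "((\<lambda>s. H' s \<omega>) \<longlongrightarrow> H' t \<omega>) (at_left t)" if "\<omega> \<in> configs" "0 < t" for \<omega> t
    using regular_left[OF assms(1) that] by (simp add: assms(2)[OF that(1)])
  show "finite {t \<in> {0<..<T}. \<not> isCont (\<lambda>s. H' s \<omega>) t}" if "\<omega> \<in> configs" for \<omega> T
    using regular_finite[OF assms(1) that, of T] by (simp add: assms(2)[OF that])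
qed

lemma shift_config_configs:
  assumes "\<omega> \<in> configs" shows "shift_config s \<omega> \<in> configs"
proof -
  have "finite ((\<lambda>x. x + s) ` \<omega> i \<inter> {a..b})" for i a b
  proof (rule finite_subset)
    show "(\<lambda>x. x + s) ` \<omega> i \<inter> {a..b} \<subseteq> (\<lambda>x. x + s) ` (\<omega> i \<inter> {a - s..b - s})" by auto
    show "finite ((\<lambda>x. x + s) ` (\<omega> i \<inter> {a - s..b - s}))" using assms by (simp add: configs_def)
  qed
  moreover have "(\<lambda>x. x + s) ` \<omega> i \<inter> (\<lambda>x. x + s) ` \<omega> j = {}" if "i \<noteq> j" for i j
  proof -
    have "\<omega> i \<inter> \<omega> j = {}" using assms that unfolding configs_def by blast
    then show ?thesis by auto
  qed
  ultimately show ?thesis by (simp add: configs_def shift_config_def)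
qed

lemma card_shift_config: "card (shift_config s \<omega> i \<inter> B) = card (\<omega> i \<inter> {x. x + s \<in> B})"
proof -
  have "shift_config s \<omega> i \<inter> B = (\<lambda>x. x + s) ` (\<omega> i \<inter> {x. x + s \<in> B})" by (auto simp: shift_config_def)
  then show ?thesis by (simp add: card_image)
qed

lemma measurable_shift_config: "shift_config s \<in> config_algebra \<rightarrow>\<^sub>M config_algebra"
proof (rule measurable_config_algebraI)
  fix i :: 'a and B :: "real set" assume B: "B \<in> sets borel" "bounded B"
  have "(\<lambda>x::real. x + s) -` B \<inter> space borel \<in> sets borel" by (rule measurable_sets[OF _ B(1)]) simp
  then have 1: "{x. x + s \<in> B} \<in> sets borel" by (simp add: vimage_def)
  have "{x. x + s \<in> B} = (\<lambda>x. x - s) ` B" by force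
  then have 2: "bounded {x. x + s \<in> B}" using bounded_translation_minus[OF B(2), of s] by simp
  show "(\<lambda>\<omega>. card (shift_config s \<omega> i \<inter> B)) \<in> config_algebra \<rightarrow>\<^sub>M count_space UNIV"
    unfolding card_shift_config by (rule measurable_card[OF 1 2])
qed (auto intro: shift_config_configs)

lemma shot_noise_shift: "shot_noise f a i t (shift_config s \<omega>) = shot_noise f a i (t - s) \<omega>"
proof -
  have "shift_config s \<omega> i \<inter> {t - a..<t} = (\<lambda>x. x + s) ` (\<omega> i \<inter> {t - s - a..<t - s})" by (auto simp: shift_config_def)
  then have "shot_noise f a i t (shift_config s \<omega>) = (\<Sum>x\<in>(\<lambda>x. x + s) ` (\<omega> i \<inter> {t - s - a..<t - s}). f (t - x))"
    by (simp add: shot_noise_def)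
  also have "\<dots> = shot_noise f a i (t - s) \<omega>" unfolding shot_noise_def
    by (subst sum.reindex) (auto simp: inj_on_def algebra_simps intro!: sum.cong)
  finally show ?thesis .
qed

lemma points_shot_noise: "real (points \<omega> {t - a..<t}) = (\<Sum>j\<in>UNIV. shot_noise (\<lambda>_. 1) a j t \<omega>)"
  by (simp add: points_def shot_noise_def)

locale stationary_process = hawkes_process M lam c A b
  for M :: "'d::finite config measure" and lam :: "'d \<Rightarrow> 'd config \<Rightarrow> real \<Rightarrow> real" and c A b :: real +
  assumes stationary: "\<And>s. distr M config_algebra (shift_config s) = M"
begin

lemma nn_integral_shift:
  assumes "f \<in> borel_measurable config_algebra"
  shows "(\<integral>\<^sup>+\<omega>. f (shift_config s \<omega>) \<partial>M) = (\<integral>\<^sup>+\<omega>. f \<omega> \<partial>M)"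
proof -
  have "shift_config s \<in> M \<rightarrow>\<^sub>M config_algebra"
    unfolding measurable_cong_sets[OF sets_M refl] by (rule measurable_shift_config)
  from nn_integral_distr[OF this, of f] measurable_M[OF assms] assms show ?thesis by (simp add: stationary)
qed

lemma mean_card_finite:
  assumes "B \<in> sets borel" "bounded B" shows "(\<integral>\<^sup>+\<omega>. of_nat (card (\<omega> i \<inter> B)) \<partial>M) < \<infinity>"
proof -
  obtain m where m: "\<And>x. x \<in> B \<Longrightarrow> \<bar>x\<bar> \<le> m" using assms(2) unfolding bounded_real by blast
  let ?W = "{-m - 1<..m}" and ?f = "\<lambda>\<omega>. of_nat (card (\<omega> i \<inter> {0<..2 * m + 1})) :: ennreal"
  have B: "B \<subseteq> ?W" using m by (fastforce simp: abs_le_iff)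
  have f: "?f \<in> borel_measurable config_algebra"
    by (rule measurable_compose[OF measurable_card]) auto
  have "(\<integral>\<^sup>+\<omega>. of_nat (card (\<omega> i \<inter> B)) \<partial>M) \<le> (\<integral>\<^sup>+\<omega>. ?f (shift_config (m + 1) \<omega>) \<partial>M)"
  proof (rule nn_integral_mono)
    fix \<omega> assume "\<omega> \<in> space M"
    then have w: "\<omega> \<in> configs" by (simp add: space_M)
    have "?W = {x. x + (m + 1) \<in> {0<..2 * m + 1}}" by auto
    then have "card (shift_config (m + 1) \<omega> i \<inter> {0<..2 * m + 1}) = card (\<omega> i \<inter> ?W)"
      by (simp only: card_shift_config)
    moreover have "card (\<omega> i \<inter> B) \<le> card (\<omega> i \<inter> ?W)"
      using B by (intro card_mono config_finite[OF w]) auto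
    ultimately show "of_nat (card (\<omega> i \<inter> B)) \<le> ?f (shift_config (m + 1) \<omega>)" by simp
  qed
  also have "\<dots> = (\<integral>\<^sup>+\<omega>. ?f \<omega> \<partial>M)" by (rule nn_integral_shift[OF f])
  also have "\<dots> < \<infinity>" by (rule finite_mean)
  finally show ?thesis .
qed

text \<open>
  By stationarity all times have the same expected number of points, and infinitely many of them fit
  into an interval of finite mean.
\<close>

lemma AE_not_point: "AE \<omega> in M. \<forall>i. t \<notin> \<omega> i"
proof -
  define e where "e i = (\<integral>\<^sup>+\<omega>. of_nat (card (\<omega> i \<inter> {t})) \<partial>M)" for i
  have meas: "(\<lambda>\<omega>. of_nat (card (\<omega> i \<inter> {s})) :: ennreal) \<in> borel_measurable config_algebra" for i :: 'd and s
    by (rule measurable_compose[OF measurable_card]) auto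
  have shift: "(\<integral>\<^sup>+\<omega>. of_nat (card (\<omega> i \<inter> {s})) \<partial>M) = e i" for i s
  proof -
    have "{x. x + (t - s) \<in> {t}} = {s}" by auto
    then have "card (shift_config (t - s) \<omega> i \<inter> {t}) = card (\<omega> i \<inter> {s})" for \<omega> :: "'d config"
      by (simp only: card_shift_config)
    then show ?thesis using nn_integral_shift[OF meas[of i t], of "t - s"] by (simp add: e_def)
  qed
  have bound: "of_nat n * e i \<le> (\<integral>\<^sup>+\<omega>. of_nat (card (\<omega> i \<inter> {0<..1})) \<partial>M)" for n i
  proof -
    have "of_nat n * e i = (\<Sum>k<n. \<integral>\<^sup>+\<omega>. of_nat (card (\<omega> i \<inter> {1 / real (Suc k)})) \<partial>M)" by (simp add: shift)
    also have "\<dots> = (\<integral>\<^sup>+\<omega>. (\<Sum>k<n. of_nat (card (\<omega> i \<inter> {1 / real (Suc k)}))) \<partial>M)"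
      by (rule nn_integral_sum[symmetric]) (rule measurable_M[OF meas])
    also have "\<dots> \<le> (\<integral>\<^sup>+\<omega>. of_nat (card (\<omega> i \<inter> {0<..1})) \<partial>M)"
    proof (rule nn_integral_mono)
      fix \<omega> assume "\<omega> \<in> space M"
      then have w: "\<omega> \<in> configs" by (simp add: space_M)
      have "(\<Sum>k<n. card (\<omega> i \<inter> {1 / real (Suc k)})) = card (\<Union>k\<in>{..<n}. \<omega> i \<inter> {1 / real (Suc k)})"
        by (rule card_UN_disjoint[symmetric]) auto
      also have "\<dots> \<le> card (\<omega> i \<inter> {0<..1})"
        by (rule card_mono) (auto intro!: config_finite[OF w] simp: divide_le_eq)
      finally show "(\<Sum>k<n. of_nat (card (\<omega> i \<inter> {1 / real (Suc k)}))) \<le> (of_nat (card (\<omega> i \<inter> {0<..1})) :: ennreal)"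
        by (simp only: of_nat_sum[symmetric] of_nat_le_iff)
    qed
    finally show ?thesis .
  qed
  have "e i = 0" for i
  proof (rule ccontr)
    assume "e i \<noteq> 0"
    then have "(SUP n::nat. of_nat n * e i) = \<infinity>"
      by (subst SUP_mult_right_ennreal[symmetric]) (simp add: ennreal_SUP_of_nat_eq_top ennreal_top_mult)
    moreover have "(SUP n::nat. of_nat n * e i) \<le> (\<integral>\<^sup>+\<omega>. of_nat (card (\<omega> i \<inter> {0<..1})) \<partial>M)"
      by (rule SUP_least) (rule bound)
    ultimately have "\<infinity> \<le> (\<integral>\<^sup>+\<omega>. of_nat (card (\<omega> i \<inter> {0<..1})) \<partial>M)" by metis
    then show False using finite_mean[of i 1] by (meson leD)
  qed
  then have "AE \<omega> in M. of_nat (card (\<omega> i \<inter> {t})) = (0 :: ennreal)" for i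
    using nn_integral_0_iff_AE[OF measurable_M[OF meas[of i t]]] by (simp add: e_def)
  then have "AE \<omega> in M. \<forall>i\<in>UNIV. of_nat (card (\<omega> i \<inter> {t})) = (0 :: ennreal)"
    by (intro AE_finite_allI) auto
  then show ?thesis by (rule eventually_mono) (simp add: card_eq_0_iff)
qed

text \<open>
  Fubini, after which stationarity makes the inner mean independent of time.
\<close>

lemma nn_integral_time_stationary:
  assumes H: "regular_process H" and shift: "\<And>t \<omega>. H t \<omega> = H 0 (shift_config (- t) \<omega>)" and T: "0 < T"
  shows "(\<integral>\<^sup>+\<omega>. \<integral>\<^sup>+t. ennreal (H t \<omega>) * indicator {0<..T} t \<partial>lborel \<partial>M) = ennreal T * (\<integral>\<^sup>+\<omega>. ennreal (H 0 \<omega>) \<partial>M)"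
proof -
  have joint: "(\<lambda>(\<omega>, t). ennreal (H t \<omega>) * indicator {0<..T} t) \<in> borel_measurable (M \<Otimes>\<^sub>M lborel)"
    by (rule regular_joint_measurable_ennreal[OF H sets_M])
  interpret pair: pair_sigma_finite M lborel ..
  have H0: "H 0 \<in> borel_measurable config_algebra" by (rule regular_measurable_config[OF H]) simp
  have const: "(\<integral>\<^sup>+\<omega>. ennreal (H t \<omega>) \<partial>M) = (\<integral>\<^sup>+\<omega>. ennreal (H 0 \<omega>) \<partial>M)" for t
    using nn_integral_shift[of "\<lambda>\<omega>. ennreal (H 0 \<omega>)" "- t"] H0 by (simp add: shift[of t])
  have "(\<integral>\<^sup>+\<omega>. \<integral>\<^sup>+t. ennreal (H t \<omega>) * indicator {0<..T} t \<partial>lborel \<partial>M) =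
    (\<integral>\<^sup>+t. \<integral>\<^sup>+\<omega>. ennreal (H t \<omega>) * indicator {0<..T} t \<partial>M \<partial>lborel)"
    by (rule pair.Fubini'[OF joint, symmetric])
  also have "\<dots> = (\<integral>\<^sup>+t. (\<integral>\<^sup>+\<omega>. ennreal (H 0 \<omega>) \<partial>M) * indicator {0<..T} t \<partial>lborel)"
  proof (rule nn_integral_cong)
    fix t :: real
    show "(\<integral>\<^sup>+\<omega>. ennreal (H t \<omega>) * indicator {0<..T} t \<partial>M) = (\<integral>\<^sup>+\<omega>. ennreal (H 0 \<omega>) \<partial>M) * indicator {0<..T} t"
      by (cases "t \<in> {0<..T}") (simp_all add: const[of t])
  qed
  also have "\<dots> = ennreal T * (\<integral>\<^sup>+\<omega>. ennreal (H 0 \<omega>) \<partial>M)" using T by (subst nn_integral_cmult_indicator) (auto simp: mult.commute)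
  finally show ?thesis .
qed

text \<open>
  Tilting gives the event for a window in the future; stationarity moves it to the past. The extra unit of
  length absorbs the difference between half-open and closed windows.
\<close>

lemma prob_no_points_window:
  assumes T: "0 < T" shows "0 < measure M (void_event (\<lambda>_. {-T..0}))"
proof -
  let ?V = "\<lambda>B. void_event (\<lambda>_. B) :: 'd config set"
  have V: "?V {1..T + 1} \<in> sets config_algebra" "?V {-T..0} \<in> sets config_algebra" by (auto intro: void_event_measurable)
  have "0 < measure M (?V {0<..T + 1})" by (rule prob_no_points_pos) (use T in simp)
  also have "\<dots> \<le> measure M (?V {1..T + 1})"
  proof (rule finite_measure_mono)
    have "{1..T + 1} \<subseteq> {0<..T + 1}" by auto
    then show "?V {0<..T + 1} \<subseteq> ?V {1..T + 1}" unfolding void_event_def by fast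
  qed (use V sets_M in simp)
  also have "measure M (?V {1..T + 1}) = measure M (?V {-T..0})"
  proof -
    have "emeasure M (?V {1..T + 1}) = (\<integral>\<^sup>+\<omega>. indicator (?V {1..T + 1}) \<omega> \<partial>M)" using V sets_M by simp
    also have "\<dots> = (\<integral>\<^sup>+\<omega>. indicator (?V {1..T + 1}) (shift_config (T + 1) \<omega>) \<partial>M)"
      by (rule nn_integral_shift[symmetric]) (use V in simp)
    also have "\<dots> = (\<integral>\<^sup>+\<omega>. indicator (?V {-T..0}) \<omega> \<partial>M)"
    proof (rule nn_integral_cong)
      fix \<omega> assume "\<omega> \<in> space M"
      then have w: "\<omega> \<in> configs" by (simp add: space_M)
      have "shift_config (T + 1) \<omega> i \<inter> {1..T + 1} = (\<lambda>x. x + (T + 1)) ` (\<omega> i \<inter> {-T..0})" for i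
        by (auto simp: shift_config_def)
      then have "shift_config (T + 1) \<omega> \<in> ?V {1..T + 1} \<longleftrightarrow> \<omega> \<in> ?V {-T..0}"
        using w shift_config_configs[OF w] by (simp add: void_event_def)
      then show "indicator (?V {1..T + 1}) (shift_config (T + 1) \<omega>) = (indicator (?V {-T..0}) \<omega> :: ennreal)"
        by (simp add: indicator_def)
    qed
    also have "\<dots> = emeasure M (?V {-T..0})" using V sets_M by simp
    finally show ?thesis by (simp add: emeasure_eq_measure)
  qed
  finally show ?thesis .
qed

end

section \<open>Moments of the number of recent points\<close>

lemma antiderivative_exists:
  fixes p :: "real \<Rightarrow> real"
  assumes "\<And>x. isCont p x" shows "\<exists>P. \<forall>x. (P has_real_derivative p x) (at x)"
  using einterval_antiderivative[of "-\<infinity>" "\<infinity>" p] assms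
  by (auto simp: has_real_derivative_iff_has_vector_derivative)

text \<open>
  The derivative of the Lyapunov function. Clipping makes the function Lipschitz, hence integrable before
  any moment is known to be finite; the clipping level tends to infinity at the end.
\<close>

definition clipped_power :: "nat \<Rightarrow> real \<Rightarrow> real \<Rightarrow> real" where
  "clipped_power q m v = (min (max v 0) m) ^ q"

lemma clipped_power_bounds:
  assumes "0 \<le> m"
  shows "0 \<le> clipped_power q m v" "clipped_power q m v \<le> m ^ q"
    "0 \<le> v \<Longrightarrow> clipped_power q m v \<le> v ^ q"
  using assms by (auto simp: clipped_power_def intro!: power_mono)

lemma clipped_power_mono: "0 \<le> m \<Longrightarrow> v \<le> v' \<Longrightarrow> clipped_power q m v \<le> clipped_power q m v'"
  by (auto simp: clipped_power_def intro!: power_mono)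

text \<open>
  A single point changes the clipped power by a factor close to one once the argument is large.
\<close>

lemma clipped_power_ratio:
  assumes "0 < v" "0 \<le> f" "0 \<le> m"
  shows "clipped_power q m (v + f) \<le> (1 + f / v) ^ q * clipped_power q m v"
proof -
  have "min (v + f) m \<le> (1 + f / v) * min v m"
  proof (cases "v \<le> m")
    case True
    have "(1 + f / v) * v = v + f" using assms by (simp add: field_simps)
    with True show ?thesis by (simp add: min_def)
  next
    case False
    have "1 * m \<le> (1 + f / v) * m" using assms by (intro mult_right_mono) auto
    with False show ?thesis by (simp add: min_def)
  qed
  then have "min (v + f) m ^ q \<le> ((1 + f / v) * min v m) ^ q" using assms by (intro power_mono) auto
  then show ?thesis using assms by (simp add: clipped_power_def power_mult_distrib max_def)
qed

lemma clipped_power_isCont: "isCont (clipped_power q m) v"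
  unfolding clipped_power_def by (intro continuous_intros)

context stationary_process
begin

context
  fixes u \<beta> :: "'d \<Rightarrow> real" and g :: "'d \<Rightarrow> 'd \<Rightarrow> real \<Rightarrow> real"
  assumes g_cont: "\<And>i j x. isCont (g i j) x" and g_nonneg: "\<And>i j x. 0 \<le> g i j x"
    and lam_le: "\<And>i \<omega> t. \<omega> \<in> configs \<Longrightarrow> lam i \<omega> t \<le> \<beta> i + (\<Sum>j\<in>UNIV. shot_noise (g i j) A j t \<omega>)"
    and u_ge: "\<And>j. 1 \<le> u j" and u_eq: "\<And>j. u j = 1 + (\<Sum>i\<in>UNIV. u i * integral {0..A} (g i j))"
begin

text \<open>
  The weights satisfy \<open>u j = 1 + \<integral> offspring_rate j\<close>: the importance of a point is one for itself plus
  the weighted intensity that it is going to cause directly. The function \<open>residual j r\<close> is the part of that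
  intensity still to come when the point has age \<open>r\<close>, plus a term that decays linearly over twice the
  memory. The slope \<open>leak\<close> is chosen such that a new point contributes \<open>u j - 1 / 2\<close>, strictly less than
  \<open>u j\<close>; and since the linear term is still positive at age \<open>A\<close>, the potential dominates the
  number of points in the window of length \<open>A\<close>.
\<close>

definition leak where "leak = 1 / (4 * A)"
definition offspring_rate where "offspring_rate j x = (\<Sum>i\<in>UNIV. u i * g i j x)"
definition residual where "residual j r = integral {0..A} (offspring_rate j) - integral {0..max 0 (min r A)} (offspring_rate j) + leak * (2 * A - r)"
definition residual_slope where "residual_slope j r = - (if r \<le> A then offspring_rate j r else 0) - leak"
definition potential where "potential t \<omega> = (\<Sum>j\<in>UNIV. shot_noise (residual j) (2 * A) j t \<omega>)"
definition potential_plus where "potential_plus t \<omega> = (\<Sum>j\<in>UNIV. \<Sum>s\<in>\<omega> j \<inter> {t - 2 * A<..t}. residual j (t - s))"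
definition excitation where "excitation t \<omega> = (\<Sum>i\<in>UNIV. u i * (\<Sum>j\<in>UNIV. shot_noise (g i j) A j t \<omega>))"
definition window_count :: "real \<Rightarrow> 'd config \<Rightarrow> real" where "window_count t \<omega> = (\<Sum>j\<in>UNIV. shot_noise (\<lambda>_. 1) (2 * A) j t \<omega>)"

lemma leak_pos: "0 < leak" using A_pos by (simp add: leak_def)

lemma offspring_nonneg: "0 \<le> offspring_rate j x"
  unfolding offspring_rate_def using u_ge g_nonneg by (intro sum_nonneg mult_nonneg_nonneg) (auto intro: order_trans[OF zero_le_one])

lemma offspring_cont: "isCont (offspring_rate j) x"
  unfolding offspring_rate_def[abs_def] by (intro continuous_intros g_cont)

lemma offspring_integrable: "offspring_rate j integrable_on {x..y}"
  by (intro integrable_continuous_real continuous_at_imp_continuous_on ballI offspring_cont)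

lemma offspring_primitive_cont: "isCont (\<lambda>r. integral {0..max 0 (min r A)} (offspring_rate j)) r"
proof -
  have "continuous_on {0..A} (\<lambda>x. integral {0..x} (offspring_rate j))"
    by (rule indefinite_integral_continuous_1[OF offspring_integrable])
  then have "continuous_on UNIV (\<lambda>r. integral {0..max 0 (min r A)} (offspring_rate j))"
    by (rule continuous_on_compose2) (use A_pos in \<open>auto intro!: continuous_intros\<close>)
  then show ?thesis by (simp add: continuous_on_eq_continuous_at)
qed

lemma residual_cont: "isCont (residual j) r"
  unfolding residual_def[abs_def] by (intro continuous_intros offspring_primitive_cont)

lemma residual_deriv:
  assumes "0 < r" "r < 2 * A" "r \<noteq> A"
  shows "(residual j has_real_derivative residual_slope j r) (at r)"
proof (cases "r < A")
  case True
  have "((\<lambda>x. integral {0..x} (offspring_rate j)) has_vector_derivative offspring_rate j r) (at r within {0..A} - {})"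
    by (rule integral_has_vector_derivative_continuous_at[OF offspring_integrable])
      (use True assms offspring_cont in \<open>auto intro: continuous_at_imp_continuous_at_within\<close>)
  moreover have "at r within {0..A} - {} = at r" using True assms by (intro at_within_interior) (auto simp: interior_atLeastAtMost_real)
  ultimately have I: "((\<lambda>x. integral {0..x} (offspring_rate j)) has_real_derivative offspring_rate j r) (at r)"
    by (simp add: has_real_derivative_iff_has_vector_derivative)
  have "((\<lambda>x. integral {0..A} (offspring_rate j) - integral {0..x} (offspring_rate j) + leak * (2 * A - x)) has_real_derivative residual_slope j r) (at r)"
    using True by (auto intro!: derivative_eq_intros I simp: residual_slope_def)
  moreover have "\<forall>\<^sub>F x in nhds r. x \<in> {0<..<A}" using True assms by (intro eventually_nhds_in_open) auto
  then have "\<forall>\<^sub>F x in nhds r. residual j x = integral {0..A} (offspring_rate j) - integral {0..x} (offspring_rate j) + leak * (2 * A - x)"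
    by eventually_elim (simp add: residual_def)
  ultimately show ?thesis by (subst DERIV_cong_ev[OF refl _ refl])
next
  case False
  have "((\<lambda>x. leak * (2 * A - x)) has_real_derivative residual_slope j r) (at r)"
    using False assms by (auto intro!: derivative_eq_intros simp: residual_slope_def)
  moreover have "\<forall>\<^sub>F x in nhds r. x \<in> {A<..}" using False assms by (intro eventually_nhds_in_open) auto
  then have "\<forall>\<^sub>F x in nhds r. residual j x = leak * (2 * A - x)"
    by eventually_elim (use A_pos in \<open>simp add: residual_def\<close>)
  ultimately show ?thesis by (subst DERIV_cong_ev[OF refl _ refl])
qed

lemma residual_zero: "residual j 0 = u j - 1 / 2"
proof -
  have "integral {0..A} (offspring_rate j) = (\<Sum>i\<in>UNIV. u i * integral {0..A} (g i j))"
    unfolding offspring_rate_def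
    by (subst integral_sum) (auto intro!: integrable_continuous_real continuous_at_imp_continuous_on continuous_intros g_cont)
  then show ?thesis using u_eq[of j] A_pos by (simp add: residual_def leak_def)
qed

lemma residual_end: "residual j (2 * A) = 0"
  using A_pos by (simp add: residual_def)

lemma residual_bounds:
  assumes "0 \<le> r" "r \<le> 2 * A" shows "0 \<le> residual j r" "residual j r \<le> residual j 0" "r \<le> A \<Longrightarrow> leak * A \<le> residual j r"
proof -
  have le: "integral {0..max 0 (min r A)} (offspring_rate j) \<le> integral {0..A} (offspring_rate j)"
    by (rule integral_subset_le) (use A_pos offspring_integrable offspring_nonneg in auto)
  have ge: "0 \<le> integral {0..max 0 (min r A)} (offspring_rate j)"
    by (rule integral_nonneg[OF offspring_integrable offspring_nonneg])
  have k: "0 \<le> leak * (2 * A - r)" "leak * (2 * A - r) \<le> leak * (2 * A)" using assms leak_pos by (auto intro: mult_left_mono)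
  show "0 \<le> residual j r" using le k by (simp add: residual_def)
  show "residual j r \<le> residual j 0" using ge k A_pos by (simp add: residual_def)
  assume "r \<le> A"
  then have "leak * A \<le> leak * (2 * A - r)" using leak_pos by (intro mult_left_mono) auto
  then show "leak * A \<le> residual j r" using le by (simp add: residual_def)
qed

lemma regular_potential: "regular_process potential" and regular_excitation: "regular_process excitation" and regular_window_count: "regular_process window_count"
proof -
  show "regular_process potential" unfolding potential_def[abs_def]
    by (intro regular_sum regular_shot_noise residual_cont) (use A_pos in auto)
  show "regular_process excitation" unfolding excitation_def[abs_def]
    by (intro regular_sum regular_cmult regular_shot_noise g_cont) (use A_pos in auto)
  show "regular_process window_count" unfolding window_count_def[abs_def]
    by (intro regular_sum regular_shot_noise) (use A_pos in auto)
qed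

lemma window_count_eq: "window_count t \<omega> = real (points \<omega> {t - 2 * A..<t})"
  by (simp add: window_count_def points_shot_noise)

lemma window_count_nonneg: "0 \<le> window_count t \<omega>" by (simp add: window_count_eq)

definition residual_max where "residual_max = (\<Sum>j\<in>UNIV. residual j 0)"

lemma residual_le_max: "residual j 0 \<le> residual_max"
  unfolding residual_max_def using residual_bounds(1)[of 0] A_pos by (intro member_le_sum) auto

lemma residual_max_pos: "0 < residual_max"
  using residual_le_max[of undefined] u_ge[of undefined] residual_zero[of undefined] by linarith

lemma potential_bounds:
  assumes w: "\<omega> \<in> configs"
  shows "0 \<le> potential t \<omega>" "potential t \<omega> \<le> residual_max * window_count t \<omega>" "leak * A * real (points \<omega> {t - A..<t}) \<le> potential t \<omega>"
proof -
  have r: "0 \<le> t - s" "t - s \<le> 2 * A" if "s \<in> \<omega> j \<inter> {t - 2 * A..<t}" for s j using that by auto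
  show "0 \<le> potential t \<omega>" unfolding potential_def shot_noise_def
    using residual_bounds(1)[OF r] by (intro sum_nonneg) blast
  have "potential t \<omega> \<le> (\<Sum>j\<in>UNIV. \<Sum>s\<in>\<omega> j \<inter> {t - 2 * A..<t}. residual_max * 1)"
    unfolding potential_def shot_noise_def mult_1_right
    using residual_bounds(2)[OF r] residual_le_max by (intro sum_mono) (meson order_trans)
  also have "\<dots> = residual_max * window_count t \<omega>" by (simp add: window_count_def shot_noise_def sum_distrib_left mult.commute)
  finally show "potential t \<omega> \<le> residual_max * window_count t \<omega>" .
  have "leak * A * real (points \<omega> {t - A..<t}) = (\<Sum>j\<in>UNIV. \<Sum>s\<in>\<omega> j \<inter> {t - A..<t}. leak * A)"
    by (simp add: points_def sum_distrib_left mult_ac)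
  also have "\<dots> \<le> (\<Sum>j\<in>UNIV. \<Sum>s\<in>\<omega> j \<inter> {t - A..<t}. residual j (t - s))"
    using A_pos by (intro sum_mono residual_bounds(3)) auto
  also have "\<dots> \<le> potential t \<omega>" unfolding potential_def shot_noise_def
    using A_pos residual_bounds(1)[OF r] by (intro sum_mono sum_mono2 config_finite[OF w]) auto
  finally show "leak * A * real (points \<omega> {t - A..<t}) \<le> potential t \<omega>" .
qed

lemma excitation_nonneg: "0 \<le> excitation t \<omega>"
  unfolding excitation_def shot_noise_def using u_ge g_nonneg
  by (intro sum_nonneg mult_nonneg_nonneg) (auto intro: order_trans[OF zero_le_one])

text \<open>
  Between points the potential falls at the rate of the current weighted excitation plus a multiple of
  the number of points in the window. New points raise it, on average, by slightly less than the
  excitation, up to the baseline.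
\<close>

lemma potential_deriv:
  assumes w: "\<omega> \<in> configs" and t: "\<And>j. t \<notin> \<omega> j" "\<And>j. t - A \<notin> \<omega> j" "\<And>j. t - 2 * A \<notin> \<omega> j"
  shows "((\<lambda>t. potential t \<omega>) has_real_derivative - (excitation t \<omega> + leak * window_count t \<omega>)) (at t)"
proof -
  have "((\<lambda>t. potential t \<omega>) has_real_derivative (\<Sum>j\<in>UNIV. shot_noise (residual_slope j) (2 * A) j t \<omega>)) (at t)"
    unfolding potential_def
  proof (intro DERIV_sum shot_noise_deriv w t)
    fix j s assume s: "s \<in> \<omega> j" "t - 2 * A < s" "s < t"
    then have "t - s \<noteq> A" using t(2)[of j] by (auto simp: algebra_simps)
    with s show "(residual j has_real_derivative residual_slope j (t - s)) (at (t - s))" by (intro residual_deriv) auto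
  qed
  also have "(\<Sum>j\<in>UNIV. shot_noise (residual_slope j) (2 * A) j t \<omega>) = - (excitation t \<omega> + leak * window_count t \<omega>)"
  proof -
    have "shot_noise (residual_slope j) (2 * A) j t \<omega> = - shot_noise (offspring_rate j) A j t \<omega> - leak * shot_noise (\<lambda>_. 1) (2 * A) j t \<omega>" for j
    proof -
      have fin: "finite (\<omega> j \<inter> {t - 2 * A..<t})" by (rule config_finite[OF w]) simp
      have "shot_noise (residual_slope j) (2 * A) j t \<omega> = - (\<Sum>s\<in>\<omega> j \<inter> {t - 2 * A..<t}. if t - s \<le> A then offspring_rate j (t - s) else 0)
        - leak * shot_noise (\<lambda>_. 1) (2 * A) j t \<omega>"
        by (simp add: shot_noise_def residual_slope_def sum_subtractf sum_negf sum_distrib_left mult_ac)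
      also have "(\<Sum>s\<in>\<omega> j \<inter> {t - 2 * A..<t}. if t - s \<le> A then offspring_rate j (t - s) else 0) =
        (\<Sum>s\<in>(\<omega> j \<inter> {t - 2 * A..<t}) \<inter> {s. t - s \<le> A}. offspring_rate j (t - s))"
        using fin by (simp add: sum.inter_restrict)
      also have "(\<omega> j \<inter> {t - 2 * A..<t}) \<inter> {s. t - s \<le> A} = \<omega> j \<inter> {t - A..<t}" using A_pos by auto
      finally show ?thesis by (simp add: shot_noise_def)
    qed
    moreover have "(\<Sum>j\<in>UNIV. shot_noise (offspring_rate j) A j t \<omega>) = excitation t \<omega>"
    proof -
      have "shot_noise (offspring_rate j) A j t \<omega> = (\<Sum>i\<in>UNIV. u i * shot_noise (g i j) A j t \<omega>)" for j
        unfolding shot_noise_def offspring_rate_def sum_distrib_left by (rule sum.swap)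
      then have "(\<Sum>j\<in>UNIV. shot_noise (offspring_rate j) A j t \<omega>) = (\<Sum>j\<in>UNIV. \<Sum>i\<in>UNIV. u i * shot_noise (g i j) A j t \<omega>)" by simp
      also have "\<dots> = excitation t \<omega>" unfolding excitation_def sum_distrib_left by (rule sum.swap)
      finally show ?thesis .
    qed
    ultimately show ?thesis by (simp add: window_count_def sum_subtractf sum_negf sum_distrib_left)
  qed
  finally show ?thesis .
qed

lemma potential_plus_jump:
  assumes w: "\<omega> \<in> configs"
  shows "potential_plus t \<omega> = potential t \<omega> + (\<Sum>j\<in>UNIV. if t \<in> \<omega> j then residual j 0 else 0)"
proof -
  have "(\<Sum>s\<in>\<omega> j \<inter> {t - 2 * A<..t}. residual j (t - s)) = shot_noise (residual j) (2 * A) j t \<omega> + (if t \<in> \<omega> j then residual j 0 else 0)" for j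
  proof -
    have fin: "finite (\<omega> j \<inter> B)" if "bounded B" for B by (rule config_finite[OF w that])
    have "(\<Sum>s\<in>\<omega> j \<inter> {t - 2 * A<..t}. residual j (t - s)) + (\<Sum>s\<in>\<omega> j \<inter> {t - 2 * A}. residual j (t - s)) =
      (\<Sum>s\<in>\<omega> j \<inter> {t - 2 * A<..t} \<union> \<omega> j \<inter> {t - 2 * A}. residual j (t - s))"
      by (intro sum.union_disjoint[symmetric] fin) auto
    also have "\<omega> j \<inter> {t - 2 * A<..t} \<union> \<omega> j \<inter> {t - 2 * A} = \<omega> j \<inter> {t - 2 * A..<t} \<union> \<omega> j \<inter> {t}"
      using A_pos by auto
    also have "(\<Sum>s\<in>\<dots>. residual j (t - s)) = (\<Sum>s\<in>\<omega> j \<inter> {t - 2 * A..<t}. residual j (t - s)) + (\<Sum>s\<in>\<omega> j \<inter> {t}. residual j (t - s))"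
      by (intro sum.union_disjoint fin) auto
    finally show ?thesis
      by (cases "t \<in> \<omega> j"; cases "t - 2 * A \<in> \<omega> j") (simp_all add: shot_noise_def residual_end)
  qed
  then show ?thesis by (simp add: potential_plus_def potential_def sum.distrib)
qed

lemma potential_path:
  assumes w: "\<omega> \<in> configs" and T: "0 < T" and ends: "\<And>j. 0 \<notin> \<omega> j" "\<And>j. T \<notin> \<omega> j"
    and \<psi>: "\<And>x. (\<psi> has_real_derivative \<psi>' x) (at x)"
  shows "\<psi> (potential T \<omega>) - \<psi> (potential 0 \<omega>) = (\<Sum>j\<in>UNIV. \<Sum>s\<in>\<omega> j \<inter> {0<..T}. \<psi> (potential s \<omega> + residual j 0) - \<psi> (potential s \<omega>))
    - integral {0..T} (\<lambda>t. \<psi>' (potential t \<omega>) * (excitation t \<omega> + leak * window_count t \<omega>))"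
proof -
  let ?S = "\<Union>j. \<omega> j \<inter> {0<..T}"
  let ?D = "(\<Union>j. {t\<in>{0<..<T}. t \<in> \<omega> j \<or> t - A \<in> \<omega> j}) \<union> (\<Union>j. {t\<in>{0<..<T}. t \<in> \<omega> j \<or> t - 2 * A \<in> \<omega> j})"
  have \<psi>_cont: "isCont \<psi> x" for x using \<psi> by (rule DERIV_isCont)
  have fin: "finite (\<omega> j \<inter> {0<..T})" for j by (rule config_finite[OF w]) simp
  have disj: "\<omega> i \<inter> \<omega> j = {}" if "i \<noteq> j" for i j using w that by (simp add: configs_def)
  have nojump: "potential_plus t \<omega> = potential t \<omega>" if "\<And>j. t \<notin> \<omega> j" for t
    using potential_plus_jump[OF w, of t] that by simp
  have "((\<lambda>t. - (\<psi>' (potential t \<omega>) * (excitation t \<omega> + leak * window_count t \<omega>))) has_integral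
    (\<psi> (potential_plus T \<omega>) - \<psi> (potential 0 \<omega>) - (\<Sum>t\<in>?S. \<psi> (potential_plus t \<omega>) - \<psi> (potential t \<omega>)))) {0..T}"
  proof (rule jump_ftc[where X="\<lambda>t. \<psi> (potential t \<omega>)" and Xp="\<lambda>t. \<psi> (potential_plus t \<omega>)" and D="?D", OF T])
    show "finite ?S" by (intro finite_UN_I fin finite)
    show "?S \<subseteq> {0<..T}" by auto
    show "finite ?D" by (intro finite_UnI finite_UN_I finite finite_shifted_points w)
    show "((\<lambda>t. \<psi> (potential t \<omega>)) \<longlongrightarrow> \<psi> (potential t \<omega>)) (at_left t)" if "0 < t" for t
      by (rule isCont_tendsto_compose[OF \<psi>_cont regular_left[OF regular_potential w that]])
    show "((\<lambda>t. \<psi> (potential t \<omega>)) \<longlongrightarrow> \<psi> (potential_plus t \<omega>)) (at_right t)" for t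
    proof (rule isCont_tendsto_compose[OF \<psi>_cont])
      show "((\<lambda>t. potential t \<omega>) \<longlongrightarrow> potential_plus t \<omega>) (at_right t)" unfolding potential_def potential_plus_def
        by (intro tendsto_sum shot_noise_right w residual_cont)
    qed
    show "\<psi> (potential_plus t \<omega>) = \<psi> (potential t \<omega>)" if "0 \<le> t" "t \<le> T" "t \<notin> ?S" for t
    proof -
      have "t \<notin> \<omega> j" for j using that ends(1)[of j] by (cases "t = 0") auto
      then show ?thesis using nojump by simp
    qed
    show "((\<lambda>t. \<psi> (potential t \<omega>)) has_real_derivative - (\<psi>' (potential t \<omega>) * (excitation t \<omega> + leak * window_count t \<omega>))) (at t)"
      if "0 < t" "t < T" "t \<notin> ?D" for t
    proof -
      have "t \<notin> \<omega> j" "t - A \<notin> \<omega> j" "t - 2 * A \<notin> \<omega> j" for j using that by auto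
      from DERIV_chain2[OF \<psi> potential_deriv[OF w this]] show ?thesis by (simp only: mult_minus_right)
    qed
  qed
  then have "integral {0..T} (\<lambda>t. - (\<psi>' (potential t \<omega>) * (excitation t \<omega> + leak * window_count t \<omega>))) =
    \<psi> (potential_plus T \<omega>) - \<psi> (potential 0 \<omega>) - (\<Sum>t\<in>?S. \<psi> (potential_plus t \<omega>) - \<psi> (potential t \<omega>))" by (rule integral_unique)
  moreover have "potential_plus T \<omega> = potential T \<omega>" by (rule nojump) (rule ends)
  moreover have "(\<Sum>t\<in>?S. \<psi> (potential_plus t \<omega>) - \<psi> (potential t \<omega>)) = (\<Sum>j\<in>UNIV. \<Sum>s\<in>\<omega> j \<inter> {0<..T}. \<psi> (potential s \<omega> + residual j 0) - \<psi> (potential s \<omega>))"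
  proof -
    have "(\<Sum>t\<in>?S. \<psi> (potential_plus t \<omega>) - \<psi> (potential t \<omega>)) = (\<Sum>j\<in>UNIV. \<Sum>t\<in>\<omega> j \<inter> {0<..T}. \<psi> (potential_plus t \<omega>) - \<psi> (potential t \<omega>))"
      using disj fin by (intro sum.UNION_disjoint) auto
    also have "\<dots> = (\<Sum>j\<in>UNIV. \<Sum>s\<in>\<omega> j \<inter> {0<..T}. \<psi> (potential s \<omega> + residual j 0) - \<psi> (potential s \<omega>))"
    proof (intro sum.cong refl)
      fix j s assume s: "s \<in> \<omega> j \<inter> {0<..T}"
      have "s \<in> \<omega> k \<longleftrightarrow> k = j" for k using s disj[of k j] by auto
      then have "potential_plus s \<omega> = potential s \<omega> + residual j 0" using potential_plus_jump[OF w, of s] by simp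
      then show "\<psi> (potential_plus s \<omega>) - \<psi> (potential s \<omega>) = \<psi> (potential s \<omega> + residual j 0) - \<psi> (potential s \<omega>)" by simp
    qed
    finally show ?thesis .
  qed
  ultimately show ?thesis by simp
qed

text \<open>
  For a potential above the level \<open>v0\<close> a new point of type \<open>j\<close> raises \<open>\<psi>\<close> by at most \<open>u j\<close> times the
  slope, so the gain is at most slope times baseline plus excitation, and half of the leak
  pays for the baseline. Below that level everything is bounded by a multiple of the number of recent points,
  uniformly in the clipping level.
\<close>

lemma pointwise_drift:
  obtains C where "0 \<le> C"
    and "\<And>m \<psi> \<omega> t. 0 \<le> m \<Longrightarrow> (\<And>x. (\<psi> has_real_derivative clipped_power r m x) (at x)) \<Longrightarrow> \<omega> \<in> configs \<Longrightarrow>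
      leak / 2 * (clipped_power r m (potential t \<omega>) * window_count t \<omega>)
      + (\<Sum>j\<in>UNIV. (\<psi> (potential t \<omega> + residual j 0) - \<psi> (potential t \<omega>)) * lam j \<omega> t)
      \<le> clipped_power r m (potential t \<omega>) * (excitation t \<omega> + leak * window_count t \<omega>) + C * (1 + window_count t \<omega>)"
proof -
  define B where "B = (\<Sum>j\<in>UNIV. u j * \<beta> j)"
  have u_pos: "0 < u j" for j using u_ge[of j] by simp
  have f_pos: "0 < residual j 0" "residual j 0 < u j" for j using u_ge[of j] residual_zero[of j] by auto
  \<comment> \<open>A new point contributes strictly less than u j, which leaves room for the factor from the ratio bound at high levels.\<close>
  have "\<forall>\<^sub>F v in at_top. residual j 0 * (1 + residual j 0 / v) ^ r \<le> u j" for j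
  proof -
    have "((\<lambda>v. residual j 0 / v) \<longlongrightarrow> 0) at_top"
      by (rule tendsto_divide_0[OF tendsto_const filterlim_at_top_imp_at_infinity[OF filterlim_ident]])
    then have "((\<lambda>v. residual j 0 * (1 + residual j 0 / v) ^ r) \<longlongrightarrow> residual j 0 * (1 + 0) ^ r) at_top" by (intro tendsto_intros)
    from order_tendstoD(2)[OF this, of "u j"] f_pos[of j] show ?thesis by (auto elim: eventually_mono)
  qed
  then have "\<forall>\<^sub>F v in at_top. \<forall>j. residual j 0 * (1 + residual j 0 / v) ^ r \<le> u j" by (rule eventually_all_finite)
  moreover have "\<forall>\<^sub>F v in at_top. 2 * B * residual_max / leak \<le> (v::real)" by (rule eventually_ge_at_top)
  moreover have "\<forall>\<^sub>F v in at_top. 0 < (v::real)" by (rule eventually_gt_at_top)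
  ultimately have "\<forall>\<^sub>F v in at_top. (\<forall>j. residual j 0 * (1 + residual j 0 / v) ^ r \<le> u j) \<and> 2 * B * residual_max / leak \<le> v \<and> 0 < v"
    by eventually_elim simp
  then obtain v0 where "\<forall>v\<ge>v0. (\<forall>j. residual j 0 * (1 + residual j 0 / v) ^ r \<le> u j) \<and> 2 * B * residual_max / leak \<le> v \<and> 0 < v"
    unfolding eventually_at_top_linorder by blast
  then have v0: "\<And>v j. v0 \<le> v \<Longrightarrow> residual j 0 * (1 + residual j 0 / v) ^ r \<le> u j" "2 * B * residual_max / leak \<le> v0" "0 < v0" by auto
  define C where "C = real CARD('d) * (residual_max * (v0 + residual_max) ^ r * b)"
  have "0 \<le> C" unfolding C_def using residual_max_pos v0(3) b_pos by simp
  moreover have "leak / 2 * (clipped_power r m (potential t \<omega>) * window_count t \<omega>)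
      + (\<Sum>j\<in>UNIV. (\<psi> (potential t \<omega> + residual j 0) - \<psi> (potential t \<omega>)) * lam j \<omega> t)
      \<le> clipped_power r m (potential t \<omega>) * (excitation t \<omega> + leak * window_count t \<omega>) + C * (1 + window_count t \<omega>)"
    if m: "0 \<le> m" and \<psi>: "\<And>x. (\<psi> has_real_derivative clipped_power r m x) (at x)" and w: "\<omega> \<in> configs" for m \<psi> \<omega> t
  proof -
    let ?p = "clipped_power r m" and ?V = "potential t \<omega>" and ?W = "window_count t \<omega>" and ?e = "excitation t \<omega>"
    let ?\<Lambda> = "\<lambda>j. \<Sum>k\<in>UNIV. shot_noise (g j k) A k t \<omega>"
    have p: "0 \<le> ?p x" for x by (rule clipped_power_bounds(1)[OF m])
    have H: "\<psi> (?V + residual j 0) - \<psi> ?V \<le> residual j 0 * ?p (?V + residual j 0)" for j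
    proof -
      obtain z where z: "z < ?V + residual j 0" "\<psi> (?V + residual j 0) - \<psi> ?V = (?V + residual j 0 - ?V) * ?p z"
        using MVT2[of ?V "?V + residual j 0" \<psi> ?p] \<psi> f_pos(1)[of j] by auto
      have "?p z \<le> ?p (?V + residual j 0)" using z(1) by (intro clipped_power_mono m) simp
      then show ?thesis using z(2) f_pos(1)[of j] by simp
    qed
    have lam: "0 \<le> lam j \<omega> t" for j using lam_pos[OF w, of j t] by simp
    have V: "0 \<le> ?V" "?V \<le> residual_max * ?W" using potential_bounds[OF w] by auto
    have W: "0 \<le> ?W" by (rule window_count_nonneg)
    show ?thesis
    proof (cases "v0 \<le> ?V")
      case True
      have "(\<psi> (?V + residual j 0) - \<psi> ?V) * lam j \<omega> t \<le> u j * ?p ?V * (\<beta> j + ?\<Lambda> j)" for j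
      proof -
        have "\<psi> (?V + residual j 0) - \<psi> ?V \<le> residual j 0 * ((1 + residual j 0 / ?V) ^ r * ?p ?V)"
          using H[of j] clipped_power_ratio[of ?V "residual j 0" m r] True v0(3) f_pos(1)[of j] m
          by (smt (verit) mult_left_mono)
        also have "\<dots> = (residual j 0 * (1 + residual j 0 / ?V) ^ r) * ?p ?V" by simp
        also have "\<dots> \<le> u j * ?p ?V" by (intro mult_right_mono v0(1) True p)
        finally have "(\<psi> (?V + residual j 0) - \<psi> ?V) * lam j \<omega> t \<le> u j * ?p ?V * lam j \<omega> t" by (intro mult_right_mono lam)
        also have "\<dots> \<le> u j * ?p ?V * (\<beta> j + ?\<Lambda> j)"
          using u_pos[of j] p by (intro mult_left_mono lam_le w) (simp add: less_imp_le)
        finally show ?thesis .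
      qed
      then have "(\<Sum>j\<in>UNIV. (\<psi> (?V + residual j 0) - \<psi> ?V) * lam j \<omega> t) \<le> (\<Sum>j\<in>UNIV. u j * ?p ?V * (\<beta> j + ?\<Lambda> j))"
        by (intro sum_mono)
      also have "\<dots> = ?p ?V * (B + ?e)"
        by (simp add: B_def excitation_def sum_distrib_left sum.distrib[symmetric] algebra_simps)
      also have "\<dots> \<le> ?p ?V * (leak / 2 * ?W + ?e)"
      proof (intro mult_left_mono p add_right_mono)
        have "2 * B * residual_max / leak \<le> residual_max * ?W" using v0(2) True V(2) by linarith
        then have "(2 * B / leak) * residual_max \<le> ?W * residual_max" by (simp add: mult.commute)
        then have "2 * B / leak \<le> ?W" using residual_max_pos by (simp only: mult_le_cancel_right_pos)
        then show "B \<le> leak / 2 * ?W" using leak_pos by (simp add: field_simps)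
      qed
      finally have "(\<Sum>j\<in>UNIV. (\<psi> (?V + residual j 0) - \<psi> ?V) * lam j \<omega> t) \<le> ?p ?V * (leak / 2 * ?W + ?e)" .
      moreover have "leak / 2 * (?p ?V * ?W) + ?p ?V * (leak / 2 * ?W + ?e) = ?p ?V * (?e + leak * ?W)"
        by (simp add: algebra_simps)
      moreover have "0 \<le> C * (1 + ?W)" using \<open>0 \<le> C\<close> W by simp
      ultimately show ?thesis by linarith
    next
      case False
      have "(\<psi> (?V + residual j 0) - \<psi> ?V) * lam j \<omega> t \<le> residual_max * (v0 + residual_max) ^ r * (b * (1 + ?W))" for j
      proof (rule mult_mono)
        have "?p (?V + residual j 0) \<le> (?V + residual j 0) ^ r" by (rule clipped_power_bounds(3)[OF m]) (use V f_pos[of j] in auto)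
        also have "\<dots> \<le> (v0 + residual_max) ^ r" using False V f_pos[of j] residual_le_max[of j] by (intro power_mono) auto
        finally have "residual j 0 * ?p (?V + residual j 0) \<le> residual_max * (v0 + residual_max) ^ r"
          using f_pos(1)[of j] residual_le_max[of j] p residual_max_pos by (intro mult_mono) auto
        then show "\<psi> (?V + residual j 0) - \<psi> ?V \<le> residual_max * (v0 + residual_max) ^ r" using H[of j] by linarith
        have "points \<omega> {t - A..<t} \<le> points \<omega> {t - 2 * A..<t}" using A_pos by (intro points_mono w) auto
        then have "b * (1 + real (points \<omega> {t - A..<t})) \<le> b * (1 + ?W)" using b_pos by (simp add: window_count_eq)
        then show "lam j \<omega> t \<le> b * (1 + ?W)" using growth[OF w, of j t] by linarith
      qed (use lam residual_max_pos v0(3) in auto)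
      then have "(\<Sum>j\<in>UNIV. (\<psi> (?V + residual j 0) - \<psi> ?V) * lam j \<omega> t) \<le> (\<Sum>j\<in>(UNIV::'d set). residual_max * (v0 + residual_max) ^ r * (b * (1 + ?W)))"
        by (intro sum_mono)
      also have "\<dots> = C * (1 + ?W)" by (simp add: C_def)
      finally have 1: "(\<Sum>j\<in>UNIV. (\<psi> (?V + residual j 0) - \<psi> ?V) * lam j \<omega> t) \<le> C * (1 + ?W)" .
      have "leak / 2 * ?W \<le> ?e + leak * ?W" using excitation_nonneg[of t \<omega>] leak_pos W by (simp add: add_increasing)
      then have "?p ?V * (leak / 2 * ?W) \<le> ?p ?V * (?e + leak * ?W)" by (intro mult_left_mono p)
      with 1 show ?thesis by (simp add: mult_ac)
    qed
  qed
  ultimately show ?thesis by (rule that)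
qed

lemma integrable_points:
  assumes "S \<in> sets borel" "bounded S" shows "integrable M (\<lambda>\<omega>. real (points \<omega> S))"
  unfolding points_def of_nat_sum
proof (rule Bochner_Integration.integrable_sum)
  fix i :: 'd
  show "integrable M (\<lambda>\<omega>. real (card (\<omega> i \<inter> S)))"
  proof (rule integrableI_nonneg)
    show "(\<lambda>\<omega>. real (card (\<omega> i \<inter> S))) \<in> borel_measurable M"
      by (rule measurable_M[OF measurable_compose[OF measurable_card[OF assms]]]) simp
    show "(\<integral>\<^sup>+\<omega>. ennreal (real (card (\<omega> i \<inter> S))) \<partial>M) < \<infinity>"
      using mean_card_finite[OF assms, of i] by (simp add: ennreal_of_nat_eq_real_of_nat)
  qed simp
qed

lemma integrable_potential:
  assumes t: "0 \<le> t" and m: "0 \<le> m" and \<psi>: "\<And>x. (\<psi> has_real_derivative clipped_power r m x) (at x)"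
  shows "integrable M (\<lambda>\<omega>. \<psi> (potential t \<omega>))"
proof (rule Bochner_Integration.integrable_bound)
  have "integrable M (\<lambda>\<omega>. \<bar>\<psi> 0\<bar> + m ^ r * (residual_max * real (points \<omega> {t - 2 * A..<t})))"
    by (intro Bochner_Integration.integrable_add integrable_mult_right integrable_points integrable_const) auto
  then show "integrable M (\<lambda>\<omega>. \<bar>\<psi> 0\<bar> + m ^ r * (residual_max * window_count t \<omega>))" by (simp add: window_count_eq)
  have "\<psi> \<in> borel_measurable borel"
    by (intro borel_measurable_continuous_onI continuous_at_imp_continuous_on ballI DERIV_isCont[OF \<psi>])
  from measurable_compose[OF measurable_M[OF regular_measurable_config[OF regular_potential t]] this]
  show "(\<lambda>\<omega>. \<psi> (potential t \<omega>)) \<in> borel_measurable M" .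
  show "AE \<omega> in M. norm (\<psi> (potential t \<omega>)) \<le> norm (\<bar>\<psi> 0\<bar> + m ^ r * (residual_max * window_count t \<omega>))"
  proof (rule AE_I2)
    fix \<omega> assume "\<omega> \<in> space M"
    then have w: "\<omega> \<in> configs" by (simp add: space_M)
    have V: "0 \<le> potential t \<omega>" "potential t \<omega> \<le> residual_max * window_count t \<omega>" using potential_bounds[OF w] by auto
    have "\<bar>\<psi> (potential t \<omega>) - \<psi> 0\<bar> \<le> m ^ r * potential t \<omega>"
    proof (cases "potential t \<omega> = 0")
      case False
      with V have "0 < potential t \<omega>" by simp
      then obtain z where z: "\<psi> (potential t \<omega>) - \<psi> 0 = (potential t \<omega> - 0) * clipped_power r m z"
        using MVT2[of 0 "potential t \<omega>" \<psi> "clipped_power r m"] \<psi> by auto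
      then show ?thesis using clipped_power_bounds(1,2)[OF m, of r z] V(1)
        by (simp add: abs_mult mult.commute mult_right_mono)
    qed simp
    also have "\<dots> \<le> m ^ r * (residual_max * window_count t \<omega>)" using V m by (intro mult_left_mono) auto
    finally show "norm (\<psi> (potential t \<omega>)) \<le> norm (\<bar>\<psi> 0\<bar> + m ^ r * (residual_max * window_count t \<omega>))" by simp
  qed
qed

lemma potential_shift: "potential t \<omega> = potential 0 (shift_config (- t) \<omega>)" and window_count_shift: "window_count t \<omega> = window_count 0 (shift_config (- t) \<omega>)"
  by (simp_all add: potential_def window_count_def shot_noise_shift)

lemma integral_potential:
  fixes \<psi> :: "real \<Rightarrow> real"
  assumes t: "0 \<le> t" and \<psi>: "\<And>x. isCont \<psi> x"
  shows "(\<integral>\<omega>. \<psi> (potential t \<omega>) \<partial>M) = (\<integral>\<omega>. \<psi> (potential 0 \<omega>) \<partial>M)"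
proof -
  have "\<psi> \<in> borel_measurable borel"
    by (intro borel_measurable_continuous_onI continuous_at_imp_continuous_on ballI \<psi>)
  from measurable_compose[OF regular_measurable_config[OF regular_potential order_refl] this]
  have f: "(\<lambda>\<omega>. \<psi> (potential 0 \<omega>)) \<in> borel_measurable config_algebra" .
  have "shift_config (- t) \<in> M \<rightarrow>\<^sub>M config_algebra"
    unfolding measurable_cong_sets[OF sets_M refl] by (rule measurable_shift_config)
  from integral_distr[OF this f] show ?thesis by (simp add: stationary potential_shift[of t])
qed

text \<open>
  In the stationary regime the mean of \<open>\<psi> (potential t)\<close> does not change over the unit interval, so
  the expected gain at points equals the expected decay. By the drift inequality the difference dominates the
  moment, up to a constant times the mean number of points. Times \<open>0\<close> and \<open>1\<close> are almost surely not points.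
\<close>

lemma clipped_moment_bound:
  "\<exists>C. \<forall>m\<ge>0. (\<integral>\<^sup>+\<omega>. ennreal (clipped_power r m (potential 0 \<omega>) * window_count 0 \<omega>) \<partial>M) \<le> ennreal C"
proof (rule pointwise_drift[of r])
  fix C assume C: "0 \<le> C" and drift: "\<And>m \<psi> \<omega> t. 0 \<le> m \<Longrightarrow> (\<And>x. (\<psi> has_real_derivative clipped_power r m x) (at x)) \<Longrightarrow>
    \<omega> \<in> configs \<Longrightarrow> leak / 2 * (clipped_power r m (potential t \<omega>) * window_count t \<omega>)
      + (\<Sum>j\<in>UNIV. (\<psi> (potential t \<omega> + residual j 0) - \<psi> (potential t \<omega>)) * lam j \<omega> t)
      \<le> clipped_power r m (potential t \<omega>) * (excitation t \<omega> + leak * window_count t \<omega>) + C * (1 + window_count t \<omega>)"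
  let ?N = "\<lambda>\<omega>::'d config. real (points \<omega> {- 2 * A..1})"
  have intN: "integrable M (\<lambda>\<omega>. C * (1 + ?N \<omega>))"
    by (intro integrable_mult_right Bochner_Integration.integrable_add integrable_const integrable_points) auto
  have "(\<integral>\<^sup>+\<omega>. ennreal (clipped_power r m (potential 0 \<omega>) * window_count 0 \<omega>) \<partial>M) \<le> ennreal (2 / leak * (\<integral>\<omega>. C * (1 + ?N \<omega>) \<partial>M))"
    if m: "0 \<le> m" for m
  proof -
    let ?p = "clipped_power r m"
    obtain \<psi> where \<psi>: "\<And>x. (\<psi> has_real_derivative ?p x) (at x)"
      using antiderivative_exists[of ?p, OF clipped_power_isCont] by blast
    have \<psi>c: "isCont \<psi> x" for x by (rule DERIV_isCont[OF \<psi>])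
    have \<psi>b: "\<psi> \<in> borel_measurable borel"
      by (intro borel_measurable_continuous_onI continuous_at_imp_continuous_on ballI \<psi>c)
    let ?H = "\<lambda>j t \<omega>. \<psi> (potential t \<omega> + residual j 0) - \<psi> (potential t \<omega>)"
    have f_pos: "0 < residual j 0" for j using u_ge[of j] residual_zero[of j] by auto
    have regH: "regular_process (?H j)" for j
      by (intro regular_diff regular_compose[OF _ \<psi>b] regular_add regular_potential regular_const \<psi>c)
    have bndH: "\<bar>?H j t \<omega>\<bar> \<le> residual j 0 * m ^ r" for j t \<omega>
    proof -
      obtain z where "?H j t \<omega> = (potential t \<omega> + residual j 0 - potential t \<omega>) * ?p z"
        using MVT2[of "potential t \<omega>" "potential t \<omega> + residual j 0" \<psi> ?p] \<psi> f_pos[of j] by auto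
      then show ?thesis using clipped_power_bounds(1,2)[OF m, of r z] f_pos[of j] by (simp add: abs_mult)
    qed
    have lbH: "locally_bounded (?H j)" for j unfolding locally_bounded_def using bndH by blast
    note campbell = campbell_bounded_real[OF zero_less_one regH lbH bndH]
    have regp: "regular_process (\<lambda>t \<omega>. ?p (potential t \<omega>))"
      by (rule regular_compose[OF regular_potential]) (auto intro!: borel_measurable_continuous_onI continuous_at_imp_continuous_on clipped_power_isCont)
    have lbp: "locally_bounded (\<lambda>t \<omega>. ?p (potential t \<omega>))"
      by (rule locally_bounded_le[OF locally_bounded_const[of "m ^ r"]]) (use clipped_power_bounds(1,2)[OF m] m in auto)
    have shot: "locally_bounded (shot_noise h a j)" if h: "\<And>x. isCont h x" and a: "0 < a" for h a and j :: 'd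
      unfolding locally_bounded_def
    proof (intro ballI allI)
      fix \<omega> :: "'d config" and T assume w: "\<omega> \<in> configs"
      have "compact (h ` {0..a})"
        by (intro compact_continuous_image continuous_at_imp_continuous_on ballI h) simp
      then obtain K where K: "\<And>x. 0 \<le> x \<Longrightarrow> x \<le> a \<Longrightarrow> \<bar>h x\<bar> \<le> K"
        using compact_imp_bounded bounded_real by (metis (no_types, lifting) atLeastAtMost_iff imageI)
      have K0: "0 \<le> K" using K[of 0] a by linarith
      have "\<bar>shot_noise h a j t \<omega>\<bar> \<le> K * real (card (\<omega> j \<inter> {-a..T}))" if t: "t \<in> {0..T}" for t
      proof -
        have "\<bar>shot_noise h a j t \<omega>\<bar> \<le> (\<Sum>s\<in>\<omega> j \<inter> {t - a..<t}. \<bar>h (t - s)\<bar>)" unfolding shot_noise_def by (rule sum_abs)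
        also have "\<dots> \<le> (\<Sum>s\<in>\<omega> j \<inter> {t - a..<t}. K)" by (intro sum_mono K) auto
        also have "\<dots> = K * real (card (\<omega> j \<inter> {t - a..<t}))" by simp
        also have "\<dots> \<le> K * real (card (\<omega> j \<inter> {-a..T}))"
          using t by (intro mult_left_mono K0 of_nat_mono card_mono config_finite[OF w]) auto
        finally show ?thesis .
      qed
      then show "\<exists>K. \<forall>t\<in>{0..T}. \<bar>shot_noise h a j t \<omega>\<bar> \<le> K" by blast
    qed
    have lbe: "locally_bounded excitation" unfolding excitation_def[abs_def]
      by (intro locally_bounded_sum locally_bounded_mult locally_bounded_const shot g_cont A_pos) auto
    have lbw: "locally_bounded window_count" unfolding window_count_def[abs_def]
      by (intro locally_bounded_sum shot) (use A_pos in auto)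
    let ?D = "\<lambda>t \<omega>. ?p (potential t \<omega>) * (excitation t \<omega> + leak * window_count t \<omega>)"
    have D: "regular_process ?D" "locally_bounded ?D"
      by (intro regular_mult regp regular_add regular_excitation regular_cmult regular_window_count)
        (intro locally_bounded_mult lbp locally_bounded_add lbe lbw locally_bounded_const)
    let ?pW = "\<lambda>t \<omega>. ?p (potential t \<omega>) * window_count t \<omega>"
    have pW: "regular_process ?pW" "locally_bounded ?pW"
      by (intro regular_mult regp regular_window_count) (intro locally_bounded_mult lbp lbw)
    let ?J = "\<lambda>\<omega>. integral {0..1} (\<lambda>t. ?D t \<omega>)"
    let ?R = "\<lambda>\<omega>. (\<Sum>j\<in>UNIV. \<Sum>s\<in>\<omega> j \<inter> {0<..1}. ?H j s \<omega>) - (\<psi> (potential 1 \<omega>) - \<psi> (potential 0 \<omega>))"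
    have intR: "integrable M ?R"
      by (intro Bochner_Integration.integrable_diff Bochner_Integration.integrable_sum campbell(1) integrable_potential[OF _ m \<psi>]) auto
    have J_meas: "?J \<in> borel_measurable M"
      by (rule measurable_M[OF regular_measurable_config[OF regular_integral[OF D]]]) simp
    have JR: "AE \<omega> in M. ?R \<omega> = ?J \<omega>"
      using AE_not_point[of 0] AE_not_point[of 1] AE_space
    proof eventually_elim
      case (elim \<omega>)
      then show ?case using potential_path[of \<omega> 1 \<psi> ?p, OF _ zero_less_one _ _ \<psi>] by (simp add: space_M)
    qed
    have intJ: "integrable M ?J"
      using integrable_cong_AE[OF borel_measurable_integrable[OF intR] J_meas JR] intR by simp
    have "(\<integral>\<omega>. ?J \<omega> \<partial>M) = (\<integral>\<omega>. ?R \<omega> \<partial>M)"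
      by (rule integral_cong_AE[OF J_meas borel_measurable_integrable[OF intR]]) (use JR in \<open>auto elim: eventually_mono\<close>)
    also have "\<dots> = (\<Sum>j\<in>UNIV. \<integral>\<omega>. (\<Sum>s\<in>\<omega> j \<inter> {0<..1}. ?H j s \<omega>) \<partial>M)"
      using integral_potential[of 1 \<psi>, OF _ \<psi>c]
      by (simp add: Bochner_Integration.integral_diff Bochner_Integration.integral_sum campbell(1) integrable_potential[OF _ m \<psi>])
    also have "\<dots> = (\<Sum>j\<in>UNIV. \<integral>\<omega>. integral {0..1} (\<lambda>t. ?H j t \<omega> * lam j \<omega> t) \<partial>M)"
      by (intro sum.cong refl campbell(3))
    finally have EJ: "(\<integral>\<omega>. ?J \<omega> \<partial>M) = (\<Sum>j\<in>UNIV. \<integral>\<omega>. integral {0..1} (\<lambda>t. ?H j t \<omega> * lam j \<omega> t) \<partial>M)" .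
    have path: "leak / 2 * integral {0..1} (\<lambda>t. ?pW t \<omega>) \<le>
      ?J \<omega> - (\<Sum>j\<in>UNIV. integral {0..1} (\<lambda>t. ?H j t \<omega> * lam j \<omega> t)) + C * (1 + ?N \<omega>)" if w: "\<omega> \<in> configs" for \<omega>
    proof -
      have i1: "(\<lambda>t. ?pW t \<omega>) integrable_on {0..1}" by (rule regular_integrable_on[OF pW w])
      have i2: "(\<lambda>t. ?H j t \<omega> * lam j \<omega> t) integrable_on {0..1}" for j
        by (rule regular_integrable_on[OF regular_mult[OF regH regular_lam] locally_bounded_mult[OF lbH bounded_lam] w])
      have i3: "(\<lambda>t. ?D t \<omega>) integrable_on {0..1}" by (rule regular_integrable_on[OF D w])
      have "integral {0..1} (\<lambda>t. leak / 2 * ?pW t \<omega> + (\<Sum>j\<in>UNIV. ?H j t \<omega> * lam j \<omega> t)) \<le>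
        integral {0..1} (\<lambda>t. ?D t \<omega> + C * (1 + ?N \<omega>))"
      proof (rule integral_le)
        fix t :: real assume t: "t \<in> {0..1}"
        have "window_count t \<omega> \<le> ?N \<omega>" unfolding window_count_eq of_nat_le_iff
          by (rule points_mono[OF w]) (use t in auto)
        then have "C * (1 + window_count t \<omega>) \<le> C * (1 + ?N \<omega>)" by (intro mult_left_mono C) simp
        with drift[OF m \<psi> w, of t]
        show "leak / 2 * ?pW t \<omega> + (\<Sum>j\<in>UNIV. ?H j t \<omega> * lam j \<omega> t) \<le> ?D t \<omega> + C * (1 + ?N \<omega>)" by linarith
      qed (intro integrable_add integrable_on_mult_right integrable_sum i1 i2 i3 integrable_const_ivl finite)+
      also have "\<dots> = ?J \<omega> + C * (1 + ?N \<omega>)" 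
        using Henstock_Kurzweil_Integration.integral_add[OF i3 integrable_const_ivl[of "C * (1 + ?N \<omega>)" 0 1]] by simp
      also have "integral {0..1} (\<lambda>t. leak / 2 * ?pW t \<omega> + (\<Sum>j\<in>UNIV. ?H j t \<omega> * lam j \<omega> t)) =
        leak / 2 * integral {0..1} (\<lambda>t. ?pW t \<omega>) + (\<Sum>j\<in>UNIV. integral {0..1} (\<lambda>t. ?H j t \<omega> * lam j \<omega> t))"
        using i1 i2 by (subst Henstock_Kurzweil_Integration.integral_add) (auto intro!: integrable_on_mult_right integrable_sum simp: integral_sum)
      finally show ?thesis by linarith
    qed
    let ?I = "\<lambda>\<omega>. integral {0..1} (\<lambda>t. ?pW t \<omega>)"
    let ?U = "\<lambda>\<omega>. ?J \<omega> - (\<Sum>j\<in>UNIV. integral {0..1} (\<lambda>t. ?H j t \<omega> * lam j \<omega> t)) + C * (1 + ?N \<omega>)"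
    have pW_nonneg: "0 \<le> ?pW t \<omega>" for t \<omega>
      by (intro mult_nonneg_nonneg clipped_power_bounds(1)[OF m] window_count_nonneg)
    have I_nonneg: "0 \<le> ?I \<omega>" if "\<omega> \<in> configs" for \<omega> by (rule nn_integral_time(2)[OF pW that pW_nonneg])
    have intU: "integrable M ?U"
      by (intro Bochner_Integration.integrable_add Bochner_Integration.integrable_diff intJ intN Bochner_Integration.integrable_sum campbell(2))
    have EU: "(\<integral>\<omega>. ?U \<omega> \<partial>M) = (\<integral>\<omega>. C * (1 + ?N \<omega>) \<partial>M)"
    proof -
      have s: "integrable M (\<lambda>\<omega>. \<Sum>j\<in>UNIV. integral {0..1} (\<lambda>t. ?H j t \<omega> * lam j \<omega> t))"
        by (intro Bochner_Integration.integrable_sum campbell(2))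
      have "(\<integral>\<omega>. ?U \<omega> \<partial>M) = (\<integral>\<omega>. ?J \<omega> \<partial>M) - (\<integral>\<omega>. (\<Sum>j\<in>UNIV. integral {0..1} (\<lambda>t. ?H j t \<omega> * lam j \<omega> t)) \<partial>M)
        + (\<integral>\<omega>. C * (1 + ?N \<omega>) \<partial>M)"
        using Bochner_Integration.integral_add[OF Bochner_Integration.integrable_diff[OF intJ s] intN]
          Bochner_Integration.integral_diff[OF intJ s] by presburger
      also have "(\<integral>\<omega>. (\<Sum>j\<in>UNIV. integral {0..1} (\<lambda>t. ?H j t \<omega> * lam j \<omega> t)) \<partial>M) = (\<integral>\<omega>. ?J \<omega> \<partial>M)"
        unfolding EJ by (intro Bochner_Integration.integral_sum campbell(2))
      finally show ?thesis by simp
    qed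
    have time: "(\<integral>\<^sup>+\<omega>. ennreal (?I \<omega>) \<partial>M) = (\<integral>\<^sup>+\<omega>. ennreal (?pW 0 \<omega>) \<partial>M)"
    proof -
      have "(\<integral>\<^sup>+\<omega>. ennreal (?I \<omega>) \<partial>M) = (\<integral>\<^sup>+\<omega>. \<integral>\<^sup>+t. ennreal (?pW t \<omega>) * indicator {0<..1} t \<partial>lborel \<partial>M)"
        by (intro nn_integral_cong nn_integral_time(1)[OF pW _ pW_nonneg, symmetric]) (simp add: space_M)
      also have "\<dots> = ennreal 1 * (\<integral>\<^sup>+\<omega>. ennreal (?pW 0 \<omega>) \<partial>M)"
      proof (rule nn_integral_time_stationary[OF pW(1)])
        show "?pW t \<omega> = ?pW 0 (shift_config (- t) \<omega>)" for t \<omega> by (simp only: potential_shift[of t] window_count_shift[of t])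
      qed simp
      finally show ?thesis by simp
    qed
    have "(\<integral>\<^sup>+\<omega>. ennreal (?I \<omega>) \<partial>M) \<le> (\<integral>\<^sup>+\<omega>. ennreal (2 / leak * ?U \<omega>) \<partial>M)"
    proof (intro nn_integral_mono ennreal_leI)
      fix \<omega> assume "\<omega> \<in> space M"
      then have "leak / 2 * ?I \<omega> \<le> ?U \<omega>" by (intro path) (simp add: space_M)
      then show "?I \<omega> \<le> 2 / leak * ?U \<omega>" using leak_pos by (simp add: field_simps)
    qed
    also have "\<dots> = ennreal (\<integral>\<omega>. 2 / leak * ?U \<omega> \<partial>M)"
    proof (rule nn_integral_eq_integral)
      show "integrable M (\<lambda>\<omega>. 2 / leak * ?U \<omega>)" by (intro integrable_mult_right intU)
      show "AE \<omega> in M. 0 \<le> 2 / leak * ?U \<omega>"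
      proof (rule AE_I2)
        fix \<omega> assume "\<omega> \<in> space M"
        then have w: "\<omega> \<in> configs" by (simp add: space_M)
        have "0 \<le> leak / 2 * ?I \<omega>" using I_nonneg[OF w] leak_pos by simp
        then have "0 \<le> ?U \<omega>" using path[OF w] by linarith
        then show "0 \<le> 2 / leak * ?U \<omega>" using leak_pos by simp
      qed
    qed
    also have "(\<integral>\<omega>. 2 / leak * ?U \<omega> \<partial>M) = 2 / leak * (\<integral>\<omega>. C * (1 + ?N \<omega>) \<partial>M)"
      using EU by (simp only: integral_mult_right_zero)
    finally show ?thesis unfolding time .
  qed
  then show ?thesis by blast
qed

text \<open>
  Monotone convergence in the clipping level, and the domination of the number of recent points by the
  potential.
\<close>

lemma moment_finite: "(\<integral>\<^sup>+\<omega>. ennreal (real (points \<omega> {-A..<0}) ^ Suc r) \<partial>M) < \<infinity>"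
proof -
  obtain C where C: "\<And>m. 0 \<le> m \<Longrightarrow> (\<integral>\<^sup>+\<omega>. ennreal (clipped_power r m (potential 0 \<omega>) * window_count 0 \<omega>) \<partial>M) \<le> ennreal C"
    using clipped_moment_bound[of r] by blast
  let ?f = "\<lambda>n \<omega>. ennreal (clipped_power r (real n) (potential 0 \<omega>) * window_count 0 \<omega>)"
  have meas: "?f n \<in> borel_measurable M" for n
  proof -
    have "regular_process (\<lambda>t \<omega>. clipped_power r (real n) (potential t \<omega>) * window_count t \<omega>)"
      by (intro regular_mult regular_window_count regular_compose[OF regular_potential])
        (auto intro!: borel_measurable_continuous_onI continuous_at_imp_continuous_on clipped_power_isCont)
    from measurable_M[OF regular_measurable_config[OF this order_refl]] show ?thesis by simp
  qed
  have mono: "incseq (\<lambda>n. ?f n \<omega>)" for \<omega>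
    unfolding incseq_def clipped_power_def using window_count_nonneg[of 0 \<omega>]
    by (intro allI impI ennreal_leI mult_right_mono power_mono) auto
  define K where "K = (leak * A) ^ r"
  have K: "0 < K" using leak_pos A_pos by (simp add: K_def)
  have "(\<integral>\<^sup>+\<omega>. ennreal K * ennreal (real (points \<omega> {-A..<0}) ^ Suc r) \<partial>M) \<le> (\<integral>\<^sup>+\<omega>. (SUP n. ?f n \<omega>) \<partial>M)"
  proof (rule nn_integral_mono)
    fix \<omega> assume "\<omega> \<in> space M"
    then have w: "\<omega> \<in> configs" by (simp add: space_M)
    let ?N = "real (points \<omega> {-A..<0})"
    obtain n where n: "potential 0 \<omega> \<le> real n" using real_arch_simple by blast
    have V: "leak * A * ?N \<le> potential 0 \<omega>" using potential_bounds(3)[OF w, of 0] by simp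
    have NW: "?N \<le> window_count 0 \<omega>" unfolding window_count_eq of_nat_le_iff
      by (rule points_mono[OF w]) (use A_pos in auto)
    have "K * ?N ^ Suc r = (leak * A * ?N) ^ r * ?N" by (simp add: K_def power_mult_distrib mult_ac)
    also have "\<dots> \<le> potential 0 \<omega> ^ r * window_count 0 \<omega>"
      using V NW leak_pos A_pos potential_bounds(1)[OF w, of 0] by (intro mult_mono power_mono) auto
    also have "potential 0 \<omega> ^ r = clipped_power r (real n) (potential 0 \<omega>)"
      using n potential_bounds(1)[OF w, of 0] by (simp add: clipped_power_def)
    finally have "ennreal (K * ?N ^ Suc r) \<le> ?f n \<omega>" by (rule ennreal_leI)
    also have "\<dots> \<le> (SUP n. ?f n \<omega>)" by (rule SUP_upper) simp
    finally show "ennreal K * ennreal (?N ^ Suc r) \<le> (SUP n. ?f n \<omega>)" using K by (simp add: ennreal_mult)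
  qed
  also have "\<dots> = (SUP n. \<integral>\<^sup>+\<omega>. ?f n \<omega> \<partial>M)"
    by (rule nn_integral_monotone_convergence_SUP[OF _ meas]) (use mono in \<open>auto simp: incseq_def le_fun_def\<close>)
  also have "\<dots> \<le> ennreal C" by (rule SUP_least) (rule C, simp)
  finally have le: "(\<integral>\<^sup>+\<omega>. ennreal K * ennreal (real (points \<omega> {-A..<0}) ^ Suc r) \<partial>M) \<le> ennreal C" .
  have N_meas: "(\<lambda>\<omega>. ennreal (real (points \<omega> {-A..<0}) ^ Suc r)) \<in> borel_measurable M"
    using measurable_M[OF measurable_points_config[of "{-A..<0}"]] by simp
  have "ennreal K * (\<integral>\<^sup>+\<omega>. ennreal (real (points \<omega> {-A..<0}) ^ Suc r) \<partial>M) < \<infinity>"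
    using le unfolding nn_integral_cmult[OF N_meas] by (rule le_less_trans) simp
  then show ?thesis using K by (auto simp: ennreal_mult_less_top)
qed

end

end

section \<open>Weights for a subcritical matrix\<close>

lemma sum_diagonal_diff:
  fixes v :: "'n::finite \<Rightarrow> 'a::comm_ring"
  shows "(\<Sum>j\<in>UNIV. ((if i = j then z else 0) - a j) * v j) = z * v i - (\<Sum>j\<in>UNIV. a j * v j)"
proof -
  have "(\<Sum>j\<in>UNIV. (if i = j then z else 0) * v j) = (\<Sum>j\<in>UNIV. if i = j then z * v j else 0)"
    by (intro sum.cong) auto
  then show ?thesis by (simp add: left_diff_distrib sum_subtractf)
qed

lemma det_eq_0_iff_kernel:
  fixes M :: "'a::field^'n^'n"
  shows "det M = 0 \<longleftrightarrow> (\<exists>v. v \<noteq> 0 \<and> M *v v = 0)"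
proof -
  have "invertible M \<longleftrightarrow> (\<forall>v. M *v v = 0 \<longrightarrow> v = 0)"
    by (simp only: invertible_left_inverse matrix_left_invertible_ker)
  then show ?thesis unfolding invertible_det_nz by blast
qed

lemma eigenvalue_det:
  fixes M :: "'a::field^'n^'n"
  assumes "v \<noteq> 0" "M *v v = z *s v" shows "det (\<chi> i j. (if i = j then z else 0) - M $ i $ j) = 0"
  unfolding det_eq_0_iff_kernel
proof (intro exI conjI)
  show "(\<chi> i j. (if i = j then z else 0) - M $ i $ j) *v v = 0"
    using assms(2) by (simp add: vec_eq_iff matrix_vector_mult_def sum_diagonal_diff)
qed (rule assms(1))

text \<open>
  The spectral radius is defined as a maximum, which bounds the eigenvalues only because there are
  finitely many of them, namely roots of the characteristic polynomial.
\<close>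

lemma finite_eigenvalues:
  fixes M :: "complex^'n^'n"
  shows "finite {z. \<exists>v. v \<noteq> 0 \<and> M *v v = z *s v}"
proof -
  define P where "P = det (\<chi> i j. if i = j then [:- M $ i $ j, 1:] else [:- M $ i $ j:])"
  have P: "poly P z = det (\<chi> i j. (if i = j then z else 0) - M $ i $ j)" for z
    unfolding P_def det_def poly_sum poly_mult poly_prod
    by (intro sum.cong prod.cong refl arg_cong2[where f = "(*)"]) (auto simp: of_int_poly)
  define R where "R = 1 + (\<Sum>i\<in>UNIV. \<Sum>j\<in>UNIV. cmod (M $ i $ j))"
  have R: "(\<Sum>j\<in>UNIV. cmod (M $ i $ j)) < R" for i
  proof -
    have "(\<Sum>j\<in>UNIV. cmod (M $ i $ j)) \<le> (\<Sum>i\<in>UNIV. \<Sum>j\<in>UNIV. cmod (M $ i $ j))"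
      by (rule member_le_sum) (auto intro: sum_nonneg)
    then show ?thesis by (simp add: R_def)
  qed
  have "det (\<chi> i j. (if i = j then complex_of_real R else 0) - M $ i $ j) \<noteq> 0"
  proof
    assume "det (\<chi> i j. (if i = j then complex_of_real R else 0) - M $ i $ j) = 0"
    then obtain v where v: "v \<noteq> 0" "(\<chi> i j. (if i = j then complex_of_real R else 0) - M $ i $ j) *v v = 0"
      unfolding det_eq_0_iff_kernel by blast
    have Mv: "(\<Sum>j\<in>UNIV. M $ i $ j * v $ j) = of_real R * v $ i" for i
      using v(2) by (simp add: vec_eq_iff matrix_vector_mult_def sum_diagonal_diff)
    obtain i where i: "\<And>j. cmod (v $ j) \<le> cmod (v $ i)"
    proof -
      have "finite (range (\<lambda>j. cmod (v $ j)))" by simp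
      then have "Max (range (\<lambda>j. cmod (v $ j))) \<in> range (\<lambda>j. cmod (v $ j))" by (rule Max_in) simp
      then obtain i where "Max (range (\<lambda>j. cmod (v $ j))) = cmod (v $ i)" by (rule rangeE)
      then have "cmod (v $ j) \<le> cmod (v $ i)" for j
        using Max_ge[OF \<open>finite _\<close>, of "cmod (v $ j)"] by auto
      then show ?thesis by (rule that)
    qed
    have pos: "0 < cmod (v $ i)"
    proof (rule ccontr)
      assume "\<not> ?thesis"
      then have "cmod (v $ i) \<le> 0" by simp
      then have "cmod (v $ j) \<le> 0" for j using i[of j] by linarith
      then show False using v(1) by (simp add: vec_eq_iff)
    qed
    have R0: "0 \<le> R" unfolding R_def by (simp add: add_nonneg_nonneg sum_nonneg)
    have "R * cmod (v $ i) = cmod (\<Sum>j\<in>UNIV. M $ i $ j * v $ j)" using R0 by (simp add: Mv norm_mult)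
    also have "\<dots> \<le> (\<Sum>j\<in>UNIV. cmod (M $ i $ j * v $ j))" by (rule norm_sum)
    also have "\<dots> \<le> (\<Sum>j\<in>UNIV. cmod (M $ i $ j) * cmod (v $ i))"
      unfolding norm_mult by (intro sum_mono mult_left_mono i) simp
    also have "\<dots> = (\<Sum>j\<in>UNIV. cmod (M $ i $ j)) * cmod (v $ i)" by (simp add: sum_distrib_right)
    also have "\<dots> < R * cmod (v $ i)" by (intro mult_strict_right_mono R pos)
    finally show False by simp
  qed
  then have "P \<noteq> 0" using P by auto
  then have "finite {z. poly P z = 0}" by (rule poly_roots_finite)
  then show ?thesis by (rule rev_finite_subset) (use P eigenvalue_det in auto)
qed

lemma spectral_radius_ge:
  fixes M :: "real^'n^'n"
  assumes "v \<noteq> 0" "M *v v = z *s v" shows "\<bar>z\<bar> \<le> spectral_radius M"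
proof -
  let ?v = "(\<chi> i. complex_of_real (v $ i))"
  have "?v \<noteq> 0" using assms(1) by (auto simp: vec_eq_iff)
  moreover have "map_matrix complex_of_real M *v ?v = complex_of_real z *s ?v"
    using assms(2) by (simp add: vec_eq_iff matrix_vector_mult_def map_matrix_def of_real_mult[symmetric] of_real_sum[symmetric] del: of_real_mult of_real_sum)
  ultimately have "complex_of_real z \<in> {z. \<exists>v::complex^'n. v \<noteq> 0 \<and> map_matrix complex_of_real M *v v = z *s v}" by blast
  then have "cmod (complex_of_real z) \<le> spectral_radius M" unfolding spectral_radius_def
    by (intro Max_ge finite_imageI finite_eigenvalues imageI)
  then show ?thesis by simp
qed

text \<open>
  The equation \<open>x = 1 + s G\<^sup>T x\<close> is solvable for \<open>0 \<le> s \<le> 1\<close>, because no number \<open>1 / s \<ge> 1\<close> is an eigenvalue,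
  and by Cramer's rule the solution is continuous in \<open>s\<close>. A nonnegative solution is
  automatically at least \<open>1\<close>, so nonnegativity is an open and closed condition on \<open>[0, 1]\<close>; it holds at \<open>s = 0\<close>,
  hence at \<open>s = 1\<close>. This continuity argument replaces the theorem of Perron and Frobenius.
\<close>

lemma subcritical_weights:
  fixes G :: "real^'n^'n"
  assumes nonneg: "\<And>i j. 0 \<le> G $ i $ j" and sub: "spectral_radius G < 1"
  obtains u :: "'n \<Rightarrow> real" where "\<And>j. 1 \<le> u j" "\<And>j. u j = 1 + (\<Sum>i\<in>UNIV. u i * G $ i $ j)"
proof -
  define B :: "real \<Rightarrow> real^'n^'n" where "B s = (\<chi> i j. (if i = j then 1 else 0) - s * G $ j $ i)" for s
  have det: "det (B s) \<noteq> 0" if "s \<in> {0..1}" for s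
  proof
    assume "det (B s) = 0"
    have "transpose (B s) = (\<chi> i j. (if i = j then 1 else 0) - s * G $ i $ j)" by (auto simp: transpose_def B_def vec_eq_iff)
    moreover have "det (transpose (B s)) = 0" using \<open>det (B s) = 0\<close> by (simp add: det_transpose)
    ultimately have "det (\<chi> i j. (if i = j then 1 else 0) - s * G $ i $ j) = 0" by (simp only:)
    then obtain v where v: "v \<noteq> 0" "(\<chi> i j. (if i = j then 1 else 0) - s * G $ i $ j) *v v = 0"
      unfolding det_eq_0_iff_kernel by blast
    have Gv: "v $ i = s * (\<Sum>j\<in>UNIV. G $ i $ j * v $ j)" for i
    proof -
      have "(\<Sum>j\<in>UNIV. ((if i = j then 1 else 0) - s * G $ i $ j) * v $ j) = 0"
        using arg_cong[OF v(2), of "\<lambda>w. w $ i"] by (simp add: matrix_vector_mult_def)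
      then show ?thesis unfolding sum_diagonal_diff by (simp add: sum_distrib_left mult.assoc)
    qed
    have "s \<noteq> 0"
    proof
      assume "s = 0"
      then have "v $ i = 0" for i using Gv[of i] by simp
      then show False using v(1) by (simp add: vec_eq_iff)
    qed
    have "(\<Sum>j\<in>UNIV. G $ i $ j * v $ j) = 1 / s * v $ i" for i
      using Gv[of i] \<open>s \<noteq> 0\<close> by (simp add: field_simps)
    then have "G *v v = (1 / s) *s v" by (simp add: vec_eq_iff matrix_vector_mult_def)
    from spectral_radius_ge[OF v(1) this] have "1 / s \<le> spectral_radius G" by linarith
    moreover have "1 \<le> 1 / s" using that \<open>s \<noteq> 0\<close> by simp
    ultimately show False using sub by linarith
  qed
  define x where "x s = (\<chi> k. det (\<chi> i j. if j = k then 1 else B s $ i $ j) / det (B s))" for s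
  have x_eq: "x s $ j = 1 + s * (\<Sum>i\<in>UNIV. G $ i $ j * x s $ i)" if "s \<in> {0..1}" for s j
  proof -
    have "x s = (\<chi> k. det (\<chi> i j. if j = k then ((\<chi> i. 1)::real^'n) $ i else B s $ i $ j) / det (B s))"
      by (simp add: x_def cong: if_cong)
    then have "B s *v x s = (\<chi> i. 1)" using cramer[OF det[OF that], of "x s" "\<chi> i. 1"] by blast
    from arg_cong[OF this, of "\<lambda>w. w $ j"]
    have "(\<Sum>i\<in>UNIV. ((if j = i then 1 else 0) - s * G $ i $ j) * x s $ i) = 1"
      by (simp add: matrix_vector_mult_def B_def)
    then show ?thesis unfolding sum_diagonal_diff by (simp add: sum_distrib_left mult.assoc)
  qed
  have "continuous_on {0..1} x" unfolding x_def
  proof (intro continuous_on_vec_lambda continuous_on_divide)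
    have B: "continuous_on {0..1} (\<lambda>s. B s $ i $ j)" for i j
      unfolding B_def by (auto intro!: continuous_intros)
    show "continuous_on {0..1} (\<lambda>s. det (B s))" unfolding det_def
      by (intro continuous_on_sum continuous_on_mult continuous_on_const continuous_on_prod B)
    have "continuous_on {0..1} (\<lambda>s. if j = k then 1 else B s $ i $ j)" for i j k
      using B[of i j] by (cases "j = k") auto
    then show "continuous_on {0..1} (\<lambda>s. det (\<chi> i j. if j = k then 1 else B s $ i $ j))" for k
      unfolding det_def by (auto intro!: continuous_on_sum continuous_on_mult continuous_on_const continuous_on_prod)
    show "\<forall>s\<in>{0..1}. det (B s) \<noteq> 0" using det by blast
  qed
  have ge1: "1 \<le> x s $ j" if "s \<in> {0..1}" "\<And>i. 0 \<le> x s $ i" for s j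
    unfolding x_eq[OF that(1), of j] using that nonneg by (simp add: sum_nonneg)
  let ?S = "{0..1} \<inter> x -` {y. \<forall>j. 0 \<le> y $ j}"
  have S_eq: "?S = {0..1} \<inter> x -` {y. \<forall>j. 0 < y $ j}"
    using ge1 by (force intro: less_imp_le order.strict_trans2[OF zero_less_one])
  have "closed {y::real^'n. \<forall>j. 0 \<le> y $ j}"
    by (intro closed_Collect_all closed_Collect_le continuous_intros)
  then have "closedin (top_of_set {0..1}) ?S"
    by (rule continuous_closedin_preimage[OF \<open>continuous_on {0..1} x\<close>])
  moreover have "open {y::real^'n. \<forall>j. 0 < y $ j}"
  proof -
    have "open (\<Inter>j. {y::real^'n. 0 < y $ j})"
      by (intro open_INT finite ballI open_Collect_less continuous_intros)
    then show ?thesis by (simp add: Collect_all_eq)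
  qed
  then have "openin (top_of_set {0..1}) ?S" unfolding S_eq
    by (rule continuous_openin_preimage_gen[OF \<open>continuous_on {0..1} x\<close>])
  moreover have "x 0 $ j = 1" for j using x_eq[of 0 j] by simp
  then have "0 \<in> ?S" by simp
  moreover have "connected {0..1::real}" by simp
  ultimately have "?S = {0..1}" unfolding connected_clopen by blast
  then have "1 \<in> ?S" by simp
  then have nn: "0 \<le> x 1 $ j" for j by simp
  show ?thesis
  proof (rule that[of "\<lambda>j. x 1 $ j"])
    show "1 \<le> x 1 $ j" for j by (rule ge1) (use nn in auto)
    show "x 1 $ j = 1 + (\<Sum>i\<in>UNIV. x 1 $ i * G $ i $ j)" for j
      using x_eq[of 1 j] by (simp add: mult.commute)
  qed
qed

section \<open>Regularity of the Hawkes intensity\<close>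

lemma multi_indices_0: "multi_indices 0 = {[]}"
  by (auto simp: multi_indices_def)

lemma multi_indices_1: "b \<in> Basis \<Longrightarrow> [b] \<in> multi_indices 1"
  by (auto simp: multi_indices_def)

lemma times_differentiable_onD:
  assumes "times_differentiable_on 3 U f" "x \<in> U" shows "f differentiable (at x)"
  using assms(1)[unfolded times_differentiable_on_def, rule_format, of 0 "[]" x] assms(2)
  by (simp add: multi_indices_0)

lemma frechet_derivative_bound:
  fixes f :: "'a::euclidean_space \<Rightarrow> real"
  assumes f: "f differentiable (at x)" and C: "\<And>b. b \<in> Basis \<Longrightarrow> \<bar>partials [b] f x\<bar> \<le> C"
  shows "\<bar>frechet_derivative f (at x) v\<bar> \<le> real DIM('a) * C * norm v"
proof -
  let ?D = "frechet_derivative f (at x)"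
  have lin: "linear ?D" by (rule linear_frechet_derivative[OF f])
  have "?D v = ?D (\<Sum>b\<in>Basis. (v \<bullet> b) *\<^sub>R b)" by (simp add: euclidean_representation)
  also have "\<dots> = (\<Sum>b\<in>Basis. (v \<bullet> b) * ?D b)" by (simp add: linear_sum[OF lin] linear_scale[OF lin])
  finally have "\<bar>?D v\<bar> \<le> (\<Sum>b\<in>Basis. \<bar>v \<bullet> b\<bar> * \<bar>?D b\<bar>)" by (simp add: abs_mult[symmetric] sum_abs)
  also have "\<dots> \<le> (\<Sum>b\<in>(Basis::'a set). norm v * C)"
    using C by (intro sum_mono mult_mono Basis_le_norm) auto
  finally show ?thesis by (simp add: mult_ac)
qed

lemma line_deriv:
  fixes f :: "'a::euclidean_space \<Rightarrow> real"
  assumes "f differentiable (at (x + \<tau> *\<^sub>R d))"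
  shows "((\<lambda>\<tau>. f (x + \<tau> *\<^sub>R d)) has_real_derivative frechet_derivative f (at (x + \<tau> *\<^sub>R d)) d) (at \<tau>)"
proof -
  let ?D = "frechet_derivative f (at (x + \<tau> *\<^sub>R d))"
  have "(f has_derivative ?D) (at (x + \<tau> *\<^sub>R d))" using assms by (simp add: frechet_derivative_works)
  moreover have "((\<lambda>\<tau>. x + \<tau> *\<^sub>R d) has_derivative (\<lambda>t. t *\<^sub>R d)) (at \<tau>)"
    by (auto intro!: derivative_eq_intros)
  ultimately have "((\<lambda>\<tau>. f (x + \<tau> *\<^sub>R d)) has_derivative (\<lambda>t. ?D (t *\<^sub>R d))) (at \<tau>)"
    using has_derivative_compose by blast
  moreover have "(\<lambda>t. ?D (t *\<^sub>R d)) = (*) (?D d)"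
    using linear_scale[OF linear_frechet_derivative[OF assms]] by (auto simp: mult.commute)
  ultimately show ?thesis by (simp add: has_field_derivative_def)
qed

locale hawkes_model =
  fixes A :: real
    and Dom K \<Theta> \<Theta>\<^sub>0 :: "(real^'p) set"
    and \<nu> :: "real^'p \<Rightarrow> 'd::finite \<Rightarrow> real"
    and \<phi> :: "real^'p \<Rightarrow> 'd \<Rightarrow> real \<Rightarrow> real"
    and h :: "real^'p \<Rightarrow> 'd \<Rightarrow> 'd \<Rightarrow> real \<Rightarrow> real"
    and L :: "real^'p \<Rightarrow> 'd \<Rightarrow> real"
    and P :: "real^'p \<Rightarrow> 'd config measure"
  assumes A_pos: "0 < A"
    and law: "\<And>\<theta>. \<theta> \<in> \<Theta> \<Longrightarrow> stationary_hawkes_law A \<nu> \<phi> h \<theta> (P \<theta>)"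
    and cond_a: "condition_a A Dom K \<Theta> \<Theta>\<^sub>0 \<nu> \<phi> h"
    and cond_b: "condition_b A Dom K h"
    and cond_c: "condition_c A K \<Theta> \<nu> \<phi> h L"
begin

abbreviation "X \<equiv> attainable_predictors A \<nu> h K"
abbreviation "lam \<equiv> intensity A \<nu> \<phi> h"
abbreviation "pred \<equiv> linear_predictor A \<nu> h"
abbreviation "\<Phi> i \<equiv> (\<lambda>(\<theta>, x). \<phi> \<theta> i x)"

lemma convex_K: "convex K" and \<Theta>_K: "\<Theta> \<subseteq> K" and \<Theta>\<^sub>0_\<Theta>: "\<Theta>\<^sub>0 \<subseteq> \<Theta>"
proof -
  show "convex K" using cond_a unfolding condition_a_def Let_def by (elim conjE)
  show "\<Theta> \<subseteq> K" using cond_a unfolding condition_a_def Let_def by (elim conjE)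
  have "\<Theta>\<^sub>0 \<subseteq> interior \<Theta>" using cond_a unfolding condition_a_def Let_def by (elim conjE)
  then show "\<Theta>\<^sub>0 \<subseteq> \<Theta>" using interior_subset by (rule subset_trans)
qed

lemma pred_X: "\<theta> \<in> K \<Longrightarrow> \<omega> \<in> configs \<Longrightarrow> pred \<theta> i \<omega> t \<in> X i"
  unfolding attainable_predictors_def by blast

lemma link_lower: "\<exists>c>0. \<forall>i. \<forall>\<theta>\<in>K. \<forall>x\<in>X i. c \<le> \<phi> \<theta> i x"
  using cond_a unfolding condition_a_def Let_def by (elim conjE)

lemma link_growth: "\<exists>C m. \<forall>i. \<forall>n\<le>3. \<forall>bs\<in>multi_indices n. \<forall>\<theta>\<in>K. \<forall>x\<in>X i.
          \<bar>partials bs (\<Phi> i) (\<theta>, x)\<bar> \<le> C * (1 + \<bar>x\<bar>) ^ m"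
  using cond_a unfolding condition_a_def Let_def by (elim conjE)

lemma baseline_bound: "\<exists>C. \<forall>i. \<forall>n\<le>3. \<forall>bs\<in>multi_indices n. \<forall>\<theta>\<in>K. \<bar>partials bs (\<lambda>\<theta>. \<nu> \<theta> i) \<theta>\<bar> \<le> C"
  using cond_a unfolding condition_a_def Let_def by (elim conjE)

lemma kernel_bound: "\<exists>C. \<forall>i j. \<forall>n\<le>3. \<forall>bs\<in>multi_indices n. \<forall>u\<in>{0..A}. \<forall>\<theta>\<in>K.
        \<bar>partials bs (\<lambda>\<theta>. h \<theta> i j u) \<theta>\<bar> \<le> C"
  using cond_b unfolding condition_b_def by (elim conjE)

lemma link_open: "\<exists>W. open W \<and> K \<times> X i \<subseteq> W \<and> W \<subseteq> Dom \<times> UNIV \<and> C_on 3 W (\<Phi> i)"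
  using cond_a unfolding condition_a_def Let_def by (elim conjE allE[of _ i])

lemma baseline_differentiable: "\<theta> \<in> K \<Longrightarrow> (\<lambda>\<theta>. \<nu> \<theta> i) differentiable (at \<theta>)"
proof -
  assume "\<theta> \<in> K"
  moreover have "\<exists>U. open U \<and> K \<subseteq> U \<and> U \<subseteq> Dom \<and> C_on 3 U (\<lambda>\<theta>. \<nu> \<theta> i)"
    using cond_a unfolding condition_a_def Let_def by (elim conjE allE[of _ i])
  ultimately show ?thesis unfolding C_on_def by (blast intro: times_differentiable_onD)
qed

lemma kernel_differentiable:
  assumes "\<theta> \<in> K" "u \<in> {0..A}" shows "(\<lambda>\<theta>. h \<theta> i j u) differentiable (at \<theta>)"
proof -
  have "\<exists>U. open U \<and> K \<subseteq> U \<and> U \<subseteq> Dom \<and> (\<forall>u\<in>{0..A}. times_differentiable_on 3 U (\<lambda>\<theta>. h \<theta> i j u))"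
    using cond_b unfolding condition_b_def by blast
  then show ?thesis using assms by (blast intro: times_differentiable_onD)
qed

lemma link_differentiable:
  assumes "\<theta> \<in> K" "x \<in> X i" shows "\<Phi> i differentiable (at (\<theta>, x))"
proof -
  obtain W where W: "K \<times> X i \<subseteq> W" "C_on 3 W (\<Phi> i)" using link_open by blast
  have "(\<theta>, x) \<in> W" using W(1) assms by blast
  with W(2) show ?thesis unfolding C_on_def by (intro times_differentiable_onD) auto
qed

lemma kernel_continuous:
  assumes "\<theta> \<in> K" shows "continuous_on {0..A} (h \<theta> i j)"
proof -
  have "\<forall>i j. \<forall>n\<le>3. \<forall>bs\<in>multi_indices n. continuous_on ({0..A} \<times> K) (\<lambda>(u, \<theta>). partials bs (\<lambda>\<theta>. h \<theta> i j u) \<theta>)"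
    using cond_b unfolding condition_b_def by (elim conjE)
  from this[rule_format, of 0 "[]" i j]
  have "continuous_on ({0..A} \<times> K) (\<lambda>(u, \<theta>). h \<theta> i j u)" by (simp add: multi_indices_0)
  then have "continuous_on {0..A} (\<lambda>u. (\<lambda>(u, \<theta>). h \<theta> i j u) (u, \<theta>))"
    by (rule continuous_on_compose2) (use assms in \<open>auto intro!: continuous_intros\<close>)
  then show ?thesis by simp
qed

text \<open>
  The kernel extended to the whole line by its values at the end points. The shot noise sees only ages in
  \<open>[0, A]\<close>, where nothing is changed, and the extension is continuous everywhere.
\<close>

definition ext_kernel :: "real^'p \<Rightarrow> 'd \<Rightarrow> 'd \<Rightarrow> real \<Rightarrow> real" where
  "ext_kernel \<theta> i j u = h \<theta> i j (max 0 (min A u))"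

lemma ext_kernel_cont: "\<theta> \<in> K \<Longrightarrow> isCont (ext_kernel \<theta> i j) u"
proof -
  assume "\<theta> \<in> K"
  then have "continuous_on UNIV (ext_kernel \<theta> i j)" unfolding ext_kernel_def[abs_def]
    by (intro continuous_on_compose2[OF kernel_continuous]) (use A_pos in \<open>auto intro!: continuous_intros\<close>)
  then show ?thesis by (simp add: continuous_on_eq_continuous_at)
qed

lemma ext_kernel_eq: "u \<in> {0..A} \<Longrightarrow> ext_kernel \<theta> i j u = h \<theta> i j u"
  by (simp add: ext_kernel_def min_absorb2 max_absorb2)

lemma pred_eq: "pred \<theta> i \<omega> t = \<nu> \<theta> i + (\<Sum>j\<in>UNIV. shot_noise (ext_kernel \<theta> i j) A j t \<omega>)"
  unfolding linear_predictor_def shot_noise_def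
  by (intro arg_cong2[where f = "(+)"] refl sum.cong) (auto simp: kernel_def ext_kernel_eq)

lemma regular_pred: "\<theta> \<in> K \<Longrightarrow> regular_process (\<lambda>t \<omega>. pred \<theta> i \<omega> t)"
  unfolding pred_eq
  by (intro regular_add regular_const regular_sum regular_shot_noise ext_kernel_cont A_pos) auto

text \<open>
  The link is controlled only near the attainable predictors. It is replaced by zero outside an open set of continuity containing all values of the predictor, which changes nothing along the path.
\<close>

lemma regular_lam:
  assumes \<theta>: "\<theta> \<in> K" shows "regular_process (\<lambda>t \<omega>. lam \<theta> i \<omega> t)"
proof -
  obtain W where W: "open W" "K \<times> X i \<subseteq> W" "C_on 3 W (\<Phi> i)" using link_open by blast
  have cont: "continuous_on W (\<Phi> i)"
  proof -
    have "\<forall>n\<le>3. \<forall>bs\<in>multi_indices n. continuous_on W (partials bs (\<Phi> i))" using W(3) unfolding C_on_def by (rule conjunct2)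
    from this[rule_format, of 0 "[]"] show ?thesis by (simp add: multi_indices_0)
  qed
  define S where "S = {x. (\<theta>, x) \<in> W}"
  have "open ((\<lambda>x. (\<theta>, x)) -` W)" by (rule open_vimage[OF W(1)]) (intro continuous_intros)
  then have S: "open S" by (simp add: S_def vimage_def)
  have "continuous_on S (\<lambda>x. \<Phi> i (\<theta>, x))"
    by (rule continuous_on_compose2[OF cont]) (auto simp: S_def intro!: continuous_intros)
  then have cS: "continuous_on S (\<phi> \<theta> i)" by simp
  let ?f = "\<lambda>x. if x \<in> S then \<phi> \<theta> i x else 0"
  have "regular_process (\<lambda>t \<omega>. ?f (pred \<theta> i \<omega> t))"
  proof (rule regular_compose[OF regular_pred[OF \<theta>]])
    show "?f \<in> borel_measurable borel"
      by (rule borel_measurable_continuous_on_if) (use S cS in auto)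
    fix t :: real and \<omega> :: "'d config" assume "\<omega> \<in> configs"
    then have x: "pred \<theta> i \<omega> t \<in> S" using pred_X[OF \<theta>] W(2) \<theta> by (auto simp: S_def)
    have "isCont (\<phi> \<theta> i) (pred \<theta> i \<omega> t)" using cS S x continuous_on_eq_continuous_at by blast
    moreover have "\<forall>\<^sub>F y in nhds (pred \<theta> i \<omega> t). ?f y = \<phi> \<theta> i y"
      using eventually_nhds_in_open[OF S x] by eventually_elim simp
    ultimately show "isCont ?f (pred \<theta> i \<omega> t)" by (subst isCont_cong)
  qed
  then show ?thesis
  proof (rule regular_cong)
    fix t and \<omega> :: "'d config" assume "\<omega> \<in> configs"
    then have "pred \<theta> i \<omega> t \<in> S" using pred_X[OF \<theta>] W(2) \<theta> by (auto simp: S_def)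
    then show "lam \<theta> i \<omega> t = ?f (pred \<theta> i \<omega> t)" by (simp add: intensity_def)
  qed
qed

lemma lam_local:
  "(\<And>j. \<omega> j \<inter> {t - A..<t} = \<omega>' j \<inter> {t - A..<t}) \<Longrightarrow> lam \<theta> i \<omega> t = lam \<theta> i \<omega>' t"
  by (simp add: intensity_def linear_predictor_def)

lemma uniform_bounds:
  obtains C where "0 \<le> C" "\<And>i \<theta>. \<theta> \<in> K \<Longrightarrow> \<bar>\<nu> \<theta> i\<bar> \<le> C"
    "\<And>i j \<theta> u. \<theta> \<in> K \<Longrightarrow> u \<in> {0..A} \<Longrightarrow> \<bar>h \<theta> i j u\<bar> \<le> C"
    "\<And>i \<theta> d. \<theta> \<in> K \<Longrightarrow> \<bar>frechet_derivative (\<lambda>\<theta>. \<nu> \<theta> i) (at \<theta>) d\<bar> \<le> C * norm d"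
    "\<And>i j \<theta> u d. \<theta> \<in> K \<Longrightarrow> u \<in> {0..A} \<Longrightarrow> \<bar>frechet_derivative (\<lambda>\<theta>. h \<theta> i j u) (at \<theta>) d\<bar> \<le> C * norm d"
proof -
  obtain C1 where C1: "\<And>i n bs \<theta>. n \<le> 3 \<Longrightarrow> bs \<in> multi_indices n \<Longrightarrow> \<theta> \<in> K \<Longrightarrow> \<bar>partials bs (\<lambda>\<theta>. \<nu> \<theta> i) \<theta>\<bar> \<le> C1"
    using baseline_bound by metis
  obtain C2 where C2: "\<And>i j n bs u \<theta>. n \<le> 3 \<Longrightarrow> bs \<in> multi_indices n \<Longrightarrow> u \<in> {0..A} \<Longrightarrow> \<theta> \<in> K \<Longrightarrow>
      \<bar>partials bs (\<lambda>\<theta>. h \<theta> i j u) \<theta>\<bar> \<le> C2"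
    using kernel_bound by metis
  define C where "C = (1 + real DIM(real^'p)) * (\<bar>C1\<bar> + \<bar>C2\<bar>)"
  have C: "0 \<le> C" "C1 \<le> C" "C2 \<le> C" "real DIM(real^'p) * C1 \<le> C" "real DIM(real^'p) * C2 \<le> C"
  proof -
    have n: "0 \<le> real DIM(real^'p) * \<bar>C1\<bar>" "0 \<le> real DIM(real^'p) * \<bar>C2\<bar>" by simp_all
    have C_eq: "C = \<bar>C1\<bar> + \<bar>C2\<bar> + real DIM(real^'p) * \<bar>C1\<bar> + real DIM(real^'p) * \<bar>C2\<bar>" by (simp add: C_def algebra_simps)
    have "real DIM(real^'p) * C1 \<le> real DIM(real^'p) * \<bar>C1\<bar>" "real DIM(real^'p) * C2 \<le> real DIM(real^'p) * \<bar>C2\<bar>"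
      by (intro mult_left_mono) auto
    then show "0 \<le> C" "C1 \<le> C" "C2 \<le> C" "real DIM(real^'p) * C1 \<le> C" "real DIM(real^'p) * C2 \<le> C"
      using n unfolding C_eq by linarith+
  qed
  have f1: "\<bar>\<nu> \<theta> i\<bar> \<le> C" if "\<theta> \<in> K" for \<theta> i
    using C1[of 0 "[]" \<theta> i] C that by (simp add: multi_indices_0)
  have f2: "\<bar>h \<theta> i j u\<bar> \<le> C" if "\<theta> \<in> K" "u \<in> {0..A}" for \<theta> i j u
    using C2[of 0 "[]" u \<theta> i j] C that by (simp add: multi_indices_0)
  have f3: "\<bar>frechet_derivative (\<lambda>\<theta>. \<nu> \<theta> i) (at \<theta>) d\<bar> \<le> C * norm d" if "\<theta> \<in> K" for \<theta> i d
  proof -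
    have "\<bar>frechet_derivative (\<lambda>\<theta>. \<nu> \<theta> i) (at \<theta>) d\<bar> \<le> real DIM(real^'p) * C1 * norm d"
      by (rule frechet_derivative_bound[OF baseline_differentiable[OF that] C1[OF _ multi_indices_1]]) (use that in auto)
    also have "\<dots> \<le> C * norm d" by (intro mult_right_mono C) simp
    finally show ?thesis .
  qed
  have f4: "\<bar>frechet_derivative (\<lambda>\<theta>. h \<theta> i j u) (at \<theta>) d\<bar> \<le> C * norm d" if "\<theta> \<in> K" "u \<in> {0..A}" for \<theta> i j u d
  proof -
    have "\<bar>frechet_derivative (\<lambda>\<theta>. h \<theta> i j u) (at \<theta>) d\<bar> \<le> real DIM(real^'p) * C2 * norm d"
      by (rule frechet_derivative_bound[OF kernel_differentiable[OF that] C2[OF _ multi_indices_1]]) (use that in auto)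
    also have "\<dots> \<le> C * norm d" by (intro mult_right_mono C) simp
    finally show ?thesis .
  qed
  show ?thesis
  proof (rule that[of C])
    show "0 \<le> C" by (rule C(1))
  qed (rule f1 f2 f3 f4; assumption)+
qed

lemma sum_window_bound:
  fixes a :: "'d \<Rightarrow> real \<Rightarrow> real"
  assumes "\<And>j s. s \<in> \<omega> j \<inter> {t - A..<t} \<Longrightarrow> \<bar>a j s\<bar> \<le> C"
  shows "\<bar>\<Sum>j\<in>UNIV. \<Sum>s\<in>\<omega> j \<inter> {t - A..<t}. a j s\<bar> \<le> C * real (points \<omega> {t - A..<t})"
proof -
  have "\<bar>\<Sum>j\<in>UNIV. \<Sum>s\<in>\<omega> j \<inter> {t - A..<t}. a j s\<bar> \<le> (\<Sum>j\<in>UNIV. \<Sum>s\<in>\<omega> j \<inter> {t - A..<t}. \<bar>a j s\<bar>)"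
    by (rule order_trans[OF sum_abs sum_mono[OF sum_abs]])
  also have "\<dots> \<le> (\<Sum>j\<in>UNIV. \<Sum>s\<in>\<omega> j \<inter> {t - A..<t}. C)" by (intro sum_mono assms)
  also have "\<dots> = C * real (points \<omega> {t - A..<t})" by (simp add: points_def sum_distrib_left mult.commute)
  finally show ?thesis .
qed

text \<open>
  The mean value theorem along the segment from \<open>\<theta>'\<close> to \<open>\<theta>\<close>, which lies in the convex set \<open>K\<close>. The
  derivative of the predictor is bounded by a multiple of the number of recent points, and the derivative
  of the link grows polynomially in the predictor, hence in that number.
\<close>

lemma lam_lipschitz:
  "\<exists>C\<ge>0. \<exists>m. \<forall>\<theta>\<in>K. \<forall>\<theta>'\<in>K. \<forall>i. \<forall>\<omega>\<in>configs. \<forall>t.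
     \<bar>lam \<theta> i \<omega> t - lam \<theta>' i \<omega> t\<bar> \<le> C * norm (\<theta> - \<theta>') * (1 + real (points \<omega> {t - A..<t})) ^ m"
proof (rule uniform_bounds)
  fix C assume C: "0 \<le> C" and \<nu>: "\<And>i \<theta>. \<theta> \<in> K \<Longrightarrow> \<bar>\<nu> \<theta> i\<bar> \<le> C"
    and h: "\<And>i j \<theta> u. \<theta> \<in> K \<Longrightarrow> u \<in> {0..A} \<Longrightarrow> \<bar>h \<theta> i j u\<bar> \<le> C"
    and d\<nu>: "\<And>i \<theta> d. \<theta> \<in> K \<Longrightarrow> \<bar>frechet_derivative (\<lambda>\<theta>. \<nu> \<theta> i) (at \<theta>) d\<bar> \<le> C * norm d"
    and dh: "\<And>i j \<theta> u d. \<theta> \<in> K \<Longrightarrow> u \<in> {0..A} \<Longrightarrow> \<bar>frechet_derivative (\<lambda>\<theta>. h \<theta> i j u) (at \<theta>) d\<bar> \<le> C * norm d"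
  obtain C' m where link: "\<And>i n bs \<theta> x. n \<le> 3 \<Longrightarrow> bs \<in> multi_indices n \<Longrightarrow> \<theta> \<in> K \<Longrightarrow> x \<in> X i \<Longrightarrow>
      \<bar>partials bs (\<Phi> i) (\<theta>, x)\<bar> \<le> C' * (1 + \<bar>x\<bar>) ^ m"
    using link_growth by metis
  let ?D = "real DIM((real^'p) \<times> real)"
  define C'' where "C'' = \<bar>C'\<bar> * (1 + C) ^ m"
  have C'': "0 \<le> C''" using C by (simp add: C''_def)
  have pred_bound: "1 + \<bar>pred \<theta> i \<omega> t\<bar> \<le> (1 + C) * (1 + real (points \<omega> {t - A..<t}))" if "\<theta> \<in> K" for \<theta> i \<omega> t
  proof -
    have "\<bar>\<Sum>j\<in>UNIV. \<Sum>s\<in>\<omega> j \<inter> {t - A..<t}. kernel A h \<theta> i j (t - s)\<bar> \<le> C * real (points \<omega> {t - A..<t})"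
      by (rule sum_window_bound) (use that in \<open>auto simp: kernel_def intro!: h\<close>)
    then have "\<bar>pred \<theta> i \<omega> t\<bar> \<le> C + C * real (points \<omega> {t - A..<t})"
      unfolding linear_predictor_def using \<nu>[OF that, of i] by linarith
    then show ?thesis by (simp add: algebra_simps)
  qed
  have link_bound: "\<bar>partials bs (\<Phi> i) (\<theta>, pred \<theta> i \<omega> t)\<bar> \<le> C'' * (1 + real (points \<omega> {t - A..<t})) ^ m"
    if "n \<le> 3" "bs \<in> multi_indices n" "\<theta> \<in> K" "\<omega> \<in> configs" for n bs i \<theta> \<omega> t
  proof -
    have "\<bar>partials bs (\<Phi> i) (\<theta>, pred \<theta> i \<omega> t)\<bar> \<le> C' * (1 + \<bar>pred \<theta> i \<omega> t\<bar>) ^ m"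
      by (rule link[OF that(1-3) pred_X[OF that(3,4)]])
    also have "\<dots> \<le> \<bar>C'\<bar> * ((1 + C) * (1 + real (points \<omega> {t - A..<t}))) ^ m"
      by (intro mult_mono power_mono pred_bound that) auto
    finally show ?thesis by (simp add: C''_def power_mult_distrib mult_ac)
  qed
  define B where "B = ?D * C'' * (2 + C)"
  have B: "0 \<le> B" using C C'' by (simp add: B_def)
  have bound: "\<bar>lam \<theta> i \<omega> t - lam \<theta>' i \<omega> t\<bar> \<le> B * norm (\<theta> - \<theta>') * (1 + real (points \<omega> {t - A..<t})) ^ (m + 1)"
    if \<theta>: "\<theta> \<in> K" and \<theta>': "\<theta>' \<in> K" and w: "\<omega> \<in> configs" for \<theta> \<theta>' i \<omega> t
  proof -
    let ?N = "real (points \<omega> {t - A..<t})" and ?\<delta> = "\<theta> - \<theta>'"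
    let ?\<gamma> = "\<lambda>\<tau>::real. \<theta>' + \<tau> *\<^sub>R ?\<delta>"
    have \<gamma>: "?\<gamma> \<tau> \<in> K" if "0 \<le> \<tau>" "\<tau> \<le> 1" for \<tau>
    proof -
      have "(1 - \<tau>) *\<^sub>R \<theta>' + \<tau> *\<^sub>R \<theta> \<in> K" using convexD[OF convex_K \<theta>' \<theta>, of "1 - \<tau>" \<tau>] that by simp
      then show ?thesis by (simp add: algebra_simps)
    qed
    define x where "x \<tau> = pred (?\<gamma> \<tau>) i \<omega> t" for \<tau>
    define x' where "x' \<tau> = frechet_derivative (\<lambda>\<theta>. \<nu> \<theta> i) (at (?\<gamma> \<tau>)) ?\<delta> +
      (\<Sum>j\<in>UNIV. \<Sum>s\<in>\<omega> j \<inter> {t - A..<t}. frechet_derivative (\<lambda>\<theta>. h \<theta> i j (t - s)) (at (?\<gamma> \<tau>)) ?\<delta>)" for \<tau>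
    have x_eq: "x \<tau> = \<nu> (?\<gamma> \<tau>) i + (\<Sum>j\<in>UNIV. \<Sum>s\<in>\<omega> j \<inter> {t - A..<t}. h (?\<gamma> \<tau>) i j (t - s))" for \<tau>
      unfolding x_def linear_predictor_def by (intro arg_cong2[where f = "(+)"] refl sum.cong) (auto simp: kernel_def)
    have dx: "(x has_real_derivative x' \<tau>) (at \<tau>)" if "0 \<le> \<tau>" "\<tau> \<le> 1" for \<tau>
      unfolding x_eq[abs_def] x'_def
      by (intro DERIV_add DERIV_sum line_deriv baseline_differentiable kernel_differentiable \<gamma> that) auto
    have x'_bound: "\<bar>x' \<tau>\<bar> \<le> (1 + C) * norm ?\<delta> * (1 + ?N)" if "0 \<le> \<tau>" "\<tau> \<le> 1" for \<tau>
    proof -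
      have "\<bar>\<Sum>j\<in>UNIV. \<Sum>s\<in>\<omega> j \<inter> {t - A..<t}. frechet_derivative (\<lambda>\<theta>. h \<theta> i j (t - s)) (at (?\<gamma> \<tau>)) ?\<delta>\<bar> \<le> (C * norm ?\<delta>) * ?N"
        by (rule sum_window_bound) (rule dh[OF \<gamma>[OF that]], auto)
      then have "\<bar>x' \<tau>\<bar> \<le> C * norm ?\<delta> + (C * norm ?\<delta>) * ?N"
        unfolding x'_def using d\<nu>[OF \<gamma>[OF that], of i ?\<delta>] by linarith
      also have "\<dots> = C * norm ?\<delta> * (1 + ?N)" by (simp add: algebra_simps)
      also have "\<dots> \<le> (1 + C) * norm ?\<delta> * (1 + ?N)" by (intro mult_right_mono) auto
      finally show ?thesis .
    qed
    let ?\<psi>' = "\<lambda>\<tau>. frechet_derivative (\<Phi> i) (at (?\<gamma> \<tau>, x \<tau>)) (?\<delta>, x' \<tau>)"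
    have d\<psi>: "((\<lambda>\<tau>. \<Phi> i (?\<gamma> \<tau>, x \<tau>)) has_real_derivative ?\<psi>' \<tau>) (at \<tau>)" if "0 \<le> \<tau>" "\<tau> \<le> 1" for \<tau>
    proof -
      have diff: "\<Phi> i differentiable (at (?\<gamma> \<tau>, x \<tau>))"
        unfolding x_def by (rule link_differentiable[OF \<gamma>[OF that] pred_X[OF \<gamma>[OF that] w]])
      have "((\<lambda>\<tau>. (?\<gamma> \<tau>, x \<tau>)) has_derivative (\<lambda>r. (r *\<^sub>R ?\<delta>, x' \<tau> * r))) (at \<tau>)"
        using dx[OF that] by (intro has_derivative_Pair) (auto intro!: derivative_eq_intros simp: has_field_derivative_def)
      from has_derivative_compose[OF this, of "\<Phi> i" "frechet_derivative (\<Phi> i) (at (?\<gamma> \<tau>, x \<tau>))"] diff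
      have "((\<lambda>\<tau>. \<Phi> i (?\<gamma> \<tau>, x \<tau>)) has_derivative (\<lambda>r. frechet_derivative (\<Phi> i) (at (?\<gamma> \<tau>, x \<tau>)) (r *\<^sub>R ?\<delta>, x' \<tau> * r))) (at \<tau>)"
        by (simp add: frechet_derivative_works[symmetric])
      moreover have "frechet_derivative (\<Phi> i) (at (?\<gamma> \<tau>, x \<tau>)) (r *\<^sub>R ?\<delta>, x' \<tau> * r) = ?\<psi>' \<tau> * r" for r
        using linear_scale[OF linear_frechet_derivative[OF diff], of r "(?\<delta>, x' \<tau>)"] by (simp add: mult.commute)
      ultimately show ?thesis by (simp add: has_field_derivative_def)
    qed
    have \<psi>'_bound: "\<bar>?\<psi>' \<tau>\<bar> \<le> ?D * C'' * (2 + C) * norm ?\<delta> * (1 + ?N) ^ (m + 1)" if "0 \<le> \<tau>" "\<tau> \<le> 1" for \<tau>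
    proof -
      have "\<bar>?\<psi>' \<tau>\<bar> \<le> ?D * (C'' * (1 + ?N) ^ m) * norm (?\<delta>, x' \<tau>)"
        unfolding x_def
        by (rule frechet_derivative_bound[OF link_differentiable[OF \<gamma>[OF that] pred_X[OF \<gamma>[OF that] w]]])
          (rule link_bound[OF _ multi_indices_1 \<gamma>[OF that] w], auto)
      also have "\<dots> \<le> ?D * (C'' * (1 + ?N) ^ m) * ((2 + C) * norm ?\<delta> * (1 + ?N))"
      proof (rule mult_left_mono)
        have "norm (?\<delta>, x' \<tau>) \<le> norm ?\<delta> + \<bar>x' \<tau>\<bar>" using norm_Pair_le[of ?\<delta> "x' \<tau>"] by simp
        also have "\<dots> \<le> norm ?\<delta> * (1 + ?N) + (1 + C) * norm ?\<delta> * (1 + ?N)"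
          using x'_bound[OF that] by (intro add_mono) (auto simp: mult_le_cancel_left1)
        also have "\<dots> = (2 + C) * norm ?\<delta> * (1 + ?N)" by (simp add: algebra_simps)
        finally show "norm (?\<delta>, x' \<tau>) \<le> (2 + C) * norm ?\<delta> * (1 + ?N)" .
      qed (use C'' in simp)
      also have "\<dots> = ?D * C'' * (2 + C) * norm ?\<delta> * (1 + ?N) ^ (m + 1)" by (simp only: power_add power_one_right mult_ac)
      finally show ?thesis .
    qed
    obtain z where z: "0 < z" "z < 1" "\<Phi> i (?\<gamma> 1, x 1) - \<Phi> i (?\<gamma> 0, x 0) = (1 - 0) * ?\<psi>' z"
      using MVT2[of 0 1 "\<lambda>\<tau>. \<Phi> i (?\<gamma> \<tau>, x \<tau>)" ?\<psi>', OF zero_less_one d\<psi>] by blast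
    have "lam \<theta> i \<omega> t - lam \<theta>' i \<omega> t = \<Phi> i (?\<gamma> 1, x 1) - \<Phi> i (?\<gamma> 0, x 0)"
      by (simp add: x_def intensity_def)
    then have "\<bar>lam \<theta> i \<omega> t - lam \<theta>' i \<omega> t\<bar> \<le> ?D * C'' * (2 + C) * (norm ?\<delta> * (1 + ?N) ^ (m + 1))"
      using z \<psi>'_bound[of z] by (simp add: mult.assoc)
    then show ?thesis by (simp add: B_def mult.assoc)
  qed
  show ?thesis
    by (intro exI[of _ B] conjI exI[of _ "m + 1"] ballI allI B bound; assumption)
qed

end

section \<open>Comparison of two stationary laws\<close>

lemma regular_power: "regular_process H \<Longrightarrow> regular_process (\<lambda>t \<omega>. H t \<omega> ^ q)"
  by (induction q) (simp_all add: regular_const regular_mult)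

context stationary_process
begin

lemma regular_recent_count: "regular_process (\<lambda>t \<omega>. real (points \<omega> {t - A..<t}))"
  unfolding points_shot_noise by (intro regular_sum regular_shot_noise A_pos) auto

lemma nn_integral_window_power:
  assumes T: "0 < T" and K: "0 \<le> K"
  shows "(\<integral>\<^sup>+\<omega>. \<integral>\<^sup>+t. ennreal (K * (1 + real (points \<omega> {t - A..<t})) ^ q) * indicator {0<..T} t \<partial>lborel \<partial>M) =
    ennreal (K * T) * (\<integral>\<^sup>+\<omega>. ennreal ((1 + real (points \<omega> {- A..<0})) ^ q) \<partial>M)"
proof -
  let ?H = "\<lambda>t \<omega>. K * (1 + real (points \<omega> {t - A..<t})) ^ q"
  have regular: "regular_process ?H"
    by (intro regular_cmult regular_power regular_add regular_const regular_recent_count)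
  have shift: "?H t \<omega> = ?H 0 (shift_config (- t) \<omega>)" for t and \<omega> :: "'d config"
    unfolding points_shot_noise by (simp add: shot_noise_shift)
  have meas: "(\<lambda>\<omega>. ennreal ((1 + real (points \<omega> {0 - A..<0})) ^ q)) \<in> borel_measurable M"
  proof (rule measurable_M)
    have [measurable]: "(\<lambda>\<omega>::'d config. real (points \<omega> {0 - A..<0})) \<in> borel_measurable config_algebra"
      by (rule measurable_points_config) auto
    show "(\<lambda>\<omega>::'d config. ennreal ((1 + real (points \<omega> {0 - A..<0})) ^ q)) \<in> borel_measurable config_algebra"
      by measurable
  qed
  have "(\<integral>\<^sup>+\<omega>. \<integral>\<^sup>+t. ennreal (?H t \<omega>) * indicator {0<..T} t \<partial>lborel \<partial>M) = ennreal T * (\<integral>\<^sup>+\<omega>. ennreal (?H 0 \<omega>) \<partial>M)"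
    by (rule nn_integral_time_stationary[OF regular shift T])
  also have "(\<integral>\<^sup>+\<omega>. ennreal (?H 0 \<omega>) \<partial>M) = ennreal K * (\<integral>\<^sup>+\<omega>. ennreal ((1 + real (points \<omega> {0 - A..<0})) ^ q) \<partial>M)"
    unfolding ennreal_mult'[OF K] by (rule nn_integral_cmult[OF meas])
  finally show ?thesis using T K by (simp add: ennreal_mult' mult_ac)
qed

end

text \<open>
  Write \<open>\<ell>\<close> for the log-likelihood ratio. On \<open>E\<close> the inequality \<open>ln x \<le> x - 1\<close> gives \<open>- \<ell> \<le> U\<close>, where \<open>U\<close> is the
  sum of \<open>\<lambda> / \<lambda>' - 1\<close> over the points minus \<open>\<integral> (\<Lambda> - \<Lambda>')\<close>, whose mean under \<open>M\<close> is the mean of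
  \<open>\<integral> \<Sum> (\<lambda> - \<lambda>')\<^sup>2 / \<lambda>'\<close>. The variable \<open>exp \<ell> + U\<close> is nonnegative and dominates \<open>- \<ell>\<close>, and
  the change of measure gives the mean of \<open>exp \<ell>\<close> on \<open>E\<close>, namely the probability of \<open>E\<close>. Markov's inequality bounds the
  probability of \<open>\<ell> < - s\<close>; elsewhere \<open>M'\<close> retains at least the fraction \<open>exp (- s)\<close> of \<open>M\<close>.
\<close>

lemma two_point_bound:
  fixes M M' :: "'d::finite config measure"
  assumes H: "stationary_process M lam c A b" and H': "hawkes_process M' lam' c A b"
    and local: "\<And>i \<omega> \<omega>' t. \<omega> \<in> configs \<Longrightarrow> \<omega>' \<in> configs \<Longrightarrow>
      (\<And>j. \<omega> j \<inter> {t - A..<t} = \<omega>' j \<inter> {t - A..<t}) \<Longrightarrow> lam' i \<omega> t = lam' i \<omega>' t"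
    and diff: "\<And>i \<omega> t. \<omega> \<in> configs \<Longrightarrow> \<bar>lam i \<omega> t - lam' i \<omega> t\<bar> \<le> \<eta> * (1 + real (points \<omega> {t - A..<t})) ^ m"
    and moment: "(\<integral>\<^sup>+\<omega>. ennreal ((1 + real (points \<omega> {- A..<0})) ^ (2 * m)) \<partial>M) \<le> ennreal \<mu>"
    and \<eta>: "0 \<le> \<eta>" and \<mu>: "0 \<le> \<mu>" and T: "0 < T" and X: "X \<in> sets (observed {-A..T})" and s: "0 < s"
  defines "E \<equiv> void_event (\<lambda>_. {-A..0}) :: 'd config set"
  assumes p': "0 < measure M' E"
  shows "measure M' E * exp (- s) * (measure M (X \<inter> E) - (measure M E + real CARD('d) * (\<eta>\<^sup>2 * \<mu> * T / c)) / s)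
    \<le> measure M E * measure M' (X \<inter> E)"
proof -
  interpret stationary_process M lam c A b by (rule H)
  interpret p: hawkes_process M' lam' c A b by (rule H')
  let ?w = "\<lambda>t \<omega>. 1 + real (points \<omega> {t - A..<t})"
  let ?l = "\<lambda>\<omega>. log_likelihood lam' T \<omega> - log_likelihood lam T \<omega>"
  let ?I = "\<lambda>\<omega>. indicator E \<omega> :: real"
  let ?d = "\<lambda>i t \<omega>. lam i \<omega> t - lam' i \<omega> t"
  let ?h = "\<lambda>i t \<omega>. ?I \<omega> * (?d i t \<omega> / lam' i \<omega> t)"
  let ?j = "\<lambda>i t \<omega>. ?I \<omega> * (?d i t \<omega> * ?d i t \<omega> / lam' i \<omega> t)"
  have E_obs: "E \<in> sets (observed {..0})" unfolding E_def by (rule void_event_past)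
  have E_M: "E \<in> sets M" unfolding E_def by (rule void_event_past_M)
  have E_configs: "E \<subseteq> configs" by (auto simp: E_def void_event_def)
  have X_cfg: "X \<in> sets config_algebra"
    using X sets_observed_subset[of "{-A..T}"] by auto
  have l_meas: "?l \<in> borel_measurable M"
    using T by (intro measurable_M borel_measurable_diff measurable_log_likelihood p.measurable_log_likelihood) auto
  have inv_bounded: "locally_bounded (\<lambda>t \<omega>. inverse (lam' i \<omega> t))" for i
    by (rule locally_bounded_le[OF locally_bounded_const[of "inverse c"]])
      (use p.lam_ge p.lam_pos c_pos in \<open>auto simp: less_imp_le le_imp_inverse_le\<close>)
  have d: "regular_process (?d i)" "locally_bounded (?d i)" for i
    by (intro regular_diff regular_lam p.regular_lam locally_bounded_diff bounded_lam p.bounded_lam)+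
  have I: "regular_process (\<lambda>t. ?I)" "locally_bounded (\<lambda>t. ?I)"
    by (rule regular_indicator[OF E_obs], rule locally_bounded_le[OF locally_bounded_const[of 1]]) (simp add: indicator_def)
  have lam'_nz: "lam' i \<omega> t \<noteq> 0" if "\<omega> \<in> configs" for i \<omega> t using p.lam_pos[OF that, of i t] by simp
  have h: "regular_process (?h i)" "locally_bounded (?h i)" for i
    by (intro regular_mult regular_divide I d p.regular_lam lam'_nz; assumption)
      (unfold divide_inverse, intro locally_bounded_mult I d inv_bounded)
  have j: "regular_process (?j i)" "locally_bounded (?j i)" for i
    by (intro regular_mult regular_divide I d p.regular_lam lam'_nz; assumption)
      (unfold divide_inverse, intro locally_bounded_mult I d inv_bounded)
  have j_nonneg: "0 \<le> ?j i t \<omega>" if "\<omega> \<in> configs" for i t \<omega>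
    using p.lam_pos[OF that, of i t] by (simp add: indicator_def)
  have sq: "?d i t \<omega> * ?d i t \<omega> / lam' i \<omega> t \<le> \<eta>\<^sup>2 / c * ?w t \<omega> ^ (2 * m)" if w: "\<omega> \<in> configs" for i t \<omega>
  proof -
    have "?d i t \<omega> * ?d i t \<omega> = \<bar>?d i t \<omega>\<bar>\<^sup>2" by (simp add: power2_eq_square)
    also have "\<dots> \<le> (\<eta> * ?w t \<omega> ^ m)\<^sup>2" by (rule power_mono[OF diff[OF w]]) simp
    also have "\<dots> = \<eta>\<^sup>2 * ?w t \<omega> ^ (2 * m)" by (simp only: power_mult_distrib power_mult[symmetric] mult.commute)
    finally have "?d i t \<omega> * ?d i t \<omega> / lam' i \<omega> t \<le> (\<eta>\<^sup>2 * ?w t \<omega> ^ (2 * m)) / c"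
      using p.lam_ge[OF w, of i t] c_pos by (intro frac_le) auto
    then show ?thesis by simp
  qed
  have j_le: "?j i t \<omega> \<le> \<eta>\<^sup>2 / c * ?w t \<omega> ^ (2 * m)" if w: "\<omega> \<in> configs" for i t \<omega>
  proof -
    have "?j i t \<omega> \<le> ?d i t \<omega> * ?d i t \<omega> / lam' i \<omega> t"
      using p.lam_pos[OF w, of i t] by (simp add: indicator_def)
    also note sq[OF w]
    finally show ?thesis .
  qed
  have nn_j: "(\<integral>\<^sup>+\<omega>. \<integral>\<^sup>+t. ennreal (?j i t \<omega>) * indicator {0<..T} t \<partial>lborel \<partial>M) \<le> ennreal (\<eta>\<^sup>2 * \<mu> * T / c)" for i
  proof -
    have "(\<integral>\<^sup>+\<omega>. \<integral>\<^sup>+t. ennreal (?j i t \<omega>) * indicator {0<..T} t \<partial>lborel \<partial>M) \<le>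
        (\<integral>\<^sup>+\<omega>. \<integral>\<^sup>+t. ennreal (\<eta>\<^sup>2 / c * ?w t \<omega> ^ (2 * m)) * indicator {0<..T} t \<partial>lborel \<partial>M)"
      using j_le by (intro nn_integral_mono mult_right_mono ennreal_leI) (auto simp: space_M)
    also have "\<dots> = ennreal (\<eta>\<^sup>2 / c * T) * (\<integral>\<^sup>+\<omega>. ennreal ((1 + real (points \<omega> {- A..<0})) ^ (2 * m)) \<partial>M)"
      by (rule nn_integral_window_power[OF T]) (use c_pos in simp)
    also have "\<dots> \<le> ennreal (\<eta>\<^sup>2 / c * T) * ennreal \<mu>" by (rule mult_left_mono[OF moment]) simp
    also have "\<dots> = ennreal (\<eta>\<^sup>2 * \<mu> * T / c)"
      using c_pos T \<mu> by (simp add: ennreal_mult[symmetric] mult_ac)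
    finally show ?thesis .
  qed
  \<comment> \<open>For finiteness in the Campbell formula; the intensity is at most the other one plus the difference.\<close>
  have h_lam: "\<bar>?h i t \<omega>\<bar> * lam i \<omega> t \<le> (\<eta> + \<eta>\<^sup>2 / c) * ?w t \<omega> ^ (2 * m)" if w: "\<omega> \<in> configs" for i t \<omega>
  proof -
    have pos: "0 < lam' i \<omega> t" by (rule p.lam_pos[OF w])
    have "\<bar>?h i t \<omega>\<bar> * lam i \<omega> t \<le> \<bar>?d i t \<omega>\<bar> / lam' i \<omega> t * (lam' i \<omega> t + \<bar>?d i t \<omega>\<bar>)"
      using pos lam_pos[OF w, of i t] by (intro mult_mono) (auto simp: indicator_def abs_mult)
    also have "\<dots> = \<bar>?d i t \<omega>\<bar> + ?d i t \<omega> * ?d i t \<omega> / lam' i \<omega> t"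
      using pos by (simp add: field_simps)
    also have "\<dots> \<le> \<eta> * ?w t \<omega> ^ (2 * m) + \<eta>\<^sup>2 / c * ?w t \<omega> ^ (2 * m)"
    proof (rule add_mono[OF _ sq[OF w]])
      have "?w t \<omega> ^ m \<le> ?w t \<omega> ^ (2 * m)" by (rule power_increasing) auto
      then show "\<bar>?d i t \<omega>\<bar> \<le> \<eta> * ?w t \<omega> ^ (2 * m)"
        using diff[OF w, of i t] \<eta> by (meson mult_left_mono order_trans)
    qed
    finally show ?thesis by (simp only: distrib_right)
  qed
  have fin: "(\<integral>\<^sup>+\<omega>. \<integral>\<^sup>+t. ennreal (\<bar>?h i t \<omega>\<bar> * lam i \<omega> t) * indicator {0<..T} t \<partial>lborel \<partial>M) < \<infinity>" for i
  proof -
    have "(\<integral>\<^sup>+\<omega>. \<integral>\<^sup>+t. ennreal (\<bar>?h i t \<omega>\<bar> * lam i \<omega> t) * indicator {0<..T} t \<partial>lborel \<partial>M) \<le>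
        (\<integral>\<^sup>+\<omega>. \<integral>\<^sup>+t. ennreal ((\<eta> + \<eta>\<^sup>2 / c) * ?w t \<omega> ^ (2 * m)) * indicator {0<..T} t \<partial>lborel \<partial>M)"
      using h_lam by (intro nn_integral_mono mult_right_mono ennreal_leI) (auto simp: space_M)
    also have "\<dots> = ennreal ((\<eta> + \<eta>\<^sup>2 / c) * T) * (\<integral>\<^sup>+\<omega>. ennreal ((1 + real (points \<omega> {- A..<0})) ^ (2 * m)) \<partial>M)"
      by (rule nn_integral_window_power[OF T]) (use c_pos \<eta> in simp)
    also have "\<dots> < \<infinity>" using moment by (auto simp: ennreal_mult_less_top intro: le_less_trans)
    finally show ?thesis .
  qed
  note camp = campbell[OF T h fin]
  define S where "S i \<omega> = (\<Sum>s\<in>\<omega> i \<inter> {0<..T}. ?h i s \<omega>)" for i \<omega>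
  define B where "B i \<omega> = integral {0..T} (\<lambda>u. ?h i u \<omega> * lam i \<omega> u)" for i \<omega>
  define J where "J i \<omega> = integral {0..T} (\<lambda>u. ?j i u \<omega>)" for i \<omega>
  have S_int: "integrable M (S i)" and B_int: "integrable M (B i)" and SB: "(\<integral>\<omega>. S i \<omega> \<partial>M) = (\<integral>\<omega>. B i \<omega> \<partial>M)" for i
    unfolding S_def B_def by (rule camp)+
  have J_nn: "(\<integral>\<^sup>+\<omega>. ennreal (J i \<omega>) \<partial>M) \<le> ennreal (\<eta>\<^sup>2 * \<mu> * T / c)" and J_nonneg: "\<omega> \<in> configs \<Longrightarrow> 0 \<le> J i \<omega>" for i \<omega>
  proof -
    have time: "(\<integral>\<^sup>+t. ennreal (?j i t \<omega>) * indicator {0<..T} t \<partial>lborel) = ennreal (J i \<omega>) \<and> 0 \<le> J i \<omega>"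
      if w: "\<omega> \<in> configs" for \<omega>
      unfolding J_def
      using nn_integral_time[where H = "?j i" and T = T and \<omega> = \<omega>, OF j[of i] w j_nonneg[OF w]] by blast
    have "(\<integral>\<^sup>+\<omega>. ennreal (J i \<omega>) \<partial>M) = (\<integral>\<^sup>+\<omega>. \<integral>\<^sup>+t. ennreal (?j i t \<omega>) * indicator {0<..T} t \<partial>lborel \<partial>M)"
    proof (rule nn_integral_cong)
      fix \<omega> assume "\<omega> \<in> space M"
      then have "\<omega> \<in> configs" by (simp only: space_M)
      from time[OF this] show "ennreal (J i \<omega>) = (\<integral>\<^sup>+t. ennreal (?j i t \<omega>) * indicator {0<..T} t \<partial>lborel)" by (simp only:)
    qed
    also note nn_j[of i]
    finally show "(\<integral>\<^sup>+\<omega>. ennreal (J i \<omega>) \<partial>M) \<le> ennreal (\<eta>\<^sup>2 * \<mu> * T / c)" .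
    show "0 \<le> J i \<omega>" if "\<omega> \<in> configs" using time[OF that] by blast
  qed
  have J_meas: "J i \<in> borel_measurable M" for i
  proof (rule measurable_M)
    have "0 \<le> T" using T by simp
    from regular_measurable_config[OF regular_integral[OF j[of i]] this]
    show "J i \<in> borel_measurable config_algebra" unfolding J_def[abs_def] .
  qed
  have J_int: "integrable M (J i)" for i
  proof (rule integrableI_nonneg[OF J_meas])
    show "AE \<omega> in M. 0 \<le> J i \<omega>" using J_nonneg by (auto simp: space_M)
    show "(\<integral>\<^sup>+\<omega>. ennreal (J i \<omega>) \<partial>M) < \<infinity>" using J_nn[of i] by (simp add: le_less_trans)
  qed
  have J_le: "(\<integral>\<omega>. J i \<omega> \<partial>M) \<le> \<eta>\<^sup>2 * \<mu> * T / c" for i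
    using J_nonneg J_nn[of i] \<mu> T c_pos
    by (subst integral_eq_nn_integral[OF J_meas]) (auto simp: space_M intro!: enn2real_leI)
  define U where "U \<omega> = (\<Sum>i\<in>UNIV. S i \<omega> - B i \<omega> + J i \<omega>)" for \<omega>
  have U_int: "integrable M U" unfolding U_def by (intro Bochner_Integration.integrable_sum Bochner_Integration.integrable_add Bochner_Integration.integrable_diff S_int B_int J_int)
  have U_le: "(\<integral>\<omega>. U \<omega> \<partial>M) \<le> real CARD('d) * (\<eta>\<^sup>2 * \<mu> * T / c)"
  proof -
    have "(\<integral>\<omega>. U \<omega> \<partial>M) = (\<Sum>i\<in>UNIV. \<integral>\<omega>. J i \<omega> \<partial>M)"
      unfolding U_def using S_int B_int J_int SB
      by (subst Bochner_Integration.integral_sum) (auto intro!: sum.cong)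
    also have "\<dots> \<le> (\<Sum>i\<in>(UNIV::'d set). \<eta>\<^sup>2 * \<mu> * T / c)" by (rule sum_mono) (rule J_le)
    finally show ?thesis by simp
  qed
  have U_ge: "- ?l \<omega> \<le> U \<omega>" if wE: "\<omega> \<in> E" for \<omega>
  proof -
    have w: "\<omega> \<in> configs" using wE E_configs by blast
    have ion: "(\<lambda>u. lam i \<omega> u) integrable_on {0..T}" "(\<lambda>u. lam' i \<omega> u) integrable_on {0..T}" for i
      by (rule regular_integrable_on[OF regular_lam bounded_lam w], rule regular_integrable_on[OF p.regular_lam p.bounded_lam w])
    have BJ: "B i \<omega> - J i \<omega> = integral {0..T} (\<lambda>u. lam i \<omega> u) - integral {0..T} (\<lambda>u. lam' i \<omega> u)" for i
    proof -
      have eq: "?h i u \<omega> * lam i \<omega> u - ?j i u \<omega> = lam i \<omega> u - lam' i \<omega> u" for u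
      proof -
        have "lam' i \<omega> u \<noteq> 0" by (rule lam'_nz[OF w])
        then show ?thesis using wE by (simp add: field_simps)
      qed
      have "B i \<omega> - J i \<omega> = integral {0..T} (\<lambda>u. ?h i u \<omega> * lam i \<omega> u - ?j i u \<omega>)" unfolding B_def J_def
        by (rule Henstock_Kurzweil_Integration.integral_diff[symmetric])
          (rule regular_integrable_on[OF regular_mult[OF h(1) regular_lam] locally_bounded_mult[OF h(2) bounded_lam] w],
           rule regular_integrable_on[OF j w])
      also have "\<dots> = integral {0..T} (\<lambda>u. lam i \<omega> u - lam' i \<omega> u)" by (simp only: eq)
      also have "\<dots> = integral {0..T} (\<lambda>u. lam i \<omega> u) - integral {0..T} (\<lambda>u. lam' i \<omega> u)"
        by (rule Henstock_Kurzweil_Integration.integral_diff[OF ion])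
      finally show ?thesis .
    qed
    have S_ge: "(\<Sum>s\<in>\<omega> i \<inter> {0<..T}. ln (lam i \<omega> s)) - (\<Sum>s\<in>\<omega> i \<inter> {0<..T}. ln (lam' i \<omega> s)) \<le> S i \<omega>" for i
      unfolding S_def sum_subtractf[symmetric]
    proof (rule sum_mono)
      fix s
      have pos: "0 < lam i \<omega> s" "0 < lam' i \<omega> s" by (rule lam_pos[OF w], rule p.lam_pos[OF w])
      then have "ln (lam i \<omega> s) - ln (lam' i \<omega> s) = ln (lam i \<omega> s / lam' i \<omega> s)" by (simp add: ln_div)
      also have "\<dots> \<le> lam i \<omega> s / lam' i \<omega> s - 1" using pos by (intro ln_le_minus_one) simp
      also have "\<dots> = ?h i s \<omega>" using pos wE by (simp add: diff_divide_distrib)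
      finally show "ln (lam i \<omega> s) - ln (lam' i \<omega> s) \<le> ?h i s \<omega>" .
    qed
    have tot: "integral {0..T} (\<lambda>u. \<Sum>i\<in>UNIV. lam i \<omega> u) = (\<Sum>i\<in>UNIV. integral {0..T} (\<lambda>u. lam i \<omega> u))"
      "integral {0..T} (\<lambda>u. \<Sum>i\<in>UNIV. lam' i \<omega> u) = (\<Sum>i\<in>UNIV. integral {0..T} (\<lambda>u. lam' i \<omega> u))"
      by (intro Henstock_Kurzweil_Integration.integral_sum ion finite)+
    have "- ?l \<omega> = (\<Sum>i\<in>UNIV. ((\<Sum>s\<in>\<omega> i \<inter> {0<..T}. ln (lam i \<omega> s)) - (\<Sum>s\<in>\<omega> i \<inter> {0<..T}. ln (lam' i \<omega> s)))
        - (integral {0..T} (\<lambda>u. lam i \<omega> u) - integral {0..T} (\<lambda>u. lam' i \<omega> u)))"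
      unfolding log_likelihood_def tot sum_subtractf by simp
    also have "\<dots> \<le> (\<Sum>i\<in>UNIV. S i \<omega> - (B i \<omega> - J i \<omega>))" unfolding BJ by (intro sum_mono diff_right_mono S_ge)
    also have "\<dots> = U \<omega>" unfolding U_def by (rule sum.cong) auto
    finally show ?thesis .
  qed
  have U_zero: "U \<omega> = 0" if "\<omega> \<notin> E" for \<omega> using that by (simp add: U_def S_def B_def J_def)
  have com: "ennreal (measure M' E) * (\<integral>\<^sup>+\<omega>. indicator (Y \<inter> E) \<omega> * ennreal (exp (?l \<omega>)) \<partial>M) = ennreal (measure M E) * emeasure M' (Y \<inter> E)"
    if "Y \<in> sets (observed {-A..T})" for Y
    unfolding E_def by (rule change_of_measure[OF hawkes_process_axioms H' local T that])
  have mass: "(\<integral>\<^sup>+\<omega>. indicator E \<omega> * ennreal (exp (?l \<omega>)) \<partial>M) = ennreal (measure M E)"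
  proof -
    have "configs \<in> sets (observed {-A..T})" using sets.top[of "observed {-A..T}"] by (simp add: space_observed)
    from com[OF this] have "ennreal (measure M' E) * (\<integral>\<^sup>+\<omega>. indicator E \<omega> * ennreal (exp (?l \<omega>)) \<partial>M)
        = ennreal (measure M' E) * ennreal (measure M E)"
      using E_configs by (simp add: Int_absorb1 p.emeasure_eq_measure mult.commute)
    then show ?thesis using p' by (subst (asm) ennreal_mult_cancel_left) auto
  qed
  define R where "R \<omega> = ?I \<omega> * exp (?l \<omega>)" for \<omega>
  have R_nn: "(\<integral>\<^sup>+\<omega>. ennreal (R \<omega>) \<partial>M) = ennreal (measure M E)"
    unfolding mass[symmetric] R_def by (rule nn_integral_cong) (simp add: indicator_def)
  have R_meas: "R \<in> borel_measurable M" unfolding R_def using l_meas E_M by simp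
  have R_int: "integrable M R" and R_eq: "(\<integral>\<omega>. R \<omega> \<partial>M) = measure M E"
  proof -
    have nonneg: "AE \<omega> in M. 0 \<le> R \<omega>" by (simp add: R_def)
    show "integrable M R" by (rule integrableI_nonneg[OF R_meas nonneg]) (simp add: R_nn)
    show "(\<integral>\<omega>. R \<omega> \<partial>M) = measure M E" using integral_eq_nn_integral[OF R_meas nonneg] by (simp add: R_nn)
  qed
  let ?bad = "{\<omega> \<in> space M. \<omega> \<in> E \<and> ?l \<omega> < - s}"
  have bad: "?bad \<in> sets M" using l_meas E_M by measurable
  have bad_le: "measure M ?bad \<le> (measure M E + real CARD('d) * (\<eta>\<^sup>2 * \<mu> * T / c)) / s"
  proof -
    have "s * measure M ?bad = (\<integral>\<omega>. s * indicator ?bad \<omega> \<partial>M)" using bad by simp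
    also have "\<dots> \<le> (\<integral>\<omega>. R \<omega> + U \<omega> \<partial>M)"
    proof (rule integral_mono_AE)
      show "integrable M (\<lambda>\<omega>. s * indicator ?bad \<omega>)" 
        by (intro Bochner_Integration.integrable_mult_right integrable_real_indicator bad) (simp add: less_top[symmetric])
      show "integrable M (\<lambda>\<omega>. R \<omega> + U \<omega>)" by (rule Bochner_Integration.integrable_add[OF R_int U_int])
      have "s * indicator ?bad \<omega> \<le> R \<omega> + U \<omega>" for \<omega>
      proof (cases "\<omega> \<in> E")
        case True
        have "1 + ?l \<omega> \<le> exp (?l \<omega>)" by (rule exp_ge_add_one_self)
        then have ge: "0 \<le> exp (?l \<omega>) + U \<omega>" "- ?l \<omega> \<le> exp (?l \<omega>) + U \<omega>"
          using U_ge[OF True] exp_gt_zero[of "?l \<omega>"] by linarith+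
        show ?thesis
        proof (cases "\<omega> \<in> ?bad")
          case bad: True
          then have "s \<le> - ?l \<omega>" by simp
          with ge(2) have "s \<le> exp (?l \<omega>) + U \<omega>" by linarith
          then show ?thesis using bad True by (simp only: R_def indicator_simps mult_1_right mult_1_left)
        next
          case False
          have "s * indicator ?bad \<omega> = 0" using False by (auto simp: indicator_def)
          moreover have "R \<omega> = exp (?l \<omega>)" using True by (simp add: R_def)
          ultimately show ?thesis using ge(1) by linarith
        qed
      next
        case False
        then show ?thesis by (simp add: U_zero R_def)
      qed
      then show "AE \<omega> in M. s * indicator ?bad \<omega> \<le> R \<omega> + U \<omega>" by simp
    qed
    also have "\<dots> = measure M E + (\<integral>\<omega>. U \<omega> \<partial>M)" using R_int U_int by (simp add: R_eq)
    also have "\<dots> \<le> measure M E + real CARD('d) * (\<eta>\<^sup>2 * \<mu> * T / c)" using U_le by simp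
    finally show ?thesis using s by (simp add: pos_le_divide_eq mult.commute)
  qed
  have XE: "X \<inter> E \<in> sets M" using X_cfg E_M sets_M by auto
  have "measure M (X \<inter> E) - measure M ?bad \<le> measure M (X \<inter> E - ?bad)"
    using finite_measure_Diff'[OF XE bad] finite_measure_mono[of "X \<inter> E \<inter> ?bad" ?bad] bad by simp
  then have "exp (- s) * (measure M (X \<inter> E) - (measure M E + real CARD('d) * (\<eta>\<^sup>2 * \<mu> * T / c)) / s)
      \<le> exp (- s) * measure M (X \<inter> E - ?bad)"
    using bad_le by (intro mult_left_mono) auto
  moreover have "ennreal (exp (- s) * measure M (X \<inter> E - ?bad)) \<le> (\<integral>\<^sup>+\<omega>. indicator (X \<inter> E) \<omega> * ennreal (exp (?l \<omega>)) \<partial>M)"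
  proof -
    have "ennreal (exp (- s) * measure M (X \<inter> E - ?bad)) = (\<integral>\<^sup>+\<omega>. ennreal (exp (- s)) * indicator (X \<inter> E - ?bad) \<omega> \<partial>M)"
      using XE bad by (simp add: nn_integral_cmult_indicator emeasure_eq_measure ennreal_mult)
    also have "\<dots> \<le> (\<integral>\<^sup>+\<omega>. indicator (X \<inter> E) \<omega> * ennreal (exp (?l \<omega>)) \<partial>M)"
      by (rule nn_integral_mono) (auto simp: indicator_def intro!: ennreal_leI)
    finally show ?thesis .
  qed
  ultimately have "ennreal (exp (- s) * (measure M (X \<inter> E) - (measure M E + real CARD('d) * (\<eta>\<^sup>2 * \<mu> * T / c)) / s))
      \<le> (\<integral>\<^sup>+\<omega>. indicator (X \<inter> E) \<omega> * ennreal (exp (?l \<omega>)) \<partial>M)" (is "ennreal ?a \<le> _")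
    by (meson ennreal_leI order_trans)
  then have "ennreal (measure M' E) * ennreal ?a \<le> ennreal (measure M E) * emeasure M' (X \<inter> E)"
    unfolding com[OF X, symmetric] by (rule mult_left_mono) simp
  then have "ennreal (measure M' E * ?a) \<le> ennreal (measure M E * measure M' (X \<inter> E))"
    by (simp add: p.emeasure_eq_measure ennreal_mult')
  then have "measure M' E * ?a \<le> measure M E * measure M' (X \<inter> E)"
    by (subst (asm) ennreal_le_iff) auto
  then show ?thesis by (simp only: mult.assoc)
qed

section \<open>The stationary Hawkes laws\<close>

lemma one_plus_power_le: "(1 + x) ^ k \<le> 2 ^ k * (1 + x ^ Suc k)" if "0 \<le> x" for x :: real
proof (cases "x \<le> 1")
  case True
  then have "(1 + x) ^ k \<le> 2 ^ k" using that by (intro power_mono) auto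
  also have "\<dots> \<le> 2 ^ k * (1 + x ^ Suc k)" using that by (simp add: mult_le_cancel_left1)
  finally show ?thesis .
next
  case False
  then have "(1 + x) ^ k \<le> (2 * x) ^ k" by (intro power_mono) auto
  also have "\<dots> \<le> 2 ^ k * (1 + x ^ Suc k)"
  proof -
    have "x ^ k \<le> x ^ Suc k" using False by (intro power_increasing) auto
    then show ?thesis unfolding power_mult_distrib by (intro mult_left_mono) auto
  qed
  finally show ?thesis .
qed

lemma shift_config_measurable_law:
  assumes "sets M = sets config_algebra" shows "shift_config s \<in> M \<rightarrow>\<^sub>M config_algebra"
  unfolding measurable_cong_sets[OF assms refl] by (rule measurable_shift_config)

context hawkes_model
begin

lemma law_sets: "\<theta> \<in> \<Theta> \<Longrightarrow> sets (P \<theta>) = sets config_algebra"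
  and law_space: "\<theta> \<in> \<Theta> \<Longrightarrow> space (P \<theta>) = configs"
  and law_prob: "\<theta> \<in> \<Theta> \<Longrightarrow> prob_space (P \<theta>)"
  and law_stationary: "\<theta> \<in> \<Theta> \<Longrightarrow> distr (P \<theta>) config_algebra (shift_config s) = P \<theta>"
  and law_intensity: "\<theta> \<in> \<Theta> \<Longrightarrow> has_conditional_intensity (P \<theta>) (lam \<theta>)"
  and law_mean: "\<theta> \<in> \<Theta> \<Longrightarrow> (\<integral>\<^sup>+\<omega>. of_nat (card (\<omega> i \<inter> {0<..1})) \<partial>P \<theta>) < \<infinity>"
  using law[of \<theta>] by (auto simp: stationary_hawkes_law_def)

lemma finite_mean:
  assumes \<theta>: "\<theta> \<in> \<Theta>" shows "(\<integral>\<^sup>+\<omega>. of_nat (card (\<omega> i \<inter> {0<..T})) \<partial>P \<theta>) < \<infinity>"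
proof -
  have meas: "(\<lambda>\<omega>. of_nat (card (\<omega> i \<inter> {0<..1})) :: ennreal) \<in> borel_measurable config_algebra"
    by (rule measurable_compose[OF measurable_card]) auto
  have unit: "(\<integral>\<^sup>+\<omega>. of_nat (card (\<omega> i \<inter> {real k<..real k + 1})) \<partial>P \<theta>) = (\<integral>\<^sup>+\<omega>. of_nat (card (\<omega> i \<inter> {0<..1})) \<partial>P \<theta>)"
    and meas': "(\<lambda>\<omega>. of_nat (card (\<omega> i \<inter> {real k<..real k + 1})) :: ennreal) \<in> borel_measurable (P \<theta>)" for k
  proof -
    have "{x. x + - real k \<in> {0<..1}} = {real k<..real k + 1}" by auto
    then have eq: "card (shift_config (- real k) \<omega> i \<inter> {0<..1}) = card (\<omega> i \<inter> {real k<..real k + 1})" for \<omega> :: "'d config"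
      by (simp only: card_shift_config)
    have sh: "shift_config (- real k) \<in> P \<theta> \<rightarrow>\<^sub>M config_algebra" by (rule shift_config_measurable_law[OF law_sets[OF \<theta>]])
    have "(\<lambda>\<omega>. of_nat (card (\<omega> i \<inter> {0<..1})) :: ennreal) \<in> borel_measurable (distr (P \<theta>) config_algebra (shift_config (- real k)))"
      using meas by (simp only: measurable_distr_eq1)
    from nn_integral_distr[OF sh this]
    show "(\<integral>\<^sup>+\<omega>. of_nat (card (\<omega> i \<inter> {real k<..real k + 1})) \<partial>P \<theta>) = (\<integral>\<^sup>+\<omega>. of_nat (card (\<omega> i \<inter> {0<..1})) \<partial>P \<theta>)"
      by (simp add: law_stationary[OF \<theta>] eq)
    show "(\<lambda>\<omega>. of_nat (card (\<omega> i \<inter> {real k<..real k + 1})) :: ennreal) \<in> borel_measurable (P \<theta>)"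
      using measurable_compose[OF sh meas] by (simp add: eq)
  qed
  let ?n = "nat \<lceil>T\<rceil>"
  have "(\<integral>\<^sup>+\<omega>. of_nat (card (\<omega> i \<inter> {0<..T})) \<partial>P \<theta>) \<le>
      (\<integral>\<^sup>+\<omega>. (\<Sum>k<?n. of_nat (card (\<omega> i \<inter> {real k<..real k + 1}))) \<partial>P \<theta>)"
  proof (rule nn_integral_mono)
    fix \<omega> assume "\<omega> \<in> space (P \<theta>)"
    then have w: "\<omega> \<in> configs" by (simp add: law_space[OF \<theta>])
    have sub: "\<omega> i \<inter> {0<..T} \<subseteq> (\<Union>k<?n. \<omega> i \<inter> {real k<..real k + 1})"
    proof
      fix x assume x: "x \<in> \<omega> i \<inter> {0<..T}"
      let ?k = "nat (\<lceil>x\<rceil> - 1)"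
      have k: "real ?k = of_int \<lceil>x\<rceil> - 1" using x by (simp add: of_nat_nat)
      have "\<lceil>x\<rceil> \<le> \<lceil>T\<rceil>" using x by (intro ceiling_mono) auto
      then have "?k < ?n" using x by (auto simp: zless_nat_conj)
      moreover have "x \<in> {real ?k<..real ?k + 1}" unfolding k using ceiling_correct[of x] by auto
      ultimately show "x \<in> (\<Union>k<?n. \<omega> i \<inter> {real k<..real k + 1})" using x by blast
    qed
    have "card (\<omega> i \<inter> {0<..T}) \<le> card (\<Union>k<?n. \<omega> i \<inter> {real k<..real k + 1})"
    proof (rule card_mono[OF _ sub])
      have "finite (\<omega> i \<inter> {real k<..real k + 1})" for k by (rule config_finite[OF w]) simp
      then show "finite (\<Union>k<?n. \<omega> i \<inter> {real k<..real k + 1})" by blast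
    qed
    also have "\<dots> \<le> (\<Sum>k<?n. card (\<omega> i \<inter> {real k<..real k + 1}))" by (rule card_UN_le) simp
    finally show "(of_nat (card (\<omega> i \<inter> {0<..T})) :: ennreal) \<le> (\<Sum>k<?n. of_nat (card (\<omega> i \<inter> {real k<..real k + 1})))"
      by (simp only: of_nat_sum[symmetric] of_nat_le_iff)
  qed
  also have "\<dots> = (\<Sum>k<?n. \<integral>\<^sup>+\<omega>. of_nat (card (\<omega> i \<inter> {real k<..real k + 1})) \<partial>P \<theta>)"
    by (rule nn_integral_sum) (rule meas')
  also have "\<dots> < \<infinity>" unfolding unit using law_mean[OF \<theta>, of i] by (simp add: ennreal_mult_less_top ennreal_of_nat_eq_real_of_nat)
  finally show ?thesis .
qed

lemma empty_config: "(\<lambda>_. {}) \<in> (configs :: 'd config set)"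
  by (simp add: configs_def)

lemma lipschitz: "\<theta> \<in> \<Theta> \<Longrightarrow> (L \<theta> i)-lipschitz_on (X i) (\<phi> \<theta> i)"
  using cond_c unfolding condition_c_def by blast

lemma L_nonneg: "\<theta> \<in> \<Theta> \<Longrightarrow> 0 \<le> L \<theta> i"
  using lipschitz lipschitz_on_nonneg by blast

text \<open>
  The Lipschitz condition, applied between the actual predictor and the baseline, which is attained by the
  empty configuration.
\<close>

lemma lam_linear:
  assumes \<theta>: "\<theta> \<in> \<Theta>" and w: "\<omega> \<in> configs"
  shows "lam \<theta> i \<omega> t \<le> \<bar>\<phi> \<theta> i (\<nu> \<theta> i)\<bar> + (\<Sum>j\<in>UNIV. shot_noise (\<lambda>u. L \<theta> i * \<bar>ext_kernel \<theta> i j u\<bar>) A j t \<omega>)"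
proof -
  have \<theta>K: "\<theta> \<in> K" using \<theta> \<Theta>_K by blast
  have base: "\<nu> \<theta> i \<in> X i" using pred_X[OF \<theta>K empty_config, of i 0] by (simp add: linear_predictor_def)
  have "\<phi> \<theta> i (pred \<theta> i \<omega> t) - \<phi> \<theta> i (\<nu> \<theta> i) \<le> L \<theta> i * \<bar>pred \<theta> i \<omega> t - \<nu> \<theta> i\<bar>"
    using lipschitz_onD[OF lipschitz[OF \<theta>] pred_X[OF \<theta>K w, of i t] base] by (simp add: dist_real_def abs_le_iff)
  also have "\<dots> \<le> L \<theta> i * (\<Sum>j\<in>UNIV. shot_noise (\<lambda>u. \<bar>ext_kernel \<theta> i j u\<bar>) A j t \<omega>)"
  proof (rule mult_left_mono[OF _ L_nonneg[OF \<theta>]])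
    have "\<bar>pred \<theta> i \<omega> t - \<nu> \<theta> i\<bar> \<le> (\<Sum>j\<in>UNIV. \<bar>shot_noise (ext_kernel \<theta> i j) A j t \<omega>\<bar>)" unfolding pred_eq by simp
    also have "\<dots> \<le> (\<Sum>j\<in>UNIV. shot_noise (\<lambda>u. \<bar>ext_kernel \<theta> i j u\<bar>) A j t \<omega>)"
      unfolding shot_noise_def by (intro sum_mono sum_abs)
    finally show "\<bar>pred \<theta> i \<omega> t - \<nu> \<theta> i\<bar> \<le> (\<Sum>j\<in>UNIV. shot_noise (\<lambda>u. \<bar>ext_kernel \<theta> i j u\<bar>) A j t \<omega>)" .
  qed
  also have "\<dots> = (\<Sum>j\<in>UNIV. shot_noise (\<lambda>u. L \<theta> i * \<bar>ext_kernel \<theta> i j u\<bar>) A j t \<omega>)"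
    by (simp add: shot_noise_def sum_distrib_left)
  finally show ?thesis unfolding intensity_def by linarith
qed

lemma lam_growth:
  assumes \<theta>: "\<theta> \<in> \<Theta>"
  shows "\<exists>B. \<forall>i. \<forall>\<omega>\<in>configs. \<forall>t. lam \<theta> i \<omega> t \<le> B * (1 + real (points \<omega> {t - A..<t}))"
proof (rule uniform_bounds)
  fix C assume C: "0 \<le> C" and hC: "\<And>i j \<theta> u. \<theta> \<in> K \<Longrightarrow> u \<in> {0..A} \<Longrightarrow> \<bar>h \<theta> i j u\<bar> \<le> C"
  have \<theta>K: "\<theta> \<in> K" using \<theta> \<Theta>_K by blast
  define B where "B = (\<Sum>i\<in>UNIV. \<bar>\<phi> \<theta> i (\<nu> \<theta> i)\<bar> + L \<theta> i * C)"
  have B: "\<bar>\<phi> \<theta> i (\<nu> \<theta> i)\<bar> + L \<theta> i * C \<le> B" for i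
    unfolding B_def by (rule member_le_sum) (use C L_nonneg[OF \<theta>] in auto)
  show ?thesis
  proof (intro exI[of _ B] allI ballI)
    fix i t and \<omega> :: "'d config" assume w: "\<omega> \<in> configs"
    let ?N = "real (points \<omega> {t - A..<t})"
    have "(\<Sum>j\<in>UNIV. shot_noise (\<lambda>u. L \<theta> i * \<bar>ext_kernel \<theta> i j u\<bar>) A j t \<omega>) \<le> (\<Sum>j\<in>UNIV. shot_noise (\<lambda>u. L \<theta> i * C) A j t \<omega>)"
      unfolding shot_noise_def
    proof (intro sum_mono mult_left_mono L_nonneg[OF \<theta>])
      fix j s assume "s \<in> \<omega> j \<inter> {t - A..<t}"
      then show "\<bar>ext_kernel \<theta> i j (t - s)\<bar> \<le> C" using hC[OF \<theta>K, of "t - s"] by (simp add: ext_kernel_eq)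
    qed
    also have "\<dots> = L \<theta> i * C * ?N" by (simp add: shot_noise_def points_def sum_distrib_left mult.commute)
    finally have "lam \<theta> i \<omega> t \<le> \<bar>\<phi> \<theta> i (\<nu> \<theta> i)\<bar> + L \<theta> i * C * ?N" using lam_linear[OF \<theta> w, of i t] by linarith
    also have "\<dots> \<le> B + B * ?N"
      using B[of i] C L_nonneg[OF \<theta>, of i] by (intro add_mono mult_right_mono) (auto intro: order_trans[OF _ B[of i]])
    finally show "lam \<theta> i \<omega> t \<le> B * (1 + ?N)" by (simp add: distrib_left)
  qed
qed

lemma stationary_process_law:
  assumes \<theta>: "\<theta> \<in> \<Theta>" and c: "0 < c" "\<And>i \<omega> t. \<omega> \<in> configs \<Longrightarrow> c \<le> lam \<theta> i \<omega> t"
    and B: "\<And>i \<omega> t. \<omega> \<in> configs \<Longrightarrow> lam \<theta> i \<omega> t \<le> B * (1 + real (points \<omega> {t - A..<t}))"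
  shows "stationary_process (P \<theta>) (lam \<theta>) c A B"
proof (intro stationary_process.intro hawkes_process.intro counting_process.intro
    stationary_process_axioms.intro hawkes_process_axioms.intro)
  have \<theta>K: "\<theta> \<in> K" using \<theta> \<Theta>_K by blast
  show "locally_bounded (\<lambda>t \<omega>. lam \<theta> i \<omega> t)" for i
    unfolding locally_bounded_def
  proof (intro ballI allI)
    fix \<omega> :: "'d config" and T assume w: "\<omega> \<in> configs"
    have B0: "0 \<le> B"
    proof -
      have "points (\<lambda>_::'d. {}) {0 - A..<0} = 0" by (simp add: points_def)
      then have "c \<le> B" using c(2)[OF empty_config, of i 0] B[OF empty_config, of i 0] by simp
      then show ?thesis using c(1) by simp
    qed
    have "\<bar>lam \<theta> i \<omega> t\<bar> \<le> B * (1 + real (points \<omega> {-A..T}))" if "t \<in> {0..T}" for t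
    proof -
      have "points \<omega> {t - A..<t} \<le> points \<omega> {-A..T}" by (rule points_mono[OF w]) (use that in auto)
      then have "B * (1 + real (points \<omega> {t - A..<t})) \<le> B * (1 + real (points \<omega> {-A..T}))" by (intro mult_left_mono B0) simp
      then show ?thesis using B[OF w, of i t] c(1) c(2)[OF w, of i t] by linarith
    qed
    then show "\<exists>K. \<forall>t\<in>{0..T}. \<bar>lam \<theta> i \<omega> t\<bar> \<le> K" by blast
  qed
  show "sets (P \<theta>) = sets config_algebra" by (rule law_sets[OF \<theta>])
  show "(\<integral>\<^sup>+\<omega>. of_nat (card (\<omega> i \<inter> {0<..T})) \<partial>P \<theta>) < \<infinity>" for i T by (rule finite_mean[OF \<theta>])
  show "regular_process (\<lambda>t \<omega>. lam \<theta> i \<omega> t)" for i by (rule regular_lam[OF \<theta>K])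
qed (use \<theta> c B A_pos in \<open>auto intro: law_prob law_intensity law_stationary\<close>)

text \<open>
  The matrix of the subcriticality condition consists exactly of the integrals of the linear majorants
  of the intensity, so its weights feed the moment bound.
\<close>

lemma window_moment_finite:
  assumes \<theta>: "\<theta> \<in> \<Theta>" and "stationary_process (P \<theta>) (lam \<theta>) c A B"
  shows "(\<integral>\<^sup>+\<omega>. ennreal ((1 + real (points \<omega> {-A..<0})) ^ k) \<partial>P \<theta>) < \<infinity>"
proof -
  interpret stationary_process "P \<theta>" "lam \<theta>" c A B by (rule assms(2))
  have \<theta>K: "\<theta> \<in> K" using \<theta> \<Theta>_K by blast
  let ?g = "\<lambda>i j u. L \<theta> i * \<bar>ext_kernel \<theta> i j u\<bar>" and ?G = "G_abs A h L \<theta>"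
  have G: "?G $ i $ j = integral {0..A} (?g i j)" for i j
  proof -
    have "integral {0..A} (\<lambda>u. \<bar>kernel A h \<theta> i j u\<bar>) = integral {0..A} (\<lambda>u. \<bar>ext_kernel \<theta> i j u\<bar>)"
      by (rule Henstock_Kurzweil_Integration.integral_cong) (simp add: kernel_def ext_kernel_eq)
    then show ?thesis by (simp add: G_abs_def)
  qed
  have g_nonneg: "0 \<le> ?g i j x" for i j x using L_nonneg[OF \<theta>] by simp
  have g_cont: "isCont (?g i j) x" for i j x
    by (intro continuous_intros ext_kernel_cont[OF \<theta>K])
  have "0 \<le> ?G $ i $ j" for i j
    unfolding G by (rule Henstock_Kurzweil_Integration.integral_nonneg) (use g_nonneg g_cont in \<open>auto intro!: integrable_continuous_interval continuous_at_imp_continuous_on\<close>)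
  moreover have "spectral_radius ?G < 1"
  proof -
    obtain e where "0 < e" "\<forall>\<theta>\<in>\<Theta>. spectral_radius (G_abs A h L \<theta>) \<le> 1 - e"
      using cond_c unfolding condition_c_def by blast
    with \<theta> have "spectral_radius ?G \<le> 1 - e" by blast
    with \<open>0 < e\<close> show ?thesis by linarith
  qed
  ultimately obtain u where u: "\<And>j. 1 \<le> u j" "\<And>j. u j = 1 + (\<Sum>i\<in>UNIV. u i * ?G $ i $ j)"
    by (rule subcritical_weights) blast
  have mom: "(\<integral>\<^sup>+\<omega>. ennreal (real (points \<omega> {-A..<0}) ^ Suc k) \<partial>P \<theta>) < \<infinity>"
    by (rule moment_finite[where g = ?g and u = u and \<beta> = "\<lambda>i. \<bar>\<phi> \<theta> i (\<nu> \<theta> i)\<bar>"])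
      (rule g_cont g_nonneg lam_linear[OF \<theta>] u(1) u(2)[unfolded G] abs_ge_zero; assumption?)+
  have meas: "(\<lambda>\<omega>. ennreal (real (points \<omega> {-A..<0}) ^ Suc k)) \<in> borel_measurable (P \<theta>)"
  proof (rule measurable_M)
    have [measurable]: "(\<lambda>\<omega>::'d config. real (points \<omega> {- A..<0})) \<in> borel_measurable config_algebra"
      by (rule measurable_points_config) auto
    show "(\<lambda>\<omega>::'d config. ennreal (real (points \<omega> {-A..<0}) ^ Suc k)) \<in> borel_measurable config_algebra" by measurable
  qed
  have "(\<integral>\<^sup>+\<omega>. ennreal ((1 + real (points \<omega> {-A..<0})) ^ k) \<partial>P \<theta>) \<le>
      (\<integral>\<^sup>+\<omega>. ennreal (2 ^ k) * (1 + ennreal (real (points \<omega> {-A..<0}) ^ Suc k)) \<partial>P \<theta>)"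
  proof (rule nn_integral_mono)
    fix \<omega> :: "'d config"
    have "ennreal ((1 + real (points \<omega> {-A..<0})) ^ k) \<le> ennreal (2 ^ k * (1 + real (points \<omega> {-A..<0}) ^ Suc k))"
      by (intro ennreal_leI one_plus_power_le) simp
    also have "\<dots> = ennreal (2 ^ k) * (1 + ennreal (real (points \<omega> {-A..<0}) ^ Suc k))"
      by (subst ennreal_mult, simp, simp, subst ennreal_plus, simp, simp, simp only: ennreal_1)
    finally show "ennreal ((1 + real (points \<omega> {-A..<0})) ^ k) \<le> ennreal (2 ^ k) * (1 + ennreal (real (points \<omega> {-A..<0}) ^ Suc k))" .
  qed
  also have "\<dots> = ennreal (2 ^ k) * (1 + (\<integral>\<^sup>+\<omega>. ennreal (real (points \<omega> {-A..<0}) ^ Suc k) \<partial>P \<theta>))"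
    using meas by (simp add: nn_integral_cmult nn_integral_add emeasure_space_1 del: power_Suc)
  also have "\<dots> < \<infinity>" using mom by (simp add: ennreal_mult_less_top del: power_Suc)
  finally show ?thesis .
qed

end

section \<open>The lower bound\<close>

text \<open>
  Either the estimator misses \<open>\<theta>\<close> on half of the event \<open>E\<close>, or it is close to \<open>\<theta>\<close> there, hence far from \<open>\<theta>'\<close>,
  and the two-point bound transfers this to \<open>M'\<close>. The level \<open>s = 4 (1 + q) / p\<^sub>0\<close> makes the
  error term of that bound at most \<open>p\<^sub>0 / 4\<close>.
\<close>

lemma two_point_risk:
  fixes M M' :: "'d::finite config measure" and \<theta> \<theta>' :: "'a::{real_normed_vector, second_countable_topology}"
  assumes H: "stationary_process M lam c A b" and H': "hawkes_process M' lam' c A b"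
    and local: "\<And>i \<omega> \<omega>' t. \<omega> \<in> configs \<Longrightarrow> \<omega>' \<in> configs \<Longrightarrow>
      (\<And>j. \<omega> j \<inter> {t - A..<t} = \<omega>' j \<inter> {t - A..<t}) \<Longrightarrow> lam' i \<omega> t = lam' i \<omega>' t"
    and diff: "\<And>i \<omega> t. \<omega> \<in> configs \<Longrightarrow> \<bar>lam i \<omega> t - lam' i \<omega> t\<bar> \<le> \<eta> * (1 + real (points \<omega> {t - A..<t})) ^ m"
    and moment: "(\<integral>\<^sup>+\<omega>. ennreal ((1 + real (points \<omega> {- A..<0})) ^ (2 * m)) \<partial>M) \<le> ennreal \<mu>"
    and \<eta>: "0 \<le> \<eta>" and \<mu>: "0 \<le> \<mu>" and T: "0 < T"
    and p0: "0 < p\<^sub>0" "p\<^sub>0 \<le> measure M (void_event (\<lambda>_. {-A..0}))" "p\<^sub>0 \<le> measure M' (void_event (\<lambda>_. {-A..0}))"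
    and q: "real CARD('d) * (\<eta>\<^sup>2 * \<mu> * T / c) \<le> q" "0 \<le> q"
    and est: "est \<in> observed {-A..T} \<rightarrow>\<^sub>M borel" and sep: "2 * \<delta> \<le> norm (\<theta> - \<theta>')"
  defines "\<epsilon> \<equiv> p\<^sub>0\<^sup>2 * exp (- (4 * (1 + q) / p\<^sub>0)) / 4"
  shows "\<epsilon> \<le> measure M {\<omega> \<in> space M. \<delta> \<le> norm (est \<omega> - \<theta>)} \<or>
    \<epsilon> \<le> measure M' {\<omega> \<in> space M'. \<delta> \<le> norm (est \<omega> - \<theta>')}"
proof -
  interpret stationary_process M lam c A b by (rule H)
  interpret p: hawkes_process M' lam' c A b by (rule H')
  define E :: "'d config set" where "E = void_event (\<lambda>_. {-A..0})"
  define s where "s = 4 * (1 + q) / p\<^sub>0"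
  define X where "X = {\<omega> \<in> configs. norm (est \<omega> - \<theta>) < \<delta>}"
  note p0 = p0[folded E_def]
  have s: "0 < s" using p0(1) q(2) by (simp add: s_def)
  have E_cfg: "E \<in> sets config_algebra" unfolding E_def by (rule void_event_measurable) auto
  have obs: "(\<lambda>\<omega>. norm (est \<omega> - \<tau>)) \<in> borel_measurable (observed {-A..T})" for \<tau>
    using est by measurable
  have level: "{\<omega> \<in> configs. \<delta> \<le> norm (est \<omega> - \<tau>)} \<in> sets config_algebra" for \<tau>
  proof -
    have "{\<omega> \<in> space (observed {-A..T}). \<delta> \<le> norm (est \<omega> - \<tau>)} \<in> sets (observed {-A..T})"
      using obs by measurable
    then show ?thesis using sets_observed_subset[of "{-A..T}"] by (auto simp: space_observed)
  qed
  have X: "X \<in> sets (observed {-A..T})"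
  proof -
    have "{\<omega> \<in> space (observed {-A..T}). norm (est \<omega> - \<theta>) < \<delta>} \<in> sets (observed {-A..T})"
      using obs by measurable
    then show ?thesis by (simp add: X_def space_observed)
  qed
  then have X_cfg: "X \<in> sets config_algebra" using sets_observed_subset[of "{-A..T}"] by auto
  have \<epsilon>_le: "\<epsilon> \<le> p\<^sub>0 / 4"
  proof -
    have "p\<^sub>0 \<le> 1" using p0(2) prob_le_1 by (rule order_trans)
    then have "p\<^sub>0 * (p\<^sub>0 * exp (- s)) \<le> p\<^sub>0 * (1 * 1)" using p0(1) s by (intro mult_left_mono mult_mono) auto
    then show ?thesis unfolding \<epsilon>_def s_def[symmetric] by (simp add: power2_eq_square mult.assoc)
  qed
  show ?thesis
  proof (cases "measure M (X \<inter> E) \<le> measure M E / 2")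
    case True
    have "measure M E = measure M (X \<inter> E) + measure M (E - X)"
      using finite_measure_Diff'[of E X] E_cfg X_cfg by (simp add: sets_M Int_commute)
    also have "measure M (E - X) \<le> measure M {\<omega> \<in> space M. \<delta> \<le> norm (est \<omega> - \<theta>)}"
      using level[of \<theta>] by (intro finite_measure_mono) (auto simp: space_M sets_M X_def E_def void_event_def)
    finally show ?thesis using True p0 \<epsilon>_le by linarith
  next
    case False
    have "1 + q \<noteq> 0" using q(2) by linarith
    then have "(1 + q) / s = p\<^sub>0 / 4" unfolding s_def divide_divide_eq_right mult.commute[of "1 + q"]
      by (rule nonzero_mult_divide_mult_cancel_right)
    then have "p\<^sub>0 / 4 = p\<^sub>0 / 2 - (1 + q) / s" by simp
    also have "\<dots> \<le> measure M (X \<inter> E) - (measure M E + real CARD('d) * (\<eta>\<^sup>2 * \<mu> * T / c)) / s"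
    proof (rule diff_mono)
      show "p\<^sub>0 / 2 \<le> measure M (X \<inter> E)" using False p0(2) by linarith
      show "(measure M E + real CARD('d) * (\<eta>\<^sup>2 * \<mu> * T / c)) / s \<le> (1 + q) / s"
        using s by (intro divide_right_mono add_mono prob_le_1 q(1)) simp
    qed
    finally have gap: "p\<^sub>0 / 4 \<le> measure M (X \<inter> E) - (measure M E + real CARD('d) * (\<eta>\<^sup>2 * \<mu> * T / c)) / s" .
    have "\<epsilon> = p\<^sub>0 * exp (- s) * (p\<^sub>0 / 4)" by (simp add: \<epsilon>_def s_def power2_eq_square)
    also have "\<dots> \<le> measure M' E * exp (- s) * (measure M (X \<inter> E) - (measure M E + real CARD('d) * (\<eta>\<^sup>2 * \<mu> * T / c)) / s)"
      using gap p0 by (intro mult_mono) auto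
    also have "\<dots> \<le> measure M E * measure M' (X \<inter> E)" unfolding E_def
      by (rule two_point_bound[OF H H' local diff moment \<eta> \<mu> T X s]) (use p0 E_def in auto)
    also have "\<dots> \<le> 1 * measure M' (X \<inter> E)" by (intro mult_right_mono prob_le_1) simp
    also have "\<dots> \<le> 1 * measure M' {\<omega> \<in> space M'. \<delta> \<le> norm (est \<omega> - \<theta>')}"
    proof (intro mult_left_mono p.finite_measure_mono subsetI)
      fix \<omega> assume w: "\<omega> \<in> X \<inter> E"
      have "norm (\<theta> - \<theta>') \<le> norm (est \<omega> - \<theta>) + norm (est \<omega> - \<theta>')"
        using norm_triangle_ineq4[of "est \<omega> - \<theta>'" "est \<omega> - \<theta>"] by (simp add: add.commute)
      then show "\<omega> \<in> {\<omega> \<in> space M'. \<delta> \<le> norm (est \<omega> - \<theta>')}" using w sep by (auto simp: X_def p.space_M)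
    qed (use level in \<open>auto simp: p.sets_M p.space_M\<close>)
    finally show ?thesis by simp
  qed
qed

text \<open>
  The Baire category theorem, in the form that one member of a countable cover is dense in a ball.
\<close>

lemma countable_cover_dense_somewhere:
  fixes x :: "'a::{real_normed_vector, heine_borel}"
  assumes r: "0 < r" and cover: "ball x r \<subseteq> (\<Union>n::nat. S n)"
  obtains n y \<rho> where "0 < \<rho>" "ball y \<rho> \<subseteq> closure (S n)"
proof -
  define F where "F n = closure (S n) \<inter> cball x (r / 2)" for n
  have "\<exists>n. interior (F n) \<noteq> {}"
  proof (rule ccontr)
    assume "\<nexists>n. interior (F n) \<noteq> {}"
    then have dense: "closure (- F n) = UNIV" for n by (simp add: closure_complement)
    have "UNIV \<subseteq> closure (\<Inter> (range (\<lambda>n. - F n)))"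
    proof (rule Baire)
      fix U assume "U \<in> range (\<lambda>n. - F n)"
      then obtain n where U: "U = - F n" by blast
      have "open U" unfolding U F_def by (intro open_Compl closed_Int) auto
      then show "openin (top_of_set UNIV) U \<and> UNIV \<subseteq> closure U" unfolding U dense by simp
    qed auto
    then have "x \<in> closure (\<Inter> (range (\<lambda>n. - F n)))" by blast
    then obtain z where z: "z \<in> \<Inter> (range (\<lambda>n. - F n))" "dist z x < r / 2"
      using r unfolding closure_approachable by (metis half_gt_zero)
    have "z \<in> ball x r" using z(2) r by (simp add: dist_commute)
    then obtain n where "z \<in> S n" using cover by blast
    then have "z \<in> F n" using z(2) closure_subset by (auto simp: F_def dist_commute)
    then show False using z(1) by blast
  qed
  then obtain n y where "y \<in> interior (F n)" by blast
  then obtain \<rho> where "0 < \<rho>" "ball y \<rho> \<subseteq> F n" unfolding mem_interior by blast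
  then show ?thesis using that[of \<rho> y n] by (auto simp: F_def)
qed

text \<open>
  Two points near the ends of a segment of length \<open>4 \<delta>\<close>.
\<close>

lemma separated_pair_in_dense_set:
  fixes y :: "'a::euclidean_space"
  assumes dense: "ball y \<rho> \<subseteq> closure S" and \<delta>: "0 < \<delta>" "8 * \<delta> \<le> \<rho>"
  obtains \<theta> \<theta>' where "\<theta> \<in> S" "\<theta>' \<in> S" "2 * \<delta> \<le> norm (\<theta> - \<theta>')" "norm (\<theta> - \<theta>') \<le> 6 * \<delta>"
proof -
  obtain e :: 'a where e: "norm e = 1" using norm_Basis nonempty_Basis by blast
  let ?z = "y + (4 * \<delta>) *\<^sub>R e"
  have dz: "dist y ?z = 4 * \<delta>" using e \<delta> by (simp add: dist_norm)
  have "y \<in> closure S" using dense \<delta> by (auto simp: subset_iff)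
  moreover have "?z \<in> closure S" using dense dz \<delta> by (auto simp: subset_iff)
  ultimately obtain \<theta> \<theta>' where \<theta>: "\<theta> \<in> S" "dist \<theta> y < \<delta>" and \<theta>': "\<theta>' \<in> S" "dist \<theta>' ?z < \<delta>"
    unfolding closure_approachable using \<delta>(1) by blast
  have "dist y ?z \<le> dist \<theta> y + dist \<theta> \<theta>' + dist \<theta>' ?z" "dist \<theta> \<theta>' \<le> dist \<theta> y + dist y ?z + dist \<theta>' ?z"
    by metric+
  then show ?thesis using that[OF \<theta>(1) \<theta>'(1)] \<theta>(2) \<theta>'(2) dz by (simp add: dist_norm)
qed

theorem theorem2p12:
  fixes A :: real
    and Dom K \<Theta> \<Theta>\<^sub>0 :: "(real^'p) set"
    and \<nu> :: "real^'p \<Rightarrow> 'd::finite \<Rightarrow> real"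
    and \<phi> :: "real^'p \<Rightarrow> 'd \<Rightarrow> real \<Rightarrow> real"
    and h :: "real^'p \<Rightarrow> 'd \<Rightarrow> 'd \<Rightarrow> real \<Rightarrow> real"
    and L :: "real^'p \<Rightarrow> 'd \<Rightarrow> real"
    and P :: "real^'p \<Rightarrow> 'd config measure"
    and \<theta>\<^sub>0 :: "real^'p" and r :: real
  assumes "0 < A"
    and "\<And>\<theta>. \<theta> \<in> \<Theta> \<Longrightarrow> stationary_hawkes_law A \<nu> \<phi> h \<theta> (P \<theta>)"
    and "condition_a A Dom K \<Theta> \<Theta>\<^sub>0 \<nu> \<phi> h"
    and "condition_b A Dom K h"
    and "condition_c A K \<Theta> \<nu> \<phi> h L"
    and "condition_d A \<Theta> \<Theta>\<^sub>0 \<nu> \<phi> h P"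
    and "0 < r" and "ball \<theta>\<^sub>0 r \<subseteq> \<Theta>\<^sub>0" and "ball \<theta>\<^sub>0 r \<subseteq> interior \<Theta>"
  shows "\<exists>a\<^sub>0>0. \<exists>\<epsilon>\<^sub>0>0. \<exists>T\<^sub>0>0. \<forall>a T. 0 < a \<longrightarrow> a \<le> a\<^sub>0 \<longrightarrow> T\<^sub>0 \<le> T \<longrightarrow>
    \<epsilon>\<^sub>0 \<le> (INF est\<in>estimators A T. SUP \<theta>\<in>\<Theta>\<^sub>0.
      measure (P \<theta>) {\<omega> \<in> space (P \<theta>). a / sqrt T \<le> norm (est \<omega> - \<theta>)})"
proof -
  interpret hawkes_model A Dom K \<Theta> \<Theta>\<^sub>0 \<nu> \<phi> h L P by unfold_locales (use assms in auto)
  let ?E = "void_event (\<lambda>_. {-A..0}) :: 'd config set"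
  obtain c where c: "0 < c" "\<And>i \<theta> x. \<theta> \<in> K \<Longrightarrow> x \<in> X i \<Longrightarrow> c \<le> \<phi> \<theta> i x" using link_lower by blast
  have lam_c: "c \<le> lam \<theta> i \<omega> t" if "\<theta> \<in> \<Theta>" "\<omega> \<in> configs" for \<theta> i \<omega> t
    unfolding intensity_def using that \<Theta>_K by (intro c(2) pred_X) auto
  obtain C m where C: "0 \<le> C" and lam_diff: "\<And>\<theta> \<theta>' i \<omega> t. \<theta> \<in> K \<Longrightarrow> \<theta>' \<in> K \<Longrightarrow> \<omega> \<in> configs \<Longrightarrow>
      \<bar>lam \<theta> i \<omega> t - lam \<theta>' i \<omega> t\<bar> \<le> C * norm (\<theta> - \<theta>') * (1 + real (points \<omega> {t - A..<t})) ^ m"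
    using lam_lipschitz by blast
  define moment where "moment \<theta> = (\<integral>\<^sup>+\<omega>. ennreal ((1 + real (points \<omega> {-A..<0})) ^ (2 * m)) \<partial>P \<theta>)" for \<theta>
  have process: "\<exists>B. \<forall>B'\<ge>B. stationary_process (P \<theta>) (lam \<theta>) c A B'" if \<theta>: "\<theta> \<in> \<Theta>" for \<theta>
  proof -
    obtain B where B: "\<And>i \<omega> t. \<omega> \<in> configs \<Longrightarrow> lam \<theta> i \<omega> t \<le> B * (1 + real (points \<omega> {t - A..<t}))"
      using lam_growth[OF \<theta>] by blast
    have "stationary_process (P \<theta>) (lam \<theta>) c A B'" if "B \<le> B'" for B'
    proof (rule stationary_process_law[OF \<theta> c(1) lam_c[OF \<theta>]])
      fix i t and \<omega> :: "'d config" assume w: "\<omega> \<in> configs"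
      have "B * (1 + real (points \<omega> {t - A..<t})) \<le> B' * (1 + real (points \<omega> {t - A..<t}))"
        using that by (intro mult_right_mono) auto
      with B[OF w] show "lam \<theta> i \<omega> t \<le> B' * (1 + real (points \<omega> {t - A..<t}))" by (rule order_trans)
    qed
    then show ?thesis by blast
  qed
  have void_pos: "0 < measure (P \<theta>) ?E" and moment_fin: "moment \<theta> < \<infinity>" if \<theta>: "\<theta> \<in> \<Theta>" for \<theta>
  proof -
    obtain B where B: "stationary_process (P \<theta>) (lam \<theta>) c A B" using process[OF \<theta>] by blast
    show "0 < measure (P \<theta>) ?E" by (rule stationary_process.prob_no_points_window[OF B A_pos])
    show "moment \<theta> < \<infinity>" unfolding moment_def by (rule window_moment_finite[OF \<theta> B])
  qed
  \<comment> \<open>Pointwise positivity and finiteness, quantified by a single index.\<close>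
  define S where "S n = {\<theta> \<in> ball \<theta>\<^sub>0 r. 1 / real (Suc n) \<le> measure (P \<theta>) ?E \<and> moment \<theta> \<le> ennreal (real (Suc n))}" for n
  have ball_\<Theta>\<^sub>0: "ball \<theta>\<^sub>0 r \<subseteq> \<Theta>\<^sub>0" by fact
  have cover: "ball \<theta>\<^sub>0 r \<subseteq> (\<Union>n. S n)"
  proof
    fix \<theta> assume b: "\<theta> \<in> ball \<theta>\<^sub>0 r"
    then have \<theta>: "\<theta> \<in> \<Theta>" using ball_\<Theta>\<^sub>0 \<Theta>\<^sub>0_\<Theta> by blast
    obtain n1 where n1: "inverse (real (Suc n1)) < measure (P \<theta>) ?E" using reals_Archimedean[OF void_pos[OF \<theta>]] by blast
    obtain x where x: "moment \<theta> = ennreal x" "0 \<le> x" using moment_fin[OF \<theta>] by (cases "moment \<theta>") auto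
    obtain n2 where n2: "x \<le> real n2" using real_arch_simple by blast
    have "1 / real (Suc (max n1 n2)) \<le> measure (P \<theta>) ?E"
    proof -
      have "1 / real (Suc (max n1 n2)) \<le> inverse (real (Suc n1))" unfolding inverse_eq_divide by (intro divide_left_mono) auto
      then show ?thesis using n1 by linarith
    qed
    moreover have "moment \<theta> \<le> ennreal (real (Suc (max n1 n2)))" unfolding x(1) using n2 by (intro ennreal_leI) simp
    ultimately have "\<theta> \<in> S (max n1 n2)" using b by (simp add: S_def)
    then show "\<theta> \<in> (\<Union>n. S n)" by blast
  qed
  obtain n y \<rho> where \<rho>: "0 < \<rho>" "ball y \<rho> \<subseteq> closure (S n)"
    by (rule countable_cover_dense_somewhere[OF \<open>0 < r\<close> cover])
  define p\<^sub>0 where "p\<^sub>0 = 1 / real (Suc n)"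
  define \<mu> where "\<mu> = real (Suc n)"
  define q where "q = real CARD('d) * (36 * C\<^sup>2 * \<mu> / c)"
  define \<epsilon> where "\<epsilon> = p\<^sub>0\<^sup>2 * exp (- (4 * (1 + q) / p\<^sub>0)) / 4"
  have p0: "0 < p\<^sub>0" and \<mu>: "0 \<le> \<mu>" by (simp_all add: p\<^sub>0_def \<mu>_def)
  have q: "0 \<le> q" using c(1) \<mu> by (simp add: q_def)
  have "\<epsilon> \<le> (INF est\<in>estimators A T. SUP \<theta>\<in>\<Theta>\<^sub>0. measure (P \<theta>) {\<omega> \<in> space (P \<theta>). a / sqrt T \<le> norm (est \<omega> - \<theta>)})"
    if a: "0 < a" "a \<le> 1" and T0: "64 / \<rho>\<^sup>2 \<le> T" for a T
  proof (rule cINF_greatest)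
    have T: "0 < T" using T0 \<rho>(1) by (meson less_le_trans zero_less_divide_iff zero_less_numeral zero_less_power)
    show "estimators A T \<noteq> ({} :: ('d config \<Rightarrow> real^'p) set)"
    proof -
      have "(\<lambda>_. 0) \<in> (estimators A T :: ('d config \<Rightarrow> real^'p) set)" by (simp add: estimators_def)
      then show ?thesis by blast
    qed
    fix est :: "'d config \<Rightarrow> real^'p" assume "est \<in> estimators A T"
    then have est: "est \<in> observed {-A..T} \<rightarrow>\<^sub>M borel" by (simp add: estimators_def)
    define \<delta> where "\<delta> = a / sqrt T"
    have \<delta>: "0 < \<delta>" using a T by (simp add: \<delta>_def)
    have \<delta>T: "\<delta>\<^sup>2 * T \<le> 1"
    proof -
      have "\<delta>\<^sup>2 * T = a\<^sup>2" using T by (simp add: \<delta>_def power_divide)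
      also have "\<dots> \<le> 1" using a by (simp add: power_le_one)
      finally show ?thesis .
    qed
    \<comment> \<open>The condition T >= 64 / rho^2 keeps both parameters inside the small ball.\<close>
    have "8 * \<delta> \<le> \<rho>"
    proof -
      have "64 * \<delta>\<^sup>2 \<le> \<rho>\<^sup>2 * (T * \<delta>\<^sup>2)"
        using mult_right_mono[OF T0, of "\<rho>\<^sup>2 * \<delta>\<^sup>2"] \<rho>(1) by (simp add: field_simps)
      also have "\<dots> \<le> \<rho>\<^sup>2 * 1" using \<delta>T by (intro mult_left_mono) (auto simp: mult.commute)
      finally have "(8 * \<delta>)\<^sup>2 \<le> \<rho>\<^sup>2" by (simp add: power_mult_distrib)
      then show ?thesis by (rule power2_le_imp_le) (use \<rho>(1) in simp)
    qed
    from \<rho>(2) \<delta> this obtain \<theta> \<theta>' where S: "\<theta> \<in> S n" "\<theta>' \<in> S n"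
      and sep: "2 * \<delta> \<le> norm (\<theta> - \<theta>')" "norm (\<theta> - \<theta>') \<le> 6 * \<delta>" by (rule separated_pair_in_dense_set)
    have in_\<Theta>\<^sub>0: "\<theta> \<in> \<Theta>\<^sub>0" "\<theta>' \<in> \<Theta>\<^sub>0" using S ball_\<Theta>\<^sub>0 by (auto simp: S_def)
    then have in_\<Theta>: "\<theta> \<in> \<Theta>" "\<theta>' \<in> \<Theta>" and in_K: "\<theta> \<in> K" "\<theta>' \<in> K" using \<Theta>\<^sub>0_\<Theta> \<Theta>_K by blast+
    \<comment> \<open>The growth constant may vary wildly with the parameter, but it does not enter the bound.\<close>
    obtain B where H: "stationary_process (P \<theta>) (lam \<theta>) c A B" and H': "stationary_process (P \<theta>') (lam \<theta>') c A B"
      using process[OF in_\<Theta>(1)] process[OF in_\<Theta>(2)] by (meson max.cobounded1 max.cobounded2)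
    define \<eta> where "\<eta> = C * norm (\<theta> - \<theta>')"
    have "\<eta>\<^sup>2 * T \<le> 36 * C\<^sup>2"
    proof -
      have "\<eta>\<^sup>2 \<le> (C * (6 * \<delta>))\<^sup>2" unfolding \<eta>_def using sep(2) C by (intro power_mono mult_left_mono) auto
      then have "\<eta>\<^sup>2 * T \<le> (36 * C\<^sup>2) * (\<delta>\<^sup>2 * T)" using T by (simp add: power_mult_distrib mult_right_mono mult.assoc mult.left_commute)
      also have "\<dots> \<le> (36 * C\<^sup>2) * 1" by (rule mult_left_mono[OF \<delta>T]) simp
      finally show ?thesis by simp
    qed
    then have "\<eta>\<^sup>2 * T * (\<mu> / c) \<le> 36 * C\<^sup>2 * (\<mu> / c)" by (rule mult_right_mono) (use c(1) \<mu> in simp)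
    then have q_ge: "real CARD('d) * (\<eta>\<^sup>2 * \<mu> * T / c) \<le> q" unfolding q_def by (intro mult_left_mono) (simp_all add: mult_ac)
    let ?risk = "\<lambda>\<theta>. measure (P \<theta>) {\<omega> \<in> space (P \<theta>). \<delta> \<le> norm (est \<omega> - \<theta>)}"
    have "\<epsilon> \<le> ?risk \<theta> \<or> \<epsilon> \<le> ?risk \<theta>'" unfolding \<epsilon>_def
    proof (rule two_point_risk[OF H stationary_process.axioms(1)[OF H'] lam_local _ _ _ \<mu> T p0 _ _ q_ge q est sep(1)])
      show "\<bar>lam \<theta> i \<omega> t - lam \<theta>' i \<omega> t\<bar> \<le> \<eta> * (1 + real (points \<omega> {t - A..<t})) ^ m" if "\<omega> \<in> configs" for i \<omega> t
        unfolding \<eta>_def by (rule lam_diff[OF in_K that])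
      show "(\<integral>\<^sup>+\<omega>. ennreal ((1 + real (points \<omega> {- A..<0})) ^ (2 * m)) \<partial>P \<theta>) \<le> ennreal \<mu>"
        using S(1) by (simp add: S_def moment_def \<mu>_def)
      show "0 \<le> \<eta>" using C by (simp add: \<eta>_def)
    qed (use S in \<open>auto simp: S_def p\<^sub>0_def\<close>)
    moreover have "?risk \<theta> \<le> (SUP \<theta>\<in>\<Theta>\<^sub>0. ?risk \<theta>)" if "\<theta> \<in> \<Theta>\<^sub>0" for \<theta>
    proof (rule cSUP_upper[OF that bdd_aboveI2[of _ _ 1]])
      fix \<theta> assume "\<theta> \<in> \<Theta>\<^sub>0"
      then have "prob_space (P \<theta>)" using \<Theta>\<^sub>0_\<Theta> law_prob by blast
      then show "?risk \<theta> \<le> 1" by (rule prob_space.prob_le_1)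
    qed
    ultimately have "\<epsilon> \<le> (SUP \<theta>\<in>\<Theta>\<^sub>0. ?risk \<theta>)" using in_\<Theta>\<^sub>0 by (meson order_trans)
    then show "\<epsilon> \<le> (SUP \<theta>\<in>\<Theta>\<^sub>0. measure (P \<theta>) {\<omega> \<in> space (P \<theta>). a / sqrt T \<le> norm (est \<omega> - \<theta>)})"
      unfolding \<delta>_def .
  qed
  note bound = this
  show ?thesis
  proof (intro exI conjI allI impI)
    show "0 < (1::real)" by simp
    show "0 < \<epsilon>" using p0 by (simp add: \<epsilon>_def)
    show "0 < 64 / \<rho>\<^sup>2" using \<rho>(1) by simp
  qed (rule bound)
qed

end
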